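(* Let $A=(A_1,\dots,A_N)\in\mathcal M_d(\mathbb R)^N$, let $x_0\in\mathbb R^d$, and let $(\nu_n,\mu_n,P_n)_{n\in\mathbb N}$ be a sequence of parameters of Markov processes for $A$. Up to extracting a subsequence, there exists a convexified Markov process for $A$ such that the following holds: one can realize on a common probability space Markov processes $(x_n,\sigma_n)$ for $A$ with parameters $(\nu_n,\mu_n,P_n)$ and $x_n(0)=x_0$, $n\in\mathbb N$, together with the convexified Markov process $(x,\sigma)$ with $x(0)=x_0$, in such a way that, for all $T,\delta>0$, $$\mathbb P\Bigl(\sup_{t\in[0,T]}|x(t)-x_n(t)|>\delta\Bigr)\underset{n\to+\infty}{\longrightarrow}0.$$
   Context: $d,N$ are positive integers, $\mathcal M_d(\mathbb R)$ is the space of real $d\times d$ matrices, $|\cdot|$ is a norm on $\mathbb R^d$, and $\mathrm{co}$ denotes the convex hull. Parameters $(\nu,\mu,P)$ of a Markov process consist of a stochastic matrix $P=(p_{ij})\in\mathcal M_N(\mathbb R)$, a number $\mu>0$ and a probability (row) vector $\nu\in\mathbb R^N$. The associated $\sigma$ is the continuous-time Markov chain on $\{1,\dots,N\}$ with initial law $\nu$, transition matrix $P$ and jump rate $\mu$: the times between successive jumps are independent exponential variables of parameter $\mu$, and at each jump the chain goes from $i$ to $j$ with probability $p_{ij}$ (trivial jumps allowed). A Markov process $(x,\sigma)$ for $A$ with parameters $(\nu,\mu,P)$ consists of such a $\sigma$ and the solution $x$ of $\dot x(t)=A_{\sigma(t)}x(t)$, $x(0)=x_0$; the matrices $A_1,\dots,A_N$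 are its modes. A convexified Markov process $(x,\sigma)$ for $A$ is a continuous-time Markov process with modes $B_1,\dots,B_k$, that is, $\sigma$ is the continuous-time Markov chain on $\{1,\dots,k\}$ with some initial law $\nu$ (a probability vector in $\mathbb R^k$), some transition matrix $P=(p_{ij})$ (a stochastic $k\times k$ matrix) and some jump rate $\mu>0$ (the times between successive jumps are independent exponential variables of parameter $\mu$, and at each jump the chain goes from $i$ to $j$ with probability $p_{ij}$, trivial jumps allowed), and $x$ is the solution of $\dot x(t)=B_{\sigma(t)}x(t)$, $x(0)=x_0$, where $k\in\{1,\dots,N\}$, $B_j\in\mathrm{co}\{A_\ell\mid\ell\in I_j\}$ for $j=1,\dots,k$, and $I_1,\dots,I_k$ are pairwise disjoint nonempty subsets of $\{1,\dots,N\}$. *)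

theory Defs
  imports "HOL-Probability.Probability"
begin

text \<open>States are natural numbers: a chain with \<open>N\<close> states lives on \<open>{1..N}\<close>, and vectors, matrices
  and families of modes indexed by the states are functions on \<open>nat\<close> whose values outside
  \<open>{1..N}\<close> are never used.\<close>

definition is_norm :: "('a::real_vector \<Rightarrow> real) \<Rightarrow> bool" where
  "is_norm p \<longleftrightarrow>
     (\<forall>v. 0 \<le> p v) \<and> (\<forall>v. p v = 0 \<longleftrightarrow> v = 0) \<and>
     (\<forall>c v. p (c *\<^sub>R v) = \<bar>c\<bar> * p v) \<and> (\<forall>v w. p (v + w) \<le> p v + p w)"

definition probability_vector :: "nat \<Rightarrow> (nat \<Rightarrow> real) \<Rightarrow> bool" where
  "probability_vector N \<nu> \<longleftrightarrow> (\<forall>i\<in>{1..N}. 0 \<le> \<nu> i) \<and> (\<Sum>i\<in>{1..N}. \<nu> i) = 1"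

definition stochastic_matrix :: "nat \<Rightarrow> (nat \<Rightarrow> nat \<Rightarrow> real) \<Rightarrow> bool" where
  "stochastic_matrix N P \<longleftrightarrow> (\<forall>i\<in>{1..N}. probability_vector N (P i))"

definition parameters :: "nat \<Rightarrow> (nat \<Rightarrow> real) \<Rightarrow> real \<Rightarrow> (nat \<Rightarrow> nat \<Rightarrow> real) \<Rightarrow> bool" where
  "parameters N \<nu> \<mu> P \<longleftrightarrow> probability_vector N \<nu> \<and> 0 < \<mu> \<and> stochastic_matrix N P"

text \<open>The Markov property together with the initial law \<open>\<nu>\<close> and the transition matrix \<open>P\<close> is
  expressed through the probabilities of all finite paths.\<close>

definition discrete_markov_chain ::
  "'w measure \<Rightarrow> nat \<Rightarrow> (nat \<Rightarrow> real) \<Rightarrow> (nat \<Rightarrow> nat \<Rightarrow> real) \<Rightarrow> (nat \<Rightarrow> 'w \<Rightarrow> nat) \<Rightarrow> bool" where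
  "discrete_markov_chain M N \<nu> P Z \<longleftrightarrow>
     (\<forall>n. Z n \<in> measurable M (count_space {1..N})) \<and>
     (\<forall>n i. (\<forall>m\<le>n. i m \<in> {1..N}) \<longrightarrow>
        measure M {\<omega>\<in>space M. \<forall>m\<le>n. Z m \<omega> = i m} = \<nu> (i 0) * (\<Prod>m<n. P (i m) (i (Suc m))))"

text \<open>\<open>Z n\<close> is the state between the \<open>n\<close>-th and the \<open>(n+1)\<close>-st jump and \<open>S n\<close> is the time
  spent between them (the \<open>0\<close>-th jump being time \<open>0\<close>); trajectories are right-continuous. Since the
  jump times tend to infinity almost surely, the last clause determines \<open>\<sigma>\<close> on \<open>[0,\<infinity>)\<close> almost surely.
  The independence of the sequences \<open>Z\<close> and \<open>S\<close> is stated through the sigma-algebras they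
  generate because \<open>indep_var\<close> requires both variables to take values in the same type.\<close>

definition continuous_time_markov_chain ::
  "'w measure \<Rightarrow> nat \<Rightarrow> (nat \<Rightarrow> real) \<Rightarrow> real \<Rightarrow> (nat \<Rightarrow> nat \<Rightarrow> real) \<Rightarrow> (real \<Rightarrow> 'w \<Rightarrow> nat) \<Rightarrow> bool" where
  "continuous_time_markov_chain M N \<nu> \<mu> P \<sigma> \<longleftrightarrow>
     prob_space M \<and>
     (\<forall>t\<ge>0. \<sigma> t \<in> measurable M (count_space {1..N})) \<and>
     (\<exists>Z S.
        discrete_markov_chain M N \<nu> P Z \<and>
        (\<forall>n. distributed M lborel (S n) (exponential_density \<mu>)) \<and>
        prob_space.indep_vars M (\<lambda>_. borel) S UNIV \<and>
        prob_space.indep_set M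
          (sets (vimage_algebra (space M) (\<lambda>\<omega> n. Z n \<omega>) (\<Pi>\<^sub>M n\<in>UNIV. count_space {1..N})))
          (sets (vimage_algebra (space M) (\<lambda>\<omega> n. S n \<omega>) (\<Pi>\<^sub>M n\<in>UNIV. borel))) \<and>
        (AE \<omega> in M. \<forall>t\<ge>0. \<forall>n.
           (\<Sum>m<n. S m \<omega>) \<le> t \<and> t < (\<Sum>m<Suc n. S m \<omega>) \<longrightarrow> \<sigma> t \<omega> = Z n \<omega>))"

text \<open>Solution on \<open>[0,\<infinity>)\<close> for a switching signal \<open>s\<close> with locally finitely many discontinuities:
  \<open>\<xi>\<close> is continuous and satisfies the equation outside a locally finite set of times.\<close>

definition switched_solution ::
  "(nat \<Rightarrow> real^'d^'d) \<Rightarrow> (real \<Rightarrow> nat) \<Rightarrow> real^'d \<Rightarrow> (real \<Rightarrow> real^'d) \<Rightarrow> bool" where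
  "switched_solution B s x0 \<xi> \<longleftrightarrow>
     \<xi> 0 = x0 \<and> continuous_on {0..} \<xi> \<and>
     (\<forall>T>0. \<exists>F. finite F \<and>
        (\<forall>t\<in>{0..T} - F. (\<xi> has_vector_derivative (B (s t) *v \<xi> t)) (at t)))"

definition markov_process ::
  "'w measure \<Rightarrow> nat \<Rightarrow> (nat \<Rightarrow> real^'d^'d) \<Rightarrow> (nat \<Rightarrow> real) \<Rightarrow> real \<Rightarrow> (nat \<Rightarrow> nat \<Rightarrow> real) \<Rightarrow>
   real^'d \<Rightarrow> (real \<Rightarrow> 'w \<Rightarrow> real^'d) \<Rightarrow> (real \<Rightarrow> 'w \<Rightarrow> nat) \<Rightarrow> bool" where
  "markov_process M N B \<nu> \<mu> P x0 x \<sigma> \<longleftrightarrow>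
     parameters N \<nu> \<mu> P \<and>
     continuous_time_markov_chain M N \<nu> \<mu> P \<sigma> \<and>
     (\<forall>t\<ge>0. x t \<in> borel_measurable M) \<and>
     (AE \<omega> in M. switched_solution B (\<lambda>t. \<sigma> t \<omega>) x0 (\<lambda>t. x t \<omega>))"

definition convexified_modes ::
  "nat \<Rightarrow> (nat \<Rightarrow> real^'d^'d) \<Rightarrow> nat \<Rightarrow> (nat \<Rightarrow> real^'d^'d) \<Rightarrow> bool" where
  "convexified_modes N A k B \<longleftrightarrow>
     k \<in> {1..N} \<and>
     (\<exists>I. (\<forall>j\<in>{1..k}. I j \<noteq> {} \<and> I j \<subseteq> {1..N}) \<and> disjoint_family_on I {1..k} \<and>
          (\<forall>j\<in>{1..k}. B j \<in> convex hull (A ` I j)))"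

end

theory Submission
  imports Defs "HOL-Library.Diagonal_Subsequence"
begin

text \<open>A solution of the switched equation feels its switching signal only through the times that the
  signal spends in the states: if for each state \<open>l\<close> the time spent by \<open>\<sigma>\<^sub>n\<close> in \<open>l\<close> is close, uniformly
  on \<open>[0,T]\<close>, to the time spent by another signal \<open>\<sigma>\<close> in the states \<open>s\<close> counted with weights \<open>\<pi>\<^sub>s(l)\<close>,
  then the solution for the modes \<open>A\<^sub>l\<close> along \<open>\<sigma>\<^sub>n\<close> is close to the solution for the averaged modes
  \<open>\<Sum>\<^sub>l \<pi>\<^sub>s(l) A\<^sub>l\<close> along \<open>\<sigma>\<close>. This is \<open>solutions_close_if_occupations_close\<close>, an integration by parts
  followed by Gronwall's inequality. Everything else is about the occupation times of the chains.

  The jump rates \<open>\<mu>\<^sub>n\<close> may tend to \<open>0\<close>, to infinity, or oscillate, and states that are left at very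
  different speeds may coexist. To compactify all these regimes at once, observe the chain at the
  points of an independent Poisson process of rate \<open>c\<close>. The observed states form a discrete-time
  Markov chain whose transition matrix is the resolvent \<open>c (c + \<mu> (1 - P))\<^sup>-\<^sup>1\<close> (\<open>skeleton_law\<close>), a stochastic
  matrix whatever \<open>\<mu>\<close> is. After extraction of a subsequence these matrices converge for every
  integer rate \<open>c\<close>. The limits satisfy the resolvent identity, but need not be the resolvents of a
  generator: for \<open>c\<close> tending to infinity they accumulate at an idempotent
  stochastic matrix \<open>Q\<close>, which need not be the identity. Such a \<open>Q\<close> splits the states that it charges into
  disjoint classes \<open>s\<close> with equilibrium laws \<open>\<pi>\<^sub>s\<close>, supported on the classes (\<open>class_structure\<close>); these are the groups of states between which infinitely fast switching takes
  place in the limit. Read on the classes, the limits are the resolvents of a generator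
  \<open>\<mu>' (P' - 1)\<close> (\<open>limit_chain_exists\<close>), and this is the limit chain. Its modes are the averages of the \<open>A\<^sub>l\<close>
  under the laws \<open>\<pi>\<^sub>s\<close>, hence convex combinations over disjoint sets of states.

  It remains to compare occupation times. For large \<open>c\<close>, uniformly in the parameters of the chain, occupation
  times are the frequencies of visits among the observed states
  (\<open>occupation_close_to_skeleton\<close>). Under the limit law, given its class, an observed state has law
  \<open>\<pi>\<^sub>s\<close> independently of the past, so a maximal inequality replaces the visits to a state by the average over
  the visits to its class (\<open>atypical_unlikely\<close>). Finally, for fixed \<open>c\<close> the law of
  the sequence of observed classes converges to the law of the observed states of the limit chain. These are laws on a finite set of words, so they can be coupled
  with a small probability of disagreement. The limit chain is kept fixed while the
  precision grows along the subsequence, and the couplings are realized on one space by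
  letting the limit chain select conditional laws from an independent family (\<open>gluing\<close>).\<close>

section \<open>Flows of linear equations\<close>

text \<open>The matrix exponential applied to a vector, as a power series of vectors: this keeps
  the proofs free of a norm on matrices.\<close>
definition flow :: "real^'d^'d \<Rightarrow> real \<Rightarrow> real^'d \<Rightarrow> real^'d" where
  "flow A t v = (\<Sum>k. (t ^ k / fact k) *\<^sub>R (((*v) A ^^ k) v))"

lemma norm_iterate_le:
  fixes A :: "real^'d^'d"
  shows "norm (((*v) A ^^ k) v) \<le> onorm ((*v) A) ^ k * norm v"
proof (induction k)
  case (Suc k)
  have "norm (((*v) A ^^ Suc k) v) \<le> onorm ((*v) A) * norm (((*v) A ^^ k) v)"
    using onorm[OF matrix_vector_mul_bounded_linear, of A] by simp
  also have "\<dots> \<le> onorm ((*v) A) * (onorm ((*v) A) ^ k * norm v)"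
    by (intro mult_left_mono Suc onorm_pos_le matrix_vector_mul_bounded_linear)
  finally show ?case by (simp add: mult.assoc)
qed simp

lemma summable_norm_flow:
  fixes A :: "real^'d^'d"
  shows "summable (\<lambda>k. norm ((t ^ k / fact k) *\<^sub>R (((*v) A ^^ k) v)))"
proof (rule summable_comparison_test')
  show "summable (\<lambda>k. norm v * ((onorm ((*v) A) * \<bar>t\<bar>) ^ k /\<^sub>R fact k))"
    by (intro summable_mult summable_exp_generic)
  fix k :: nat
  have "\<bar>t\<bar> ^ k / fact k * norm (((*v) A ^^ k) v) \<le> \<bar>t\<bar> ^ k / fact k * (onorm ((*v) A) ^ k * norm v)"
    by (intro mult_left_mono norm_iterate_le) auto
  then show "norm (norm ((t ^ k / fact k) *\<^sub>R (((*v) A ^^ k) v)))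
     \<le> norm v * ((onorm ((*v) A) * \<bar>t\<bar>) ^ k /\<^sub>R fact k)"
    by (simp add: power_mult_distrib power_abs abs_mult divide_inverse mult_ac)
qed

lemma flow_0 [simp]: "flow A 0 v = v"
proof -
  have "flow A 0 v = (\<Sum>k\<in>{0}. ((0::real) ^ k / fact k) *\<^sub>R (((*v) A ^^ k) v))"
    unfolding flow_def by (rule suminf_finite) auto
  then show ?thesis by simp
qed

lemma sums_flow: "(\<lambda>k. (t ^ k / fact k) *\<^sub>R (((*v) A ^^ k) v)) sums flow A t v"
  unfolding flow_def by (intro summable_sums summable_norm_cancel[OF summable_norm_flow])

text \<open>Each coordinate is a scalar power series, so termwise differentiation applies.\<close>
lemma flow_has_vector_derivative:
  fixes A :: "real^'d^'d"
  shows "((\<lambda>t. flow A t v) has_vector_derivative (A *v flow A t v)) (at t)"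
proof -
  have comp: "(\<lambda>k. (((*v) A ^^ k) v $ i / fact k) * t ^ k) sums (flow A t v $ i)" for i t
    using sums_vec_nth[OF sums_flow[of t A v], of i] by (simp add: field_simps)
  have "((\<lambda>t. flow A t v $ i) has_field_derivative (A *v flow A t v) $ i) (at t)" for i
  proof -
    let ?c = "\<lambda>k. ((*v) A ^^ k) v $ i / fact k"
    have *: "((\<lambda>x. \<Sum>k. ?c k * x ^ k) has_field_derivative (\<Sum>k. diffs ?c k * t ^ k)) (at t)"
      by (rule termdiffs_strong_converges_everywhere) (use comp sums_summable in blast)
    have d: "diffs ?c k * t ^ k = (t ^ k / fact k) * (A *v ((*v) A ^^ k) v) $ i" for k
      by (simp add: diffs_def del: of_nat_Suc)
    have "(\<lambda>k. A *v ((t ^ k / fact k) *\<^sub>R (((*v) A ^^ k) v))) sums (A *v flow A t v)"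
      by (rule bounded_linear.sums[OF matrix_vector_mul_bounded_linear sums_flow])
    from sums_vec_nth[OF this, of i]
    have "(\<lambda>k. diffs ?c k * t ^ k) sums (A *v flow A t v) $ i"
      by (simp add: d matrix_vector_mult_scaleR)
    with * comp show ?thesis by (simp add: sums_iff cong: suminf_cong)
  qed
  then have r: "((\<lambda>t. \<Sum>i\<in>UNIV. flow A t v $ i *\<^sub>R (axis i 1 :: real^'d)) has_vector_derivative
      (\<Sum>i\<in>UNIV. (A *v flow A t v) $ i *\<^sub>R axis i 1)) (at t)"
    by (auto intro!: derivative_eq_intros)
  have *: "(\<Sum>i\<in>UNIV. w $ i *\<^sub>R axis i 1) = w" for w :: "real^'d"
    using basis_expansion[of w] by (simp add: scalar_mult_eq_scaleR)
  show ?thesis using r unfolding * .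
qed

lemma flow_measurable [measurable (raw)]:
  fixes A :: "real^'d^'d"
  assumes [measurable]: "f \<in> borel_measurable M" "g \<in> borel_measurable M"
  shows "(\<lambda>x. flow A (f x) (g x)) \<in> borel_measurable M"
proof -
  have [measurable]: "((*v) A ^^ k) \<in> borel_measurable borel" for k
  proof (induction k)
    case (Suc k)
    have "(*v) A \<in> borel_measurable borel"
      by (intro borel_measurable_continuous_onI linear_continuous_on matrix_vector_mul_bounded_linear)
    from measurable_compose[OF Suc this] show ?case by (simp add: comp_def)
  qed simp
  have "(\<lambda>x. \<Sum>k. (f x ^ k / fact k) *\<^sub>R (((*v) A ^^ k) (g x))) \<in> borel_measurable M"
    by (rule borel_measurable_suminf) measurable
  then show ?thesis unfolding flow_def .
qed

section \<open>Functions composed stage by stage\<close>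

definition jump_time :: "(nat \<Rightarrow> real) \<Rightarrow> nat \<Rightarrow> real" where
  "jump_time S n = (\<Sum>m<n. S m)"

definition stage :: "(nat \<Rightarrow> real) \<Rightarrow> real \<Rightarrow> nat" where
  "stage S t = (LEAST n. t < jump_time S (Suc n))"

text \<open>Holding times for which every time lies in a well-defined stage. Natural numbers as bounds keep
  the condition visibly measurable.\<close>
definition admissible :: "(nat \<Rightarrow> real) \<Rightarrow> bool" where
  "admissible S \<longleftrightarrow> (\<forall>n. 0 < S n) \<and> (\<forall>K::nat. \<exists>n. real K \<le> jump_time S n)"

lemma jump_time_simps [simp]: "jump_time S 0 = 0" "jump_time S (Suc n) = jump_time S n + S n"
  by (simp_all add: jump_time_def)

lemma admissible_pos: "admissible S \<Longrightarrow> 0 < S n"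
  by (auto simp: admissible_def)

lemma admissible_exceeds: assumes "admissible S" shows "\<exists>n. t < jump_time S n"
proof -
  obtain K :: nat where "t < real K" using reals_Archimedean2 by blast
  moreover obtain n where "real K \<le> jump_time S n" using assms by (auto simp: admissible_def)
  ultimately show ?thesis by (auto intro!: exI[of _ n])
qed

lemma jump_time_mono: assumes "admissible S" "m \<le> n" shows "jump_time S m \<le> jump_time S n"
  using assms(2)
proof (induction rule: dec_induct)
  case (step k)
  then show ?case using admissible_pos[OF assms(1), of k] by simp
qed simp

lemma jump_time_nonneg: assumes "admissible S" shows "0 \<le> jump_time S n"
  using jump_time_mono[OF assms, of 0 n] by simp

lemma stage_eq:
  assumes S: "admissible S" and t: "jump_time S n \<le> t" "t < jump_time S (Suc n)"
  shows "stage S t = n"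
  unfolding stage_def
proof (rule Least_equality)
  fix m assume "t < jump_time S (Suc m)"
  with t(1) have "jump_time S n < jump_time S (Suc m)" by linarith
  then show "n \<le> m" using jump_time_mono[OF S, of "Suc m" n] by (meson not_less_eq_eq not_le)
qed (use t in simp)

lemma stage_bounds:
  assumes S: "admissible S" and t: "0 \<le> t"
  shows "jump_time S (stage S t) \<le> t" "t < jump_time S (Suc (stage S t))"
proof -
  obtain n where n: "t < jump_time S n" using admissible_exceeds[OF S] by blast
  with t obtain m where "n = Suc m" by (cases n) auto
  with n have ex: "t < jump_time S (Suc m)" by simp
  then show 1: "t < jump_time S (Suc (stage S t))"
    unfolding stage_def by (rule LeastI)
  show "jump_time S (stage S t) \<le> t"
  proof (cases "stage S t")
    case (Suc k)
    then have "\<not> t < jump_time S (Suc k)"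
      unfolding stage_def by (metis lessI not_less_Least)
    with Suc show ?thesis by simp
  qed (use t in simp)
qed

primrec node :: "(nat \<Rightarrow> real \<Rightarrow> 'v \<Rightarrow> 'v) \<Rightarrow> (nat \<Rightarrow> real) \<Rightarrow> 'v \<Rightarrow> nat \<Rightarrow> 'v" where
  "node \<phi> S v 0 = v"
| "node \<phi> S v (Suc n) = \<phi> n (S n) (node \<phi> S v n)"

text \<open>Common form of trajectories and of occupation times: during stage \<open>n\<close> the value evolves by
  the flow \<open>\<phi> n\<close>, restarted at each jump from the value reached.\<close>
definition stagewise :: "(nat \<Rightarrow> real \<Rightarrow> 'v \<Rightarrow> 'v) \<Rightarrow> (nat \<Rightarrow> real) \<Rightarrow> 'v \<Rightarrow> real \<Rightarrow> 'v" where
  "stagewise \<phi> S v t = \<phi> (stage S t) (t - jump_time S (stage S t)) (node \<phi> S v (stage S t))"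

locale stage_flows =
  fixes \<phi> :: "nat \<Rightarrow> real \<Rightarrow> 'v::real_normed_vector \<Rightarrow> 'v"
    and \<psi> :: "nat \<Rightarrow> 'v \<Rightarrow> 'v" and S :: "nat \<Rightarrow> real"
  assumes adm: "admissible S"
    and init: "\<And>n v. \<phi> n 0 v = v"
    and deriv: "\<And>n t v. ((\<lambda>t. \<phi> n t v) has_vector_derivative \<psi> n (\<phi> n t v)) (at t)"
begin

text \<open>The formula for stage \<open>n\<close> also holds at its right end point, because the flow of the next stage starts there from
  the same value. Continuity follows from this overlap.\<close>
lemma stagewise_on_stage:
  assumes "jump_time S n \<le> t" "t \<le> jump_time S (Suc n)"
  shows "stagewise \<phi> S v t = \<phi> n (t - jump_time S n) (node \<phi> S v n)"
proof (cases "t < jump_time S (Suc n)")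
  case True
  then show ?thesis using stage_eq[OF adm assms(1)] by (simp add: stagewise_def)
next
  case False
  with assms have t: "t = jump_time S (Suc n)" by simp
  have "stage S t = Suc n" unfolding t
    by (rule stage_eq[OF adm]) (simp_all add: admissible_pos[OF adm])
  then show ?thesis by (simp add: stagewise_def init t)
qed

lemma stagewise_0: "stagewise \<phi> S v 0 = v"
  using stagewise_on_stage[of 0 0 v] admissible_pos[OF adm, of 0] by (simp add: init)

lemma stage_flow_continuous: "continuous_on X (\<lambda>t. \<phi> n (t - c) w)"
proof -
  have 1: "continuous_on UNIV (\<lambda>t. \<phi> n t w)"
    by (intro continuous_at_imp_continuous_on ballI has_vector_derivative_continuous[OF deriv])
  show ?thesis
    by (rule continuous_on_compose2[OF 1]) (auto intro!: continuous_intros)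
qed

lemma stagewise_continuous_upto: "continuous_on {0..jump_time S n} (stagewise \<phi> S v)"
proof (induction n)
  case (Suc n)
  have 1: "continuous_on {jump_time S n..jump_time S (Suc n)} (stagewise \<phi> S v)"
    using stage_flow_continuous
    by (subst continuous_on_cong[OF refl stagewise_on_stage]) auto
  have "{0..jump_time S (Suc n)} = {0..jump_time S n} \<union> {jump_time S n..jump_time S (Suc n)}"
    using jump_time_nonneg[OF adm, of n] admissible_pos[OF adm, of n] by auto
  then show ?case using continuous_on_closed_Un[OF _ _ Suc 1] by simp
qed simp

lemma stagewise_continuous: "continuous_on {0..} (stagewise \<phi> S v)"
  unfolding continuous_on_eq_continuous_within
proof
  fix t :: real assume t: "t \<in> {0..}"
  obtain n where n: "t < jump_time S n" using admissible_exceeds[OF adm] by blast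
  have "continuous (at t within {0..jump_time S n}) (stagewise \<phi> S v)"
    using stagewise_continuous_upto t n by (auto simp: continuous_on_eq_continuous_within)
  moreover have "at t within {0..jump_time S n} = at t within {0..}"
    by (rule at_within_nhd[of _ "{..<jump_time S n}"]) (use n in auto)
  ultimately show "continuous (at t within {0..}) (stagewise \<phi> S v)"
    by (simp add: continuous_within)
qed

text \<open>Away from the jumps, the stage is locally constant.\<close>
lemma stagewise_derivative:
  assumes t: "0 \<le> t" "t \<notin> range (jump_time S)"
  shows "(stagewise \<phi> S v has_vector_derivative \<psi> (stage S t) (stagewise \<phi> S v t)) (at t)"
proof -
  let ?n = "stage S t"
  have b: "jump_time S ?n < t" "t < jump_time S (Suc ?n)"
    using stage_bounds[OF adm t(1)] t(2) by (metis order_le_less rangeI)+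
  have "((\<lambda>t. \<phi> ?n (t - jump_time S ?n) (node \<phi> S v ?n)) has_vector_derivative
      1 *\<^sub>R \<psi> ?n (\<phi> ?n (t - jump_time S ?n) (node \<phi> S v ?n))) (at t)"
    by (rule vector_diff_chain_at[unfolded comp_def, of "\<lambda>t. t - jump_time S ?n" 1 t "\<lambda>t. \<phi> ?n t (node \<phi> S v ?n)"])
       (auto intro!: derivative_eq_intros deriv)
  then have "((\<lambda>t. \<phi> ?n (t - jump_time S ?n) (node \<phi> S v ?n)) has_vector_derivative
      \<psi> ?n (stagewise \<phi> S v t)) (at t)"
    by (simp add: stagewise_def)
  then show ?thesis
    by (rule has_vector_derivative_transform_within_open[of _ _ _ "{jump_time S ?n<..<jump_time S (Suc ?n)}"])
       (use b in \<open>auto intro!: stagewise_on_stage[symmetric]\<close>)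
qed

end

lemma finite_jump_times: assumes "admissible S" shows "finite (range (jump_time S) \<inter> {..T})"
proof -
  obtain n where n: "T < jump_time S n" using admissible_exceeds[OF assms] by blast
  have "range (jump_time S) \<inter> {..T} \<subseteq> jump_time S ` {..n}"
  proof safe
    fix m assume "jump_time S m \<le> T"
    with n have "jump_time S m < jump_time S n" by simp
    then have "m \<le> n" using jump_time_mono[OF assms, of n m] by (meson nle_le not_less)
    then show "jump_time S m \<in> jump_time S ` {..n}" by simp
  qed
  then show ?thesis by (rule finite_subset) simp
qed

section \<open>Solutions with close occupation times are close\<close>

lemma nonincreasing_off_finite:
  fixes f f' :: "real \<Rightarrow> real"
  assumes "finite F" and cont: "continuous_on {0..T} f" and t: "0 \<le> t" "t \<le> T"
    and der: "\<And>s. s \<in> {0..T} - F \<Longrightarrow> (f has_real_derivative f' s) (at s)"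
    and neg: "\<And>s. s \<in> {0..T} - F \<Longrightarrow> f' s \<le> 0"
  shows "f t \<le> f 0"
proof -
  define g where "g s = (if s \<in> F then 0 else f' s)" for s
  have "(g has_integral (f t - f 0)) {0..t}"
  proof (rule fundamental_theorem_of_calculus_interior_strong[OF \<open>finite F\<close> t(1)])
    show "continuous_on {0..t} f" using cont by (rule continuous_on_subset) (use t in auto)
    fix s assume "s \<in> {0<..<t} - F"
    with t der[of s] show "(f has_vector_derivative g s) (at s)"
      by (simp add: g_def has_real_derivative_iff_has_vector_derivative)
  qed
  moreover have "((\<lambda>_. 0) has_integral 0) {0..t}" by (rule has_integral_0)
  ultimately have "f t - f 0 \<le> 0"
    by (rule has_integral_le) (use neg t in \<open>auto simp: g_def\<close>)
  then show ?thesis by simp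
qed

text \<open>The squared norm is used because it is differentiable everywhere, unlike the norm; the mixed
  term is absorbed by \<open>2 |w| c \<le> |w|\<^sup>2 + c\<^sup>2\<close>.\<close>
lemma gronwall_square:
  fixes w w' :: "real \<Rightarrow> 'a::real_inner"
  assumes F: "finite F" and cont: "continuous_on {0..T} w" and t: "0 \<le> t" "t \<le> T" and K: "0 \<le> K"
    and der: "\<And>s. s \<in> {0..T} - F \<Longrightarrow> (w has_vector_derivative w' s) (at s)"
    and le: "\<And>s. s \<in> {0..T} - F \<Longrightarrow> norm (w' s) \<le> K * norm (w s) + c"
  shows "(norm (w t))\<^sup>2 \<le> exp ((2 * K + 1) * t) * ((norm (w 0))\<^sup>2 + c\<^sup>2)"
proof -
  define L where "L = 2 * K + 1"
  define f where "f s = exp (- L * s) * (w s \<bullet> w s + c\<^sup>2)" for s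
  define f' where "f' s = exp (- L * s) * (2 * (w s \<bullet> w' s)) + (- L * exp (- L * s)) * (w s \<bullet> w s + c\<^sup>2)" for s
  have "f t \<le> f 0"
  proof (rule nonincreasing_off_finite[OF F _ t])
    show "continuous_on {0..T} f" unfolding f_def by (intro continuous_intros cont)
    fix s assume s: "s \<in> {0..T} - F"
    have 1: "((\<lambda>s. w s \<bullet> w s) has_vector_derivative (w s \<bullet> w' s + w' s \<bullet> w s)) (at s)"
      by (rule bounded_bilinear.has_vector_derivative[OF bounded_bilinear_inner der[OF s] der[OF s]])
    then have "((\<lambda>s. w s \<bullet> w s) has_real_derivative (2 * (w s \<bullet> w' s))) (at s)"
      by (simp add: has_real_derivative_iff_has_vector_derivative inner_commute)
    from this show "(f has_real_derivative f' s) (at s)"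
      unfolding f_def f'_def by (auto intro!: derivative_eq_intros simp: algebra_simps)
    have "w s \<bullet> w' s \<le> norm (w s) * norm (w' s)" by (rule norm_cauchy_schwarz)
    also have "\<dots> \<le> norm (w s) * (K * norm (w s) + c)" using le[OF s] by (rule mult_left_mono) simp
    finally have a: "2 * (w s \<bullet> w' s) \<le> 2 * (norm (w s) * (K * norm (w s) + c))" by simp
    have "0 \<le> (norm (w s) - c)\<^sup>2" by simp
    then have "2 * (norm (w s) * c) \<le> (norm (w s))\<^sup>2 + c\<^sup>2"
      by (simp add: power2_eq_square algebra_simps)
    with a have b: "2 * (w s \<bullet> w' s) \<le> L * (norm (w s))\<^sup>2 + c\<^sup>2"
      by (simp add: L_def power2_eq_square algebra_simps)
    have "L * c\<^sup>2 \<ge> c\<^sup>2" using K by (simp add: L_def algebra_simps)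
    with b have "2 * (w s \<bullet> w' s) - L * (w s \<bullet> w s + c\<^sup>2) \<le> 0"
      by (simp add: power2_norm_eq_inner algebra_simps)
    moreover have "f' s = exp (- L * s) * (2 * (w s \<bullet> w' s) - L * (w s \<bullet> w s + c\<^sup>2))"
      unfolding f'_def by (simp add: algebra_simps)
    ultimately show "f' s \<le> 0" by (simp add: mult_nonneg_nonpos)
  qed
  then have "exp (L * t) * f t \<le> exp (L * t) * (w 0 \<bullet> w 0 + c\<^sup>2)"
    by (intro mult_left_mono) (simp_all add: f_def)
  moreover have "exp (L * t) * exp (- L * t) = 1" by (simp add: exp_minus)
  then have "exp (L * t) * f t = w t \<bullet> w t + c\<^sup>2"
    by (simp add: f_def mult.assoc[symmetric])
  ultimately have "w t \<bullet> w t + c\<^sup>2 \<le> exp (L * t) * (w 0 \<bullet> w 0 + c\<^sup>2)" by simp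
  then have "w t \<bullet> w t \<le> exp (L * t) * (w 0 \<bullet> w 0 + c\<^sup>2)"
    using zero_le_power2[of c] by linarith
  then show ?thesis by (simp add: power2_norm_eq_inner L_def)
qed

lemma sum_matrix_vector_mult:
  fixes A :: "nat \<Rightarrow> real^'d^'d"
  shows "(\<Sum>l\<in>I. c l *\<^sub>R A l) *v v = (\<Sum>l\<in>I. c l *\<^sub>R (A l *v v))"
  by (induction I rule: infinite_finite_induct)
     (simp_all add: matrix_vector_mult_add_rdistrib scaleR_matrix_vector_assoc)

text \<open>Evaluation of a family written as a sum against indicators: a mode at the current
  state is the sum of all modes weighted by derivatives of occupation times.\<close>
lemma sum_of_bool_scaleR:
  fixes f :: "'a \<Rightarrow> 'b::real_vector"
  assumes "finite I" "a \<in> I" shows "(\<Sum>l\<in>I. of_bool (a = l) *\<^sub>R f l) = f a"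
  using assms by (subst sum.remove[of I a]) (auto intro!: sum.neutral)

text \<open>The difference of the two coefficient matrices is not small, but it is the derivative of
  \<open>\<Sum>\<^sub>l d\<^sub>l A\<^sub>l\<close>, where \<open>d\<^sub>l\<close> is the difference of the occupation times and is at most \<open>\<epsilon>\<close>. Subtracting
  this matrix applied to \<open>y\<close> from \<open>x - y\<close> leaves a function \<open>w\<close> whose derivative is
  \<open>A w\<close> up to terms of order \<open>\<epsilon>\<close>.\<close>
lemma solutions_close_if_occupations_close:
  fixes A B :: "nat \<Rightarrow> real^'d^'d" and x y :: "real \<Rightarrow> real^'d"
  assumes F: "finite F" and t: "0 \<le> t" "t \<le> T" and K: "0 \<le> K" and \<epsilon>: "0 \<le> \<epsilon>"
    and x: "continuous_on {0..T} x" "\<And>s. s \<in> {0..T} - F \<Longrightarrow> (x has_vector_derivative A (\<sigma> s) *v x s) (at s)"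
    and y: "continuous_on {0..T} y" "\<And>s. s \<in> {0..T} - F \<Longrightarrow> (y has_vector_derivative B (\<sigma>' s) *v y s) (at s)"
    and init: "x 0 = x0" "y 0 = x0"
    and states: "\<And>s. s \<in> {0..T} \<Longrightarrow> \<sigma> s \<in> {1..N}" "\<And>s. s \<in> {0..T} \<Longrightarrow> \<sigma>' s \<in> {1..k}"
    and A: "\<And>l v. l \<in> {1..N} \<Longrightarrow> norm (A l *v v) \<le> K * norm v"
    and BK: "\<And>j v. j \<in> {1..k} \<Longrightarrow> norm (B j *v v) \<le> K * norm v"
    and B: "\<And>j. j \<in> {1..k} \<Longrightarrow> B j = (\<Sum>l\<in>{1..N}. p j l *\<^sub>R A l)"
    and o: "\<And>l. continuous_on {0..T} (q l)"
      "\<And>s l. s \<in> {0..T} - F \<Longrightarrow> (q l has_real_derivative of_bool (\<sigma> s = l)) (at s)"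
    and o': "\<And>j. continuous_on {0..T} (q' j)"
      "\<And>s j. s \<in> {0..T} - F \<Longrightarrow> (q' j has_real_derivative of_bool (\<sigma>' s = j)) (at s)"
    and q0: "\<And>l. q l 0 = 0" "\<And>j. q' j 0 = 0"
    and close: "\<And>s l. s \<in> {0..T} \<Longrightarrow> l \<in> {1..N} \<Longrightarrow> \<bar>q l s - (\<Sum>j\<in>{1..k}. q' j s * p j l)\<bar> \<le> \<epsilon>"
  shows "norm (x t - y t) \<le> \<epsilon> * (real N * K * (2 * K + 1) * (exp ((2 * K + 1) * T))\<^sup>2 * norm x0)"
proof -
  \<comment> \<open>one constant that dominates the Gronwall factors, and their roots, on all of \<open>[0,T]\<close>\<close>
  define E where "E = exp ((2 * K + 1) * T)"
  have T0: "0 \<le> T" using t by simp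
  have E1: "1 \<le> E" unfolding E_def using K T0 by simp
  have E2: "z \<le> E * b" if "z\<^sup>2 \<le> exp ((2 * K + 1) * s) * b\<^sup>2" "s \<in> {0..T}" "0 \<le> b" for z b s :: real
  proof -
    have "exp ((2 * K + 1) * s) \<le> E" unfolding E_def using K that by (simp add: mult_left_mono)
    also have "E \<le> E\<^sup>2" using E1 by (simp add: power2_eq_square)
    finally have "exp ((2 * K + 1) * s) * b\<^sup>2 \<le> E\<^sup>2 * b\<^sup>2" by (intro mult_right_mono) auto
    with that(1) have "z\<^sup>2 \<le> (E * b)\<^sup>2" unfolding power_mult_distrib by (rule order_trans)
    moreover have "0 \<le> E * b" using E1 that(3) by simp
    ultimately show ?thesis by (rule power2_le_imp_le)
  qed
  have ybound: "norm (y s) \<le> E * norm x0" if s: "s \<in> {0..T}" for s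
    by (rule E2[OF _ s])
       (use gronwall_square[OF F y(1) _ _ K y(2), of s 0] BK states(2) s init in auto)
  define d where "d l s = q l s - (\<Sum>j\<in>{1..k}. q' j s * p j l)" for l s
  define d' where "d' l s = of_bool (\<sigma> s = l) - (\<Sum>j\<in>{1..k}. of_bool (\<sigma>' s = j) * p j l)" for l s
  define D where "D s v = (\<Sum>l\<in>{1..N}. d l s *\<^sub>R (A l *v v))" for s v
  have d: "(d l has_real_derivative d' l s) (at s)" if "s \<in> {0..T} - F" for l s
    unfolding d_def d'_def using o(2)[OF that] o'(2)[OF that]
    by (auto intro!: derivative_eq_intros)
  have d'sum: "(\<Sum>l\<in>{1..N}. d' l s *\<^sub>R (A l *v v)) = A (\<sigma> s) *v v - B (\<sigma>' s) *v v" if s: "s \<in> {0..T}" for s v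
  proof -
    have 1: "(\<Sum>j\<in>{1..k}. of_bool (\<sigma>' s = j) * p j l) = p (\<sigma>' s) l" for l
      using sum_of_bool_scaleR[of "{1..k}" "\<sigma>' s" "\<lambda>j. p j l"] states(2)[OF s] by simp
    have "(\<Sum>l\<in>{1..N}. d' l s *\<^sub>R (A l *v v)) =
        (\<Sum>l\<in>{1..N}. of_bool (\<sigma> s = l) *\<^sub>R (A l *v v)) - (\<Sum>l\<in>{1..N}. p (\<sigma>' s) l *\<^sub>R (A l *v v))"
      by (simp only: d'_def 1 scaleR_diff_left sum_subtractf)
    also have "(\<Sum>l\<in>{1..N}. of_bool (\<sigma> s = l) *\<^sub>R (A l *v v)) = A (\<sigma> s) *v v"
      by (rule sum_of_bool_scaleR) (use states(1)[OF s] in auto)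
    also have "(\<Sum>l\<in>{1..N}. p (\<sigma>' s) l *\<^sub>R (A l *v v)) = B (\<sigma>' s) *v v"
      unfolding B[OF states(2)[OF s]] by (simp add: sum_matrix_vector_mult)
    finally show ?thesis .
  qed
  have Dbound: "norm (D s v) \<le> \<epsilon> * real N * K * norm v" if s: "s \<in> {0..T}" for s v
  proof -
    have "norm (D s v) \<le> (\<Sum>l\<in>{1..N}. \<epsilon> * (K * norm v))"
      unfolding D_def
    proof (rule sum_norm_le)
      fix l assume l: "l \<in> {1..N}"
      show "norm (d l s *\<^sub>R (A l *v v)) \<le> \<epsilon> * (K * norm v)"
        using close[OF s l] A[OF l, of v] \<epsilon> by (auto simp: d_def intro!: mult_mono)
    qed
    then show ?thesis by (simp add: algebra_simps)
  qed
  \<comment> \<open>the corrected difference: the derivative of \<open>D s (y s)\<close> contains \<open>A y - B y\<close> and cancels the large term\<close>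
  define w where "w s = x s - y s - D s (y s)" for s
  define w' where "w' s = A (\<sigma> s) *v w s + A (\<sigma> s) *v D s (y s) - D s (B (\<sigma>' s) *v y s)" for s
  define c where "c = 2 * K * (\<epsilon> * real N * K * (E * norm x0))"
  have wder: "(w has_vector_derivative w' s) (at s)" if s: "s \<in> {0..T} - F" for s
  proof -
    have s': "s \<in> {0..T}" using s by simp
    have "((\<lambda>s. A l *v y s) has_vector_derivative A l *v (B (\<sigma>' s) *v y s)) (at s)" for l
      by (rule bounded_linear.has_vector_derivative[OF matrix_vector_mul_bounded_linear y(2)[OF s]])
    then have "((\<lambda>s. D s (y s)) has_vector_derivative
        (\<Sum>l\<in>{1..N}. d l s *\<^sub>R (A l *v (B (\<sigma>' s) *v y s)) + d' l s *\<^sub>R (A l *v y s))) (at s)"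
      unfolding D_def using d[OF s]
      by (auto intro!: has_vector_derivative_sum has_vector_derivative_scaleR)
    then have "((\<lambda>s. D s (y s)) has_vector_derivative
        (D s (B (\<sigma>' s) *v y s) + (A (\<sigma> s) *v y s - B (\<sigma>' s) *v y s))) (at s)"
      using d'sum[OF s', of "y s"] by (simp add: sum.distrib D_def)
    from has_vector_derivative_diff[OF has_vector_derivative_diff[OF x(2)[OF s] y(2)[OF s]] this]
    show ?thesis unfolding w_def w'_def
      by (simp add: algebra_simps matrix_vector_mult_diff_distrib)
  qed
  have wle: "norm (w' s) \<le> K * norm (w s) + c" if s: "s \<in> {0..T} - F" for s
  proof -
    have s': "s \<in> {0..T}" using s by simp
    have e: "0 \<le> \<epsilon> * real N * K" using \<epsilon> K by simp
    have "norm (A (\<sigma> s) *v D s (y s)) \<le> K * (\<epsilon> * real N * K * (E * norm x0))"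
      using A[OF states(1)[OF s'], of "D s (y s)"] Dbound[OF s', of "y s"] mult_left_mono[OF ybound[OF s'] e] K
      by (meson mult_left_mono order_trans)
    moreover have "norm (D s (B (\<sigma>' s) *v y s)) \<le> \<epsilon> * real N * K * (K * (E * norm x0))"
      using Dbound[OF s', of "B (\<sigma>' s) *v y s"] BK[OF states(2)[OF s'], of "y s"] ybound[OF s'] K e
      by (meson mult_left_mono order_trans)
    moreover have "norm (w' s) \<le> norm (A (\<sigma> s) *v w s) + norm (A (\<sigma> s) *v D s (y s)) + norm (D s (B (\<sigma>' s) *v y s))"
      unfolding w'_def by (meson add_right_mono norm_triangle_ineq norm_triangle_ineq4 order_trans)
    ultimately show ?thesis using A[OF states(1)[OF s'], of "w s"] by (simp add: c_def algebra_simps)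
  qed
  have "continuous_on {0..T} w"
    unfolding w_def D_def d_def
    by (intro continuous_intros x(1) y(1) o(1) o'(1)
        bounded_linear.continuous_on[OF matrix_vector_mul_bounded_linear])
  from gronwall_square[OF F this t K wder wle]
  have "(norm (w t))\<^sup>2 \<le> exp ((2 * K + 1) * t) * ((norm (w 0))\<^sup>2 + c\<^sup>2)" .
  moreover have "w 0 = 0" by (simp add: w_def D_def d_def init q0)
  ultimately have wt: "norm (w t) \<le> E * c"
    by (intro E2[of _ t]) (use t K \<epsilon> E1 in \<open>auto simp: c_def\<close>)
  have tT: "t \<in> {0..T}" using t by simp
  have e: "0 \<le> \<epsilon> * real N * K" using \<epsilon> K by simp
  have "norm (D t (y t)) \<le> \<epsilon> * real N * K * (E * norm x0)"
    using Dbound[OF tT, of "y t"] mult_left_mono[OF ybound[OF tT] e] by linarith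
  moreover have "\<epsilon> * real N * K * (E * norm x0) \<le> \<epsilon> * real N * K * (E * (E * norm x0))"
    using e E1 by (intro mult_left_mono) (simp_all add: mult_le_cancel_right1)
  moreover have "norm (x t - y t) \<le> norm (w t) + norm (D t (y t))"
    using norm_triangle_ineq[of "w t" "D t (y t)"] by (simp add: w_def)
  ultimately have "norm (x t - y t) \<le> E * c + \<epsilon> * real N * K * (E * (E * norm x0))"
    using wt by linarith
  also have "\<dots> = \<epsilon> * (real N * K * (2 * K + 1) * E\<^sup>2 * norm x0)"
    by (simp add: c_def algebra_simps power2_eq_square)
  finally show ?thesis by (simp add: E_def)
qed

section \<open>Quantiles of discrete laws\<close>

definition unif :: "real measure" where "unif = uniform_measure lborel {0..<1}"

lemma sets_unif [measurable_cong, simp]: "sets unif = sets borel"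
  and space_unif [simp]: "space unif = UNIV"
  by (simp_all add: unif_def)

lemma prob_space_unif: "prob_space unif"
  unfolding unif_def by (rule prob_space_uniform_measure) auto

lemma AE_unif: "AE u in unif. u \<in> {0..<1}"
  unfolding unif_def by (rule AE_uniform_measureI) auto

text \<open>The generalized inverse of the distribution function with point masses \<open>p\<close>; it turns a uniform
  variable into a variable with the law \<open>p\<close>.\<close>
definition quantile :: "(nat \<Rightarrow> real) \<Rightarrow> real \<Rightarrow> nat" where
  "quantile p u = (LEAST k. u < (\<Sum>i\<le>k. p i))"

lemma quantile_measurable [measurable (raw)]:
  assumes [measurable]: "\<And>i. (\<lambda>x. p x i) \<in> borel_measurable M" "f \<in> borel_measurable M"
  shows "(\<lambda>x. quantile (p x) (f x)) \<in> measurable M (count_space UNIV)"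
  unfolding quantile_def by measurable

lemma pmf_partial_sums_exceed: assumes "u < 1" shows "\<exists>k. u < (\<Sum>i\<le>k. pmf q (i::nat))"
proof -
  have "(\<lambda>k. measure (measure_pmf q) {..<k}) \<longlonglongrightarrow> measure (measure_pmf q) (\<Union>k. {..<k})"
    by (rule measure_pmf.finite_Lim_measure_incseq) (auto simp: incseq_def)
  also have "(\<Union>k::nat. {..<k}) = UNIV" by auto
  finally have "(\<lambda>k. \<Sum>i<k. pmf q i) \<longlonglongrightarrow> 1"
    by (simp add: measure_measure_pmf_finite)
  then have "eventually (\<lambda>k. u < (\<Sum>i<k. pmf q i)) sequentially"
    using assms by (rule order_tendstoD)
  then obtain k where "u < (\<Sum>i<k. pmf q i)" by (auto simp: eventually_sequentially)
  also have "\<dots> \<le> (\<Sum>i\<le>k. pmf q i)" by (rule sum_mono2) auto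
  finally show ?thesis by blast
qed

lemma quantile_eq_iff:
  assumes u: "0 \<le> u" "u < 1"
  shows "quantile (pmf q) u = k \<longleftrightarrow> (\<Sum>i<k. pmf q i) \<le> u \<and> u < (\<Sum>i\<le>k. pmf q i)"
proof
  assume k: "quantile (pmf q) u = k"
  have "u < (\<Sum>i\<le>k. pmf q i)"
    using LeastI_ex[OF pmf_partial_sums_exceed[OF u(2), of q]] k by (simp add: quantile_def)
  moreover have "(\<Sum>i<k. pmf q i) \<le> u"
  proof (cases k)
    case (Suc j)
    then have "j < quantile (pmf q) u" using k by simp
    then have "\<not> u < (\<Sum>i\<le>j. pmf q i)" unfolding quantile_def by (rule not_less_Least)
    with Suc show ?thesis by (simp add: lessThan_Suc_atMost)
  qed (use u in simp)
  ultimately show "(\<Sum>i<k. pmf q i) \<le> u \<and> u < (\<Sum>i\<le>k. pmf q i)" by simp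
next
  assume k: "(\<Sum>i<k. pmf q i) \<le> u \<and> u < (\<Sum>i\<le>k. pmf q i)"
  show "quantile (pmf q) u = k" unfolding quantile_def
  proof (rule Least_equality)
    fix j assume j: "u < (\<Sum>i\<le>j. pmf q i)"
    show "k \<le> j"
    proof (rule ccontr)
      assume "\<not> k \<le> j"
      then have "(\<Sum>i\<le>j. pmf q i) \<le> (\<Sum>i<k. pmf q i)" by (intro sum_mono2) auto
      with j k show False by simp
    qed
  qed (use k in simp)
qed

lemma distr_qnt: "distr unif (count_space UNIV) (quantile (pmf q)) = measure_pmf q"
proof (rule measure_eqI_countable[of _ UNIV])
  fix k :: nat
  let ?a = "\<Sum>i<k. pmf q i" and ?b = "\<Sum>i\<le>k. pmf q i"
  have b: "?b = ?a + pmf q k" by (simp add: lessThan_Suc_atMost[symmetric])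
  have "?b = measure (measure_pmf q) {..k}" by (simp add: measure_measure_pmf_finite)
  then have "?b \<le> 1" by simp
  then have "{0..<1} \<inter> {u. quantile (pmf q) u = k} = {?a..<?b}"
  proof (intro set_eqI iffI)
    fix u assume u: "u \<in> {?a..<?b}"
    have "0 \<le> ?a" by (simp add: sum_nonneg)
    with u \<open>?b \<le> 1\<close> have "0 \<le> u" "u < 1" by auto
    with u show "u \<in> {0..<1} \<inter> {u. quantile (pmf q) u = k}" by (simp add: quantile_eq_iff)
  next
    fix u assume "u \<in> {0..<1} \<inter> {u. quantile (pmf q) u = k}"
    then show "u \<in> {?a..<?b}" using quantile_eq_iff[of u q k] by auto
  qed
  then have "emeasure lborel ({0..<1} \<inter> {u. quantile (pmf q) u = k}) = ennreal (pmf q k)" by (simp add: b)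
  moreover have "(\<lambda>u. quantile (pmf q) u) \<in> measurable borel (count_space UNIV)" by measurable
  from measurable_sets[OF this, of "{k}"] have "{u. quantile (pmf q) u = k} \<in> sets lborel" by (simp add: vimage_def)
  ultimately have "emeasure unif {u. quantile (pmf q) u = k} = ennreal (pmf q k)"
    unfolding unif_def by (subst emeasure_uniform_measure) (simp_all add: divide_ennreal_def)
  then show "emeasure (distr unif (count_space UNIV) (quantile (pmf q))) {k} = emeasure (measure_pmf q) {k}"
    by (simp add: emeasure_distr vimage_def emeasure_pmf_single)
qed auto

lemma quantile_in_set_pmf: assumes "0 \<le> u" "u < 1" shows "quantile (pmf q) u \<in> set_pmf q"
proof -
  have "(\<Sum>i<quantile (pmf q) u. pmf q i) < (\<Sum>i\<le>quantile (pmf q) u. pmf q i)"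
    using quantile_eq_iff[OF assms, of q "quantile (pmf q) u"] by linarith
  then show ?thesis by (auto simp: lessThan_Suc_atMost[symmetric] set_pmf_iff)
qed

section \<open>Poisson counts as functions of a uniform variable\<close>

lemma poisson_factorial_moments:
  "(\<lambda>k. r ^ k / fact k * exp (- r) * real k) sums r"
  "(\<lambda>k. r ^ k / fact k * exp (- r) * (real k * (real k - 1))) sums r\<^sup>2"
proof -
  have e: "(\<lambda>k. exp (- r) * (r ^ k / fact k)) sums (exp (- r) * exp r)"
    using exp_converges[of r] by (intro sums_mult) (simp add: scaleR_conv_of_real divide_inverse mult.commute)
  then have e: "(\<lambda>k. exp (- r) * (r ^ k / fact k)) sums 1" by (simp add: exp_minus)
  have "(\<lambda>k. r * (exp (- r) * (r ^ k / fact k))) sums (r * 1)" by (rule sums_mult[OF e])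
  also have "(\<lambda>k. r * (exp (- r) * (r ^ k / fact k))) = (\<lambda>k. r ^ Suc k / fact (Suc k) * exp (- r) * real (Suc k))"
    by (simp add: fun_eq_iff)
  finally show 1: "(\<lambda>k. r ^ k / fact k * exp (- r) * real k) sums r" by (subst (asm) sums_Suc_iff) simp
  have "(\<lambda>k. r\<^sup>2 * (exp (- r) * (r ^ k / fact k))) sums (r\<^sup>2 * 1)" by (rule sums_mult[OF e])
  also have "(\<lambda>k. r\<^sup>2 * (exp (- r) * (r ^ k / fact k))) =
      (\<lambda>k. r ^ Suc (Suc k) / fact (Suc (Suc k)) * exp (- r) * (real (Suc (Suc k)) * (real (Suc (Suc k)) - 1)))"
  proof
    fix k :: nat
    have "fact (Suc (Suc k)) = real (Suc (Suc k)) * (real (Suc k) * fact k)" by (simp only: fact_Suc of_nat_mult)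
    moreover have e: "real (Suc (Suc k)) - 1 = real (Suc k)" by simp
    ultimately show "r\<^sup>2 * (exp (- r) * (r ^ k / fact k)) =
      r ^ Suc (Suc k) / fact (Suc (Suc k)) * exp (- r) * (real (Suc (Suc k)) * (real (Suc (Suc k)) - 1))"
    proof -
      assume f: "fact (Suc (Suc k)) = real (Suc (Suc k)) * (real (Suc k) * fact k)"
      have *: "X / (a * (b * F)) * z * (a * b) = X / F * z" if "a \<noteq> 0" "b \<noteq> 0" for X a b F z :: real
        using that by simp
      have "r ^ Suc (Suc k) / (real (Suc (Suc k)) * (real (Suc k) * fact k)) * exp (- r) * (real (Suc (Suc k)) * real (Suc k)) =
          r ^ Suc (Suc k) / fact k * exp (- r)" by (rule *) simp_all
      also have "\<dots> = r\<^sup>2 * (exp (- r) * (r ^ k / fact k))" by (simp add: power2_eq_square)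
      finally show ?thesis unfolding f e by (rule sym)
    qed
  qed
  finally show "(\<lambda>k. r ^ k / fact k * exp (- r) * (real k * (real k - 1))) sums r\<^sup>2"
    by (subst (asm) sums_Suc_iff, subst (asm) sums_Suc_iff) simp
qed

lemma has_bochner_integral_pmf_nat:
  fixes f :: "nat \<Rightarrow> real"
  assumes s: "(\<lambda>k. pmf q k * f k) sums c" and f: "\<And>k. 0 \<le> f k"
  shows "has_bochner_integral (measure_pmf q) f c"
proof (rule has_bochner_integral_nn_integral)
  have "(\<integral>\<^sup>+ k. ennreal (f k) \<partial>measure_pmf q) = (\<integral>\<^sup>+ k. ennreal (pmf q k * f k) \<partial>count_space UNIV)"
    by (simp add: nn_integral_measure_pmf ennreal_mult'[OF pmf_nonneg])
  also have "\<dots> = (\<Sum>k. ennreal (pmf q k * f k))" by (rule nn_integral_count_space_nat)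
  also have "\<dots> = ennreal c"
    using s f by (subst suminf_ennreal2) (auto simp: sums_iff)
  finally show "(\<integral>\<^sup>+ k. ennreal (f k) \<partial>measure_pmf q) = ennreal c" .
  show "0 \<le> c" by (rule sums_le[OF _ sums_zero s]) (simp add: f)
qed (use f in auto)

lemma poisson_mean_square:
  assumes r: "0 < r" and c: "0 < c"
  shows "has_bochner_integral (measure_pmf (poisson_pmf r)) (\<lambda>k. real k / c - r / c) 0"
    and "has_bochner_integral (measure_pmf (poisson_pmf r)) (\<lambda>k. (real k / c - r / c)\<^sup>2) (r / c\<^sup>2)"
proof -
  let ?M = "measure_pmf (poisson_pmf r)"
  have 1: "has_bochner_integral ?M real r"
    by (rule has_bochner_integral_pmf_nat, simp only: pmf_poisson[OF r]) (rule poisson_factorial_moments(1), simp)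
  have 2: "has_bochner_integral ?M (\<lambda>k. real k * (real k - 1)) (r\<^sup>2)"
  proof (rule has_bochner_integral_pmf_nat)
    show "0 \<le> real k * (real k - 1)" for k by (cases k) simp_all
    show "(\<lambda>k. pmf (poisson_pmf r) k * (real k * (real k - 1))) sums r\<^sup>2"
      unfolding pmf_poisson[OF r] by (rule poisson_factorial_moments(2))
  qed
  have 3: "has_bochner_integral ?M (\<lambda>k. b) b" for b :: real
    by (simp add: has_bochner_integral_iff)
  show "has_bochner_integral ?M (\<lambda>k. real k / c - r / c) 0"
    using has_bochner_integral_diff[OF has_bochner_integral_divide_zero[OF 1, of c] 3[of "r / c"]] by simp
  have "has_bochner_integral ?M (\<lambda>k. (1 / c\<^sup>2) * (real k * (real k - 1) + real k - 2 * r * real k + r\<^sup>2))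
      ((1 / c\<^sup>2) * (r\<^sup>2 + r - 2 * r * r + r\<^sup>2))"
    by (intro has_bochner_integral_mult_right has_bochner_integral_add has_bochner_integral_diff 1 2 3)
  also have "(\<lambda>k. (1 / c\<^sup>2) * (real k * (real k - 1) + real k - 2 * r * real k + r\<^sup>2)) = (\<lambda>k. (real k / c - r / c)\<^sup>2)"
    using c by (simp add: fun_eq_iff power2_eq_square field_simps)
  also have "(1 / c\<^sup>2) * (r\<^sup>2 + r - 2 * r * r + r\<^sup>2) = r / c\<^sup>2" by (simp add: power2_eq_square)
  finally show "has_bochner_integral ?M (\<lambda>k. (real k / c - r / c)\<^sup>2) (r / c\<^sup>2)" .
qed

text \<open>The derivative of the distribution function with respect to the mean telescopes to minus the last point mass.\<close>
lemma poisson_cdf_antimono: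
  fixes r r' :: real
  assumes "0 \<le> r" "r \<le> r'"
  shows "(\<Sum>i\<le>k. r' ^ i / fact i * exp (- r')) \<le> (\<Sum>i\<le>k. r ^ i / fact i * exp (- r))"
proof (rule DERIV_nonpos_imp_nonincreasing[OF assms(2)])
  fix x assume x: "r \<le> x" "x \<le> r'"
  have "((\<lambda>x. \<Sum>i\<le>k. x ^ i / fact i * exp (- x)) has_real_derivative - (x ^ k / fact k * exp (- x))) (at x)"
  proof (induction k)
    case 0 then show ?case by (auto intro!: derivative_eq_intros)
  next
    case (Suc k)
    have f: "fact (Suc k) = real (Suc k) * fact k" by (simp only: fact_Suc)
    have "((\<lambda>x. x ^ Suc k / fact (Suc k) * exp (- x)) has_real_derivative
        x ^ k / fact k * exp (- x) - x ^ Suc k / fact (Suc k) * exp (- x)) (at x)"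
    proof -
      have "((\<lambda>x. x ^ Suc k) has_real_derivative real (Suc k) * x ^ k) (at x)"
        using DERIV_pow[of "Suc k" x] by simp
      moreover have "((\<lambda>x. exp (- x)) has_real_derivative exp (- x) * - 1) (at x)"
        by (auto intro!: derivative_eq_intros)
      ultimately have "((\<lambda>x. x ^ Suc k / fact (Suc k) * exp (- x)) has_real_derivative
          real (Suc k) * x ^ k / fact (Suc k) * exp (- x) + exp (- x) * - 1 * (x ^ Suc k / fact (Suc k))) (at x)"
        by (intro DERIV_mult DERIV_cdivide)
      moreover have "real (Suc k) * x ^ k / fact (Suc k) = x ^ k / fact k"
        unfolding f by (rule mult_divide_mult_cancel_left) simp
      ultimately show ?thesis by (simp only: mult_minus_right mult_minus_left mult_1_right mult.commute[of "exp (- x)"] add_uminus_conv_diff)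
    qed
    from DERIV_add[OF Suc this] show ?case by (simp only: sum.atMost_Suc minus_add_cancel diff_conv_add_uminus add.assoc[symmetric] add.left_inverse add_0)
  qed
  moreover have "- (x ^ k / fact k * exp (- x)) \<le> 0" using x assms by simp
  ultimately show "\<exists>y. ((\<lambda>x. \<Sum>i\<le>k. x ^ i / fact i * exp (- x)) has_real_derivative y) (at x) \<and> y \<le> 0" by blast
qed

text \<open>The number of points of a Poisson process of rate \<open>c\<close> during a stage of length \<open>fst e\<close>, read
  off a uniform variable \<open>snd e\<close> attached to the stage. Only the numbers of points per stage matter for
  the observed states, so no point process is needed; and the holding times do not depend on \<open>c\<close>, so that one
  process can be observed at all rates.\<close>
definition obs_count :: "real \<Rightarrow> real \<times> real \<Rightarrow> nat" where
  "obs_count c e = quantile (\<lambda>i. (c * fst e) ^ i / fact i * exp (- (c * fst e))) (snd e)"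

lemma obs_count_measurable [measurable]: "obs_count c \<in> measurable (borel \<Otimes>\<^sub>M borel) (count_space UNIV)"
  unfolding obs_count_def by measurable

lemma obs_count_eq:
  assumes "0 < c * s"
  shows "obs_count c (s, v) = quantile (pmf (poisson_pmf (c * s))) v"
proof -
  have "pmf (poisson_pmf (c * s)) = (\<lambda>i. (c * s) ^ i / fact i * exp (- (c * s)))"
    by (rule ext) (rule pmf_poisson[OF assms])
  then show ?thesis unfolding obs_count_def fst_conv snd_conv by (rule arg_cong[OF sym])
qed

text \<open>A quantile coupling is monotone. This permits truncation of long stages.\<close>
lemma obs_count_mono:
  assumes c: "0 < c" and s: "0 < s" "s \<le> s'" and v: "0 \<le> v" "v < 1"
  shows "obs_count c (s, v) \<le> obs_count c (s', v)"
proof -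
  have p: "0 < c * s" "0 < c * s'" "c * s \<le> c * s'" using c s by auto
  define k where "k = quantile (pmf (poisson_pmf (c * s'))) v"
  have "v < (\<Sum>i\<le>k. pmf (poisson_pmf (c * s')) i)"
    using quantile_eq_iff[OF v, of "poisson_pmf (c * s')"] unfolding k_def by blast
  also have "\<dots> \<le> (\<Sum>i\<le>k. pmf (poisson_pmf (c * s)) i)"
    unfolding pmf_poisson[OF p(1)] pmf_poisson[OF p(2)]
    by (rule poisson_cdf_antimono[OF less_imp_le[OF p(1)] p(3)])
  finally have "quantile (pmf (poisson_pmf (c * s))) v \<le> k" unfolding quantile_def by (rule Least_le)
  then show ?thesis unfolding obs_count_eq[OF p(1)] obs_count_eq[OF p(2)] k_def .
qed

lemma distr_obs_count:
  assumes "0 < c * s"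
  shows "distr unif (count_space UNIV) (\<lambda>v. obs_count c (s, v)) = measure_pmf (poisson_pmf (c * s))"
  unfolding obs_count_eq[OF assms] by (rule distr_qnt)

lemma obs_count_mean_square:
  assumes "0 < s" "0 < c"
  shows "has_bochner_integral unif (\<lambda>v. real (obs_count c (s, v)) / c - s) 0"
    and "has_bochner_integral unif (\<lambda>v. (real (obs_count c (s, v)) / c - s)\<^sup>2) (s / c)"
proof -
  have r: "0 < c * s" using assms by simp
  have e: "c * s / c = s" "c * s / c\<^sup>2 = s / c" using assms by (auto simp: power2_eq_square)
  have *: "has_bochner_integral unif (\<lambda>v. f (obs_count c (s, v))) z"
    if "has_bochner_integral (measure_pmf (poisson_pmf (c * s))) f z" for f and z :: real
  proof -
    have m: "(\<lambda>v. obs_count c (s, v)) \<in> measurable unif (count_space UNIV)" by measurable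
    show ?thesis using that unfolding distr_obs_count[OF r, symmetric] has_bochner_integral_iff
      by (subst (asm) integrable_distr_eq[OF m], simp, subst (asm) integral_distr[OF m]) simp_all
  qed
  show "has_bochner_integral unif (\<lambda>v. real (obs_count c (s, v)) / c - s) 0"
    by (rule *) (rule poisson_mean_square(1)[OF r assms(2), unfolded e])
  show "has_bochner_integral unif (\<lambda>v. (real (obs_count c (s, v)) / c - s)\<^sup>2) (s / c)"
    by (rule *) (rule poisson_mean_square(2)[OF r assms(2), unfolded e])
qed

section \<open>The number of observations during a stage\<close>

text \<open>A holding time together with the independent uniform variable that generates the observations during it.\<close>
definition stage_law :: "real \<Rightarrow> (real \<times> real) measure" where
  "stage_law \<mu> = density lborel (exponential_density \<mu>) \<Otimes>\<^sub>M unif"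

lemma sets_stage_law [measurable_cong, simp]: "sets (stage_law \<mu>) = sets (borel \<Otimes>\<^sub>M borel)"
  unfolding stage_law_def by (rule sets_pair_measure_cong) simp_all

lemma space_stage_law [simp]: "space (stage_law \<mu>) = UNIV"
  by (simp add: stage_law_def space_pair_measure)

lemma prob_space_stage_law: assumes "0 < \<mu>" shows "prob_space (stage_law \<mu>)"
  unfolding stage_law_def
  by (intro prob_space_pair prob_space_exponential_density prob_space_unif assms)

text \<open>A Poisson variable whose mean is exponentially distributed is geometric: before each observation the
  chain jumps with probability \<open>\<mu> / (c + \<mu>)\<close>.\<close>
lemma distr_stage_law_obs_count:
  assumes \<mu>: "0 < \<mu>" and c: "0 < c"
  shows "distr (stage_law \<mu>) (count_space UNIV) (obs_count c) = measure_pmf (geometric_pmf (\<mu> / (c + \<mu>)))"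
proof (rule measure_eqI_countable[of _ UNIV])
  fix d :: nat
  interpret U: prob_space unif by (rule prob_space_unif)
  let ?E = "density lborel (exponential_density \<mu>)"
  let ?q = "\<mu> / (c + \<mu>)"
  have q: "0 < ?q" "?q \<le> 1" using assms by auto
  have [measurable]: "{e. obs_count c e = d} \<in> sets (borel \<Otimes>\<^sub>M borel)"
    using measurable_sets[OF obs_count_measurable, of "{d}" c] by (simp add: vimage_def space_pair_measure)
  have "emeasure (distr (stage_law \<mu>) (count_space UNIV) (obs_count c)) {d} = emeasure (stage_law \<mu>) {e. obs_count c e = d}"
    by (subst emeasure_distr) (auto simp: vimage_def)
  also have "\<dots> = (\<integral>\<^sup>+ s. emeasure unif (Pair s -` {e. obs_count c e = d}) \<partial>?E)"
    unfolding stage_law_def by (rule U.emeasure_pair_measure_alt) (simp cong: sets_pair_measure_cong)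
  also have "\<dots> = (\<integral>\<^sup>+ s. exponential_density \<mu> s * emeasure unif {v. obs_count c (s, v) = d} \<partial>lborel)"
    by (subst nn_integral_density) (auto simp: vimage_def)
  also have "\<dots> = (\<integral>\<^sup>+ s. ennreal (\<mu> * c ^ d / (fact d * (c + \<mu>))) * ennreal (erlang_density 0 (c + \<mu>) s * s ^ d) \<partial>lborel)"
  proof (rule nn_integral_cong_AE, use AE_lborel_singleton[of 0] in eventually_elim)
    fix s :: real assume "s \<noteq> 0"
    show "exponential_density \<mu> s * emeasure unif {v. obs_count c (s, v) = d} =
      ennreal (\<mu> * c ^ d / (fact d * (c + \<mu>))) * ennreal (erlang_density 0 (c + \<mu>) s * s ^ d)"
    proof (cases "s < 0")
      case False
      then have r: "0 < c * s" using c \<open>s \<noteq> 0\<close> by simp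
      have "emeasure unif {v. obs_count c (s, v) = d} = emeasure (measure_pmf (poisson_pmf (c * s))) {d}"
        unfolding distr_obs_count[OF r, symmetric] by (subst emeasure_distr) (auto simp: vimage_def)
      also have "\<dots> = ennreal ((c * s) ^ d / fact d * exp (- (c * s)))"
        using r by (simp add: emeasure_pmf_single)
      finally have 1: "emeasure unif {v. obs_count c (s, v) = d} = ennreal ((c * s) ^ d / fact d * exp (- (c * s)))" .
      have 2: "exp (- (s * \<mu>)) * exp (- (c * s)) = exp ((- c - \<mu>) * s)"
        by (simp add: exp_add[symmetric] algebra_simps)
      have "exponential_density \<mu> s * ((c * s) ^ d / fact d * exp (- (c * s))) =
          (\<mu> * c ^ d / (fact d * (c + \<mu>))) * (erlang_density 0 (c + \<mu>) s * s ^ d)"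
      proof -
        have c1: "A / (F * g) * (g * X * Y) = A / F * (X * Y)" if "g \<noteq> 0" for A F g X Y :: real
          using that by simp
        have "exponential_density \<mu> s = \<mu> * exp (- (s * \<mu>))"
          using False by (simp add: exponential_density_def)
        moreover have "erlang_density 0 (c + \<mu>) s = (c + \<mu>) * exp (- (c + \<mu>) * s)"
          using False by (simp add: erlang_density_def)
        moreover have "c + \<mu> \<noteq> 0" using assms by simp
        ultimately show ?thesis
          by (simp only: c1) (simp add: 2 power_mult_distrib)
      qed
      then show ?thesis unfolding 1 using False assms
        by (subst (1 2) ennreal_mult'[symmetric]) (auto simp: exponential_density_nonneg)
    qed (simp add: exponential_density_def erlang_density_def)
  qed
  also have "\<dots> = ennreal (\<mu> * c ^ d / (fact d * (c + \<mu>))) * ennreal (fact d / (c + \<mu>) ^ d)"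
    using assms by (subst nn_integral_cmult) (auto simp: nn_integral_erlang_ith_moment)
  also have "\<dots> = ennreal ((1 - ?q) ^ d * ?q)"
  proof -
    have "1 - ?q = c / (c + \<mu>)" using assms by (simp add: field_simps)
    then have "\<mu> * c ^ d / (fact d * (c + \<mu>)) * (fact d / (c + \<mu>) ^ d) = (1 - ?q) ^ d * ?q"
      by (simp add: power_divide mult.commute)
    then show ?thesis using assms by (subst ennreal_mult'[symmetric]) auto
  qed
  also have "\<dots> = emeasure (measure_pmf (geometric_pmf ?q)) {d}"
    using q by (simp add: emeasure_pmf_single)
  finally show "emeasure (distr (stage_law \<mu>) (count_space UNIV) (obs_count c)) {d} =
    emeasure (measure_pmf (geometric_pmf ?q)) {d}" .
qed auto

section \<open>Integration over sequences and Kolmogorov's inequality\<close>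

context sequence_space
begin

text \<open>Splits off the first coordinate of an independent sequence. All laws of chains below are computed by this
  recursion.\<close>
lemma integral_iter:
  fixes f :: "(nat \<Rightarrow> 'a) \<Rightarrow> real"
  assumes f [measurable]: "f \<in> borel_measurable S" and C: "\<And>\<omega>. \<bar>f \<omega>\<bar> \<le> C"
  shows "(\<integral>\<omega>. f \<omega> \<partial>S) = (\<integral>a. (\<integral>\<omega>. f (case_nat a \<omega>) \<partial>S) \<partial>M)"
proof -
  have [measurable]: "(\<lambda>(s, \<omega>). case_nat s \<omega>) \<in> measurable (M \<Otimes>\<^sub>M S) S"
    by measurable
  interpret pair_sigma_finite M S ..
  have prob: "prob_space (M \<Otimes>\<^sub>M S)"
    by (intro prob_space_pair M.prob_space_axioms P.prob_space_axioms)
  have "(\<integral>\<omega>. f \<omega> \<partial>S) = (\<integral>\<omega>. f \<omega> \<partial>distr (M \<Otimes>\<^sub>M S) S (\<lambda>(s, \<omega>). case_nat s \<omega>))"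
    by (simp only: PiM_iter)
  also have "\<dots> = (\<integral>p. f ((\<lambda>(s, \<omega>). case_nat s \<omega>) p) \<partial>(M \<Otimes>\<^sub>M S))"
    by (rule integral_distr) measurable
  also have "\<dots> = (\<integral>p. (case p of (a, \<omega>) \<Rightarrow> f (case_nat a \<omega>)) \<partial>(M \<Otimes>\<^sub>M S))"
    by (intro Bochner_Integration.integral_cong) auto
  also have "\<dots> = (\<integral>a. (\<integral>\<omega>. f (case_nat a \<omega>) \<partial>S) \<partial>M)"
  proof (rule integral_fst[symmetric])
    show "integrable (M \<Otimes>\<^sub>M S) (\<lambda>(a, \<omega>). f (case_nat a \<omega>))"
    proof (rule finite_measure.integrable_const_bound[OF prob_space.finite_measure[OF prob], where B = C])
      have "(\<lambda>p. f ((\<lambda>(s, \<omega>). case_nat s \<omega>) p)) \<in> borel_measurable (M \<Otimes>\<^sub>M S)" by measurable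
      then show "(\<lambda>(a, \<omega>). f (case_nat a \<omega>)) \<in> borel_measurable (M \<Otimes>\<^sub>M S)"
        by (simp add: case_prod_beta')
    qed (use C in auto)
  qed
  finally show ?thesis .
qed

text \<open>Kolmogorov's inequality with a starting value \<open>s\<close>, which makes it
  provable by induction on the number of summands: condition on the first one and add its value to \<open>s\<close>; the
  mixed term vanishes because the summands are centred.\<close>
lemma kolmogorov_maximal:
  fixes X :: "nat \<Rightarrow> 'a \<Rightarrow> real"
  assumes "\<And>i. X i \<in> borel_measurable M"
    and "\<And>i. has_bochner_integral M (X i) 0"
    and "\<And>i. has_bochner_integral M (\<lambda>a. (X i a)\<^sup>2) (w i)" "\<And>i. w i \<le> v" and \<epsilon>: "0 < \<epsilon>"
  shows "measure S {\<omega>\<in>space S. \<exists>j\<le>J. \<epsilon> \<le> \<bar>s + (\<Sum>i<j. X i (\<omega> i))\<bar>} \<le> (s\<^sup>2 + real J * v) / \<epsilon>\<^sup>2"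
  using assms(1-4)
proof (induction J arbitrary: X w s)
  case 0
  show ?case
  proof (cases "\<epsilon> \<le> \<bar>s\<bar>")
    case True
    then have "\<epsilon>\<^sup>2 \<le> s\<^sup>2" using \<epsilon> by (simp add: abs_le_square_iff[symmetric])
    then have "1 \<le> s\<^sup>2 / \<epsilon>\<^sup>2" using \<epsilon> by simp
    then show ?thesis by (simp add: order_trans[OF P.prob_le_1])
  qed simp
next
  case (Suc J)
  note [measurable] = Suc.prems(1)
  have w0: "w 0 = M.expectation (\<lambda>a. (X 0 a)\<^sup>2)"
    using Suc.prems(3)[of 0] by (simp add: has_bochner_integral_iff)
  have "0 \<le> w 0" unfolding w0 by simp
  then have v: "0 \<le> v" using Suc.prems(4)[of 0] by simp
  let ?A = "{\<omega>\<in>space S. \<exists>j\<le>Suc J. \<epsilon> \<le> \<bar>s + (\<Sum>i<j. X i (\<omega> i))\<bar>}"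
  show ?case
  proof (cases "\<epsilon> \<le> \<bar>s\<bar>")
    case True
    then have "\<epsilon>\<^sup>2 \<le> s\<^sup>2" using \<epsilon> by (simp add: abs_le_square_iff[symmetric])
    also have "\<dots> \<le> s\<^sup>2 + real (Suc J) * v" using v by simp
    finally have "1 \<le> (s\<^sup>2 + real (Suc J) * v) / \<epsilon>\<^sup>2" using \<epsilon> by (subst le_divide_eq_1_pos) auto
    then show ?thesis by (rule order_trans[OF P.prob_le_1])
  next
    case False
    let ?B = "\<lambda>a. {\<omega>\<in>space S. \<exists>j\<le>J. \<epsilon> \<le> \<bar>(s + X 0 a) + (\<Sum>i<j. X (Suc i) (\<omega> i))\<bar>}"
    have split: "(\<exists>j\<le>Suc J. \<epsilon> \<le> \<bar>s + (\<Sum>i<j. X i (case_nat a \<omega> i))\<bar>) \<longleftrightarrow>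
        (\<exists>j\<le>J. \<epsilon> \<le> \<bar>(s + X 0 a) + (\<Sum>i<j. X (Suc i) (\<omega> i))\<bar>)" for a \<omega>
    proof -
      have e: "s + (\<Sum>i<Suc j. X i (case_nat a \<omega> i)) = (s + X 0 a) + (\<Sum>i<j. X (Suc i) (\<omega> i))" for j
        by (simp only: sum.lessThan_Suc_shift) simp
      show ?thesis
      proof
        assume "\<exists>j\<le>Suc J. \<epsilon> \<le> \<bar>s + (\<Sum>i<j. X i (case_nat a \<omega> i))\<bar>"
        then obtain j where j: "j \<le> Suc J" "\<epsilon> \<le> \<bar>s + (\<Sum>i<j. X i (case_nat a \<omega> i))\<bar>" by blast
        with False obtain k where "j = Suc k" by (cases j) auto
        with j e[of k] show "\<exists>j\<le>J. \<epsilon> \<le> \<bar>(s + X 0 a) + (\<Sum>i<j. X (Suc i) (\<omega> i))\<bar>" by (intro exI[of _ k]) simp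
      next
        assume "\<exists>j\<le>J. \<epsilon> \<le> \<bar>(s + X 0 a) + (\<Sum>i<j. X (Suc i) (\<omega> i))\<bar>"
        then obtain k where k: "k \<le> J" "\<epsilon> \<le> \<bar>(s + X 0 a) + (\<Sum>i<k. X (Suc i) (\<omega> i))\<bar>" by blast
        with e[of k] show "\<exists>j\<le>Suc J. \<epsilon> \<le> \<bar>s + (\<Sum>i<j. X i (case_nat a \<omega> i))\<bar>" by (intro exI[of _ "Suc k"]) simp
      qed
    qed
    have A: "?A \<in> sets S" by measurable
    have c: "has_bochner_integral M (\<lambda>a. b) b" for b :: real
      by (simp add: has_bochner_integral_iff M.prob_space)
    have "has_bochner_integral M (\<lambda>a. s\<^sup>2 + 2 * s * X 0 a + (X 0 a)\<^sup>2 + real J * v) (s\<^sup>2 + 2 * s * 0 + w 0 + real J * v)"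
      by (intro has_bochner_integral_add has_bochner_integral_mult_right Suc.prems c)
    moreover have "s\<^sup>2 + 2 * s * X 0 a + (X 0 a)\<^sup>2 = (s + X 0 a)\<^sup>2" for a
      by (simp add: power2_sum algebra_simps)
    ultimately have sq: "has_bochner_integral M (\<lambda>a. (s + X 0 a)\<^sup>2 + real J * v) (s\<^sup>2 + w 0 + real J * v)" by simp
    have "measure S ?A = (\<integral>\<omega>. indicator ?A \<omega> \<partial>S)" using A by simp
    also have "\<dots> = (\<integral>a. (\<integral>\<omega>. indicator ?A (case_nat a \<omega>) \<partial>S) \<partial>M)"
      by (rule integral_iter[where C = 1]) (use A in \<open>auto simp: indicator_def\<close>)
    also have "\<dots> = (\<integral>a. measure S (?B a) \<partial>M)"
    proof (rule Bochner_Integration.integral_cong[OF refl])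
      fix a assume a: "a \<in> space M"
      have "(\<integral>\<omega>. indicator ?A (case_nat a \<omega>) \<partial>S) = (\<integral>\<omega>. indicator (?B a) \<omega> \<partial>S)"
        using a split by (intro Bochner_Integration.integral_cong[OF refl])
          (auto simp: indicator_def space_PiM PiE_iff split: nat.split)
      also have "\<dots> = measure S (?B a)" by (simp add: Int_absorb2 subset_eq)
      finally show "(\<integral>\<omega>. indicator ?A (case_nat a \<omega>) \<partial>S) = measure S (?B a)" .
    qed
    also have "\<dots> \<le> (\<integral>a. ((s + X 0 a)\<^sup>2 + real J * v) / \<epsilon>\<^sup>2 \<partial>M)"
    proof (rule integral_mono_AE')
      show "integrable M (\<lambda>a. ((s + X 0 a)\<^sup>2 + real J * v) / \<epsilon>\<^sup>2)"
        using sq by (auto simp: has_bochner_integral_iff)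
      show "AE a in M. measure S (?B a) \<le> ((s + X 0 a)\<^sup>2 + real J * v) / \<epsilon>\<^sup>2"
        by (intro AE_I2 Suc.IH[OF Suc.prems(1) Suc.prems(2) Suc.prems(3) Suc.prems(4)])
      show "AE a in M. 0 \<le> ((s + X 0 a)\<^sup>2 + real J * v) / \<epsilon>\<^sup>2" using v by simp
    qed
    also have "\<dots> = (s\<^sup>2 + w 0 + real J * v) / \<epsilon>\<^sup>2"
      using sq by (simp add: has_bochner_integral_iff)
    also have "\<dots> \<le> (s\<^sup>2 + real (Suc J) * v) / \<epsilon>\<^sup>2"
      using Suc.prems(4)[of 0] by (intro divide_right_mono) (auto simp: algebra_simps)
    finally show ?thesis .
  qed
qed

end

section \<open>Markov chains driven by uniform noise\<close>

text \<open>Entries of a probability vector outside \<open>{1..N}\<close> are arbitrary and have to be cut off before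
  it can serve as a law on the natural numbers.\<close>
definition prob_row :: "nat \<Rightarrow> (nat \<Rightarrow> real) \<Rightarrow> nat \<Rightarrow> real" where
  "prob_row N p i = (if i \<in> {1..N} then p i else 0)"

lemma pmf_prob_row:
  assumes "probability_vector N p"
  shows "pmf (embed_pmf (prob_row N p)) = prob_row N p"
proof -
  have p: "0 \<le> prob_row N p i" for i
    using assms by (auto simp: prob_row_def probability_vector_def)
  have "(\<integral>\<^sup>+ i. ennreal (prob_row N p i) \<partial>count_space UNIV) = (\<Sum>i\<in>{1..N}. ennreal (prob_row N p i))"
    by (rule nn_integral_count_space') (auto simp: prob_row_def)
  also have "\<dots> = ennreal (\<Sum>i\<in>{1..N}. prob_row N p i)" by (rule sum_ennreal) (rule p)
  also have "(\<Sum>i\<in>{1..N}. prob_row N p i) = 1"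
    using assms by (simp add: prob_row_def probability_vector_def)
  finally show ?thesis using p by (intro ext pmf_embed_pmf) simp_all
qed

text \<open>The value \<open>1\<close> is used on a null set only. It makes the range a subset of \<open>{1..N}\<close> everywhere, as
  measurability into \<open>count_space {1..N}\<close> demands.\<close>
definition draw :: "nat \<Rightarrow> (nat \<Rightarrow> real) \<Rightarrow> real \<Rightarrow> nat" where
  "draw N p u = (let k = quantile (prob_row N p) u in if k \<in> {1..N} then k else 1)"

lemma draw_range: "1 \<le> N \<Longrightarrow> draw N p u \<in> {1..N}"
  by (simp add: draw_def Let_def)

lemma draw_measurable [measurable (raw)]:
  assumes [measurable]: "f \<in> borel_measurable M"
  shows "(\<lambda>x. draw N p (f x)) \<in> measurable M (count_space UNIV)"
proof -
  have "(\<lambda>x. quantile (prob_row N p) (f x)) \<in> measurable M (count_space UNIV)" by (rule quantile_measurable) measurable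
  then show ?thesis unfolding draw_def Let_def by (rule measurable_compose) simp
qed

lemma integral_draw:
  fixes F :: "nat \<Rightarrow> real"
  assumes p: "probability_vector N p" and N: "1 \<le> N"
  shows "(\<integral>u. F (draw N p u) \<partial>unif) = (\<Sum>i\<in>{1..N}. p i * F i)"
proof -
  let ?q = "embed_pmf (prob_row N p)"
  have set: "set_pmf ?q \<subseteq> {1..N}"
    unfolding set_pmf_eq pmf_prob_row[OF p] by (auto simp: prob_row_def)
  have m: "quantile (prob_row N p) \<in> measurable unif (count_space UNIV)" by measurable
  have "(\<integral>u. F (draw N p u) \<partial>unif) = (\<integral>u. F (quantile (prob_row N p) u) \<partial>unif)"
  proof (rule integral_cong_AE)
    show "AE u in unif. F (draw N p u) = F (quantile (prob_row N p) u)"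
      using AE_unif
    proof eventually_elim
      fix u :: real assume "u \<in> {0..<1}"
      then have "quantile (pmf ?q) u \<in> set_pmf ?q" by (intro quantile_in_set_pmf) auto
      with set have "quantile (prob_row N p) u \<in> {1..N}" unfolding pmf_prob_row[OF p] by blast
      then show "F (draw N p u) = F (quantile (prob_row N p) u)" by (simp add: draw_def Let_def)
    qed
  qed (use m in measurable)
  also have "\<dots> = (\<integral>k. F k \<partial>distr unif (count_space UNIV) (quantile (prob_row N p)))"
    by (rule integral_distr[symmetric, OF m]) simp
  also have "\<dots> = (\<integral>k. F k \<partial>measure_pmf ?q)"
    using distr_qnt[of ?q] by (simp only: pmf_prob_row[OF p])
  also have "\<dots> = (\<Sum>i\<in>{1..N}. F i * pmf ?q i)"
    by (rule integral_measure_pmf_real) (use set in auto)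
  also have "\<dots> = (\<Sum>i\<in>{1..N}. p i * F i)"
    by (intro sum.cong) (simp_all add: pmf_prob_row[OF p] prob_row_def)
  finally show ?thesis .
qed

primrec chain :: "nat \<Rightarrow> (nat \<Rightarrow> nat \<Rightarrow> real) \<Rightarrow> nat \<Rightarrow> (nat \<Rightarrow> real) \<Rightarrow> nat \<Rightarrow> nat" where
  "chain N P i u 0 = i"
| "chain N P i u (Suc n) = draw N (P (chain N P i u n)) (u n)"

lemma chain_range: "1 \<le> N \<Longrightarrow> i \<in> {1..N} \<Longrightarrow> chain N P i u n \<in> {1..N}"
  by (cases n) (simp_all only: chain.simps draw_range)

text \<open>The Markov property: after one step the chain is the same chain, driven by the shifted noise.\<close>
lemma chain_shift: "chain N P i (case_nat a u) (Suc n) = chain N P (draw N (P i) a) u n"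
  by (induction n) simp_all

lemma measurable_draw_state:
  fixes k :: "'a \<Rightarrow> nat"
  assumes [measurable]: "k \<in> measurable M (count_space UNIV)" "f \<in> borel_measurable M"
  shows "(\<lambda>x. draw N (P (k x)) (f x)) \<in> measurable M (count_space (UNIV :: nat set))"
  by (rule measurable_compose_countable[where f = "\<lambda>j x. draw N (P j) (f x)" and g = k]) measurable

lemma chain_measurable:
  assumes k [measurable]: "k \<in> measurable M (count_space UNIV)"
    and u [measurable]: "\<And>n. (\<lambda>x. u x n) \<in> borel_measurable M"
  shows "(\<lambda>x. chain N P (k x) (u x) n) \<in> measurable M (count_space UNIV)"
  by (induction n) (use k in \<open>simp_all add: measurable_draw_state\<close>)

abbreviation noise :: "(nat \<Rightarrow> real) measure" where
  "noise \<equiv> \<Pi>\<^sub>M n\<in>(UNIV :: nat set). unif"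

interpretation noise: sequence_space unif
  by (intro sequence_space.intro product_prob_spaceI prob_space_unif)

lemma space_noise [simp]: "space noise = UNIV"
  by (simp add: space_PiM)

text \<open>Expectation of \<open>F\<close> applied to the list of the next \<open>n\<close> states of a chain with transition matrix \<open>J\<close> that is in state
  \<open>i\<close> now; the state \<open>i\<close> itself does not belong to the list. As a recursion it is
  continuous in \<open>J\<close> and makes sense without reference to a probability space.\<close>
primrec path_exp :: "nat \<Rightarrow> (nat \<Rightarrow> nat \<Rightarrow> real) \<Rightarrow> nat \<Rightarrow> (nat list \<Rightarrow> real) \<Rightarrow> nat \<Rightarrow> real" where
  "path_exp N J 0 F i = F []"
| "path_exp N J (Suc n) F i = (\<Sum>j\<in>{1..N}. J i j * path_exp N J n (\<lambda>ys. F (j # ys)) j)"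

lemma map_chain_measurable:
  assumes k [measurable]: "k \<in> measurable M (count_space UNIV)"
    and u [measurable]: "\<And>n. (\<lambda>x. u x n) \<in> borel_measurable M"
  shows "(\<lambda>x. map (chain N P (k x) (u x)) [1..<Suc n]) \<in> measurable M (count_space UNIV)"
proof (induction n)
  case (Suc n)
  have "(\<lambda>x. map (chain N P (k x) (u x)) [1..<Suc n] @ [chain N P (k x) (u x) (Suc n)]) \<in> measurable M (count_space UNIV)"
  proof (rule measurable_compose_countable[where f = "\<lambda>l x. l @ [chain N P (k x) (u x) (Suc n)]", OF _ Suc])
    fix l
    show "(\<lambda>x. l @ [chain N P (k x) (u x) (Suc n)]) \<in> measurable M (count_space UNIV)"
      using chain_measurable[OF k u, where n = "Suc n"] by (rule measurable_compose) simp
  qed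
  then show ?case by simp
qed simp

lemma integral_path:
  fixes F :: "nat list \<Rightarrow> real"
  assumes P: "stochastic_matrix N P" and N: "1 \<le> N" and i: "i \<in> {1..N}" and F: "\<And>l. \<bar>F l\<bar> \<le> C"
  shows "(\<integral>u. F (map (chain N P i u) [1..<Suc n]) \<partial>noise) = path_exp N P n F i"
  using i F
proof (induction n arbitrary: i F)
  case 0
  show ?case using noise.P.prob_space by simp
next
  case (Suc n)
  have m: "(\<lambda>u. F (map (chain N P i u) [1..<Suc (Suc n)])) \<in> borel_measurable noise"
    by (rule measurable_compose[OF map_chain_measurable]) simp_all
  have "(\<integral>u. F (map (chain N P i u) [1..<Suc (Suc n)]) \<partial>noise)
    = (\<integral>a. (\<integral>u. F (map (chain N P i (case_nat a u)) [1..<Suc (Suc n)]) \<partial>noise) \<partial>unif)"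
    by (rule noise.integral_iter[where C = C, OF m]) (rule Suc.prems)
  also have "\<dots> = (\<integral>a. (\<integral>u. F (draw N (P i) a # map (chain N P (draw N (P i) a) u) [1..<Suc n]) \<partial>noise) \<partial>unif)"
  proof -
    have "map (chain N P i (case_nat a u)) [1..<Suc (Suc n)] = draw N (P i) a # map (chain N P (draw N (P i) a) u) [1..<Suc n]" for a u
    proof -
      have "map (chain N P i (case_nat a u)) [1..<Suc (Suc n)] = map (\<lambda>m. chain N P i (case_nat a u) (Suc m)) [0..<Suc n]"
        by (simp add: map_Suc_upt[symmetric] del: upt_Suc)
      also have "\<dots> = map (chain N P (draw N (P i) a) u) [0..<Suc n]" by (simp only: chain_shift)
      finally show ?thesis by (simp add: upt_conv_Cons del: upt_Suc)
    qed
    then show ?thesis by (simp only:)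
  qed
  also have "\<dots> = (\<integral>a. path_exp N P n (\<lambda>l. F (draw N (P i) a # l)) (draw N (P i) a) \<partial>unif)"
    by (intro Bochner_Integration.integral_cong refl Suc.IH[OF draw_range[OF N]] Suc.prems(2))
  also have "\<dots> = (\<Sum>j\<in>{1..N}. P i j * path_exp N P n (\<lambda>l. F (j # l)) j)"
    by (rule integral_draw[OF _ N, where F = "\<lambda>j. path_exp N P n (\<lambda>l. F (j # l)) j"])
       (use P Suc.prems(1) in \<open>auto simp: stochastic_matrix_def\<close>)
  finally show ?case by simp
qed

lemma path_exp_point:
  assumes "\<And>m. m \<le> n \<Longrightarrow> z m \<in> {1..N}"
  shows "path_exp N P n (\<lambda>l. c * of_bool (l = map z [1..<Suc n])) (z 0) = c * (\<Prod>m<n. P (z m) (z (Suc m)))"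
  using assms
proof (induction n arbitrary: z)
  case (Suc n)
  let ?z = "\<lambda>m. z (Suc m)"
  have l: "map z [1..<Suc (Suc n)] = z 1 # map ?z [1..<Suc n]"
    by (simp add: upt_conv_Cons map_Suc_upt[symmetric] del: upt_Suc)
  have "path_exp N P (Suc n) (\<lambda>l. c * of_bool (l = map z [1..<Suc (Suc n)])) (z 0) =
      (\<Sum>j\<in>{1..N}. P (z 0) j * path_exp N P n (\<lambda>l. c * of_bool (j # l = z 1 # map ?z [1..<Suc n])) j)"
    by (simp only: l path_exp.simps)
  also have "\<dots> = (\<Sum>j\<in>{1..N}. if j = z 1 then P (z 0) (z 1) * (c * (\<Prod>m<n. P (?z m) (?z (Suc m)))) else 0)"
  proof (intro sum.cong refl)
    fix j
    have *: "path_exp N P n (\<lambda>l. 0) i = 0" for i by (induction n arbitrary: i) simp_all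
    show "P (z 0) j * path_exp N P n (\<lambda>l. c * of_bool (j # l = z 1 # map ?z [1..<Suc n])) j =
      (if j = z 1 then P (z 0) (z 1) * (c * (\<Prod>m<n. P (?z m) (?z (Suc m)))) else 0)"
      using Suc.IH[of ?z] Suc.prems by (auto simp: * simp del: upt_Suc)
  qed
  also have "\<dots> = P (z 0) (z 1) * (c * (\<Prod>m<n. P (?z m) (?z (Suc m))))"
    using Suc.prems[of 1] by simp
  finally show ?case by (simp only: prod.lessThan_Suc_shift) (simp add: mult_ac)
qed simp

definition chain_from :: "nat \<Rightarrow> (nat \<Rightarrow> real) \<Rightarrow> (nat \<Rightarrow> nat \<Rightarrow> real) \<Rightarrow> (nat \<Rightarrow> real) \<Rightarrow> nat \<Rightarrow> nat" where
  "chain_from N \<nu> P u = chain N P (draw N \<nu> (u 0)) (\<lambda>n. u (Suc n))"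

lemma chain_from_range: "1 \<le> N \<Longrightarrow> chain_from N \<nu> P u n \<in> {1..N}"
  unfolding chain_from_def by (intro chain_range draw_range)

lemma chain_from_measurable [measurable (raw)]:
  assumes [measurable]: "\<And>n. (\<lambda>x. u x n) \<in> borel_measurable M"
  shows "(\<lambda>x. chain_from N \<nu> P (u x) n) \<in> measurable M (count_space UNIV)"
  unfolding chain_from_def by (intro chain_measurable) measurable

text \<open>The finite-dimensional laws that define a discrete Markov chain.\<close>
lemma chain_from_path_prob:
  assumes \<nu>: "probability_vector N \<nu>" and P: "stochastic_matrix N P" and N: "1 \<le> N"
    and z: "\<And>m. m \<le> n \<Longrightarrow> z m \<in> {1..N}"
  shows "measure noise {u. \<forall>m\<le>n. chain_from N \<nu> P u m = z m} = \<nu> (z 0) * (\<Prod>m<n. P (z m) (z (Suc m)))"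
proof -
  let ?F = "\<lambda>u. of_bool (\<forall>m\<le>n. chain_from N \<nu> P u m = z m) :: real"
  let ?G = "\<lambda>i l. of_bool (i = z 0) * of_bool (l = map z [1..<Suc n]) :: real"
  have F: "?F (case_nat a u) = ?G (draw N \<nu> a) (map (chain N P (draw N \<nu> a) u) [1..<Suc n])" for a u
  proof -
    have "(\<forall>m\<le>n. y m = z m) \<longleftrightarrow> y 0 = z 0 \<and> (\<forall>m\<in>{1..<Suc n}. y m = z m)" for y :: "nat \<Rightarrow> nat"
      by (auto simp: less_Suc_eq_le Suc_le_eq)
    then show ?thesis
      by (cases "draw N \<nu> a = z 0") (auto simp: chain_from_def simp del: upt_Suc)
  qed
  have "{u. \<forall>m\<le>n. chain_from N \<nu> P u m = z m} = {u\<in>space noise. \<forall>m\<le>n. chain_from N \<nu> P u m = z m}" by simp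
  also have "\<dots> \<in> sets noise" by measurable
  finally have S: "{u. \<forall>m\<le>n. chain_from N \<nu> P u m = z m} \<in> sets noise" .
  have "measure noise {u. \<forall>m\<le>n. chain_from N \<nu> P u m = z m} = (\<integral>u. indicator {u. \<forall>m\<le>n. chain_from N \<nu> P u m = z m} u \<partial>noise)"
    using S by simp
  also have "\<dots> = (\<integral>u. ?F u \<partial>noise)"
    by (intro Bochner_Integration.integral_cong) (auto simp: indicator_def)
  also have "\<dots> = (\<integral>a. (\<integral>u. ?F (case_nat a u) \<partial>noise) \<partial>unif)"
  proof (rule noise.integral_iter[where C = 1])
    show "?F \<in> borel_measurable noise"
      using borel_measurable_indicator[OF S, where ?'b = real] by (simp add: indicator_def[abs_def])
  qed simp
  also have "\<dots> = (\<integral>a. path_exp N P n (?G (draw N \<nu> a)) (draw N \<nu> a) \<partial>unif)"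
    unfolding F by (subst integral_path[OF P N draw_range[OF N], where C = 1]) auto
  also have "\<dots> = (\<Sum>i\<in>{1..N}. \<nu> i * path_exp N P n (?G i) i)"
    by (rule integral_draw[OF \<nu> N, where F = "\<lambda>i. path_exp N P n (?G i) i"])
  also have "\<dots> = (\<Sum>i\<in>{1..N}. if i = z 0 then \<nu> (z 0) * (\<Prod>m<n. P (z m) (z (Suc m))) else 0)"
  proof (intro sum.cong refl)
    fix i
    have *: "path_exp N P n (\<lambda>l. 0) i = 0" for i by (induction n arbitrary: i) simp_all
    show "\<nu> i * path_exp N P n (?G i) i = (if i = z 0 then \<nu> (z 0) * (\<Prod>m<n. P (z m) (z (Suc m))) else 0)"
      using path_exp_point[of n z N P 1] z by (auto simp: * simp del: upt_Suc)
  qed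
  finally show ?thesis using z[of 0] by simp
qed

section \<open>The base space of a Markov process\<close>

abbreviation stages :: "real \<Rightarrow> (nat \<Rightarrow> real \<times> real) measure" where
  "stages \<mu> \<equiv> \<Pi>\<^sub>M n\<in>(UNIV :: nat set). stage_law \<mu>"

lemma space_stages [simp]: "space (stages \<mu>) = UNIV"
  by (simp add: space_PiM)

lemma sequence_space_stages: "0 < \<mu> \<Longrightarrow> sequence_space (stage_law \<mu>)"
  by (intro sequence_space.intro product_prob_spaceI prob_space_stage_law)

text \<open>Noise for the chain, and for each stage its holding time with the variable that generates the observations.\<close>
type_synonym sample = "(nat \<Rightarrow> real) \<times> (nat \<Rightarrow> real \<times> real)"

text \<open>One space for all parameters \<open>\<nu>\<close> and \<open>P\<close>: the first component drives the chain, the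
  second consists of the holding times and the variables that generate the observations.\<close>
definition base :: "real \<Rightarrow> sample measure" where
  "base \<mu> = noise \<Otimes>\<^sub>M stages \<mu>"

lemma space_base [simp]: "space (base \<mu>) = UNIV"
  by (simp add: base_def space_pair_measure)

lemma prob_space_stages: "0 < \<mu> \<Longrightarrow> prob_space (stages \<mu>)"
  by (intro prob_space_PiM prob_space_stage_law)

lemma prob_space_base: "0 < \<mu> \<Longrightarrow> prob_space (base \<mu>)"
  unfolding base_def by (intro prob_space_pair prob_space_stages noise.P.prob_space_axioms)

lemma exponential_density_moments:
  assumes \<mu>: "0 < \<mu>"
  shows "has_bochner_integral (density lborel (exponential_density \<mu>)) (\<lambda>x. x ^ i) (fact i / \<mu> ^ i)"
proof -
  let ?E = "density lborel (exponential_density \<mu>)"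
  interpret E: prob_space ?E using \<mu> by (rule prob_space_exponential_density)
  have d: "distributed ?E lborel (\<lambda>x. x) (exponential_density \<mu>)"
    unfolding distributed_def by (auto simp: distr_id2 exponential_density_nonneg \<mu>)
  show ?thesis
    using E.has_bochner_integral_erlang_ith_moment[OF \<mu> d[unfolded exponential_density_def[symmetric]], of i] by simp
qed

lemma exponential_moments:
  assumes \<mu>: "0 < \<mu>"
  shows "has_bochner_integral (stage_law \<mu>) fst (1 / \<mu>)"
    and "has_bochner_integral (stage_law \<mu>) (\<lambda>e. (fst e)\<^sup>2) (2 / \<mu>\<^sup>2)"
proof -
  let ?E = "density lborel (exponential_density \<mu>)"
  have dist: "distr (stage_law \<mu>) ?E fst = ?E"
    unfolding stage_law_def by (rule prob_space.distr_pair_fst[OF prob_space_unif])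
  have f: "fst \<in> measurable (stage_law \<mu>) ?E" unfolding stage_law_def by measurable
  have *: "has_bochner_integral (stage_law \<mu>) (\<lambda>e. fst e ^ i) (fact i / \<mu> ^ i)" for i
    using exponential_density_moments[OF \<mu>, of i] unfolding has_bochner_integral_iff
    by (subst (asm) dist[symmetric], subst (asm) (2) dist[symmetric], subst (asm) integrable_distr_eq[OF f], simp,
        subst (asm) integral_distr[OF f]) simp_all
  show "has_bochner_integral (stage_law \<mu>) fst (1 / \<mu>)" using *[of 1] by simp
  show "has_bochner_integral (stage_law \<mu>) (\<lambda>e. (fst e)\<^sup>2) (2 / \<mu>\<^sup>2)" using *[of 2] by (simp add: numeral_2_eq_2)
qed

text \<open>Chebyshev's inequality: the \<open>J\<close>-th jump time has mean \<open>J / \<mu> \<ge> 2 T\<close> and variance \<open>J / \<mu>\<^sup>2\<close>.\<close>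
lemma few_jumps_unlikely:
  assumes \<mu>: "0 < \<mu>" and J: "0 < J" "2 * \<mu> * T \<le> real J"
  shows "measure (stages \<mu>) {e. jump_time (\<lambda>n. fst (e n)) J < T} \<le> 4 / real J"
proof -
  interpret sequence_space "stage_law \<mu>" by (rule sequence_space_stages[OF \<mu>])
  let ?X = "\<lambda>(i::nat) (a :: real \<times> real). fst a - 1 / \<mu>"
  have c: "has_bochner_integral (stage_law \<mu>) (\<lambda>a. b) b" for b :: real
    by (simp add: has_bochner_integral_iff M.prob_space[simplified])
  have X1: "has_bochner_integral (stage_law \<mu>) (?X i) 0" for i :: nat
    using has_bochner_integral_diff[OF exponential_moments(1)[OF \<mu>] c[of "1 / \<mu>"]] by simp
  have X2: "has_bochner_integral (stage_law \<mu>) (\<lambda>a. (?X i a)\<^sup>2) (1 / \<mu>\<^sup>2)" for i :: nat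
  proof -
    have "has_bochner_integral (stage_law \<mu>) (\<lambda>a. (fst a)\<^sup>2 - 2 / \<mu> * fst a + 1 / \<mu>\<^sup>2) (2 / \<mu>\<^sup>2 - 2 / \<mu> * (1 / \<mu>) + 1 / \<mu>\<^sup>2)"
      by (intro has_bochner_integral_add has_bochner_integral_diff has_bochner_integral_mult_right exponential_moments c \<mu>)
    moreover have "(\<lambda>a :: real \<times> real. (fst a)\<^sup>2 - 2 / \<mu> * fst a + 1 / \<mu>\<^sup>2) = (\<lambda>a. (?X i a)\<^sup>2)"
      by (simp add: fun_eq_iff power2_diff power_divide)
    moreover have "2 / \<mu>\<^sup>2 - 2 / \<mu> * (1 / \<mu>) + 1 / \<mu>\<^sup>2 = 1 / \<mu>\<^sup>2" by (simp add: power2_eq_square)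
    ultimately show ?thesis by simp
  qed
  let ?\<epsilon> = "real J / (2 * \<mu>)"
  have \<epsilon>: "0 < ?\<epsilon>" using J \<mu> by simp
  let ?B = "{\<omega>\<in>space S. \<exists>j\<le>J. ?\<epsilon> \<le> \<bar>0 + (\<Sum>i<j. ?X i (\<omega> i))\<bar>}"
  have "measure S ?B \<le> (0\<^sup>2 + real J * (1 / \<mu>\<^sup>2)) / ?\<epsilon>\<^sup>2"
    by (rule kolmogorov_maximal[where w = "\<lambda>_. 1 / \<mu>\<^sup>2", OF _ X1 X2 _ \<epsilon>]) simp_all
  also have "\<dots> = 4 / real J"
    using J \<mu> by (simp add: power2_eq_square field_simps)
  finally have "measure S ?B \<le> 4 / real J" .
  moreover have "measure S {e. jump_time (\<lambda>n. fst (e n)) J < T} \<le> measure S ?B"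
  proof (rule P.finite_measure_mono)
    show "{e. jump_time (\<lambda>n. fst (e n)) J < T} \<subseteq> ?B"
    proof safe
      fix e :: "nat \<Rightarrow> real \<times> real" assume e: "jump_time (\<lambda>n. fst (e n)) J < T"
      have "T \<le> ?\<epsilon>" using J(2) \<mu> by (simp add: field_simps)
      moreover have "(\<Sum>i<J. ?X i (e i)) = jump_time (\<lambda>n. fst (e n)) J - 2 * ?\<epsilon>"
        using \<mu> by (simp add: jump_time_def sum_subtractf)
      ultimately have "?\<epsilon> \<le> \<bar>0 + (\<Sum>i<J. ?X i (e i))\<bar>" using e by linarith
      then show "\<exists>j\<le>J. ?\<epsilon> \<le> \<bar>0 + (\<Sum>i<j. ?X i (e i))\<bar>" by blast
    qed simp
  qed measurable
  ultimately show ?thesis by linarith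
qed

lemma jump_time_measurable [measurable (raw)]:
  assumes [measurable]: "\<And>n. (\<lambda>x. S x n) \<in> borel_measurable M"
  shows "(\<lambda>x. jump_time (S x) n) \<in> borel_measurable M"
  unfolding jump_time_def by measurable

lemma stage_fst_measurable [measurable]: "(\<lambda>e. fst (e n)) \<in> borel_measurable (stages \<mu>)"
  by measurable

text \<open>Jump times are unbounded because for each \<open>K\<close> it is unlikely that many of them lie below \<open>K\<close>.\<close>
lemma AE_admissible:
  assumes \<mu>: "0 < \<mu>"
  shows "AE e in stages \<mu>. admissible (\<lambda>n. fst (e n))"
proof -
  interpret sequence_space "stage_law \<mu>" by (rule sequence_space_stages[OF \<mu>])
  have "AE e in stages \<mu>. \<forall>n. 0 < fst (e n)"
    unfolding AE_all_countable
  proof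
    fix n
    let ?E = "density lborel (exponential_density \<mu>)"
    have "AE s in ?E. 0 < s"
      using AE_lborel_singleton[of 0]
      by (subst AE_density) (auto simp: exponential_density_def elim!: eventually_mono)
    then have "AE s in distr (stage_law \<mu>) ?E fst. 0 < s"
      unfolding stage_law_def prob_space.distr_pair_fst[OF prob_space_unif] .
    then have "AE a in stage_law \<mu>. 0 < fst a"
      by (rule AE_distrD[rotated]) (unfold stage_law_def, measurable)
    then show "AE e in stages \<mu>. 0 < fst (e n)"
      by (intro AE_PiM_component prob_space_stage_law \<mu>) auto
  qed
  moreover have "AE e in stages \<mu>. \<forall>K::nat. \<exists>n. real K \<le> jump_time (\<lambda>n. fst (e n)) n"
    unfolding AE_all_countable
  proof
    fix K :: nat
    let ?B = "{e. \<forall>n. jump_time (\<lambda>n. fst (e n)) n < real K}"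
    have "?B = {e\<in>space S. \<forall>n. jump_time (\<lambda>n. fst (e n)) n < real K}" by simp
    also have "\<dots> \<in> sets S" by measurable
    finally have B: "?B \<in> sets S" .
    have "measure S ?B \<le> 0 + e" if "0 < e" for e
    proof -
      obtain J :: nat where J: "max 1 (max (4 / e) (2 * \<mu> * real K)) \<le> real J" using real_arch_simple by blast
      have "measure S ?B \<le> measure S {e. jump_time (\<lambda>n. fst (e n)) J < real K}"
      proof (rule P.finite_measure_mono)
        have "{e. jump_time (\<lambda>n. fst (e n)) J < real K} = {e\<in>space S. jump_time (\<lambda>n. fst (e n)) J < real K}" by simp
        also have "\<dots> \<in> sets S" by measurable
        finally show "{e. jump_time (\<lambda>n. fst (e n)) J < real K} \<in> sets S" .
      qed auto
      also have "\<dots> \<le> 4 / real J" by (rule few_jumps_unlikely[OF \<mu>]) (use J in auto)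
      also have "\<dots> \<le> e" using J that by (simp add: field_simps)
      finally show ?thesis by simp
    qed
    then have "measure S ?B \<le> 0" by (rule field_le_epsilon)
    then have "measure S ?B = 0" by (simp add: measure_le_0_iff)
    then have "emeasure S ?B = 0" by (simp add: P.emeasure_eq_measure)
    then show "AE e in stages \<mu>. \<exists>n. real K \<le> jump_time (\<lambda>n. fst (e n)) n"
      using B by (intro AE_I[of _ _ ?B]) (auto simp: not_le)
  qed
  ultimately show ?thesis by eventually_elim (simp add: admissible_def)
qed

text \<open>Constant holding times replace the inadmissible ones, a null set, so that trajectories are continuous for
  every sample.\<close>
definition hold :: "(nat \<Rightarrow> real \<times> real) \<Rightarrow> nat \<Rightarrow> real" where
  "hold e n = (if admissible (\<lambda>n. fst (e n)) then fst (e n) else 1)"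

lemma hold_eq: "admissible (\<lambda>n. fst (e n)) \<Longrightarrow> hold e = (\<lambda>n. fst (e n))"
  by (simp add: hold_def fun_eq_iff)

lemma admissible_hold [simp]: "admissible (hold e)"
proof (cases "admissible (\<lambda>n. fst (e n))")
  case True
  then show ?thesis by (simp add: hold_eq)
next
  case False
  then have "hold e = (\<lambda>_. 1)" by (simp add: hold_def fun_eq_iff)
  then show ?thesis by (auto simp: admissible_def jump_time_def intro: exI)
qed

lemma hold_measurable [measurable]: "(\<lambda>e. hold e n) \<in> borel_measurable (stages \<mu>)"
  unfolding hold_def admissible_def by measurable

lemma stage_measurable [measurable (raw)]:
  assumes [measurable]: "\<And>n. (\<lambda>x. S x n) \<in> borel_measurable M"
  shows "(\<lambda>x. stage (S x) t) \<in> measurable M (count_space UNIV)"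
  unfolding stage_def by measurable

definition switching :: "nat \<Rightarrow> (nat \<Rightarrow> real) \<Rightarrow> (nat \<Rightarrow> nat \<Rightarrow> real) \<Rightarrow> real \<Rightarrow> sample \<Rightarrow> nat" where
  "switching N \<nu> P t \<omega> = chain_from N \<nu> P (fst \<omega>) (stage (hold (snd \<omega>)) t)"

definition trajectory :: "(nat \<Rightarrow> real^'d^'d) \<Rightarrow> nat \<Rightarrow> (nat \<Rightarrow> real) \<Rightarrow> (nat \<Rightarrow> nat \<Rightarrow> real) \<Rightarrow> real^'d \<Rightarrow> real \<Rightarrow> sample \<Rightarrow> real^'d" where
  "trajectory A N \<nu> P x0 t \<omega> = stagewise (\<lambda>n. flow (A (chain_from N \<nu> P (fst \<omega>) n))) (hold (snd \<omega>)) x0 t"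

lemma stage_flows_trajectory: "admissible S \<Longrightarrow> stage_flows (\<lambda>n. flow (A (z n))) (\<lambda>n v. A (z n) *v v) S"
  by unfold_locales (simp_all add: flow_has_vector_derivative)

lemma trajectory_0: "trajectory A N \<nu> P x0 0 \<omega> = x0"
  unfolding trajectory_def by (rule stage_flows.stagewise_0[OF stage_flows_trajectory]) simp

lemma trajectory_continuous: "continuous_on {0..} (\<lambda>t. trajectory A N \<nu> P x0 t \<omega>)"
  unfolding trajectory_def by (rule stage_flows.stagewise_continuous[OF stage_flows_trajectory]) simp

lemma trajectory_derivative:
  assumes "0 \<le> t" "t \<notin> range (jump_time (hold (snd \<omega>)))"
  shows "((\<lambda>t. trajectory A N \<nu> P x0 t \<omega>) has_vector_derivative
     (A (switching N \<nu> P t \<omega>) *v trajectory A N \<nu> P x0 t \<omega>)) (at t)"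
  unfolding trajectory_def switching_def
  by (rule stage_flows.stagewise_derivative[OF stage_flows_trajectory, of _ _ A "chain_from N \<nu> P (fst \<omega>)"]) (use assms in simp_all)

lemma hold_snd_measurable [measurable]: "(\<lambda>\<omega>. hold (snd \<omega>) n) \<in> borel_measurable (base \<mu>)"
  unfolding base_def by (rule measurable_compose[OF measurable_snd hold_measurable])

lemma chain_fst_measurable [measurable]: "(\<lambda>\<omega>. chain_from N \<nu> P (fst \<omega>) n) \<in> measurable (base \<mu>) (count_space UNIV)"
  unfolding base_def by measurable

lemma switching_measurable [measurable]: "switching N \<nu> P t \<in> measurable (base \<mu>) (count_space UNIV)"
  unfolding switching_def
  by (rule measurable_compose_countable[where f = "\<lambda>n \<omega>. chain_from N \<nu> P (fst \<omega>) n",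
        OF chain_fst_measurable stage_measurable[OF hold_snd_measurable]])

lemma flow_state_measurable:
  assumes [measurable]: "k \<in> measurable M (count_space (UNIV :: nat set))" "f \<in> borel_measurable M" "g \<in> borel_measurable M"
  shows "(\<lambda>x. flow (A (k x)) (f x) (g x)) \<in> borel_measurable M"
  by (rule measurable_compose_countable[where f = "\<lambda>j x. flow (A j) (f x) (g x)" and g = k]) measurable

text \<open>Given the number of the stage, the trajectory is a composition of finitely many
  measurable flows; the stage takes countably many values.\<close>
lemma trajectory_measurable [measurable]: "trajectory A N \<nu> P x0 t \<in> borel_measurable (base \<mu>)"
proof -
  let ?n = "\<lambda>n \<omega>. node (\<lambda>n. flow (A (chain_from N \<nu> P (fst \<omega>) n))) (hold (snd \<omega>)) x0 n"
  have node [measurable]: "?n n \<in> borel_measurable (base \<mu>)" for n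
    by (induction n) (auto intro!: flow_state_measurable chain_fst_measurable)
  have [measurable]: "(\<lambda>\<omega>. flow (A (chain_from N \<nu> P (fst \<omega>) n)) (t - jump_time (hold (snd \<omega>)) n) (?n n \<omega>)) \<in> borel_measurable (base \<mu>)" for n
    by (intro flow_state_measurable chain_fst_measurable node borel_measurable_diff borel_measurable_const
        jump_time_measurable hold_snd_measurable)
  show ?thesis
    unfolding trajectory_def stagewise_def
    by (rule measurable_compose_countable[where f = "\<lambda>n \<omega>. flow (A (chain_from N \<nu> P (fst \<omega>) n)) (t - jump_time (hold (snd \<omega>)) n) (?n n \<omega>)",
          OF _ stage_measurable[OF hold_snd_measurable]]) measurable
qed

section \<open>Markov processes realized on the base space\<close>

lemma measurable_count_space_range:
  assumes f: "f \<in> measurable M (count_space UNIV)" and r: "\<And>x. x \<in> space M \<Longrightarrow> f x \<in> A"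
  shows "f \<in> measurable M (count_space A)"
proof (rule measurableI)
  fix B assume "B \<in> sets (count_space A)"
  show "f -` B \<inter> space M \<in> sets M" by (rule measurable_sets[OF f]) simp
qed (use r in simp)

lemma measure_preserving_measure:
  assumes "f \<in> measurable M N" "distr M N f = N" "A \<in> sets N"
  shows "measure M {\<omega>\<in>space M. f \<omega> \<in> A} = measure N A"
proof -
  have "measure N A = measure (distr M N f) A" using assms(2) by simp
  also have "\<dots> = measure M (f -` A \<inter> space M)" by (rule measure_distr[OF assms(1,3)])
  also have "f -` A \<inter> space M = {\<omega>\<in>space M. f \<omega> \<in> A}" by auto
  finally show ?thesis by simp
qed

text \<open>Any measure preserving map into the base space carries a Markov process. The couplings
  below only have to produce such maps.\<close>
theorem markov_process_from_base:
  fixes A :: "nat \<Rightarrow> real^'d^'d"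
  assumes par: "parameters N \<nu> \<mu> P" and N: "1 \<le> N"
    and M: "prob_space M" and f: "f \<in> measurable M (base \<mu>)" "distr M (base \<mu>) f = base \<mu>"
  shows "markov_process M N A \<nu> \<mu> P x0
    (\<lambda>t \<omega>. trajectory A N \<nu> P x0 t (f \<omega>)) (\<lambda>t \<omega>. switching N \<nu> P t (f \<omega>))"
proof -
  have \<nu>: "probability_vector N \<nu>" and \<mu>: "0 < \<mu>" and P: "stochastic_matrix N P"
    using par by (auto simp: parameters_def)
  interpret M: prob_space M by (rule M)
  interpret stages: prob_space "stages \<mu>" by (rule prob_space_stages[OF \<mu>])
  define u where "u \<omega> = fst (f \<omega>)" for \<omega>
  define e where "e \<omega> = snd (f \<omega>)" for \<omega>
  have fst_b: "fst \<in> measurable (base \<mu>) noise" and snd_b: "snd \<in> measurable (base \<mu>) (stages \<mu>)"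
    unfolding base_def by (rule measurable_fst, rule measurable_snd)
  have u [measurable]: "u \<in> measurable M noise" and e [measurable]: "e \<in> measurable M (stages \<mu>)"
    unfolding u_def e_def by (rule measurable_compose[OF f(1) fst_b], rule measurable_compose[OF f(1) snd_b])
  have rect: "measure M {\<omega>\<in>space M. u \<omega> \<in> a \<and> e \<omega> \<in> b} = measure noise a * measure (stages \<mu>) b"
    if "a \<in> sets noise" "b \<in> sets (stages \<mu>)" for a b
  proof -
    have "measure M {\<omega>\<in>space M. f \<omega> \<in> a \<times> b} = measure (base \<mu>) (a \<times> b)"
      by (rule measure_preserving_measure[OF f]) (use that in \<open>simp add: base_def\<close>)
    also have "\<dots> = measure noise a * measure (stages \<mu>) b"
    proof -
      have "emeasure (noise \<Otimes>\<^sub>M stages \<mu>) (a \<times> b) = emeasure noise a * emeasure (stages \<mu>) b"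
        by (rule stages.emeasure_pair_measure_Times[OF that])
      then show ?thesis by (simp add: base_def measure_def enn2real_mult)
    qed
    finally show ?thesis by (simp add: u_def e_def mem_Times_iff)
  qed
  have pu: "measure M {\<omega>\<in>space M. u \<omega> \<in> a} = measure noise a" if "a \<in> sets noise" for a
    using rect[OF that sets.top] stages.prob_space by simp
  have pe: "measure M {\<omega>\<in>space M. e \<omega> \<in> b} = measure (stages \<mu>) b" if "b \<in> sets (stages \<mu>)" for b
    using rect[OF sets.top that] noise.P.prob_space by simp
  have de: "distr M (stages \<mu>) e = stages \<mu>"
  proof (rule measure_eqI)
    fix b assume "b \<in> sets (distr M (stages \<mu>) e)"
    then have b: "b \<in> sets (stages \<mu>)" by simp
    have "emeasure (distr M (stages \<mu>) e) b = emeasure M (e -` b \<inter> space M)" by (rule emeasure_distr[OF e b])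
    also have "e -` b \<inter> space M = {\<omega>\<in>space M. e \<omega> \<in> b}" by auto
    finally show "emeasure (distr M (stages \<mu>) e) b = emeasure (stages \<mu>) b"
      using pe[OF b] by (simp add: M.emeasure_eq_measure stages.emeasure_eq_measure)
  qed simp
  define Z where "Z n \<omega> = chain_from N \<nu> P (u \<omega>) n" for n \<omega>
  define S where "S n \<omega> = fst (e \<omega> n)" for n \<omega>
  have ce: "(\<lambda>\<omega>. e \<omega> n) \<in> measurable M (stage_law \<mu>)" for n
    using e by (rule measurable_compose) (rule measurable_component_singleton, simp)
  have dc: "distr M (stage_law \<mu>) (\<lambda>\<omega>. e \<omega> n) = stage_law \<mu>" for n
  proof -
    have "distr M (stage_law \<mu>) (\<lambda>\<omega>. e \<omega> n) = distr (distr M (stages \<mu>) e) (stage_law \<mu>) (\<lambda>e. e n)"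
      by (subst distr_distr[OF measurable_component_singleton e]) (simp_all add: comp_def)
    also have "\<dots> = stage_law \<mu>" unfolding de by (rule distr_PiM_component) (simp_all add: prob_space_stage_law \<mu>)
    finally show ?thesis .
  qed
  have zf: "(\<lambda>v n. chain_from N \<nu> P v n) \<in> measurable noise (\<Pi>\<^sub>M n\<in>UNIV. count_space {1..N})"
    by (rule measurable_PiM_single') (use chain_from_range[OF N] in \<open>auto intro!: measurable_count_space_range chain_from_measurable simp del: atLeastAtMost_iff\<close>)
  have sf: "(\<lambda>v n. fst (v n)) \<in> measurable (stages \<mu>) (\<Pi>\<^sub>M n\<in>(UNIV :: nat set). borel :: real measure)"
    by (rule measurable_PiM_single') auto
  have "discrete_markov_chain M N \<nu> P Z"
    unfolding discrete_markov_chain_def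
  proof (intro conjI allI impI)
    fix n :: nat show "Z n \<in> measurable M (count_space {1..N})"
    proof (rule measurable_count_space_range)
      have "(\<lambda>v. chain_from N \<nu> P v n) \<in> measurable noise (count_space UNIV)" by measurable
      with u show "Z n \<in> measurable M (count_space UNIV)" unfolding Z_def by (rule measurable_compose)
    qed (unfold Z_def, rule chain_from_range[OF N])
  next
    fix n :: nat and i assume i: "\<forall>m\<le>n. i m \<in> {1..N}"
    have "{v. \<forall>m\<le>n. chain_from N \<nu> P v m = i m} = {v\<in>space noise. \<forall>m\<le>n. chain_from N \<nu> P v m = i m}" by simp
    also have "\<dots> \<in> sets noise" by measurable
    finally have "{v. \<forall>m\<le>n. chain_from N \<nu> P v m = i m} \<in> sets noise" .
    from pu[OF this] show "measure M {\<omega>\<in>space M. \<forall>m\<le>n. Z m \<omega> = i m} = \<nu> (i 0) * (\<Prod>m<n. P (i m) (i (Suc m)))"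
      using chain_from_path_prob[OF \<nu> P N, of n i] i by (simp add: Z_def)
  qed
  moreover have "distributed M lborel (S n) (exponential_density \<mu>)" for n :: nat
  proof -
    let ?E = "density lborel (exponential_density \<mu>)"
    have f': "fst \<in> measurable (stage_law \<mu>) lborel" by simp
    have "distr M lborel (S n) = distr (distr M (stage_law \<mu>) (\<lambda>\<omega>. e \<omega> n)) lborel fst"
      unfolding S_def by (subst distr_distr[OF f' ce]) (simp add: comp_def)
    also have "\<dots> = distr (?E \<Otimes>\<^sub>M unif) ?E fst"
      unfolding dc unfolding stage_law_def by (rule distr_cong) auto
    also have "\<dots> = ?E" by (rule prob_space.distr_pair_fst[OF prob_space_unif])
    finally show ?thesis unfolding distributed_def S_def using measurable_compose[OF ce f'] by simp
  qed
  moreover have "M.indep_vars (\<lambda>_. borel) S UNIV"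
  proof -
    have "M.indep_vars (\<lambda>_. stage_law \<mu>) (\<lambda>n \<omega>. e \<omega> n) UNIV"
      by (subst M.indep_vars_iff_distr_eq_PiM) (simp_all add: ce dc de restrict_def)
    then show ?thesis unfolding S_def by (rule M.indep_vars_compose2) simp
  qed
  moreover have "M.indep_set
          (sets (vimage_algebra (space M) (\<lambda>\<omega> n. Z n \<omega>) (\<Pi>\<^sub>M n\<in>UNIV. count_space {1..N})))
          (sets (vimage_algebra (space M) (\<lambda>\<omega> n. S n \<omega>) (\<Pi>\<^sub>M n\<in>UNIV. borel)))" (is "M.indep_set ?ZZ ?SS")
  proof -
    have ZZ: "\<exists>a'\<in>sets noise. a = {\<omega>\<in>space M. u \<omega> \<in> a'}" if a: "a \<in> ?ZZ" for a
    proof -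
      have "(\<lambda>\<omega> n. Z n \<omega>) \<in> space M \<rightarrow> space (\<Pi>\<^sub>M n\<in>UNIV. count_space {1..N})"
        using chain_from_range[OF N] by (auto simp: Z_def space_PiM simp del: atLeastAtMost_iff)
      from a[unfolded sets_vimage_algebra2[OF this]] obtain X where X: "X \<in> sets (\<Pi>\<^sub>M n\<in>(UNIV :: nat set). count_space {1..N})"
        "a = (\<lambda>\<omega> n. Z n \<omega>) -` X \<inter> space M" by auto
      show ?thesis
        by (rule bexI[OF _ measurable_sets[OF zf X(1)]]) (auto simp: X(2) Z_def)
    qed
    have SS: "\<exists>b'\<in>sets (stages \<mu>). b = {\<omega>\<in>space M. e \<omega> \<in> b'}" if b: "b \<in> ?SS" for b
    proof -
      have "(\<lambda>\<omega> n. S n \<omega>) \<in> space M \<rightarrow> space (\<Pi>\<^sub>M n\<in>(UNIV :: nat set). borel :: real measure)"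
        by (auto simp: space_PiM)
      from b[unfolded sets_vimage_algebra2[OF this]] obtain X where X: "X \<in> sets (\<Pi>\<^sub>M n\<in>(UNIV :: nat set). borel :: real measure)"
        "b = (\<lambda>\<omega> n. S n \<omega>) -` X \<inter> space M" by auto
      show ?thesis
        by (rule bexI[OF _ measurable_sets[OF sf X(1)]]) (auto simp: X(2) S_def)
    qed
    show ?thesis
    proof (rule M.indep_setI)
      show "?ZZ \<subseteq> M.events"
      proof
        fix a assume "a \<in> ?ZZ"
        from ZZ[OF this] obtain a' where [measurable]: "a' \<in> sets noise" and a: "a = {\<omega>\<in>space M. u \<omega> \<in> a'}" by blast
        show "a \<in> M.events" unfolding a by measurable
      qed
      show "?SS \<subseteq> M.events"
      proof
        fix b assume "b \<in> ?SS"
        from SS[OF this] obtain b' where [measurable]: "b' \<in> sets (stages \<mu>)" and b: "b = {\<omega>\<in>space M. e \<omega> \<in> b'}" by blast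
        show "b \<in> M.events" unfolding b by measurable
      qed
      fix a b assume "a \<in> ?ZZ" "b \<in> ?SS"
      from ZZ[OF this(1)] SS[OF this(2)] obtain a' b' where a': "a' \<in> sets noise" "a = {\<omega>\<in>space M. u \<omega> \<in> a'}"
        and b': "b' \<in> sets (stages \<mu>)" "b = {\<omega>\<in>space M. e \<omega> \<in> b'}" by blast
      have "a \<inter> b = {\<omega>\<in>space M. u \<omega> \<in> a' \<and> e \<omega> \<in> b'}" using a' b' by auto
      then show "M.prob (a \<inter> b) = M.prob a * M.prob b"
        using rect[OF a'(1) b'(1)] pu[OF a'(1)] pe[OF b'(1)] a'(2) b'(2) by simp
    qed
  qed
  moreover have "AE \<omega> in M. \<forall>t\<ge>0. \<forall>n.
           (\<Sum>m<n. S m \<omega>) \<le> t \<and> t < (\<Sum>m<Suc n. S m \<omega>) \<longrightarrow> switching N \<nu> P t (f \<omega>) = Z n \<omega>"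
  proof -
    have "AE \<omega> in distr M (stages \<mu>) e. admissible (\<lambda>n. fst (\<omega> n))"
      unfolding de by (rule AE_admissible[OF \<mu>])
    from AE_distrD[OF e this] show ?thesis
    proof eventually_elim
      fix \<omega> assume adm: "admissible (\<lambda>n. fst (e \<omega> n))"
      show "\<forall>t\<ge>0. \<forall>n. (\<Sum>m<n. S m \<omega>) \<le> t \<and> t < (\<Sum>m<Suc n. S m \<omega>) \<longrightarrow> switching N \<nu> P t (f \<omega>) = Z n \<omega>"
      proof (intro allI impI)
        fix t :: real and n assume "(\<Sum>m<n. S m \<omega>) \<le> t \<and> t < (\<Sum>m<Suc n. S m \<omega>)"
        then have "stage (hold (e \<omega>)) t = n"
          by (intro stage_eq) (simp_all add: hold_eq[OF adm] jump_time_def S_def adm)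
        then show "switching N \<nu> P t (f \<omega>) = Z n \<omega>" by (simp add: switching_def Z_def u_def e_def)
      qed
    qed
  qed
  moreover have "(\<lambda>\<omega>. switching N \<nu> P t (f \<omega>)) \<in> measurable M (count_space {1..N})" for t
    by (rule measurable_count_space_range, rule measurable_compose[OF f(1) switching_measurable])
       (simp only: switching_def chain_from_range[OF N])
  ultimately have ctmc: "continuous_time_markov_chain M N \<nu> \<mu> P (\<lambda>t \<omega>. switching N \<nu> P t (f \<omega>))"
    unfolding continuous_time_markov_chain_def using M by blast
  have sol: "switched_solution A (\<lambda>t. switching N \<nu> P t (f \<omega>)) x0 (\<lambda>t. trajectory A N \<nu> P x0 t (f \<omega>))" for \<omega>
    unfolding switched_solution_def
  proof (intro conjI allI impI)
    fix T :: real assume "0 < T"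
    let ?F = "range (jump_time (hold (snd (f \<omega>)))) \<inter> {..T}"
    show "\<exists>F. finite F \<and> (\<forall>t\<in>{0..T} - F. ((\<lambda>t. trajectory A N \<nu> P x0 t (f \<omega>)) has_vector_derivative
        A (switching N \<nu> P t (f \<omega>)) *v trajectory A N \<nu> P x0 t (f \<omega>)) (at t))"
      by (rule exI[of _ ?F]) (auto intro!: finite_jump_times trajectory_derivative)
  qed (rule trajectory_0, rule trajectory_continuous)
  show ?thesis
    unfolding markov_process_def
    using par ctmc sol measurable_compose[OF f(1) trajectory_measurable] by auto
qed

section \<open>Occupation times and observed states\<close>

text \<open>The time spent in state \<open>l\<close> up to time \<open>t\<close>, as the value of a process with
  unit or zero speed.\<close>
definition occupation :: "(nat \<Rightarrow> nat) \<Rightarrow> (nat \<Rightarrow> real) \<Rightarrow> nat \<Rightarrow> real \<Rightarrow> real" where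
  "occupation z S l t = stagewise (\<lambda>n s v. v + s * of_bool (z n = l)) S 0 t"

lemma stage_flows_occupation:
  "admissible S \<Longrightarrow> stage_flows (\<lambda>n s v. v + s * of_bool (z n = l)) (\<lambda>n v. of_bool (z n = l) :: real) S"
  by unfold_locales
     (auto intro!: derivative_eq_intros simp: has_real_derivative_iff_has_vector_derivative[symmetric])

lemma occupation_on_stage:
  assumes "admissible S" "jump_time S n \<le> t" "t \<le> jump_time S (Suc n)"
  shows "occupation z S l t = (\<Sum>i<n. of_bool (z i = l) * S i) + (t - jump_time S n) * of_bool (z n = l)"
proof -
  have "node (\<lambda>n s v. v + s * of_bool (z n = l)) S 0 n = (\<Sum>i<n. of_bool (z i = l) * S i)"
    by (induction n) (simp_all add: mult.commute)
  then show ?thesis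
    unfolding occupation_def stage_flows.stagewise_on_stage[OF stage_flows_occupation[OF assms(1)] assms(2,3)] by simp
qed

lemma occupation_0: "admissible S \<Longrightarrow> occupation z S l 0 = 0"
  unfolding occupation_def by (rule stage_flows.stagewise_0[OF stage_flows_occupation])

lemma occupation_continuous: "admissible S \<Longrightarrow> continuous_on {0..} (occupation z S l)"
  unfolding occupation_def[abs_def] by (rule stage_flows.stagewise_continuous[OF stage_flows_occupation])

lemma occupation_derivative:
  assumes "admissible S" "0 \<le> t" "t \<notin> range (jump_time S)"
  shows "(occupation z S l has_real_derivative of_bool (z (stage S t) = l)) (at t)"
  unfolding occupation_def[abs_def] has_real_derivative_iff_has_vector_derivative
  by (rule stage_flows.stagewise_derivative[OF stage_flows_occupation[OF assms(1)] assms(2,3)])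

text \<open>The state seen at observation number \<open>r\<close> (counted from \<open>0\<close>) when \<open>d n\<close> observations fall into
  stage \<open>n\<close>. The value \<open>0\<close>, which is not a state, stands for an observation that never takes place.\<close>
definition obs :: "(nat \<Rightarrow> nat) \<Rightarrow> (nat \<Rightarrow> nat) \<Rightarrow> nat \<Rightarrow> nat" where
  "obs z d r = (if \<exists>i. r < sum d {..<Suc i} then z (LEAST i. r < sum d {..<Suc i}) else 0)"

lemma obs_stage:
  assumes "sum d {..<i} \<le> r" "r < sum d {..<Suc i}"
  shows "obs z d r = z i"
proof -
  have "(LEAST i. r < sum d {..<Suc i}) = i"
  proof (rule Least_equality)
    fix j assume j: "r < sum d {..<Suc j}"
    show "i \<le> j"
    proof (rule ccontr)
      assume "\<not> i \<le> j"
      then have "sum d {..<Suc j} \<le> sum d {..<i}" by (intro sum_mono2) auto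
      with j assms(1) show False by simp
    qed
  qed (rule assms)
  with assms show ?thesis by (auto simp: obs_def)
qed

text \<open>Removing the first stage and its observations gives the recursion for the law of the observed states.\<close>
lemma obs_shift: "obs z d r = (if r < d 0 then z 0 else obs (\<lambda>n. z (Suc n)) (\<lambda>n. d (Suc n)) (r - d 0))"
proof -
  have sh: "sum d {..<Suc i} = d 0 + sum (\<lambda>n. d (Suc n)) {..<i}" for i by (rule sum.lessThan_Suc_shift)
  show ?thesis
  proof (cases "r < d 0")
    case True
    then show ?thesis using obs_stage[of d 0 r z] by simp
  next
    case False
    let ?P = "\<lambda>i. r - d 0 < sum (\<lambda>n. d (Suc n)) {..<Suc i}"
    have P: "r < sum d {..<Suc (Suc i)} \<longleftrightarrow> ?P i" for i
      using False by (subst sh) auto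
    show ?thesis
    proof (cases "\<exists>i. ?P i")
      case True
      define i where "i = (LEAST i. ?P i)"
      have 1: "?P i" unfolding i_def by (rule LeastI_ex[OF True])
      have 2: "sum (\<lambda>n. d (Suc n)) {..<i} \<le> r - d 0"
      proof (cases i)
        case (Suc k)
        then have "\<not> ?P k" using not_less_Least[of k ?P] by (simp add: i_def)
        with Suc show ?thesis by simp
      qed simp
      have "obs (\<lambda>n. z (Suc n)) (\<lambda>n. d (Suc n)) (r - d 0) = z (Suc i)"
        by (rule obs_stage[OF 2 1])
      moreover have "obs z d r = z (Suc i)"
        by (rule obs_stage) (use 1 2 P[of i] False sh[of i] in auto)
      ultimately show ?thesis using False by simp
    next
      case no: False
      have "\<not> r < sum d {..<Suc i}" for i
        using no P[of "i - 1"] False by (cases i) auto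
      with no show ?thesis using False by (simp add: obs_def)
    qed
  qed
qed

definition visits :: "(nat \<Rightarrow> nat) \<Rightarrow> (nat \<Rightarrow> nat) \<Rightarrow> nat \<Rightarrow> nat \<Rightarrow> real" where
  "visits z d l r = (\<Sum>q<r. of_bool (obs z d q = l))"

lemma visits_lipschitz: "\<bar>visits z d l r - visits z d l r'\<bar> \<le> \<bar>real r - real r'\<bar>"
proof -
  have *: "visits z d l r \<le> visits z d l r' \<and> visits z d l r' - visits z d l r \<le> real r' - real r" if "r \<le> r'" for r r'
    using that by (induction rule: dec_induct) (auto simp: visits_def)
  show ?thesis using *[of r r'] *[of r' r] by (cases "r \<le> r'") auto
qed

lemma visits_within_stage:
  assumes "m \<le> d j"
  shows "visits z d l (sum d {..<j} + m) = visits z d l (sum d {..<j}) + real m * of_bool (z j = l)"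
  using assms
proof (induction m)
  case (Suc m)
  have "obs z d (sum d {..<j} + m) = z j" using Suc.prems by (intro obs_stage) auto
  with Suc show ?case by (simp add: visits_def algebra_simps)
qed simp

lemma visits_at_stage: "visits z d l (sum d {..<j}) = (\<Sum>i<j. of_bool (z i = l) * real (d i))"
proof (induction j)
  case (Suc j)
  then show ?case using visits_within_stage[of "d j" d j z l] by (simp add: mult.commute)
qed (simp add: visits_def)

text \<open>The deterministic core of the comparison. At the beginning of the stage that contains
  \<open>t\<close> the hypotheses apply directly, to the total time (\<open>tot\<close>) and to the time in \<open>l\<close> (\<open>sel\<close>). Within that stage
  occupation and visits grow linearly, and both are Lipschitz, which bounds the
  remaining error. Long stages are truncated at \<open>T\<close> and \<open>d'\<close> counts the observations of
  the truncated stages: without truncation a slow chain could make the fluctuation within a single stage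
  unbounded. Only the last relevant stage can be longer than \<open>T\<close>, and it has at least the
  observations of its truncation.\<close>
lemma occupation_close_to_visits:
  assumes S: "admissible S" and T: "T < jump_time S J" and c: "0 < c" and t: "0 \<le> t" "t \<le> T"
    and d': "\<And>n. d' n \<le> d n" "\<And>n. S n \<le> T \<Longrightarrow> d' n = d n"
    and tot: "\<And>j. j \<le> J \<Longrightarrow> \<bar>\<Sum>i<j. real (d' i) / c - min (S i) T\<bar> < \<epsilon>"
    and sel: "\<And>j. j \<le> J \<Longrightarrow> \<bar>\<Sum>i<j. of_bool (z i = l) * (real (d' i) / c - min (S i) T)\<bar> < \<epsilon>"
  shows "\<bar>occupation z S l t - visits z d l (nat \<lfloor>c * t\<rfloor>) / c\<bar> \<le> 6 * \<epsilon> + 3 / c"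
proof -
  define j where "j = stage S t"
  note j = stage_bounds[OF S t(1), folded j_def]
  have jJ: "j < J"
  proof (rule ccontr)
    assume "\<not> j < J"
    then have "jump_time S J \<le> jump_time S j" by (intro jump_time_mono[OF S]) simp
    with j(1) t T show False by simp
  qed
  have early: "min (S i) T = S i \<and> d' i = d i" if "i < j" for i
  proof -
    have "jump_time S (Suc i) \<le> jump_time S j" using that by (intro jump_time_mono[OF S]) simp
    with j(1) t jump_time_nonneg[OF S, of i] have "S i \<le> T" by simp
    then show ?thesis using d'(2) by simp
  qed
  let ?R = "sum d {..<j}"
  have tot_j: "\<bar>real ?R / c - jump_time S j\<bar> < \<epsilon>"
    using tot[of j] jJ early by (simp add: jump_time_def sum_subtractf sum_divide_distrib)
  have sel_j: "\<bar>visits z d l ?R / c - (\<Sum>i<j. of_bool (z i = l) * S i)\<bar> < \<epsilon>"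
  proof -
    have "(\<Sum>i<j. of_bool (z i = l) * (real (d' i) / c - min (S i) T)) =
        visits z d l ?R / c - (\<Sum>i<j. of_bool (z i = l) * S i)"
      unfolding visits_at_stage sum_divide_distrib sum_subtractf[symmetric]
      by (rule sum.cong) (use early in \<open>auto simp: right_diff_distrib\<close>)
    then show ?thesis using sel[of j] jJ by simp
  qed
  define a where "a = t - jump_time S j"
  have a: "0 \<le> a" "a \<le> min (S j) T" using j t jump_time_nonneg[OF S, of j] by (auto simp: a_def)
  have "\<bar>(\<Sum>i<j. real (d' i) / c - min (S i) T) + (real (d' j) / c - min (S j) T)\<bar> < \<epsilon>"
    using tot[of "Suc j"] jJ by simp
  with tot[of j] jJ have "- (2 * \<epsilon>) \<le> real (d' j) / c - min (S j) T" by simp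
  moreover have "real (d' j) / c \<le> real (d j) / c" using d'(1)[of j] c by (simp add: divide_right_mono)
  ultimately have dj: "a - 2 * \<epsilon> \<le> real (d j) / c" using a by linarith
  \<comment> \<open>the expected number of observations up to time \<open>t\<close> within stage \<open>j\<close>, as far as the stage has so many\<close>
  define m where "m = min (nat \<lfloor>c * a\<rfloor>) (d j)"
  have fl: "real (nat \<lfloor>c * b\<rfloor>) / c \<le> b \<and> b - 1 / c \<le> real (nat \<lfloor>c * b\<rfloor>) / c" if "0 \<le> b" for b
  proof -
    have *: "X / c \<le> b \<and> b - 1 / c \<le> X / c" if "X \<le> c * b \<and> c * b - 1 \<le> X" for X
    proof
      show "X / c \<le> b" using that c by (simp add: pos_divide_le_eq mult.commute)
      have "b - 1 / c = (c * b - 1) / c" using c by (simp add: diff_divide_distrib)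
      also have "\<dots> \<le> X / c" using that c by (intro divide_right_mono) auto
      finally show "b - 1 / c \<le> X / c" .
    qed
    have "real (nat \<lfloor>c * b\<rfloor>) = of_int \<lfloor>c * b\<rfloor>" using that c by simp
    then show ?thesis by (intro *) linarith
  qed
  have m: "real m / c \<le> a" "a - 2 * \<epsilon> - 1 / c \<le> real m / c"
  proof -
    have "real m / c \<le> real (nat \<lfloor>c * a\<rfloor>) / c" using c by (intro divide_right_mono) (auto simp: m_def)
    with fl[OF a(1)] show "real m / c \<le> a" by linarith
    have "0 \<le> \<epsilon>" "0 \<le> 1 / c" using tot_j c by auto
    with fl[OF a(1)] dj show "a - 2 * \<epsilon> - 1 / c \<le> real m / c"
      by (cases "nat \<lfloor>c * a\<rfloor> \<le> d j") (simp_all add: m_def min_def)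
  qed
  have \<epsilon>: "0 < \<epsilon>" using tot_j by linarith
  have c0: "0 < 1 / c" using c by simp
  have v: "visits z d l (?R + m) / c = visits z d l ?R / c + of_bool (z j = l) * (real m / c)"
    by (subst visits_within_stage) (auto simp: m_def add_divide_distrib)
  have occ: "occupation z S l t = (\<Sum>i<j. of_bool (z i = l) * S i) + a * of_bool (z j = l)"
    using occupation_on_stage[OF S, of j t z l] j by (simp add: a_def)
  have 1: "\<bar>visits z d l (?R + m) / c - occupation z S l t\<bar> \<le> 3 * \<epsilon> + 1 / c"
    unfolding v occ using sel_j m \<epsilon> c0 by (cases "z j = l") auto
  let ?r = "nat \<lfloor>c * t\<rfloor>"
  have "real (?R + m) / c = real ?R / c + real m / c" by (simp add: add_divide_distrib)
  then have "\<bar>real ?r / c - real (?R + m) / c\<bar> \<le> 3 * \<epsilon> + 2 * (1 / c)"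
    using fl[OF t(1)] tot_j m unfolding a_def by linarith
  moreover have "\<bar>visits z d l ?r / c - visits z d l (?R + m) / c\<bar> \<le> \<bar>real ?r / c - real (?R + m) / c\<bar>"
    using visits_lipschitz[of z d l ?r "?R + m"] c
    by (simp add: diff_divide_distrib[symmetric] divide_right_mono)
  ultimately show ?thesis using 1 by simp
qed

section \<open>Occupation times are close to visit frequencies\<close>

text \<open>The variance bound combines two regimes: \<open>1 / \<mu>\<close> matters for fast chains, where there are about \<open>\<mu> T\<close>
  stages, and \<open>T\<close> for slow ones.\<close>
lemma truncated_error:
  assumes \<mu>: "0 < \<mu>" and c: "0 < c" and T: "0 < T"
  defines "Y \<equiv> \<lambda>a. real (obs_count c (min (fst a) T, snd a)) / c - min (fst a) T"
  shows "Y \<in> borel_measurable (stage_law \<mu>)"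
    and "has_bochner_integral (stage_law \<mu>) Y 0"
    and "\<exists>w. has_bochner_integral (stage_law \<mu>) (\<lambda>a. (Y a)\<^sup>2) w \<and> w \<le> min (1 / \<mu>) T / c"
proof -
  let ?E = "density lborel (exponential_density \<mu>)"
  interpret E: prob_space ?E using \<mu> by (rule prob_space_exponential_density)
  interpret U: prob_space unif by (rule prob_space_unif)
  interpret EU: pair_sigma_finite ?E unif ..
  interpret L: prob_space "stage_law \<mu>" by (rule prob_space_stage_law[OF \<mu>])
  show m [measurable]: "Y \<in> borel_measurable (stage_law \<mu>)" unfolding Y_def by measurable
  then have m' [measurable]: "Y \<in> borel_measurable (?E \<Otimes>\<^sub>M unif)" by (simp add: stage_law_def)
  have pos: "AE s in ?E. 0 < s"
    using AE_lborel_singleton[of 0]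
    by (subst AE_density) (auto simp: exponential_density_def elim!: eventually_mono)
  have inner: "has_bochner_integral unif (\<lambda>v. Y (s, v)) 0"
      "has_bochner_integral unif (\<lambda>v. (Y (s, v))\<^sup>2) (min s T / c)" if "0 < s" for s
    using obs_count_mean_square[of "min s T" c] that c T by (simp_all add: Y_def)
  define w where "w = (\<integral>s. min s T / c \<partial>?E)"
  have min_int: "integrable ?E (\<lambda>s. min s T / c)"
  proof (rule E.integrable_const_bound[where B = "T / c"])
    show "AE s in ?E. norm (min s T / c) \<le> T / c"
      using pos by eventually_elim (use T c in \<open>auto simp: divide_right_mono\<close>)
  qed simp
  have w0: "0 \<le> w" unfolding w_def
    by (rule integral_nonneg_AE) (use pos T c in \<open>auto elim!: eventually_mono\<close>)
  have "(\<integral>\<^sup>+ a. ennreal ((Y a)\<^sup>2) \<partial>stage_law \<mu>) = (\<integral>\<^sup>+ s. (\<integral>\<^sup>+ v. ennreal ((Y (s, v))\<^sup>2) \<partial>unif) \<partial>?E)"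
    unfolding stage_law_def by (rule noise.M.nn_integral_fst[symmetric]) measurable
  also have "\<dots> = (\<integral>\<^sup>+ s. ennreal (min s T / c) \<partial>?E)"
    by (rule nn_integral_cong_AE, use pos in eventually_elim)
       (use inner(2) in \<open>simp add: has_bochner_integral_iff nn_integral_eq_integral\<close>)
  also have "\<dots> = ennreal w"
    unfolding w_def by (rule nn_integral_eq_integral[OF min_int]) (use pos T c in \<open>auto elim!: eventually_mono\<close>)
  finally have sq: "has_bochner_integral (stage_law \<mu>) (\<lambda>a. (Y a)\<^sup>2) w"
    using w0 by (intro has_bochner_integral_nn_integral) simp_all
  have "w \<le> (\<integral>s. T / c \<partial>?E)"
    unfolding w_def by (rule integral_mono[OF min_int E.integrable_const]) (use c in \<open>simp add: divide_right_mono\<close>)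
  then have wT: "w \<le> T / c" by (simp add: E.prob_space[simplified])
  have m1: "has_bochner_integral ?E (\<lambda>s. s / c) (1 / \<mu> / c)"
    using has_bochner_integral_divide_zero[OF exponential_density_moments[OF \<mu>, of 1], of c] by simp
  then have i1: "integrable ?E (\<lambda>s. s / c)" and i1': "(\<integral>s. s / c \<partial>?E) = 1 / \<mu> / c"
    unfolding has_bochner_integral_iff by blast+
  have "min s T / c \<le> s / c" for s using c by (intro divide_right_mono) simp_all
  then have "w \<le> (\<integral>s. s / c \<partial>?E)"
    unfolding w_def by (intro integral_mono[OF min_int i1])
  then have "w \<le> 1 / \<mu> / c" unfolding i1' .
  with wT have "w \<le> min (1 / \<mu>) T / c" by (simp add: min_def)
  with sq show "\<exists>w. has_bochner_integral (stage_law \<mu>) (\<lambda>a. (Y a)\<^sup>2) w \<and> w \<le> min (1 / \<mu>) T / c" by blast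
  have int: "integrable (stage_law \<mu>) Y"
    using sq unfolding has_bochner_integral_iff by (blast intro: L.square_integrable_imp_integrable[OF m])
  have "(\<integral>a. Y a \<partial>stage_law \<mu>) = (\<integral>s. (\<integral>v. Y (s, v) \<partial>unif) \<partial>?E)"
    using int unfolding stage_law_def by (rule EU.integral_fst'[symmetric])
  also have "\<dots> = 0"
    by (rule integral_eq_zero_AE, use pos in eventually_elim) (use inner(1) in \<open>simp add: has_bochner_integral_iff\<close>)
  finally show "has_bochner_integral (stage_law \<mu>) Y 0" using int by (simp add: has_bochner_integral_iff)
qed

lemma AE_stage_law_snd:
  assumes "0 < \<mu>"
  shows "AE a in stage_law \<mu>. snd a \<in> {0..<1}"
proof -
  let ?E = "density lborel (exponential_density \<mu>)"
  interpret E: prob_space ?E using assms by (rule prob_space_exponential_density)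
  interpret U: prob_space unif by (rule prob_space_unif)
  interpret EU: pair_sigma_finite ?E unif ..
  have "AE s in ?E. AE v in unif. snd (s, v) \<in> {0..<1}" using AE_unif by simp
  then have "AE a in ?E \<Otimes>\<^sub>M unif. snd a \<in> {0..<1}"
    by (intro EU.AE_pair_measure) measurable
  then show ?thesis unfolding stage_law_def .
qed

text \<open>A bound on all sections bounds the product measure. It is used to freeze the chain while the holding
  times are averaged.\<close>
lemma measure_pair_le:
  assumes M: "prob_space M" and N: "prob_space N" and A: "A \<in> sets (M \<Otimes>\<^sub>M N)"
    and b: "\<And>x. x \<in> space M \<Longrightarrow> measure N (Pair x -` A) \<le> b"
  shows "measure (M \<Otimes>\<^sub>M N) A \<le> b"
proof -
  interpret M: prob_space M by (rule M)
  interpret N: prob_space N by (rule N)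
  interpret MN: prob_space "M \<Otimes>\<^sub>M N" by (rule prob_space_pair[OF M N])
  obtain x where "x \<in> space M" using M.not_empty by blast
  then have b0: "0 \<le> b" using b[of x] measure_nonneg order_trans by blast
  have "emeasure (M \<Otimes>\<^sub>M N) A = (\<integral>\<^sup>+ x. emeasure N (Pair x -` A) \<partial>M)"
    by (rule N.emeasure_pair_measure_alt[OF A])
  also have "\<dots> \<le> (\<integral>\<^sup>+ x. ennreal b \<partial>M)"
    by (intro nn_integral_mono) (use b in \<open>simp add: N.emeasure_eq_measure ennreal_leI\<close>)
  also have "\<dots> = ennreal b" by (simp add: M.emeasure_space_1)
  finally show ?thesis using b0 by (simp add: MN.emeasure_eq_measure)
qed

text \<open>The state seen at the \<open>r\<close>-th point of a Poisson process of rate \<open>c\<close>.\<close>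
abbreviation skeleton_state ::
  "real \<Rightarrow> nat \<Rightarrow> (nat \<Rightarrow> real) \<Rightarrow> (nat \<Rightarrow> nat \<Rightarrow> real) \<Rightarrow> sample \<Rightarrow> nat \<Rightarrow> nat" where
  "skeleton_state c N \<nu> P \<omega> \<equiv> obs (chain_from N \<nu> P (fst \<omega>)) (\<lambda>n. obs_count c (snd \<omega> n))"

text \<open>The threshold \<open>c0\<close> for the rate depends on neither the parameters nor the speed of the chain. There
  are at most about \<open>2 \<mu> (T + 1)\<close> relevant stages, each with a centred error of variance at most
  \<open>min (1/\<mu>) T / c\<close>, so that the sum of the variances is of order \<open>1 / c\<close> uniformly in \<open>\<mu>\<close>.\<close>
theorem occupation_close_to_skeleton:
  assumes T: "0 < T" and \<epsilon>: "0 < \<epsilon>" and \<eta>: "0 < \<eta>"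
  shows "\<exists>c0>0. \<forall>c\<ge>c0. \<forall>\<nu> \<mu> P. 0 < \<mu> \<longrightarrow>
    (\<exists>Bad\<in>sets (base \<mu>). measure (base \<mu>) Bad \<le> \<eta> \<and>
      (\<forall>\<omega>. \<omega> \<notin> Bad \<longrightarrow> (\<forall>t\<in>{0..T}. \<forall>l\<in>{1..N}.
        \<bar>occupation (chain_from N \<nu> P (fst \<omega>)) (hold (snd \<omega>)) l t
          - (\<Sum>q<nat \<lfloor>c * t\<rfloor>. of_bool (skeleton_state c N \<nu> P \<omega> q = l)) / c\<bar> \<le> \<epsilon>)))"
proof -
  obtain q :: nat where q: "max 1 (8 / \<eta>) \<le> real q" using real_arch_simple by blast
  have q0: "0 < q" using q by (cases q) auto
  define e where "e = \<epsilon> / 12"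
  have e: "0 < e" using \<epsilon> by (simp add: e_def)
  define K where "K = 2 * (T + 1) + (1 + real q) * T"
  have K: "0 < K" using T by (simp add: K_def add_pos_nonneg)
  define c0 where "c0 = max (6 / \<epsilon>) (2 * (real N + 1) * K / (\<eta> * e\<^sup>2))"
  have c0: "0 < c0" using \<epsilon> unfolding c0_def by (intro less_max_iff_disj[THEN iffD2] disjI1) simp
  show ?thesis
  proof (intro exI[of _ c0] conjI c0 allI impI)
    fix c \<nu> and \<mu> :: real and P
    assume c: "c0 \<le> c" and \<mu>: "0 < \<mu>"
    have cpos: "0 < c" using c c0 by linarith
    have c1: "6 / \<epsilon> \<le> c" and c2: "2 * (real N + 1) * K / (\<eta> * e\<^sup>2) \<le> c" using c by (simp_all add: c0_def)
    \<comment> \<open>with high probability the \<open>J\<close>-th jump comes after time \<open>T\<close>; the summand \<open>q\<close> provides the high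
      probability when \<open>\<mu>\<close> is small\<close>
    define J where "J = nat \<lceil>2 * \<mu> * (T + 1)\<rceil> + q"
    have J: "2 * \<mu> * (T + 1) \<le> real J" "real J \<le> 2 * \<mu> * (T + 1) + 1 + real q" "0 < J" "real q \<le> real J"
    proof -
      have "0 \<le> 2 * \<mu> * (T + 1)" using \<mu> T by simp
      then have "real (nat \<lceil>2 * \<mu> * (T + 1)\<rceil>) = of_int \<lceil>2 * \<mu> * (T + 1)\<rceil>" by simp
      then have "2 * \<mu> * (T + 1) \<le> real (nat \<lceil>2 * \<mu> * (T + 1)\<rceil>)" "real (nat \<lceil>2 * \<mu> * (T + 1)\<rceil>) \<le> 2 * \<mu> * (T + 1) + 1"
        by linarith+
      then show "2 * \<mu> * (T + 1) \<le> real J" "real J \<le> 2 * \<mu> * (T + 1) + 1 + real q" "0 < J" "real q \<le> real J"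
        using q0 by (simp_all add: J_def)
    qed
    interpret sequence_space "stage_law \<mu>" by (rule sequence_space_stages[OF \<mu>])
    let ?Z = "\<lambda>u. chain_from N \<nu> P u"
    let ?Y = "\<lambda>a. real (obs_count c (min (fst a) T, snd a)) / c - min (fst a) T"
    \<comment> \<open>the index \<open>0\<close>, which is not a state, selects all stages and so yields the error of the total time\<close>
    let ?f = "\<lambda>u l i. (if l = 0 then 1 else of_bool (?Z u i = l)) :: real"
    obtain w where w: "has_bochner_integral (stage_law \<mu>) (\<lambda>a. (?Y a)\<^sup>2) w" "w \<le> min (1 / \<mu>) T / c"
      using truncated_error(3)[OF \<mu> cpos T] by blast
    have Y1: "has_bochner_integral (stage_law \<mu>) ?Y 0" by (rule truncated_error(2)[OF \<mu> cpos T])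
    define good where "good e \<longleftrightarrow> admissible (\<lambda>n. fst (e n)) \<and> (\<forall>n. snd (e n) \<in> {0..<1})" for e :: "nat \<Rightarrow> real \<times> real"
    define B1 where "B1 = {\<omega> \<in> space (base \<mu>). \<not> good (snd \<omega>)}"
    define B2 where "B2 = {\<omega> \<in> space (base \<mu>). jump_time (\<lambda>n. fst (snd \<omega> n)) J < T + 1}"
    define B3 where "B3 l = {\<omega> \<in> space (base \<mu>). \<exists>j\<le>J. e \<le> \<bar>\<Sum>i<j. ?f (fst \<omega>) l i * ?Y (snd \<omega> i)\<bar>}" for l
    have comp [measurable]: "(\<lambda>\<omega>. snd \<omega> n) \<in> measurable (base \<mu>) (borel \<Otimes>\<^sub>M borel)" for n
      unfolding base_def by measurable
    have snd_b: "snd \<in> measurable (base \<mu>) (stages \<mu>)" unfolding base_def by (rule measurable_snd)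
    have "Measurable.pred (stages \<mu>) good" unfolding good_def admissible_def by measurable
    from measurable_compose[OF snd_b this] have B1m: "B1 \<in> sets (base \<mu>)" unfolding B1_def by measurable
    have "Measurable.pred (stages \<mu>) (\<lambda>e. jump_time (\<lambda>n. fst (e n)) J < T + 1)" by measurable
    from measurable_compose[OF snd_b this] have B2m: "B2 \<in> sets (base \<mu>)" unfolding B2_def by measurable
    have B3m: "B3 l \<in> sets (base \<mu>)" for l
    proof -
      have f: "(\<lambda>\<omega>. ?f (fst \<omega>) l i) \<in> borel_measurable (base \<mu>)" for i
        by (rule measurable_compose[OF chain_fst_measurable, where g = "\<lambda>k. if l = 0 then 1 else of_bool (k = l)"]) simp
      have Ym: "?Y \<in> borel_measurable (borel \<Otimes>\<^sub>M borel)" by measurable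
      define g where "g i \<omega> = ?f (fst \<omega>) l i * ?Y (snd \<omega> i)" for i \<omega>
      have [measurable]: "g i \<in> borel_measurable (base \<mu>)" for i
        unfolding g_def by (rule borel_measurable_times[OF f measurable_compose[OF comp Ym]])
      have "B3 l = {\<omega> \<in> space (base \<mu>). \<exists>j\<le>J. e \<le> \<bar>\<Sum>i<j. g i \<omega>\<bar>}" by (simp only: B3_def g_def)
      also have "\<dots> \<in> sets (base \<mu>)" by measurable
      finally show ?thesis .
    qed
    note le = measure_pair_le[OF noise.P.prob_space_axioms prob_space_stages[OF \<mu>], folded base_def]
    have m1: "measure (base \<mu>) B1 \<le> 0"
    proof (rule le[OF B1m])
      fix u
      have "AE e in stages \<mu>. \<forall>n. snd (e n) \<in> {0..<1}"
        unfolding AE_all_countable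
      proof
        fix n
        have "AE a in stage_law \<mu>. snd a \<in> {0..<1}"
          by (rule AE_stage_law_snd[OF \<mu>])
        then show "AE e in stages \<mu>. snd (e n) \<in> {0..<1}"
          by (intro AE_PiM_component prob_space_stage_law \<mu>) auto
      qed
      with AE_admissible[OF \<mu>] have "AE e in stages \<mu>. e \<notin> Pair u -` B1"
        by eventually_elim (simp add: B1_def good_def)
      then have "measure (stages \<mu>) (Pair u -` B1) = 0"
        using sets_Pair1[OF B1m[unfolded base_def], of u] by (simp add: AE_iff_measurable P.prob_eq_0)
      then show "measure (stages \<mu>) (Pair u -` B1) \<le> 0" by simp
    qed
    have m2: "measure (base \<mu>) B2 \<le> \<eta> / 2"
    proof (rule le[OF B2m])
      fix u
      have "measure (stages \<mu>) (Pair u -` B2) \<le> 4 / real J"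
        using few_jumps_unlikely[OF \<mu> J(3) J(1)] by (simp add: B2_def vimage_def)
      also have "\<dots> \<le> \<eta> / 2"
      proof -
        have "8 / \<eta> \<le> real J" using q J(4) by linarith
        then show ?thesis using \<eta> J(3) by (simp add: field_simps)
      qed
      finally show "measure (stages \<mu>) (Pair u -` B2) \<le> \<eta> / 2" .
    qed
    have m3: "measure (base \<mu>) (B3 l) \<le> \<eta> / 2 / (real N + 1)" for l
    proof (rule le[OF B3m])
      fix u
      have "measure S {\<omega>\<in>space S. \<exists>j\<le>J. e \<le> \<bar>0 + (\<Sum>i<j. ?f u l i * ?Y (\<omega> i))\<bar>} \<le> (0\<^sup>2 + real J * (min (1 / \<mu>) T / c)) / e\<^sup>2"
      proof (rule kolmogorov_maximal[where X = "\<lambda>i a. ?f u l i * ?Y a" and w = "\<lambda>i. (?f u l i)\<^sup>2 * w", OF _ _ _ _ e])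
        fix i
        show "(\<lambda>a. ?f u l i * ?Y a) \<in> borel_measurable (stage_law \<mu>)" by measurable
        show "has_bochner_integral (stage_law \<mu>) (\<lambda>a. ?f u l i * ?Y a) 0"
          using has_bochner_integral_mult_right[OF Y1, of "?f u l i"] by simp
        show "has_bochner_integral (stage_law \<mu>) (\<lambda>a. (?f u l i * ?Y a)\<^sup>2) ((?f u l i)\<^sup>2 * w)"
          unfolding power_mult_distrib by (rule has_bochner_integral_mult_right) (rule w(1))
        have "0 \<le> min (1 / \<mu>) T / c" using \<mu> T cpos by simp
        then show "(?f u l i)\<^sup>2 * w \<le> min (1 / \<mu>) T / c" using w(2) by auto
      qed
      also have "\<dots> \<le> K / c / e\<^sup>2"
      proof -
        have "real J * min (1 / \<mu>) T \<le> (2 * \<mu> * (T + 1)) * min (1 / \<mu>) T + (1 + real q) * min (1 / \<mu>) T"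
          using J(2) \<mu> T by (simp add: distrib_right[symmetric] mult_right_mono)
        also have "\<dots> \<le> (2 * \<mu> * (T + 1)) * (1 / \<mu>) + (1 + real q) * T"
          using \<mu> T by (intro add_mono mult_left_mono) auto
        also have "\<dots> = K" using \<mu> by (simp add: K_def)
        finally show ?thesis using cpos by (simp add: divide_right_mono)
      qed
      also have "\<dots> \<le> \<eta> / 2 / (real N + 1)"
        using c2 cpos \<eta> e by (simp add: field_simps)
      finally show "measure (stages \<mu>) (Pair u -` B3 l) \<le> \<eta> / 2 / (real N + 1)"
        by (simp add: B3_def vimage_def cong: if_cong)
    qed
    interpret B: prob_space "base \<mu>" by (rule prob_space_base[OF \<mu>])
    let ?Bad = "B1 \<union> B2 \<union> (\<Union>l\<in>{0..N}. B3 l)"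
    have Badm: "?Bad \<in> sets (base \<mu>)" using B1m B2m B3m by auto
    have "measure (base \<mu>) ?Bad \<le> measure (base \<mu>) (B1 \<union> B2) + measure (base \<mu>) (\<Union>l\<in>{0..N}. B3 l)"
      using B1m B2m B3m by (intro measure_Un_le) auto
    also have "measure (base \<mu>) (B1 \<union> B2) \<le> measure (base \<mu>) B1 + measure (base \<mu>) B2"
      using B1m B2m by (rule measure_Un_le)
    also have "measure (base \<mu>) (\<Union>l\<in>{0..N}. B3 l) \<le> (\<Sum>l\<in>{0..N}. measure (base \<mu>) (B3 l))"
      using B3m by (intro measure_UNION_le) auto
    also have "(\<Sum>l\<in>{0..N}. measure (base \<mu>) (B3 l)) \<le> (\<Sum>l\<in>{0..N}. \<eta> / 2 / (real N + 1))"
      by (intro sum_mono m3)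
    also have "\<dots> = \<eta> / 2"
    proof -
      have "(\<Sum>l\<in>{0..N}. x) = (real N + 1) * x" for x :: real by (simp add: add.commute)
      moreover have "a * (x / a) = x" if "0 < a" for a x :: real using that by simp
      ultimately show ?thesis by (simp only:)
    qed
    finally have Badle: "measure (base \<mu>) ?Bad \<le> \<eta>" using m1 m2 by linarith
    show "\<exists>Bad\<in>sets (base \<mu>). measure (base \<mu>) Bad \<le> \<eta> \<and>
      (\<forall>\<omega>. \<omega> \<notin> Bad \<longrightarrow> (\<forall>t\<in>{0..T}. \<forall>l\<in>{1..N}.
        \<bar>occupation (chain_from N \<nu> P (fst \<omega>)) (hold (snd \<omega>)) l t
          - (\<Sum>q<nat \<lfloor>c * t\<rfloor>. of_bool (skeleton_state c N \<nu> P \<omega> q = l)) / c\<bar> \<le> \<epsilon>))"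
    proof (rule bexI[OF _ Badm], intro conjI Badle allI impI ballI)
      fix \<omega> t l assume \<omega>: "\<omega> \<notin> ?Bad" and t: "t \<in> {0..T}" and l: "l \<in> {1..N}"
      have g: "good (snd \<omega>)" using \<omega> by (simp add: B1_def)
      then have h: "hold (snd \<omega>) = (\<lambda>n. fst (snd \<omega> n))" by (intro hold_eq) (simp add: good_def)
      have pos: "0 < fst (snd \<omega> n)" for n using g by (auto simp: good_def admissible_def)
      have B3n: "\<bar>\<Sum>i<j. ?f (fst \<omega>) l' i * ?Y (snd \<omega> i)\<bar> < e" if "l' \<in> {0..N}" "j \<le> J" for l' j
        using \<omega> that by (force simp: B3_def)
      have "\<bar>occupation (?Z (fst \<omega>)) (hold (snd \<omega>)) l t - visits (?Z (fst \<omega>)) (\<lambda>n. obs_count c (snd \<omega> n)) l (nat \<lfloor>c * t\<rfloor>) / c\<bar> \<le> 6 * e + 3 / c"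
      proof (rule occupation_close_to_visits[where T = T and J = J and d' = "\<lambda>n. obs_count c (min (fst (snd \<omega> n)) T, snd (snd \<omega> n))"])
        show "T < jump_time (hold (snd \<omega>)) J" using \<omega> by (simp add: B2_def h)
        show "obs_count c (min (fst (snd \<omega> n)) T, snd (snd \<omega> n)) \<le> obs_count c (snd \<omega> n)" for n
          using obs_count_mono[OF cpos, of "min (fst (snd \<omega> n)) T" "fst (snd \<omega> n)" "snd (snd \<omega> n)"] pos[of n] T g
          by (simp add: good_def)
        show "\<bar>\<Sum>i<j. real (obs_count c (min (fst (snd \<omega> i)) T, snd (snd \<omega> i))) / c - min (hold (snd \<omega>) i) T\<bar> < e" if "j \<le> J" for j
          using B3n[of 0 j] that by (simp add: h)
        show "\<bar>\<Sum>i<j. of_bool (?Z (fst \<omega>) i = l) * (real (obs_count c (min (fst (snd \<omega> i)) T, snd (snd \<omega> i))) / c - min (hold (snd \<omega>) i) T)\<bar> < e" if "j \<le> J" for j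
          using B3n[of l j] that l by (simp add: h)
      qed (use t cpos g in \<open>simp_all add: h good_def\<close>)
      also have "6 * e + 3 / c \<le> \<epsilon>"
      proof -
        have "3 / c \<le> \<epsilon> / 2" using c1 cpos \<epsilon> by (simp add: field_simps)
        then show ?thesis by (simp add: e_def)
      qed
      finally show "\<bar>occupation (chain_from N \<nu> P (fst \<omega>)) (hold (snd \<omega>)) l t
          - (\<Sum>q<nat \<lfloor>c * t\<rfloor>. of_bool (skeleton_state c N \<nu> P \<omega> q = l)) / c\<bar> \<le> \<epsilon>"
        by (simp add: visits_def)
    qed
  qed
qed

section \<open>The law of the observed states\<close>

text \<open>Entrywise form of \<open>(c + \<mu> (1 - P)) J = c\<close>.\<close>
definition resolvent_kernel :: "nat \<Rightarrow> real \<Rightarrow> (nat \<Rightarrow> nat \<Rightarrow> real) \<Rightarrow> real \<Rightarrow> (nat \<Rightarrow> nat \<Rightarrow> real) \<Rightarrow> bool" where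
  "resolvent_kernel N \<mu> P c J \<longleftrightarrow> (\<forall>i\<in>{1..N}. \<forall>j\<in>{1..N}.
     (c + \<mu>) * J i j = c * of_bool (i = j) + \<mu> * (\<Sum>k\<in>{1..N}. P i k * J k j))"

text \<open>The first observed state is the current one, or the chain jumps before the first observation.\<close>
lemma path_exp_resolvent_kernel:
  assumes J: "resolvent_kernel N \<mu> P c J" and i: "i \<in> {1..N}"
  shows "(c + \<mu>) * path_exp N J (Suc m) F i
    = c * path_exp N J m (\<lambda>l. F (i # l)) i + \<mu> * (\<Sum>k\<in>{1..N}. P i k * path_exp N J (Suc m) F k)"
proof -
  let ?g = "\<lambda>j. path_exp N J m (\<lambda>l. F (j # l)) j"
  have "(c + \<mu>) * path_exp N J (Suc m) F i = (\<Sum>j\<in>{1..N}. ((c + \<mu>) * J i j) * ?g j)"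
    by (simp add: sum_distrib_left mult.assoc)
  also have "\<dots> = (\<Sum>j\<in>{1..N}. c * (of_bool (i = j) * ?g j) + \<mu> * (\<Sum>k\<in>{1..N}. P i k * (J k j * ?g j)))"
    using J i by (intro sum.cong refl) (simp add: resolvent_kernel_def algebra_simps sum_distrib_left sum_distrib_right)
  also have "\<dots> = c * (\<Sum>j\<in>{1..N}. of_bool (i = j) * ?g j) + \<mu> * (\<Sum>j\<in>{1..N}. \<Sum>k\<in>{1..N}. P i k * (J k j * ?g j))"
    by (simp only: sum.distrib sum_distrib_left)
  also have "(\<Sum>j\<in>{1..N}. of_bool (i = j) * ?g j) = ?g i"
    using sum_of_bool_scaleR[of "{1..N}" i ?g] i by simp
  also have "(\<Sum>j\<in>{1..N}. \<Sum>k\<in>{1..N}. P i k * (J k j * ?g j)) = (\<Sum>k\<in>{1..N}. P i k * path_exp N J (Suc m) F k)"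
    by (subst sum.swap) (simp add: sum_distrib_left)
  finally show ?thesis .
qed

definition skeleton :: "nat \<Rightarrow> (nat \<Rightarrow> nat) \<Rightarrow> (nat \<Rightarrow> nat) \<Rightarrow> nat list" where
  "skeleton m z d = map (obs z d) [0..<m]"

lemma skeleton_shift:
  "skeleton m z d = (if m \<le> d 0 then replicate m (z 0)
     else replicate (d 0) (z 0) @ skeleton (m - d 0) (\<lambda>n. z (Suc n)) (\<lambda>n. d (Suc n)))"
proof (rule nth_equalityI)
  fix r assume "r < length (skeleton m z d)"
  then have r: "r < m" by (simp add: skeleton_def)
  then show "skeleton m z d ! r = (if m \<le> d 0 then replicate m (z 0)
     else replicate (d 0) (z 0) @ skeleton (m - d 0) (\<lambda>n. z (Suc n)) (\<lambda>n. d (Suc n))) ! r"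
    using obs_shift[of z d r] by (auto simp: skeleton_def nth_append)
qed (simp add: skeleton_def)

lemma obs_measurable:
  assumes z: "\<And>n. (\<lambda>x. z x n) \<in> measurable M (count_space UNIV)"
    and d [measurable]: "\<And>n. (\<lambda>x. d x n) \<in> measurable M (count_space UNIV)"
  shows "(\<lambda>x. obs (z x) (d x) r) \<in> measurable M (count_space UNIV)"
proof -
  have s [measurable]: "(\<lambda>x. sum (d x) {..<i}) \<in> measurable M (count_space UNIV)" for i :: nat
  proof (induction i)
    case (Suc i)
    have "(\<lambda>x. sum (d x) {..<i} + d x i) \<in> measurable M (count_space UNIV)"
      by (rule measurable_compose_countable[where f = "\<lambda>a x. a + d x i", OF _ Suc])
         (rule measurable_compose[OF d], simp)
    then show ?case by simp
  qed simp
  define R where "R i x \<longleftrightarrow> r < sum (d x) {..<Suc i}" for i x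
  have R [measurable]: "Measurable.pred M (R i)" for i :: nat
    unfolding R_def by (rule measurable_compose[OF s]) simp
  have "(\<lambda>x. LEAST i. R i x) \<in> measurable M (count_space UNIV)" by measurable
  then have "(\<lambda>x. LEAST i. r < sum (d x) {..<Suc i}) \<in> measurable M (count_space UNIV)" unfolding R_def .
  from measurable_compose_countable[where f = "\<lambda>i x. z x i", OF z this]
  have zz: "(\<lambda>x. z x (LEAST i. r < sum (d x) {..<Suc i})) \<in> measurable M (count_space UNIV)" .
  have "Measurable.pred M (\<lambda>x. \<exists>i. R i x)" by measurable
  then have "Measurable.pred M (\<lambda>x. \<exists>i. r < sum (d x) {..<Suc i})" unfolding R_def .
  from measurable_If[OF zz measurable_const this[unfolded pred_def], of 0]
  show ?thesis unfolding obs_def by simp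
qed

lemma skeleton_measurable:
  assumes z: "\<And>n. (\<lambda>x. z x n) \<in> measurable M (count_space UNIV)"
    and d: "\<And>n. (\<lambda>x. d x n) \<in> measurable M (count_space UNIV)"
  shows "(\<lambda>x. skeleton m (z x) (d x)) \<in> measurable M (count_space UNIV)"
proof (induction m)
  case (Suc m)
  have "(\<lambda>x. skeleton m (z x) (d x) @ [obs (z x) (d x) m]) \<in> measurable M (count_space UNIV)"
    by (rule measurable_compose_countable[where f = "\<lambda>l x. l @ [obs (z x) (d x) m]", OF _ Suc])
       (rule measurable_compose[OF obs_measurable[OF z d]], simp)
  then show ?case by (simp add: skeleton_def)
qed (simp add: skeleton_def)

lemma (in prob_space) abs_integral_le:
  fixes f :: "'a \<Rightarrow> real"
  assumes "\<And>x. \<bar>f x\<bar> \<le> C"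
  shows "\<bar>\<integral>x. f x \<partial>M\<bar> \<le> C"
proof (cases "integrable M f")
  case True
  have "\<bar>\<integral>x. f x \<partial>M\<bar> \<le> (\<integral>x. \<bar>f x\<bar> \<partial>M)" by (rule integral_abs_bound)
  also have "\<dots> \<le> (\<integral>x. C \<partial>M)" using True assms by (intro integral_mono) auto
  finally show ?thesis by (simp add: prob_space)
next
  case False
  have "0 \<le> C" using assms[of undefined] by linarith
  with False show ?thesis by (simp add: not_integrable_integral_eq)
qed

lemma sums_expectation_pmf:
  fixes H :: "nat \<Rightarrow> real"
  assumes H: "\<And>k. \<bar>H k\<bar> \<le> C"
  shows "(\<lambda>k. pmf q k * H k) sums (\<integral>k. H k \<partial>measure_pmf q)"
proof -
  have e: "measure_pmf q = density (count_space UNIV) (\<lambda>k. ennreal (pmf q k))"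
    by (rule measure_pmf_eq_density)
  have "integrable (measure_pmf q) H"
    by (rule measure_pmf.integrable_const_bound[where B = C]) (use H in auto)
  then have i: "integrable (count_space UNIV) (\<lambda>k. pmf q k * H k)"
    unfolding e by (subst (asm) integrable_density) auto
  have "(\<integral>k. H k \<partial>measure_pmf q) = (\<integral>k. pmf q k * H k \<partial>count_space UNIV)"
    unfolding e by (subst integral_density) auto
  then show ?thesis using sums_integral_count_space_nat[OF i] by simp
qed

text \<open>A geometric variable is zero, or one plus a copy of itself.\<close>
lemma integral_geometric:
  assumes p: "0 < p" "p \<le> 1" and H: "\<And>k. \<bar>H k\<bar> \<le> (C :: real)"
  shows "(\<integral>k. H k \<partial>measure_pmf (geometric_pmf p)) = p * H 0 + (1 - p) * (\<integral>k. H (Suc k) \<partial>measure_pmf (geometric_pmf p))"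
proof -
  have g: "pmf (geometric_pmf p) k = (1 - p) ^ k * p" for k by (rule pmf_geometric[OF p])
  have 1: "(\<lambda>k. (1 - p) ^ k * p * H k) sums (\<integral>k. H k \<partial>measure_pmf (geometric_pmf p))"
    using sums_expectation_pmf[of H C "geometric_pmf p", OF H] by (simp only: g)
  have "(\<lambda>k. (1 - p) ^ k * p * H (Suc k)) sums (\<integral>k. H (Suc k) \<partial>measure_pmf (geometric_pmf p))"
    using sums_expectation_pmf[of "\<lambda>k. H (Suc k)" C "geometric_pmf p", OF H] by (simp only: g)
  from sums_mult[OF this, of "1 - p"]
  have "(\<lambda>k. (1 - p) ^ Suc k * p * H (Suc k)) sums ((1 - p) * (\<integral>k. H (Suc k) \<partial>measure_pmf (geometric_pmf p)))"
    by (simp only: power_Suc mult.assoc)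
  then have "(\<lambda>k. (1 - p) ^ k * p * H k) sums ((1 - p) * (\<integral>k. H (Suc k) \<partial>measure_pmf (geometric_pmf p)) + (1 - p) ^ 0 * p * H 0)"
    by (rule sums_Suc)
  with 1 show ?thesis using sums_unique2 by fastforce
qed

context
  fixes N :: nat and P :: "nat \<Rightarrow> nat \<Rightarrow> real" and \<mu> c :: real
  assumes P: "stochastic_matrix N P" and N: "1 \<le> N" and \<mu>: "0 < \<mu>" and c: "0 < c"
begin

interpretation st: sequence_space "stage_law \<mu>" by (rule sequence_space_stages[OF \<mu>])

abbreviation "skel m i u e \<equiv> skeleton m (chain N P i u) (\<lambda>n. obs_count c (e n))"

lemma skel_measurable_pair:
  "(\<lambda>p. skel m i (fst p) (snd p)) \<in> measurable (noise \<Otimes>\<^sub>M stages \<mu>) (count_space UNIV)"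
proof (rule skeleton_measurable)
  show "(\<lambda>p. chain N P i (fst p) n) \<in> measurable (noise \<Otimes>\<^sub>M stages \<mu>) (count_space UNIV)" for n
    by (rule measurable_compose[OF measurable_fst], rule chain_measurable) auto
  show "(\<lambda>p. obs_count c (snd p n)) \<in> measurable (noise \<Otimes>\<^sub>M stages \<mu>) (count_space UNIV)" for n
    by (rule measurable_compose[OF measurable_snd], rule measurable_compose[OF _ obs_count_measurable]) measurable
qed

lemma skel_measurable_noise:
  "(\<lambda>u. skeleton m (chain N P i u) d) \<in> measurable noise (count_space UNIV)"
  by (rule skeleton_measurable, rule chain_measurable) auto

text \<open>Expectation over the chain started in \<open>i\<close>, for given numbers \<open>d\<close> of observations.\<close>
definition frozen_exp :: "nat \<Rightarrow> (nat \<Rightarrow> nat) \<Rightarrow> (nat list \<Rightarrow> real) \<Rightarrow> nat \<Rightarrow> real" where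
  "frozen_exp m d F i = (\<integral>u. F (skeleton m (chain N P i u) d) \<partial>noise)"

definition skel_exp :: "nat \<Rightarrow> (nat list \<Rightarrow> real) \<Rightarrow> nat \<Rightarrow> real" where
  "skel_exp m F i = (\<integral>e. frozen_exp m (\<lambda>n. obs_count c (e n)) F i \<partial>stages \<mu>)"

lemma frozen_exp_step:
  assumes i: "i \<in> {1..N}" and F: "\<And>l. \<bar>F l\<bar> \<le> C"
  shows "frozen_exp m d F i = (if m \<le> d 0 then F (replicate m i)
     else \<Sum>k\<in>{1..N}. P i k * frozen_exp (m - d 0) (\<lambda>n. d (Suc n)) (\<lambda>l. F (replicate (d 0) i @ l)) k)"
proof (cases "m \<le> d 0")
  case True
  then have "skeleton m (chain N P i u) d = replicate m i" for u by (subst skeleton_shift) simp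
  with True show ?thesis using noise.P.prob_space by (simp add: frozen_exp_def)
next
  case False
  let ?d = "\<lambda>n. d (Suc n)"
  have sk: "skeleton m (chain N P i (case_nat a u)) d =
      replicate (d 0) i @ skeleton (m - d 0) (chain N P (draw N (P i) a) u) ?d" for a u
    using False by (subst skeleton_shift) (simp only: chain_shift, simp)
  have "frozen_exp m d F i = (\<integral>a. (\<integral>u. F (skeleton m (chain N P i (case_nat a u)) d) \<partial>noise) \<partial>unif)"
    unfolding frozen_exp_def
    by (rule noise.integral_iter[where C = C]) (rule measurable_compose[OF skel_measurable_noise], simp, rule F)
  also have "\<dots> = (\<integral>a. frozen_exp (m - d 0) ?d (\<lambda>l. F (replicate (d 0) i @ l)) (draw N (P i) a) \<partial>unif)"
    unfolding sk frozen_exp_def ..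
  also have "\<dots> = (\<Sum>k\<in>{1..N}. P i k * frozen_exp (m - d 0) ?d (\<lambda>l. F (replicate (d 0) i @ l)) k)"
    by (rule integral_draw[OF _ N, where F = "\<lambda>k. frozen_exp (m - d 0) ?d (\<lambda>l. F (replicate (d 0) i @ l)) k"])
       (use P i in \<open>auto simp: stochastic_matrix_def\<close>)
  finally show ?thesis using False by simp
qed

lemma frozen_exp_bound:
  assumes F: "\<And>l. \<bar>F l\<bar> \<le> C"
  shows "\<bar>frozen_exp m d F i\<bar> \<le> C"
  unfolding frozen_exp_def by (rule noise.P.abs_integral_le) (rule F)

lemma frozen_exp_measurable:
  "(\<lambda>e. frozen_exp m (\<lambda>n. obs_count c (e n)) F i) \<in> borel_measurable (stages \<mu>)"
proof -
  have "(\<lambda>p. F (skel m i (snd p) (fst p))) \<in> borel_measurable (stages \<mu> \<Otimes>\<^sub>M noise)"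
    using measurable_compose[OF measurable_compose[OF measurable_pair_swap' skel_measurable_pair], of F borel]
    by (simp add: case_prod_beta')
  then show ?thesis
    unfolding frozen_exp_def by (intro noise.P.borel_measurable_lebesgue_integral) (simp add: case_prod_beta')
qed

lemma skel_exp_bound: "(\<And>l. \<bar>F l\<bar> \<le> C) \<Longrightarrow> \<bar>skel_exp m F i\<bar> \<le> C"
  unfolding skel_exp_def by (rule st.P.abs_integral_le) (rule frozen_exp_bound)

lemma skel_exp_0: "skel_exp 0 F i = F []"
  using noise.P.prob_space st.P.prob_space by (simp add: skel_exp_def frozen_exp_def skeleton_def)

text \<open>Decomposition at the end of the first stage, whose number of observations is geometric.\<close>
lemma skel_exp_step:
  assumes i: "i \<in> {1..N}" and F: "\<And>l. \<bar>F l\<bar> \<le> C"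
  shows "skel_exp m F i = (\<integral>d. (if m \<le> d then F (replicate m i)
     else \<Sum>k\<in>{1..N}. P i k * skel_exp (m - d) (\<lambda>l. F (replicate d i @ l)) k) \<partial>measure_pmf (geometric_pmf (\<mu> / (c + \<mu>))))"
proof -
  let ?D = "\<lambda>e n. obs_count c (e n)"
  let ?H = "\<lambda>d. (if m \<le> d then F (replicate m i)
     else \<Sum>k\<in>{1..N}. P i k * skel_exp (m - d) (\<lambda>l. F (replicate d i @ l)) k)"
  have "skel_exp m F i = (\<integral>b. (\<integral>e. frozen_exp m (?D (case_nat b e)) F i \<partial>stages \<mu>) \<partial>stage_law \<mu>)"
    unfolding skel_exp_def
    by (rule st.integral_iter[where C = C, OF frozen_exp_measurable]) (rule frozen_exp_bound[OF F])
  also have "\<dots> = (\<integral>b. ?H (obs_count c b) \<partial>stage_law \<mu>)"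
  proof (rule Bochner_Integration.integral_cong[OF refl])
    fix b
    have int: "integrable (stages \<mu>) (\<lambda>e. frozen_exp m' (?D e) F' k)" if "\<And>l. \<bar>F' l\<bar> \<le> C" for m' F' k
      by (rule st.P.integrable_const_bound[where B = C]) (use frozen_exp_bound[OF that] frozen_exp_measurable in auto)
    show "(\<integral>e. frozen_exp m (?D (case_nat b e)) F i \<partial>stages \<mu>) = ?H (obs_count c b)"
    proof (cases "m \<le> obs_count c b")
      case True
      then show ?thesis using st.P.prob_space by (subst frozen_exp_step[OF i F]) simp
    next
      case False
      then have "(\<integral>e. frozen_exp m (?D (case_nat b e)) F i \<partial>stages \<mu>) =
        (\<integral>e. (\<Sum>k\<in>{1..N}. P i k * frozen_exp (m - obs_count c b) (?D e) (\<lambda>l. F (replicate (obs_count c b) i @ l)) k) \<partial>stages \<mu>)"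
        by (subst frozen_exp_step[OF i F]) simp
      also have "\<dots> = (\<Sum>k\<in>{1..N}. \<integral>e. P i k * frozen_exp (m - obs_count c b) (?D e) (\<lambda>l. F (replicate (obs_count c b) i @ l)) k \<partial>stages \<mu>)"
        by (rule Bochner_Integration.integral_sum) (auto intro!: integrable_mult_right int F)
      also have "\<dots> = (\<Sum>k\<in>{1..N}. P i k * skel_exp (m - obs_count c b) (\<lambda>l. F (replicate (obs_count c b) i @ l)) k)"
        unfolding skel_exp_def by simp
      finally show ?thesis using False by simp
    qed
  qed
  also have "\<dots> = (\<integral>d. ?H d \<partial>distr (stage_law \<mu>) (count_space UNIV) (obs_count c))"
    by (rule integral_distr[symmetric]) (auto simp: measurable_cong_sets[OF sets_stage_law refl] obs_count_measurable)
  finally show ?thesis unfolding distr_stage_law_obs_count[OF \<mu> c] .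
qed

text \<open>By the lack of memory of the geometric law, one step of the geometric variable can be
  peeled off: either a jump occurs before the first observation, or the first observation
  shows the initial state and the rest starts afresh from there.\<close>
lemma skel_exp_Suc:
  assumes i: "i \<in> {1..N}" and F: "\<And>l. \<bar>F l\<bar> \<le> C"
  shows "skel_exp (Suc m) F i = (\<mu> / (c + \<mu>)) * (\<Sum>k\<in>{1..N}. P i k * skel_exp (Suc m) F k)
    + (1 - \<mu> / (c + \<mu>)) * skel_exp m (\<lambda>l. F (i # l)) i"
proof -
  let ?p = "\<mu> / (c + \<mu>)"
  have p: "0 < ?p" "?p \<le> 1" using \<mu> c by auto
  let ?H = "\<lambda>m F d. (if m \<le> d then F (replicate m i)
     else \<Sum>k\<in>{1..N}. P i k * skel_exp (m - d) (\<lambda>l. F (replicate d i @ l)) k)"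
  have Pi: "probability_vector N (P i)" using P i by (simp add: stochastic_matrix_def)
  have "\<bar>?H (Suc m) F d\<bar> \<le> C" for d
  proof (cases "Suc m \<le> d")
    case False
    have "\<bar>\<Sum>k\<in>{1..N}. P i k * skel_exp (Suc m - d) (\<lambda>l. F (replicate d i @ l)) k\<bar> \<le> (\<Sum>k\<in>{1..N}. P i k * C)"
      using Pi by (intro order_trans[OF sum_abs] sum_mono)
        (auto simp: abs_mult probability_vector_def intro!: mult_left_mono skel_exp_bound F)
    also have "\<dots> = C" using Pi by (simp add: sum_distrib_right[symmetric] probability_vector_def)
    finally show ?thesis using False by simp
  qed (use F in auto)
  note geo = integral_geometric[of ?p "?H (Suc m) F", OF p this]
  have "skel_exp (Suc m) F i = ?p * ?H (Suc m) F 0 + (1 - ?p) * (\<integral>d. ?H (Suc m) F (Suc d) \<partial>measure_pmf (geometric_pmf ?p))"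
    unfolding skel_exp_step[OF i F] by (rule geo)
  also have "(\<lambda>d. ?H (Suc m) F (Suc d)) = ?H m (\<lambda>l. F (i # l))" by (simp add: fun_eq_iff)
  also have "(\<integral>d. ?H m (\<lambda>l. F (i # l)) d \<partial>measure_pmf (geometric_pmf ?p)) = skel_exp m (\<lambda>l. F (i # l)) i"
    by (rule skel_exp_step[OF i, symmetric]) (rule F)
  finally show ?thesis by simp
qed

text \<open>Both sides solve the same linear equation in the initial state. The coefficient of the unknown is
  \<open>\<mu> / (c + \<mu>) < 1\<close> times a stochastic matrix, so the maximum principle gives uniqueness.\<close>
lemma skel_exp_eq_path_exp:
  assumes J: "resolvent_kernel N \<mu> P c J" and i: "i \<in> {1..N}" and F: "\<And>l. \<bar>F l\<bar> \<le> C"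
  shows "skel_exp m F i = path_exp N J m F i"
  using i F
proof (induction m arbitrary: i F)
  case 0
  then show ?case by (simp add: skel_exp_0)
next
  case (Suc m)
  let ?p = "\<mu> / (c + \<mu>)"
  let ?\<Delta> = "\<lambda>i. skel_exp (Suc m) F i - path_exp N J (Suc m) F i"
  have p: "0 \<le> ?p" "?p < 1" using \<mu> c by auto
  have cm: "c + \<mu> \<noteq> 0" using \<mu> c by simp
  have eq: "?\<Delta> i = ?p * (\<Sum>k\<in>{1..N}. P i k * ?\<Delta> k)" if i: "i \<in> {1..N}" for i
  proof -
    have "path_exp N J (Suc m) F i = (1 - ?p) * path_exp N J m (\<lambda>l. F (i # l)) i + ?p * (\<Sum>k\<in>{1..N}. P i k * path_exp N J (Suc m) F k)"
    proof -
      have *: "z = (1 - \<mu> / (c + \<mu>)) * x + \<mu> / (c + \<mu>) * y" if "(c + \<mu>) * z = c * x + \<mu> * y" for x y z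
      proof -
        have "z = (c * x + \<mu> * y) / (c + \<mu>)" using cm that by (simp add: field_simps)
        moreover have "1 - \<mu> / (c + \<mu>) = c / (c + \<mu>)" using cm by (simp add: field_simps)
        ultimately show ?thesis by (simp add: add_divide_distrib)
      qed
      show ?thesis by (rule *[OF path_exp_resolvent_kernel[OF J i]])
    qed
    moreover have "skel_exp m (\<lambda>l. F (i # l)) i = path_exp N J m (\<lambda>l. F (i # l)) i"
      by (rule Suc.IH[OF i]) (rule Suc.prems(2))
    ultimately show ?thesis
      using skel_exp_Suc[OF i Suc.prems(2), of m] by (simp add: right_diff_distrib sum_subtractf)
  qed
  \<comment> \<open>maximum principle: at a state where the difference is largest, it is at most \<open>?p\<close> times itself\<close>
  define K where "K = Max ((\<lambda>i. \<bar>?\<Delta> i\<bar>) ` {1..N})"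
  have K: "\<bar>?\<Delta> k\<bar> \<le> K" if "k \<in> {1..N}" for k
    unfolding K_def by (rule Max_ge) (use that in auto)
  have "K \<in> (\<lambda>i. \<bar>?\<Delta> i\<bar>) ` {1..N}" unfolding K_def by (rule Max_in) (use N in auto)
  then obtain i0 where i0: "i0 \<in> {1..N}" "K = \<bar>?\<Delta> i0\<bar>" by blast
  have "\<bar>?\<Delta> i0\<bar> \<le> ?p * K"
  proof -
    have Pi: "probability_vector N (P i0)" using P i0 by (simp add: stochastic_matrix_def)
    have "\<bar>\<Sum>k\<in>{1..N}. P i0 k * ?\<Delta> k\<bar> \<le> (\<Sum>k\<in>{1..N}. P i0 k * K)"
      using Pi K by (intro order_trans[OF sum_abs] sum_mono)
        (auto simp: abs_mult probability_vector_def intro!: mult_left_mono)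
    also have "\<dots> = K" using Pi by (simp add: sum_distrib_right[symmetric] probability_vector_def)
    finally have "?p * \<bar>\<Sum>k\<in>{1..N}. P i0 k * ?\<Delta> k\<bar> \<le> ?p * K" using p(1) by (rule mult_left_mono)
    then show ?thesis unfolding eq[OF i0(1)] abs_mult abs_of_nonneg[OF p(1)] .
  qed
  with i0 have "K * (1 - ?p) \<le> 0" by (simp add: algebra_simps)
  then have "K \<le> 0" using p by (simp add: mult_le_0_iff)
  then show ?case using K[OF Suc.prems(1)] by simp
qed

lemma skel_exp_Fubini:
  assumes F: "\<And>l. \<bar>F l\<bar> \<le> C"
  shows "(\<integral>u. (\<integral>e. F (skel m i u e) \<partial>stages \<mu>) \<partial>noise) = skel_exp m F i"
proof -
  interpret pair_sigma_finite noise "stages \<mu>" ..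
  have prob: "prob_space (noise \<Otimes>\<^sub>M stages \<mu>)"
    by (intro prob_space_pair noise.P.prob_space_axioms st.P.prob_space_axioms)
  have "integrable (noise \<Otimes>\<^sub>M stages \<mu>) (\<lambda>p. F (skel m i (fst p) (snd p)))"
    by (rule finite_measure.integrable_const_bound[OF prob_space.finite_measure[OF prob], where B = C])
       (use F measurable_compose[OF skel_measurable_pair, of F borel] in auto)
  then show ?thesis
    unfolding skel_exp_def frozen_exp_def
    by (intro Fubini_integral[symmetric]) (simp add: case_prod_beta')
qed

end

text \<open>The observed states form a Markov chain whose transition matrix is the resolvent; its initial state, drawn
  from \<open>\<nu>\<close>, is not itself observed.\<close>
theorem skeleton_law:
  assumes par: "parameters N \<nu> \<mu> P" and N: "1 \<le> N" and c: "0 < c"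
    and J: "resolvent_kernel N \<mu> P c J"
  shows "(\<lambda>\<omega>. map (skeleton_state c N \<nu> P \<omega>) [0..<m]) \<in> measurable (base \<mu>) (count_space UNIV)"
    and "measure (base \<mu>) {\<omega>. map (skeleton_state c N \<nu> P \<omega>) [0..<m] \<in> A} = (\<Sum>i\<in>{1..N}. \<nu> i * path_exp N J m (\<lambda>l. of_bool (l \<in> A)) i)"
proof -
  have \<nu>: "probability_vector N \<nu>" and \<mu>: "0 < \<mu>" and P: "stochastic_matrix N P"
    using par by (auto simp: parameters_def)
  interpret st: sequence_space "stage_law \<mu>" by (rule sequence_space_stages[OF \<mu>])
  interpret B: prob_space "base \<mu>" by (rule prob_space_base[OF \<mu>])
  interpret pair_sigma_finite noise "stages \<mu>" ..
  let ?sk = "\<lambda>u e. skeleton m (chain_from N \<nu> P u) (\<lambda>n. obs_count c (e n))"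
  have m: "(\<lambda>p. ?sk (fst p) (snd p)) \<in> measurable (base \<mu>) (count_space UNIV)"
    unfolding base_def
  proof (rule skeleton_measurable)
    show "(\<lambda>p. chain_from N \<nu> P (fst p) n) \<in> measurable (noise \<Otimes>\<^sub>M stages \<mu>) (count_space UNIV)" for n
      using chain_fst_measurable unfolding base_def .
    show "(\<lambda>p. obs_count c (snd p n)) \<in> measurable (noise \<Otimes>\<^sub>M stages \<mu>) (count_space UNIV)" for n
      by (rule measurable_compose[OF measurable_snd], rule measurable_compose[OF _ obs_count_measurable]) measurable
  qed
  then show 1: "(\<lambda>\<omega>. map (skeleton_state c N \<nu> P \<omega>) [0..<m]) \<in> measurable (base \<mu>) (count_space UNIV)"
    by (simp add: skeleton_def)
  let ?F = "\<lambda>l. of_bool (l \<in> A) :: real"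
  have F: "\<bar>?F l\<bar> \<le> 1" for l by simp
  have int: "integrable (noise \<Otimes>\<^sub>M stages \<mu>) (\<lambda>p. ?F (?sk (fst p) (snd p)))"
    using measurable_compose[OF m, of ?F borel] unfolding base_def
    by (intro finite_measure.integrable_const_bound[OF prob_space.finite_measure[OF B.prob_space_axioms[unfolded base_def]], where B = 1]) auto
  have "measure (base \<mu>) {\<omega>. map (skeleton_state c N \<nu> P \<omega>) [0..<m] \<in> A} = (\<integral>\<omega>. indicator {\<omega>. map (skeleton_state c N \<nu> P \<omega>) [0..<m] \<in> A} \<omega> \<partial>base \<mu>)"
    using measurable_sets[OF 1, of A] by (simp add: vimage_def)
  also have "\<dots> = (\<integral>p. ?F (?sk (fst p) (snd p)) \<partial>(noise \<Otimes>\<^sub>M stages \<mu>))"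
    unfolding base_def by (intro Bochner_Integration.integral_cong) (auto simp: indicator_def skeleton_def)
  also have "\<dots> = (\<integral>u. (\<integral>e. ?F (?sk u e) \<partial>stages \<mu>) \<partial>noise)"
    using integral_fst'[OF int] by simp
  also have "\<dots> = (\<integral>a. (\<integral>u. (\<integral>e. ?F (?sk (case_nat a u) e) \<partial>stages \<mu>) \<partial>noise) \<partial>unif)"
  proof (rule noise.integral_iter[where C = 1])
    show "(\<lambda>u. \<integral>e. ?F (?sk u e) \<partial>stages \<mu>) \<in> borel_measurable noise"
      using int by (intro st.P.borel_measurable_lebesgue_integral) (auto simp: case_prod_beta')
    show "\<bar>\<integral>e. ?F (?sk u e) \<partial>stages \<mu>\<bar> \<le> 1" for u
      by (rule st.P.abs_integral_le) simp
  qed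
  also have "\<dots> = (\<integral>a. skel_exp N P \<mu> c m ?F (draw N \<nu> a) \<partial>unif)"
    unfolding chain_from_def nat.case
    by (subst skel_exp_Fubini[OF P N \<mu> c F]) (rule refl)
  also have "\<dots> = (\<Sum>i\<in>{1..N}. \<nu> i * skel_exp N P \<mu> c m ?F i)"
    by (rule integral_draw[OF \<nu> N])
  also have "\<dots> = (\<Sum>i\<in>{1..N}. \<nu> i * path_exp N J m ?F i)"
    by (intro sum.cong refl) (simp only: skel_exp_eq_path_exp[OF P N \<mu> c J _ F])
  finally show "measure (base \<mu>) {\<omega>. map (skeleton_state c N \<nu> P \<omega>) [0..<m] \<in> A} = (\<Sum>i\<in>{1..N}. \<nu> i * path_exp N J m ?F i)" .
qed

section \<open>Resolvent matrices\<close>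

text \<open>The product of matrices indexed by \<open>{1..N}\<close>. The size has to be a term because the number of
  classes in the limit is not known in advance.\<close>
definition mmul :: "nat \<Rightarrow> (nat \<Rightarrow> nat \<Rightarrow> real) \<Rightarrow> (nat \<Rightarrow> nat \<Rightarrow> real) \<Rightarrow> nat \<Rightarrow> nat \<Rightarrow> real" where
  "mmul N A B i j = (\<Sum>k\<in>{1..N}. A i k * B k j)"

lemma mmul_assoc: "mmul N (mmul N A B) C i j = mmul N A (mmul N B C) i j"
  unfolding mmul_def sum_distrib_left sum_distrib_right
  by (subst sum.swap) (simp add: mult.assoc)

lemma mmul_cong:
  "(\<And>k. k \<in> {1..N} \<Longrightarrow> A i k = A' i k) \<Longrightarrow> (\<And>k. k \<in> {1..N} \<Longrightarrow> B k j = B' k j) \<Longrightarrow> mmul N A B i j = mmul N A' B' i j"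
  unfolding mmul_def by (intro sum.cong) auto

lemma mmul_id_left: "i \<in> {1..N} \<Longrightarrow> mmul N (\<lambda>i j. of_bool (i = j)) A i j = A i j"
  unfolding mmul_def using sum_of_bool_scaleR[of "{1..N}" i "\<lambda>k. A k j", OF finite_atLeastAtMost]
  by (simp only: real_scaleR_def)

lemma mmul_id_right: "j \<in> {1..N} \<Longrightarrow> mmul N A (\<lambda>i j. of_bool (i = j)) i j = A i j"
proof -
  assume j: "j \<in> {1..N}"
  have "mmul N A (\<lambda>i j. of_bool (i = j)) i j = (\<Sum>k\<in>{1..N}. of_bool (j = k) *\<^sub>R A i k)"
    unfolding mmul_def by (intro sum.cong refl) auto
  also have "\<dots> = A i j" by (rule sum_of_bool_scaleR) (use j in auto)
  finally show ?thesis .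
qed

lemma stochastic_mmul:
  assumes A: "stochastic_matrix N A" and B: "stochastic_matrix N B"
  shows "stochastic_matrix N (mmul N A B)"
  unfolding stochastic_matrix_def probability_vector_def
proof (intro ballI conjI)
  fix i assume i: "i \<in> {1..N}"
  show "0 \<le> mmul N A B i j" if "j \<in> {1..N}" for j
    unfolding mmul_def using A B i that
    by (intro sum_nonneg mult_nonneg_nonneg) (auto simp: stochastic_matrix_def probability_vector_def)
  have "(\<Sum>j\<in>{1..N}. mmul N A B i j) = (\<Sum>k\<in>{1..N}. A i k * (\<Sum>j\<in>{1..N}. B k j))"
    unfolding mmul_def sum_distrib_left by (rule sum.swap)
  also have "\<dots> = (\<Sum>k\<in>{1..N}. A i k)"
    using B by (intro sum.cong) (auto simp: stochastic_matrix_def probability_vector_def)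
  also have "\<dots> = 1" using A i by (simp add: stochastic_matrix_def probability_vector_def)
  finally show "(\<Sum>j\<in>{1..N}. mmul N A B i j) = 1" .
qed

lemma stochastic_id: "stochastic_matrix N (\<lambda>i j. of_bool (i = j))"
  unfolding stochastic_matrix_def probability_vector_def
proof (intro ballI conjI)
  fix i assume "i \<in> {1..N}"
  then show "(\<Sum>j\<in>{1..N}. of_bool (i = j)) = (1 :: real)"
    using sum_of_bool_scaleR[of "{1..N}" i "\<lambda>_. 1 :: real"] by simp
qed simp

lemma stochastic_entry: "stochastic_matrix N A \<Longrightarrow> i \<in> {1..N} \<Longrightarrow> j \<in> {1..N} \<Longrightarrow> 0 \<le> A i j \<and> A i j \<le> 1"
  using member_le_sum[of j "{1..N}" "A i"] by (auto simp: stochastic_matrix_def probability_vector_def)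

primrec mpow :: "nat \<Rightarrow> (nat \<Rightarrow> nat \<Rightarrow> real) \<Rightarrow> nat \<Rightarrow> nat \<Rightarrow> nat \<Rightarrow> real" where
  "mpow N P 0 = (\<lambda>i j. of_bool (i = j))"
| "mpow N P (Suc n) = mmul N P (mpow N P n)"

lemma mpow_Suc_right:
  "i \<in> {1..N} \<Longrightarrow> j \<in> {1..N} \<Longrightarrow> mpow N P (Suc n) i j = mmul N (mpow N P n) P i j"
proof (induction n arbitrary: i j)
  case 0
  then show ?case by (simp add: mmul_id_left mmul_id_right del: atLeastAtMost_iff)
next
  case (Suc n)
  have "mpow N P (Suc (Suc n)) i j = mmul N P (mmul N (mpow N P n) P) i j"
    using Suc by (subst mpow.simps(2), intro mmul_cong) (simp_all del: mpow.simps(2))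
  then show ?case by (simp add: mmul_assoc)
qed

lemma stochastic_mpow: "stochastic_matrix N P \<Longrightarrow> stochastic_matrix N (mpow N P n)"
  by (induction n) (simp_all add: stochastic_id stochastic_mmul)

text \<open>The Neumann series of \<open>c (c + \<mu> (1 - P))\<^sup>-\<^sup>1\<close>. As a convex combination of powers of \<open>P\<close> it is stochastic.\<close>
definition resolvent_matrix :: "nat \<Rightarrow> real \<Rightarrow> (nat \<Rightarrow> nat \<Rightarrow> real) \<Rightarrow> real \<Rightarrow> nat \<Rightarrow> nat \<Rightarrow> real" where
  "resolvent_matrix N \<mu> P c i j = (\<Sum>n. c / (c + \<mu>) * (\<mu> / (c + \<mu>)) ^ n * mpow N P n i j)"

context
  fixes N :: nat and \<mu> c :: real and P :: "nat \<Rightarrow> nat \<Rightarrow> real"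
  assumes P: "stochastic_matrix N P" and \<mu>: "0 < \<mu>" and c: "0 < c"
begin

lemma weights_sums: "(\<lambda>n. c / (c + \<mu>) * (\<mu> / (c + \<mu>)) ^ n) sums 1"
proof -
  have "(\<lambda>n. (\<mu> / (c + \<mu>)) ^ n) sums (1 / (1 - \<mu> / (c + \<mu>)))"
    using \<mu> c by (intro geometric_sums) auto
  moreover have "1 - \<mu> / (c + \<mu>) = c / (c + \<mu>)" using \<mu> c by (simp add: field_simps)
  ultimately have "(\<lambda>n. (\<mu> / (c + \<mu>)) ^ n) sums ((c + \<mu>) / c)" by simp
  from sums_mult[OF this, of "c / (c + \<mu>)"] show ?thesis using \<mu> c by simp
qed

lemma resolvent_sums:
  assumes "i \<in> {1..N}" "j \<in> {1..N}"
  shows "(\<lambda>n. c / (c + \<mu>) * (\<mu> / (c + \<mu>)) ^ n * mpow N P n i j) sums resolvent_matrix N \<mu> P c i j"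
  unfolding resolvent_matrix_def
proof (rule summable_sums, rule summable_comparison_test'[OF sums_summable[OF weights_sums]])
  fix n
  have "0 \<le> c / (c + \<mu>) * (\<mu> / (c + \<mu>)) ^ n" using \<mu> c by simp
  then show "norm (c / (c + \<mu>) * (\<mu> / (c + \<mu>)) ^ n * mpow N P n i j) \<le> c / (c + \<mu>) * (\<mu> / (c + \<mu>)) ^ n"
    using stochastic_entry[OF stochastic_mpow[OF P] assms, of n]
    by (metis abs_of_nonneg mult_left_le mult_nonneg_nonneg real_norm_def)
qed

lemma resolvent_matrix_stochastic: "stochastic_matrix N (resolvent_matrix N \<mu> P c)"
  unfolding stochastic_matrix_def probability_vector_def
proof (intro ballI conjI)
  fix i assume i: "i \<in> {1..N}"
  show "0 \<le> resolvent_matrix N \<mu> P c i j" if "j \<in> {1..N}" for j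
    by (rule sums_le[OF _ sums_zero resolvent_sums[OF i that]])
       (use stochastic_entry[OF stochastic_mpow[OF P] i that] \<mu> c in simp)
  have "(\<lambda>n. \<Sum>j\<in>{1..N}. c / (c + \<mu>) * (\<mu> / (c + \<mu>)) ^ n * mpow N P n i j) sums (\<Sum>j\<in>{1..N}. resolvent_matrix N \<mu> P c i j)"
    by (rule sums_sum) (rule resolvent_sums[OF i])
  moreover have "(\<Sum>j\<in>{1..N}. c / (c + \<mu>) * (\<mu> / (c + \<mu>)) ^ n * mpow N P n i j) = c / (c + \<mu>) * (\<mu> / (c + \<mu>)) ^ n" for n
    unfolding sum_distrib_left[symmetric]
    using stochastic_mpow[OF P, of n] i by (simp add: stochastic_matrix_def probability_vector_def)
  ultimately show "(\<Sum>j\<in>{1..N}. resolvent_matrix N \<mu> P c i j) = 1"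
    using weights_sums sums_unique2 by simp
qed

text \<open>The equation from the left and from the right at once: \<open>L\<close> is multiplication by \<open>P\<close> on either side.\<close>
lemma resolvent_step:
  assumes i: "i \<in> {1..N}" "j \<in> {1..N}" and L: "L = (\<lambda>A. mmul N P A i j) \<or> L = (\<lambda>A. mmul N A P i j)"
  shows "(c + \<mu>) * resolvent_matrix N \<mu> P c i j = c * of_bool (i = j) + \<mu> * L (resolvent_matrix N \<mu> P c)"
proof -
  let ?w = "\<lambda>n. c / (c + \<mu>) * (\<mu> / (c + \<mu>)) ^ n"
  have L': "L (mpow N P n) = mpow N P (Suc n) i j" for n
    using L mpow_Suc_right[OF i] by auto
  have "(\<lambda>n. L (\<lambda>i j. ?w n * mpow N P n i j)) sums L (resolvent_matrix N \<mu> P c)"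
    using L i resolvent_sums by (auto simp: mmul_def simp del: atLeastAtMost_iff intro!: sums_sum sums_mult sums_mult2)
  moreover have "L (\<lambda>i j. w * A i j) = w * L A" for w A
    using L by (auto simp: mmul_def sum_distrib_left mult_ac)
  ultimately have "(\<lambda>n. ?w n * mpow N P (Suc n) i j) sums L (resolvent_matrix N \<mu> P c)"
    by (simp only: L')
  from sums_mult[OF this, of "\<mu> / (c + \<mu>)"]
  have "(\<lambda>n. ?w (Suc n) * mpow N P (Suc n) i j) sums (\<mu> / (c + \<mu>) * L (resolvent_matrix N \<mu> P c))"
    by (simp only: power_Suc mult_ac)
  then have "(\<lambda>n. ?w n * mpow N P n i j) sums (\<mu> / (c + \<mu>) * L (resolvent_matrix N \<mu> P c) + ?w 0 * mpow N P 0 i j)"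
    by (rule sums_Suc)
  from sums_unique2[OF resolvent_sums[OF i] this]
  have "resolvent_matrix N \<mu> P c i j = \<mu> / (c + \<mu>) * L (resolvent_matrix N \<mu> P c) + c / (c + \<mu>) * of_bool (i = j)"
    by simp
  moreover have "(c + \<mu>) * (\<mu> / (c + \<mu>) * x + c / (c + \<mu>) * y) = c * y + \<mu> * x" for x y
    using \<mu> c by (simp add: distrib_left)
  ultimately show ?thesis by simp
qed

lemma resolvent_kernel_matrix: "resolvent_kernel N \<mu> P c (resolvent_matrix N \<mu> P c)"
  unfolding resolvent_kernel_def
  using resolvent_step[where L = "\<lambda>A. mmul N P A i j" for i j] by (auto simp: mmul_def simp del: atLeastAtMost_iff)

end

lemma resolvent_identity:
  assumes P: "stochastic_matrix N P" and \<mu>: "0 < \<mu>" and c: "0 < c" and d: "0 < d"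
    and i: "i \<in> {1..N}" and j: "j \<in> {1..N}"
  shows "d * resolvent_matrix N \<mu> P c i j - c * resolvent_matrix N \<mu> P d i j
    = (d - c) * mmul N (resolvent_matrix N \<mu> P d) (resolvent_matrix N \<mu> P c) i j"
proof -
  let ?C = "resolvent_matrix N \<mu> P c" and ?D = "resolvent_matrix N \<mu> P d"
  have 1: "(c + \<mu>) * ?C k j = c * of_bool (k = j) + \<mu> * mmul N P ?C k j" if "k \<in> {1..N}" for k
    by (rule resolvent_step[OF P \<mu> c that j]) simp
  have 2: "(d + \<mu>) * ?D i k = d * of_bool (i = k) + \<mu> * mmul N ?D P i k" if "k \<in> {1..N}" for k
    by (rule resolvent_step[OF P \<mu> d i that]) simp
  have "(c + \<mu>) * mmul N ?D ?C i j = (\<Sum>k\<in>{1..N}. ?D i k * ((c + \<mu>) * ?C k j))"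
    by (simp add: mmul_def sum_distrib_left mult_ac)
  also have "\<dots> = (\<Sum>k\<in>{1..N}. c * (?D i k * of_bool (k = j)) + \<mu> * (?D i k * mmul N P ?C k j))"
    by (intro sum.cong refl) (simp only: 1, simp add: algebra_simps)
  also have "\<dots> = c * ?D i j + \<mu> * mmul N ?D (mmul N P ?C) i j"
    using mmul_id_right[OF j, of ?D i] by (simp add: sum.distrib sum_distrib_left[symmetric] mmul_def[of N ?D])
  finally have a: "(c + \<mu>) * mmul N ?D ?C i j = c * ?D i j + \<mu> * mmul N ?D (mmul N P ?C) i j" .
  have "(d + \<mu>) * mmul N ?D ?C i j = (\<Sum>k\<in>{1..N}. ((d + \<mu>) * ?D i k) * ?C k j)"
    by (simp add: mmul_def sum_distrib_left mult_ac)
  also have "\<dots> = (\<Sum>k\<in>{1..N}. d * (of_bool (i = k) * ?C k j) + \<mu> * (mmul N ?D P i k * ?C k j))"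
    by (intro sum.cong refl) (simp only: 2, simp add: algebra_simps)
  also have "\<dots> = d * ?C i j + \<mu> * mmul N (mmul N ?D P) ?C i j"
    using mmul_id_left[OF i, of ?C j] by (simp add: sum.distrib sum_distrib_left[symmetric] mmul_def[of N _ ?C])
  finally have b: "(d + \<mu>) * mmul N ?D ?C i j = d * ?C i j + \<mu> * mmul N ?D (mmul N P ?C) i j"
    by (simp add: mmul_assoc)
  from a b show ?thesis by (simp add: algebra_simps)
qed

text \<open>Cantor's diagonal argument.\<close>
lemma bounded_pointwise_subsequence:
  fixes f :: "nat \<Rightarrow> 'a::countable \<Rightarrow> real"
  assumes bd: "\<And>n a. \<bar>f n a\<bar> \<le> C a"
  obtains r l where "strict_mono (r :: nat \<Rightarrow> nat)" "\<And>a. (\<lambda>n. f (r n) a) \<longlonglongrightarrow> l a"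
proof -
  let ?P = "\<lambda>k s. convergent (\<lambda>n. f (s n) (from_nat k))"
  interpret subseqs ?P
  proof
    fix k and s :: "nat \<Rightarrow> nat" assume "strict_mono s"
    have "bounded (range (\<lambda>n. f (s n) (from_nat k)))"
      using bd by (intro boundedI[of _ "C (from_nat k)"]) auto
    from bounded_imp_convergent_subsequence[OF this]
    obtain l r' where "strict_mono r'" "((\<lambda>n. f (s n) (from_nat k)) \<circ> r') \<longlonglongrightarrow> l" by blast
    then show "\<exists>r'. strict_mono r' \<and> convergent (\<lambda>n. f ((s \<circ> r') n) (from_nat k))"
      by (auto simp: comp_def convergent_def)
  qed
  have "\<exists>l. (\<lambda>n. f (diagseq n) a) \<longlonglongrightarrow> l" for a
  proof -
    have "?P (to_nat a) (diagseq \<circ> ((+) (Suc (to_nat a))))"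
    proof (rule diagseq_holds)
      fix s r n assume "strict_mono (r :: nat \<Rightarrow> nat)" "convergent (\<lambda>m. f (s m) (from_nat n))"
      then show "convergent (\<lambda>m. f ((s \<circ> r) m) (from_nat n))"
        using convergent_subseq_convergent[of "\<lambda>m. f (s m) (from_nat n)" r] by (simp add: comp_def)
    qed
    then obtain l where "(\<lambda>n. f (diagseq (Suc (to_nat a) + n)) a) \<longlonglongrightarrow> l"
      by (auto simp: convergent_def)
    then have "(\<lambda>n. f (diagseq (n + Suc (to_nat a))) a) \<longlonglongrightarrow> l" by (simp only: add.commute)
    then have "(\<lambda>n. f (diagseq n) a) \<longlonglongrightarrow> l" by (rule LIMSEQ_offset)
    then show ?thesis by blast
  qed
  then obtain l where "\<And>a. (\<lambda>n. f (diagseq n) a) \<longlonglongrightarrow> l a" by metis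
  with subseq_diagseq show ?thesis by (rule that)
qed

section \<open>Idempotent stochastic matrices\<close>

locale idempotent_stochastic =
  fixes N :: nat and Q :: "nat \<Rightarrow> nat \<Rightarrow> real"
  assumes N: "1 \<le> N" and stoch: "stochastic_matrix N Q"
    and idem: "\<And>i j. i \<in> {1..N} \<Longrightarrow> j \<in> {1..N} \<Longrightarrow> mmul N Q Q i j = Q i j"
begin

lemma nonneg: "i \<in> {1..N} \<Longrightarrow> j \<in> {1..N} \<Longrightarrow> 0 \<le> Q i j"
  using stochastic_entry[OF stoch] by blast

lemma row_sum: "i \<in> {1..N} \<Longrightarrow> (\<Sum>j\<in>{1..N}. Q i j) = 1"
  using stoch by (auto simp: stochastic_matrix_def probability_vector_def)

lemma pos_trans:
  assumes "i \<in> {1..N}" "j \<in> {1..N}" "k \<in> {1..N}" "0 < Q i j" "0 < Q j k"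
  shows "0 < Q i k"
proof -
  have "Q i j * Q j k \<le> (\<Sum>m\<in>{1..N}. Q i m * Q m k)"
    by (rule member_le_sum) (use assms nonneg in auto)
  also have "\<dots> = Q i k" using idem[OF assms(1,3)] by (simp add: mmul_def)
  finally show ?thesis using assms by (meson mult_pos_pos less_le_trans)
qed

text \<open>\<open>Q i j\<close> is the average of the entries \<open>Q k j\<close> with weights \<open>Q i k\<close>; if it is the largest of them,
  all those of positive weight are equal to it.\<close>
lemma column_maximum:
  assumes i: "i \<in> {1..N}" and j: "j \<in> {1..N}" and max: "\<And>k. k \<in> {1..N} \<Longrightarrow> Q k j \<le> Q i j"
    and k: "k \<in> {1..N}" "0 < Q i k"
  shows "Q k j = Q i j"
proof (rule ccontr)
  assume "Q k j \<noteq> Q i j"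
  with max[OF k(1)] have lt: "Q k j < Q i j" by simp
  have "(\<Sum>m\<in>{1..N}. Q i m * Q m j) < (\<Sum>m\<in>{1..N}. Q i m * Q i j)"
  proof (rule sum_strict_mono_ex1)
    show "\<forall>m\<in>{1..N}. Q i m * Q m j \<le> Q i m * Q i j"
      using max nonneg[OF i] by (auto intro: mult_left_mono)
    show "\<exists>m\<in>{1..N}. Q i m * Q m j < Q i m * Q i j" using k lt by (intro bexI[of _ k]) auto
  qed simp
  also have "\<dots> = Q i j" using row_sum[OF i] by (simp add: sum_distrib_right[symmetric])
  finally show False using idem[OF i j] by (simp add: mmul_def)
qed

text \<open>Where a nonzero column attains its maximum, in row \<open>i0\<close> say, the weight \<open>Q i0 j\<close> is positive, so the maximum is also attained in
  row \<open>j\<close>.\<close>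
lemma diagonal_maximal:
  assumes j: "j \<in> {1..N}" and i: "i \<in> {1..N}" shows "Q i j \<le> Q j j"
proof -
  define m where "m = Max ((\<lambda>i. Q i j) ` {1..N})"
  have "m \<in> (\<lambda>i. Q i j) ` {1..N}" unfolding m_def by (rule Max_in) (use N in auto)
  then obtain i0 where i0: "i0 \<in> {1..N}" "m = Q i0 j" by blast
  have max: "Q k j \<le> Q i0 j" if "k \<in> {1..N}" for k
    unfolding i0(2)[symmetric] m_def by (rule Max_ge) (use that in auto)
  show ?thesis
  proof (cases "0 < Q i0 j")
    case True
    then show ?thesis using column_maximum[OF i0(1) j max j] max[OF i] by simp
  next
    case False
    then show ?thesis using max[OF i] nonneg[OF j j] by simp
  qed
qed

text \<open>A recurrent state (\<open>0 < Q j j\<close>) and any state reached from it have equal rows, since both rows are pinned to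
  the maxima of the columns.\<close>
lemma same_class:
  assumes j: "j \<in> {1..N}" and k: "k \<in> {1..N}" and p: "0 < Q j k" and rec: "0 < Q j j"
  shows "Q k j = Q j j" "l \<in> {1..N} \<Longrightarrow> Q k l = Q j l"
proof -
  show 1: "Q k j = Q j j" by (rule column_maximum[OF j j diagonal_maximal[OF j] k p])
  have kk: "0 < Q k k" using pos_trans[OF k j k] 1 rec p by simp
  assume l: "l \<in> {1..N}"
  show "Q k l = Q j l"
  proof (cases "0 < Q l l \<and> (0 < Q j l \<or> 0 < Q k l)")
    case True
    then have jl: "0 < Q j l" using pos_trans[OF j k l p] by blast
    have lj: "Q l j = Q j j" by (rule column_maximum[OF j j diagonal_maximal[OF j] l jl])
    have lj': "0 < Q l j" unfolding lj by (rule rec)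
    have "Q j l = Q l l"
      by (rule column_maximum[OF l l diagonal_maximal[OF l] j lj'])
    moreover have lk: "0 < Q l k" by (rule pos_trans[OF l j k lj' p])
    have "Q k l = Q l l"
      by (rule column_maximum[OF l l diagonal_maximal[OF l] k lk])
    ultimately show ?thesis by simp
  next
    case False
    then show ?thesis using diagonal_maximal[OF l j] diagonal_maximal[OF l k] nonneg[OF j l] nonneg[OF k l] by auto
  qed
qed

text \<open>A canonical representative of the class of \<open>j\<close>, for recurrent \<open>j\<close>.\<close>
definition leader :: "nat \<Rightarrow> nat" where
  "leader j = (LEAST k. k \<in> {1..N} \<and> 0 < Q j k)"

lemma leader: assumes "j \<in> {1..N}" shows "leader j \<in> {1..N}" "0 < Q j (leader j)"
proof -
  have "\<exists>k. k \<in> {1..N} \<and> 0 < Q j k"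
  proof (rule ccontr)
    assume "\<not> ?thesis"
    then have "(\<Sum>k\<in>{1..N}. Q j k) \<le> (\<Sum>k\<in>{1..N}. 0)" by (intro sum_mono) (auto simp: not_less)
    with row_sum[OF assms] show False by simp
  qed
  from LeastI_ex[OF this] show "leader j \<in> {1..N}" "0 < Q j (leader j)" unfolding leader_def by blast+
qed

lemma leader_recurrent: assumes "j \<in> {1..N}" shows "0 < Q (leader j) (leader j)"
  using diagonal_maximal[OF leader(1)[OF assms] assms] leader(2)[OF assms] by simp

lemma leader_row: assumes "j \<in> {1..N}" "0 < Q j j" "l \<in> {1..N}" shows "Q (leader j) l = Q j l"
  by (rule same_class(2)[OF assms(1) leader(1)[OF assms(1)] leader(2)[OF assms(1)] assms(2,3)])

lemma leader_eq:
  assumes j: "j \<in> {1..N}" "0 < Q j j" and k: "k \<in> {1..N}" "0 < Q j k"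
  shows "leader k = leader j"
proof -
  have "Q k l = Q j l" if "l \<in> {1..N}" for l by (rule same_class(2)[OF j(1) k j(2) that])
  then show ?thesis unfolding leader_def by (intro arg_cong[where f = Least]) auto
qed

definition leaders :: "nat set" where
  "leaders = leader ` {j\<in>{1..N}. 0 < Q j j}"

text \<open>An idempotent stochastic matrix factors as \<open>Q = h \<pi>\<close>: from \<open>i\<close>, a class \<open>s\<close> is chosen with probability
  \<open>h i s\<close>, and then a state of that class by its equilibrium law \<open>\<pi> s\<close>. Transient states carry no mass and
  receive the dummy class \<open>0\<close>.\<close>
theorem class_structure:
  obtains k cls \<pi> h where "k \<in> {1..N}"
    and "\<And>s. s \<in> {1..k} \<Longrightarrow> \<exists>i\<in>{1..N}. cls i = s \<and> (\<forall>l\<in>{1..N}. \<pi> s l = Q i l)"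
    and "\<And>s l. s \<in> {1..k} \<Longrightarrow> l \<in> {1..N} \<Longrightarrow> \<pi> s l \<noteq> 0 \<Longrightarrow> cls l = s"
    and "\<And>s l m. s \<in> {1..k} \<Longrightarrow> l \<in> {1..N} \<Longrightarrow> m \<in> {1..N} \<Longrightarrow> \<pi> s l \<noteq> 0 \<Longrightarrow> Q l m = \<pi> s m"
    and "\<And>i s. h i s = (\<Sum>l\<in>{l\<in>{1..N}. cls l = s}. Q i l)"
    and "\<And>i l. i \<in> {1..N} \<Longrightarrow> l \<in> {1..N} \<Longrightarrow> Q i l = (\<Sum>s\<in>{1..k}. h i s * \<pi> s l)"
proof -
  have fin: "finite leaders" by (simp add: leaders_def)
  have sub: "leaders \<subseteq> {1..N}" using leader(1) by (auto simp: leaders_def simp del: atLeastAtMost_iff)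
  have "leader (leader 1) \<in> leaders"
    using leader(1)[of 1] leader_recurrent[of 1] N by (auto simp: leaders_def)
  then have "0 < card leaders" using fin by (auto simp: card_gt_0_iff)
  define k where "k = card leaders"
  have k: "k \<in> {1..N}" using \<open>0 < card leaders\<close> card_mono[OF _ sub] by (simp add: k_def)
  obtain f where f: "bij_betw f {1..k} leaders"
    using finite_same_card_bij[of "{1..k}" leaders] fin by (auto simp: k_def)
  define g where "g = inv_into {1..k} f"
  have gf: "g (f s) = s" if "s \<in> {1..k}" for s
    unfolding g_def using f that by (intro inv_into_f_f) (auto simp: bij_betw_def)
  have fg: "f (g a) = a \<and> g a \<in> {1..k}" if "a \<in> leaders" for a
    unfolding g_def using f that bij_betw_inv_into_right[OF f that] inv_into_into[of a f "{1..k}"] by (auto simp: bij_betw_def)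
  define cls where "cls l = (if 0 < Q l l then g (leader l) else 0)" for l
  define \<pi> where "\<pi> s l = Q (f s) l" for s l
  define h where "h i s = (\<Sum>l\<in>{l\<in>{1..N}. cls l = s}. Q i l)" for i s
  have fs: "f s \<in> {1..N} \<and> 0 < Q (f s) (f s) \<and> leader (f s) = f s" if s: "s \<in> {1..k}" for s
  proof -
    have "f s \<in> leaders" using f s by (auto simp: bij_betw_def)
    then obtain j where j: "j \<in> {1..N}" "0 < Q j j" "f s = leader j" by (auto simp: leaders_def)
    then show ?thesis using leader[OF j(1)] leader_recurrent[OF j(1)] leader_eq[OF j(1,2) leader[OF j(1)]] by simp
  qed
  have cls1: "cls l = s" if "s \<in> {1..k}" "l \<in> {1..N}" "0 < Q (f s) l" for s l
  proof -
    have "leader l = f s" using leader_eq[OF conjunct1[OF fs[OF that(1)]] _ that(2,3)] fs[OF that(1)] by simp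
    moreover have "0 < Q l l" using diagonal_maximal[OF that(2) conjunct1[OF fs[OF that(1)]]] that(3) by simp
    ultimately show ?thesis by (simp add: cls_def gf[OF that(1)])
  qed
  show ?thesis
  proof (rule that[of k cls \<pi> h])
    show "\<exists>i\<in>{1..N}. cls i = s \<and> (\<forall>l\<in>{1..N}. \<pi> s l = Q i l)" if "s \<in> {1..k}" for s
      using fs[OF that] cls1[OF that] by (intro bexI[of _ "f s"]) (auto simp: \<pi>_def simp del: atLeastAtMost_iff)
    show "cls l = s" if "s \<in> {1..k}" "l \<in> {1..N}" "\<pi> s l \<noteq> 0" for s l
      using cls1[OF that(1,2)] that(3) nonneg[OF conjunct1[OF fs[OF that(1)]] that(2)] by (simp add: \<pi>_def)
    show "Q l m = \<pi> s m" if s: "s \<in> {1..k}" and l: "l \<in> {1..N}" and m: "m \<in> {1..N}" and nz: "\<pi> s l \<noteq> 0" for s l m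
    proof -
      have fsN: "f s \<in> {1..N}" and rec: "0 < Q (f s) (f s)" using fs[OF s] by blast+
      have "0 < Q (f s) l" using nz nonneg[OF fsN l] by (simp add: \<pi>_def)
      from same_class(2)[OF fsN l this rec m] show ?thesis by (simp add: \<pi>_def)
    qed
    show "Q i l = (\<Sum>s\<in>{1..k}. h i s * \<pi> s l)" if i: "i \<in> {1..N}" and l: "l \<in> {1..N}" for i l
    proof (cases "0 < Q l l")
      case False
      have z: "Q j l = 0" if "j \<in> {1..N}" for j
        using diagonal_maximal[OF l that] nonneg[OF that l] False by simp
      have "\<pi> s l = 0" if "s \<in> {1..k}" for s unfolding \<pi>_def by (rule z) (use fs[OF that] in blast)
      then show ?thesis using z[OF i] by simp
    next
      case True
      define s where "s = g (leader l)"
      have "leader l \<in> leaders" using l True by (auto simp: leaders_def)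
      from fg[OF this] have s: "s \<in> {1..k}" "f s = leader l" by (auto simp: s_def)
      have other: "h i s' * \<pi> s' l = 0" if "s' \<in> {1..k} - {s}" for s'
      proof -
        have "\<pi> s' l = 0"
        proof (rule ccontr)
          assume "\<pi> s' l \<noteq> 0"
          then have "0 < Q (f s') l" using nonneg[of "f s'" l] fs[of s'] that l by (simp add: \<pi>_def)
          with cls1[of s' l] that l have "cls l = s'" by simp
          with True that show False by (simp add: cls_def s_def)
        qed
        then show ?thesis by simp
      qed
      have "Q i l = (\<Sum>m\<in>{1..N}. Q i m * Q m l)" using idem[OF i l] by (simp add: mmul_def)
      also have "\<dots> = (\<Sum>m\<in>{m\<in>{1..N}. cls m = s}. Q i m * Q m l)"
      proof (rule sum.mono_neutral_right)
        show "\<forall>m\<in>{1..N} - {m\<in>{1..N}. cls m = s}. Q i m * Q m l = 0"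
        proof
          fix m assume m: "m \<in> {1..N} - {m\<in>{1..N}. cls m = s}"
          show "Q i m * Q m l = 0"
          proof (cases "0 < Q m m")
            case False
            then show ?thesis using diagonal_maximal[of m i] nonneg[of i m] m i by simp
          next
            case rec: True
            have "\<not> 0 < Q m l"
            proof
              assume "0 < Q m l"
              then have "leader l = leader m" using leader_eq[of m l] m rec l by simp
              with m rec show False by (auto simp: cls_def s_def)
            qed
            then show ?thesis using nonneg[of m l] m l by simp
          qed
        qed
      qed auto
      also have "\<dots> = (\<Sum>m\<in>{m\<in>{1..N}. cls m = s}. Q i m * \<pi> s l)"
      proof (intro sum.cong refl)
        fix m assume m: "m \<in> {m\<in>{1..N}. cls m = s}"
        then have mN: "m \<in> {1..N}" and cl: "cls m = s" by auto
        have rec: "0 < Q m m" using cl s(1) by (auto simp: cls_def split: if_splits)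
        have "leader m \<in> leaders" using mN rec by (auto simp: leaders_def)
        from fg[OF this] have "leader m = f s" using cl rec by (simp add: cls_def)
        then show "Q i m * Q m l = Q i m * \<pi> s l" using leader_row[OF mN rec l] by (simp add: \<pi>_def)
      qed
      also have "\<dots> = h i s * \<pi> s l" by (simp add: h_def sum_distrib_right)
      also have "\<dots> = (\<Sum>s\<in>{1..k}. h i s * \<pi> s l)"
      proof -
        have "(\<Sum>s\<in>{1..k}. h i s * \<pi> s l) = h i s * \<pi> s l + (\<Sum>s\<in>{1..k} - {s}. h i s * \<pi> s l)"
          by (rule sum.remove) (use s(1) in auto)
        also have "(\<Sum>s\<in>{1..k} - {s}. h i s * \<pi> s l) = 0" by (rule sum.neutral) (use other in blast)
        finally show ?thesis by simp
      qed
      finally show ?thesis .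
    qed
  qed (use k h_def in auto)
qed

end

section \<open>Limits of resolvents\<close>

lemma stochastic_limit:
  assumes "\<And>n. stochastic_matrix N (A n)" and "\<And>i j. i \<in> {1..N} \<Longrightarrow> j \<in> {1..N} \<Longrightarrow> (\<lambda>n. A n i j) \<longlonglongrightarrow> B i j"
  shows "stochastic_matrix N B"
  unfolding stochastic_matrix_def probability_vector_def
proof (intro ballI conjI)
  fix i assume i: "i \<in> {1..N}"
  show "0 \<le> B i j" if "j \<in> {1..N}" for j
    by (rule LIMSEQ_le_const[OF assms(2)[OF i that]]) (use stochastic_entry[OF assms(1) i that] in auto)
  have "(\<lambda>n. \<Sum>j\<in>{1..N}. A n i j) \<longlonglongrightarrow> (\<Sum>j\<in>{1..N}. B i j)" by (intro tendsto_sum assms(2) i)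
  moreover have "(\<Sum>j\<in>{1..N}. A n i j) = 1" for n
    using assms(1)[of n] i by (auto simp: stochastic_matrix_def probability_vector_def)
  ultimately show "(\<Sum>j\<in>{1..N}. B i j) = 1" by (simp add: LIMSEQ_const_iff)
qed

lemma mmul_tendsto:
  assumes "\<And>k. k \<in> {1..N} \<Longrightarrow> (\<lambda>n. A n i k) \<longlonglongrightarrow> A' i k" "\<And>k. k \<in> {1..N} \<Longrightarrow> (\<lambda>n. B n k j) \<longlonglongrightarrow> B' k j"
  shows "(\<lambda>n. mmul N (A n) (B n) i j) \<longlonglongrightarrow> mmul N A' B' i j"
  unfolding mmul_def by (intro tendsto_sum tendsto_mult assms)

text \<open>Families of stochastic matrices with the resolvent identity; \<open>J c\<close> belongs to the rate \<open>Suc c\<close>, as only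
  positive integer rates are used.\<close>
locale pseudo_resolvent =
  fixes N :: nat and J :: "nat \<Rightarrow> nat \<Rightarrow> nat \<Rightarrow> real"
  assumes N: "1 \<le> N" and stoch: "\<And>c. stochastic_matrix N (J c)"
    and identity: "\<And>c d i j. i \<in> {1..N} \<Longrightarrow> j \<in> {1..N} \<Longrightarrow>
      real (Suc d) * J c i j - real (Suc c) * J d i j = (real (Suc d) - real (Suc c)) * mmul N (J d) (J c) i j"
begin

text \<open>Divide the resolvent identity by the rate that tends to infinity.\<close>
lemma subsequence_limit:
  fixes s :: "nat \<Rightarrow> nat"
  assumes s: "strict_mono s" and Q: "\<And>i j. i \<in> {1..N} \<Longrightarrow> j \<in> {1..N} \<Longrightarrow> (\<lambda>m. J (s m) i j) \<longlonglongrightarrow> Q i j"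
    and i: "i \<in> {1..N}" and j: "j \<in> {1..N}"
  shows "mmul N Q (J c) i j = J c i j" "mmul N (J c) Q i j = J c i j" "mmul N Q Q i j = Q i j"
proof -
  have inv: "(\<lambda>m. a / real (Suc (s m))) \<longlonglongrightarrow> 0" for a
    using LIMSEQ_subseq_LIMSEQ[OF LIMSEQ_Suc[OF lim_const_over_n[of a]] s] by (simp add: comp_def)
  have L: "mmul N Q (J c) i j = J c i j" if i: "i \<in> {1..N}" and j: "j \<in> {1..N}" for i j c
  proof -
    have "J c i j - real (Suc c) / real (Suc (s m)) * J (s m) i j = (1 - real (Suc c) / real (Suc (s m))) * mmul N (J (s m)) (J c) i j" for m
    proof -
      have *: "x - b / a * y = (1 - b / a) * z" if "a * x - b * y = (a - b) * z" "0 < a" for a b x y z :: real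
        using that by (simp add: field_simps)
      show ?thesis by (rule *[OF identity[OF i j]]) simp
    qed
    moreover have "(\<lambda>m. J c i j - real (Suc c) / real (Suc (s m)) * J (s m) i j) \<longlonglongrightarrow> J c i j - 0 * Q i j"
      by (intro tendsto_intros inv Q i j)
    moreover have "(\<lambda>m. (1 - real (Suc c) / real (Suc (s m))) * mmul N (J (s m)) (J c) i j) \<longlonglongrightarrow> (1 - 0) * mmul N Q (J c) i j"
      by (intro tendsto_intros inv mmul_tendsto Q i)
    ultimately show ?thesis by (simp add: LIMSEQ_unique)
  qed
  then show "mmul N Q (J c) i j = J c i j" using i j .
  show "mmul N (J c) Q i j = J c i j"
  proof -
    have "J c i j - real (Suc c) / real (Suc (s m)) * J (s m) i j = (1 - real (Suc c) / real (Suc (s m))) * mmul N (J c) (J (s m)) i j" for m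
    proof -
      have *: "x - b / a * y = (1 - b / a) * z" if "b * y - a * x = (b - a) * z" "0 < a" for a b x y z :: real
        using that by (simp add: field_simps)
      show ?thesis by (rule *[OF identity[OF i j]]) simp
    qed
    moreover have "(\<lambda>m. J c i j - real (Suc c) / real (Suc (s m)) * J (s m) i j) \<longlonglongrightarrow> J c i j - 0 * Q i j"
      by (intro tendsto_intros inv Q i j)
    moreover have "(\<lambda>m. (1 - real (Suc c) / real (Suc (s m))) * mmul N (J c) (J (s m)) i j) \<longlonglongrightarrow> (1 - 0) * mmul N (J c) Q i j"
      by (intro tendsto_intros inv mmul_tendsto Q j)
    ultimately show ?thesis by (simp add: LIMSEQ_unique)
  qed
  have "(\<lambda>m. mmul N Q (J (s m)) i j) \<longlonglongrightarrow> mmul N Q Q i j" by (intro mmul_tendsto tendsto_const Q j)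
  then have "(\<lambda>m. J (s m) i j) \<longlonglongrightarrow> mmul N Q Q i j" by (simp only: L[OF i j])
  with Q[OF i j] show "mmul N Q Q i j = Q i j" by (simp add: LIMSEQ_unique)
qed

text \<open>If the resolvents converge to the identity for large rates, they are the resolvents of a
  generator. The approximations \<open>X d = d (1 - J d)\<close> of the generator are bounded: multiplied by a fixed resolvent
  that is close to the identity, they are of the order of the rate of that resolvent, and
  this determines the size of their diagonal. So they have a limit point \<open>Y\<close>, and \<open>Y = \<mu> (1 - P)\<close> for every \<open>\<mu>\<close>
  above the diagonal of \<open>Y\<close>.\<close>
lemma generator:
  fixes s :: "nat \<Rightarrow> nat"
  assumes s: "strict_mono s"
    and id: "\<And>i j. i \<in> {1..N} \<Longrightarrow> j \<in> {1..N} \<Longrightarrow> (\<lambda>m. J (s m) i j) \<longlonglongrightarrow> of_bool (i = j)"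
  shows "\<exists>\<mu> P. 0 < \<mu> \<and> stochastic_matrix N P \<and> (\<forall>c. resolvent_kernel N \<mu> P (real (Suc c)) (J c))"
proof -
  have ent: "0 \<le> J c i j" "J c i j \<le> 1" if "i \<in> {1..N}" "j \<in> {1..N}" for c i j
    using stochastic_entry[OF stoch that] by auto
  have rows: "(\<Sum>j\<in>{1..N}. J c i j) = 1" if "i \<in> {1..N}" for c i
    using stoch[of c] that by (auto simp: stochastic_matrix_def probability_vector_def)
  have "\<forall>i\<in>{1..N}. eventually (\<lambda>m. 3 / 4 < J (s m) i i) sequentially"
  proof
    fix i assume i: "i \<in> {1..N}"
    have "3 / 4 < (of_bool (i = i) :: real)" by simp
    with id[OF i i] show "eventually (\<lambda>m. 3 / 4 < J (s m) i i) sequentially" by (rule order_tendstoD(1))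
  qed
  then have "eventually (\<lambda>m. \<forall>i\<in>{1..N}. 3 / 4 < J (s m) i i) sequentially"
    by (subst eventually_ball_finite_distrib) auto
  then obtain m0 where m0: "\<forall>i\<in>{1..N}. 3 / 4 < J (s m0) i i" by (auto simp: eventually_sequentially)
  \<comment> \<open>from here on \<open>J c0\<close> is close to the identity: above \<open>3/4\<close> on the diagonal, at most \<open>1/4\<close> elsewhere\<close>
  define c0 where "c0 = s m0"
  have off: "J c0 u t \<le> 1 / 4" if u: "u \<in> {1..N}" and t: "t \<in> {1..N}" and "u \<noteq> t" for u t
  proof -
    have "J c0 u u + J c0 u t = (\<Sum>j\<in>{u, t}. J c0 u j)" using that by simp
    also have "\<dots> \<le> (\<Sum>j\<in>{1..N}. J c0 u j)" by (rule sum_mono2) (use u t ent in auto)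
    finally show ?thesis using rows[OF u] m0 u by (force simp: c0_def)
  qed
  define X where "X d i j = real (Suc d) * (of_bool (i = j) - J d i j)" for d i j
  have Xrow: "(\<Sum>j\<in>{1..N}. X d i j) = 0" if "i \<in> {1..N}" for d i
  proof -
    have "(\<Sum>j\<in>{1..N}. of_bool (i = j)) = (1 :: real)"
      using stochastic_id[of N] that by (auto simp: stochastic_matrix_def probability_vector_def)
    then show ?thesis unfolding X_def sum_distrib_left[symmetric] sum_subtractf using rows[OF that] by simp
  qed
  have Xoff: "X d i j \<le> 0" if "i \<in> {1..N}" "j \<in> {1..N}" "i \<noteq> j" for d i j
    using ent(1)[OF that(1,2), of d] that(3) by (simp add: X_def mult_nonneg_nonpos)
  have Xmul: "mmul N (X d) (J c) i j = real (Suc c) * (J d i j - mmul N (J d) (J c) i j)" if i: "i \<in> {1..N}" and j: "j \<in> {1..N}" for d c i j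
  proof -
    have "mmul N (X d) (J c) i j = real (Suc d) * (mmul N (\<lambda>i j. of_bool (i = j)) (J c) i j - mmul N (J d) (J c) i j)"
      unfolding mmul_def X_def sum_subtractf[symmetric] sum_distrib_left by (intro sum.cong refl) (simp add: algebra_simps)
    also have "\<dots> = real (Suc d) * (J c i j - mmul N (J d) (J c) i j)" by (simp only: mmul_id_left[OF i])
    also have "\<dots> = real (Suc c) * (J d i j - mmul N (J d) (J c) i j)"
      using identity[OF i j, of d c] by (simp only: algebra_simps)
    finally show ?thesis .
  qed
  have Xdiag: "0 \<le> X d i i \<and> X d i i \<le> 2 * real (Suc c0)" if i: "i \<in> {1..N}" for d i
  proof
    show 0: "0 \<le> X d i i" using ent(2)[OF i i, of d] by (simp add: X_def)
    have rest: "(\<Sum>u\<in>{1..N} - {i}. X d i u) = - X d i i"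
      using Xrow[OF i, of d] i by (subst (asm) sum.remove[of _ i]) auto
    have "X d i i * (3 / 4) + (\<Sum>u\<in>{1..N} - {i}. X d i u * (1 / 4)) \<le> X d i i * J c0 i i + (\<Sum>u\<in>{1..N} - {i}. X d i u * J c0 u i)"
    proof (intro add_mono sum_mono)
      show "X d i i * (3 / 4) \<le> X d i i * J c0 i i" using 0 m0 i by (intro mult_left_mono) (force simp: c0_def)+
      show "X d i u * (1 / 4) \<le> X d i u * J c0 u i" if "u \<in> {1..N} - {i}" for u
        using Xoff[OF i, of u d] off[of u i] that i by (intro mult_left_mono_neg) auto
    qed
    also have "\<dots> = mmul N (X d) (J c0) i i" unfolding mmul_def using i by (subst (2) sum.remove[of _ i]) auto
    also have "\<dots> \<le> real (Suc c0) * 1"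
    proof -
      have "0 \<le> mmul N (J d) (J c0) i i" unfolding mmul_def using ent i by (intro sum_nonneg mult_nonneg_nonneg) auto
      then show ?thesis unfolding Xmul[OF i i] using ent(2)[OF i i, of d] by (intro mult_left_mono) auto
    qed
    finally show "X d i i \<le> 2 * real (Suc c0)"
      unfolding sum_distrib_right[symmetric] rest by simp
  qed
  have Xbound: "\<bar>X d i j\<bar> \<le> 2 * real (Suc c0)" if i: "i \<in> {1..N}" and j: "j \<in> {1..N}" for d i j
  proof (cases "i = j")
    case True
    then show ?thesis using Xdiag[OF i, of d] by simp
  next
    case False
    have "X d i i + X d i j = (\<Sum>u\<in>{i, j}. X d i u)" using False by simp
    also have "\<dots> \<ge> (\<Sum>u\<in>{1..N}. X d i u)"
    proof -
      have "(\<Sum>u\<in>{1..N}. X d i u) = (\<Sum>u\<in>{i, j}. X d i u) + (\<Sum>u\<in>{1..N} - {i, j}. X d i u)"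
        using i j by (subst sum.subset_diff[of "{i, j}"]) auto
      moreover have "(\<Sum>u\<in>{1..N} - {i, j}. X d i u) \<le> 0" by (rule sum_nonpos) (use Xoff[OF i] in auto)
      ultimately show ?thesis by simp
    qed
    finally show ?thesis using Xoff[OF i j False, of d] Xdiag[OF i, of d] Xrow[OF i, of d] by simp
  qed
  define f where "f m = (\<lambda>(i, j). if i \<in> {1..N} \<and> j \<in> {1..N} then X (s m) i j else 0)" for m
  have "\<bar>f m a\<bar> \<le> 2 * real (Suc c0)" for m a
    using Xbound by (auto simp: f_def simp del: atLeastAtMost_iff split: prod.split)
  from bounded_pointwise_subsequence[of f "\<lambda>_. 2 * real (Suc c0)", OF this]
  obtain q l where q: "strict_mono (q :: nat \<Rightarrow> nat)" and l: "\<And>a. (\<lambda>m. f (q m) a) \<longlonglongrightarrow> l a" by blast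
  define Y where "Y i j = l (i, j)" for i j
  have Y: "(\<lambda>m. X (s (q m)) i j) \<longlonglongrightarrow> Y i j" if "i \<in> {1..N}" "j \<in> {1..N}" for i j
    using l[of "(i, j)"] that by (simp add: f_def Y_def del: atLeastAtMost_iff)
  have idq: "(\<lambda>m. J (s (q m)) i j) \<longlonglongrightarrow> of_bool (i = j)" if "i \<in> {1..N}" "j \<in> {1..N}" for i j
    using LIMSEQ_subseq_LIMSEQ[OF id[OF that] q] by (simp add: comp_def)
  have Yrow: "(\<Sum>j\<in>{1..N}. Y i j) = 0" if i: "i \<in> {1..N}" for i
  proof -
    have "(\<lambda>m. \<Sum>j\<in>{1..N}. X (s (q m)) i j) \<longlonglongrightarrow> (\<Sum>j\<in>{1..N}. Y i j)" by (intro tendsto_sum Y i)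
    then show ?thesis unfolding Xrow[OF i] by (simp add: LIMSEQ_const_iff)
  qed
  have Yoff: "Y i j \<le> 0" if "i \<in> {1..N}" "j \<in> {1..N}" "i \<noteq> j" for i j
    by (rule LIMSEQ_le_const2[OF Y[OF that(1,2)]]) (use Xoff[OF that] in auto)
  have Ydiag: "0 \<le> Y i i" if "i \<in> {1..N}" for i
    by (rule LIMSEQ_le_const[OF Y[OF that that]]) (use Xdiag[OF that] in auto)
  have Ymul: "mmul N Y (J c) i j = real (Suc c) * (of_bool (i = j) - J c i j)" if i: "i \<in> {1..N}" and j: "j \<in> {1..N}" for c i j
  proof -
    have "(\<lambda>m. mmul N (X (s (q m))) (J c) i j) \<longlonglongrightarrow> mmul N Y (J c) i j"
      by (intro mmul_tendsto Y i tendsto_const)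
    moreover have "(\<lambda>m. real (Suc c) * (J (s (q m)) i j - mmul N (J (s (q m))) (J c) i j)) \<longlonglongrightarrow>
        real (Suc c) * (of_bool (i = j) - mmul N (\<lambda>i j. of_bool (i = j)) (J c) i j)"
      by (intro tendsto_intros mmul_tendsto idq i j)
    ultimately show ?thesis using LIMSEQ_unique by (simp only: Xmul[OF i j] mmul_id_left[OF i]) blast
  qed
  \<comment> \<open>larger than all exit rates, which makes \<open>P\<close> nonnegative, and positive even if \<open>Y = 0\<close>\<close>
  define \<mu> where "\<mu> = 1 + (\<Sum>i\<in>{1..N}. Y i i)"
  have "0 \<le> (\<Sum>i\<in>{1..N}. Y i i)" by (intro sum_nonneg Ydiag)
  then have \<mu>: "0 < \<mu>" by (simp add: \<mu>_def)
  have Y\<mu>: "Y i i \<le> \<mu>" if i: "i \<in> {1..N}" for i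
    using member_le_sum[OF i, of "\<lambda>i. Y i i"] Ydiag by (simp add: \<mu>_def)
  define P where "P i j = of_bool (i = j) - Y i j / \<mu>" for i j
  have "stochastic_matrix N P"
    unfolding stochastic_matrix_def probability_vector_def
  proof (intro ballI conjI)
    fix i assume i: "i \<in> {1..N}"
    show "0 \<le> P i j" if j: "j \<in> {1..N}" for j
      using Yoff[OF i j] Y\<mu>[OF i] \<mu> by (cases "i = j") (simp_all add: P_def divide_nonpos_pos)
    have "(\<Sum>j\<in>{1..N}. of_bool (i = j)) = (1 :: real)"
      using stochastic_id[of N] i by (auto simp: stochastic_matrix_def probability_vector_def)
    then show "(\<Sum>j\<in>{1..N}. P i j) = 1"
      unfolding P_def sum_subtractf sum_divide_distrib[symmetric] by (simp add: Yrow[OF i, simplified])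
  qed
  moreover have "resolvent_kernel N \<mu> P (real (Suc c)) (J c)" for c
    unfolding resolvent_kernel_def
  proof (intro ballI)
    fix i j assume i: "i \<in> {1..N}" and j: "j \<in> {1..N}"
    have "\<mu> * (\<Sum>k\<in>{1..N}. P i k * J c k j) = \<mu> * mmul N (\<lambda>i j. of_bool (i = j)) (J c) i j - mmul N Y (J c) i j"
      unfolding mmul_def sum_distrib_left sum_subtractf[symmetric]
      by (intro sum.cong refl) (use \<mu> in \<open>simp add: P_def algebra_simps\<close>)
    then show "(real (Suc c) + \<mu>) * J c i j = real (Suc c) * of_bool (i = j) + \<mu> * (\<Sum>k\<in>{1..N}. P i k * J c k j)"
      unfolding mmul_id_left[OF i] Ymul[OF i j] by (simp only: algebra_simps)
  qed
  ultimately show ?thesis using \<mu> by blast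
qed

end

section \<open>The limit chain\<close>

text \<open>The structure of the limit of the observed chains: a state \<open>i\<close> enters class \<open>s\<close> with probability
  \<open>h i s\<close>, the class evolves by the resolvent \<open>Jk c\<close>, and the observed state is drawn from the equilibrium law
  \<open>\<pi> t\<close> of the class reached. A state charged by \<open>\<pi> s\<close> belongs to class \<open>s\<close> and enters no other.\<close>
locale limit_chain =
  fixes N k :: nat and JJ Jk :: "nat \<Rightarrow> nat \<Rightarrow> nat \<Rightarrow> real" and cls :: "nat \<Rightarrow> nat" and \<pi> h :: "nat \<Rightarrow> nat \<Rightarrow> real"
  assumes k: "k \<in> {1..N}"
    and \<pi>: "\<And>s. s \<in> {1..k} \<Longrightarrow> probability_vector N (\<pi> s)"
    and cls: "\<And>s l. s \<in> {1..k} \<Longrightarrow> l \<in> {1..N} \<Longrightarrow> \<pi> s l \<noteq> 0 \<Longrightarrow> cls l = s"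
    and h: "\<And>i. i \<in> {1..N} \<Longrightarrow> probability_vector k (h i)"
    and h_class: "\<And>s l t. s \<in> {1..k} \<Longrightarrow> l \<in> {1..N} \<Longrightarrow> \<pi> s l \<noteq> 0 \<Longrightarrow> h l t = of_bool (t = s)"
    and factor: "\<And>c i l. i \<in> {1..N} \<Longrightarrow> l \<in> {1..N} \<Longrightarrow>
      JJ c i l = (\<Sum>s\<in>{1..k}. \<Sum>t\<in>{1..k}. h i s * Jk c s t * \<pi> t l)"

context pseudo_resolvent
begin

text \<open>With \<open>Q = h \<pi>\<close> a limit point of the family for large rates, \<open>J = Q J Q\<close> reduces \<open>J\<close> to the matrices \<open>Jk = \<pi> J h\<close> on
  the classes. These satisfy the resolvent identity again, and because \<open>\<pi> h\<close> is the identity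
  they now converge to the identity.\<close>
theorem limit_chain_exists:
  obtains k cls \<pi> h Jk \<mu>' P' where "limit_chain N k J Jk cls \<pi> h"
    and "0 < \<mu>'" "stochastic_matrix k P'" "\<And>c. resolvent_kernel k \<mu>' P' (real (Suc c)) (Jk c)"
proof -
  have ent: "0 \<le> J c i j" "J c i j \<le> 1" if "i \<in> {1..N}" "j \<in> {1..N}" for c i j
    using stochastic_entry[OF stoch that] by auto
  have rows: "(\<Sum>j\<in>{1..N}. J c i j) = 1" if "i \<in> {1..N}" for c i
    using stoch[of c] that by (auto simp: stochastic_matrix_def probability_vector_def)
  define f where "f m = (\<lambda>(i, j). if i \<in> {1..N} \<and> j \<in> {1..N} then J m i j else 0)" for m
  have "\<bar>f m a\<bar> \<le> 1" for m a
    using ent by (auto simp: f_def abs_le_iff simp del: atLeastAtMost_iff split: prod.split intro: order_trans[OF _ ent(1)])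
  from bounded_pointwise_subsequence[of f "\<lambda>_. 1", OF this]
  obtain s l where s: "strict_mono (s :: nat \<Rightarrow> nat)" and l: "\<And>a. (\<lambda>m. f (s m) a) \<longlonglongrightarrow> l a" by blast
  define Q where "Q i j = l (i, j)" for i j
  have Q: "(\<lambda>m. J (s m) i j) \<longlonglongrightarrow> Q i j" if "i \<in> {1..N}" "j \<in> {1..N}" for i j
    using l[of "(i, j)"] that by (simp add: f_def Q_def del: atLeastAtMost_iff)
  have lim: "mmul N Q (J c) i j = J c i j" "mmul N (J c) Q i j = J c i j" "mmul N Q Q i j = Q i j"
    if "i \<in> {1..N}" "j \<in> {1..N}" for c i j
    by (rule subsequence_limit(1)[OF s _ that], rule Q, assumption+,
        rule subsequence_limit(2)[OF s _ that], rule Q, assumption+,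
        rule subsequence_limit(3)[OF s _ that], rule Q, assumption+)
  have stochQ: "stochastic_matrix N Q"
    by (rule stochastic_limit[of N "\<lambda>m. J (s m)"], rule stoch, rule Q)
  interpret Q: idempotent_stochastic N Q
    by unfold_locales (fact N stochQ lim(3))+
  obtain k cls \<pi> h where k: "k \<in> {1..N}"
    and rep: "\<And>s. s \<in> {1..k} \<Longrightarrow> \<exists>i\<in>{1..N}. cls i = s \<and> (\<forall>l\<in>{1..N}. \<pi> s l = Q i l)"
    and cls: "\<And>s l. s \<in> {1..k} \<Longrightarrow> l \<in> {1..N} \<Longrightarrow> \<pi> s l \<noteq> 0 \<Longrightarrow> cls l = s"
    and row: "\<And>s l m. s \<in> {1..k} \<Longrightarrow> l \<in> {1..N} \<Longrightarrow> m \<in> {1..N} \<Longrightarrow> \<pi> s l \<noteq> 0 \<Longrightarrow> Q l m = \<pi> s m"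
    and h: "\<And>i s. h i s = (\<Sum>l\<in>{l\<in>{1..N}. cls l = s}. Q i l)"
    and split: "\<And>i l. i \<in> {1..N} \<Longrightarrow> l \<in> {1..N} \<Longrightarrow> Q i l = (\<Sum>s\<in>{1..k}. h i s * \<pi> s l)"
    by (rule Q.class_structure) (rule that, assumption+)
  obtain rp where rp: "\<And>s. s \<in> {1..k} \<Longrightarrow> rp s \<in> {1..N}" "\<And>s l. s \<in> {1..k} \<Longrightarrow> l \<in> {1..N} \<Longrightarrow> \<pi> s l = Q (rp s) l"
    using rep by metis
  have \<pi>: "probability_vector N (\<pi> s)" if "s \<in> {1..k}" for s
    using Q.nonneg[OF rp(1)[OF that]] Q.row_sum[OF rp(1)[OF that]] rp(2)[OF that]
    by (simp add: probability_vector_def)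
  have \<pi>sum: "(\<Sum>l\<in>{1..N}. \<pi> s l) = 1" if "s \<in> {1..k}" for s
    using \<pi>[OF that] by (simp add: probability_vector_def)
  have \<pi>cls: "(\<Sum>l\<in>{l\<in>{1..N}. cls l = t}. \<pi> s l) = of_bool (t = s)" if s: "s \<in> {1..k}" for s t
  proof (cases "t = s")
    case True
    have "(\<Sum>l\<in>{l\<in>{1..N}. cls l = t}. \<pi> s l) = (\<Sum>l\<in>{1..N}. \<pi> s l)"
      by (rule sum.mono_neutral_left) (use cls[OF s] True in auto)
    with True show ?thesis by (simp add: \<pi>sum[OF s, simplified])
  next
    case False
    have "(\<Sum>l\<in>{l\<in>{1..N}. cls l = t}. \<pi> s l) = 0"
      by (rule sum.neutral) (use cls[OF s] False in auto)
    with False show ?thesis by simp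
  qed
  have h_class: "h l t = of_bool (t = s)" if "s \<in> {1..k}" "l \<in> {1..N}" "\<pi> s l \<noteq> 0" for s l t
  proof -
    have "h l t = (\<Sum>m\<in>{m\<in>{1..N}. cls m = t}. \<pi> s m)" unfolding h by (intro sum.cong refl row that) auto
    with \<pi>cls[OF that(1)] show ?thesis by simp
  qed
  have hprob: "probability_vector k (h i)" if i: "i \<in> {1..N}" for i
    unfolding probability_vector_def
  proof (intro conjI ballI)
    show "0 \<le> h i t" for t unfolding h by (intro sum_nonneg Q.nonneg i) auto
    have "1 = (\<Sum>l\<in>{1..N}. \<Sum>s\<in>{1..k}. h i s * \<pi> s l)"
      unfolding Q.row_sum[OF i, symmetric] by (intro sum.cong refl split i)
    also have "\<dots> = (\<Sum>s\<in>{1..k}. h i s * (\<Sum>l\<in>{1..N}. \<pi> s l))"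
      unfolding sum_distrib_left by (rule sum.swap)
    also have "\<dots> = (\<Sum>s\<in>{1..k}. h i s)" by (intro sum.cong refl) (simp only: \<pi>sum mult_1_right)
    finally show "(\<Sum>s\<in>{1..k}. h i s) = 1" by simp
  qed
  define G where "G c i t = (\<Sum>l\<in>{l\<in>{1..N}. cls l = t}. J c i l)" for c i t
  define Jk where "Jk c s t = G c (rp s) t" for c s t
  have G_h: "(\<Sum>m\<in>{1..N}. J c i m * h m t) = G c i t" if i: "i \<in> {1..N}" for c i t
  proof -
    have "(\<Sum>m\<in>{1..N}. J c i m * h m t) = (\<Sum>l\<in>{l\<in>{1..N}. cls l = t}. mmul N (J c) Q i l)"
      unfolding h mmul_def sum_distrib_left by (rule sum.swap)
    also have "\<dots> = G c i t" unfolding G_def by (intro sum.cong refl lim(2) i) auto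
    finally show ?thesis .
  qed
  have J_split: "J c i l = (\<Sum>s\<in>{1..k}. h i s * J c (rp s) l)" if i: "i \<in> {1..N}" and l: "l \<in> {1..N}" for c i l
  proof -
    have "J c i l = mmul N Q (J c) i l" using lim(1)[OF i l] by simp
    also have "\<dots> = (\<Sum>m\<in>{1..N}. \<Sum>s\<in>{1..k}. h i s * (Q (rp s) m * J c m l))"
      unfolding mmul_def
    proof (intro sum.cong refl)
      fix m assume m: "m \<in> {1..N}"
      have "Q i m = (\<Sum>s\<in>{1..k}. h i s * Q (rp s) m)"
        unfolding split[OF i m] by (intro sum.cong refl) (simp only: rp(2) m)
      then show "Q i m * J c m l = (\<Sum>s\<in>{1..k}. h i s * (Q (rp s) m * J c m l))"
        by (simp add: sum_distrib_right mult.assoc)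
    qed
    also have "\<dots> = (\<Sum>s\<in>{1..k}. h i s * mmul N Q (J c) (rp s) l)"
      unfolding mmul_def sum_distrib_left by (rule sum.swap)
    also have "\<dots> = (\<Sum>s\<in>{1..k}. h i s * J c (rp s) l)"
      by (intro sum.cong refl) (simp only: lim(1)[OF rp(1) l])
    finally show ?thesis .
  qed
  have G_split: "G c i t = (\<Sum>s\<in>{1..k}. h i s * Jk c s t)" if i: "i \<in> {1..N}" for c i t
  proof -
    have "G c i t = (\<Sum>l\<in>{l\<in>{1..N}. cls l = t}. \<Sum>s\<in>{1..k}. h i s * J c (rp s) l)"
      unfolding G_def by (intro sum.cong refl J_split i) auto
    also have "\<dots> = (\<Sum>s\<in>{1..k}. h i s * Jk c s t)"
      unfolding Jk_def G_def sum_distrib_left by (rule sum.swap)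
    finally show ?thesis .
  qed
  have J_G: "J c i l = (\<Sum>t\<in>{1..k}. G c i t * \<pi> t l)" if i: "i \<in> {1..N}" and l: "l \<in> {1..N}" for c i l
  proof -
    have "J c i l = (\<Sum>m\<in>{1..N}. \<Sum>t\<in>{1..k}. J c i m * h m t * \<pi> t l)"
      unfolding lim(2)[OF i l, symmetric] mmul_def
      by (intro sum.cong refl) (simp only: split[OF _ l] sum_distrib_left mult.assoc)
    also have "\<dots> = (\<Sum>t\<in>{1..k}. (\<Sum>m\<in>{1..N}. J c i m * h m t) * \<pi> t l)"
      unfolding sum_distrib_right by (rule sum.swap)
    finally show ?thesis by (simp only: G_h[OF i])
  qed
  have factor: "J c i l = (\<Sum>s\<in>{1..k}. \<Sum>t\<in>{1..k}. h i s * Jk c s t * \<pi> t l)" if i: "i \<in> {1..N}" and l: "l \<in> {1..N}" for c i l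
    unfolding J_G[OF i l] G_split[OF i] sum_distrib_right by (rule sum.swap)
  have Jk_stoch: "stochastic_matrix k (Jk c)" for c
    unfolding stochastic_matrix_def probability_vector_def
  proof (intro ballI conjI)
    fix s assume s: "s \<in> {1..k}"
    show "0 \<le> Jk c s t" for t unfolding Jk_def G_def by (intro sum_nonneg ent rp s) auto
    have "1 = (\<Sum>l\<in>{1..N}. \<Sum>t\<in>{1..k}. G c (rp s) t * \<pi> t l)"
      unfolding rows[OF rp(1)[OF s], of c, symmetric] by (intro sum.cong refl J_G rp s)
    also have "\<dots> = (\<Sum>t\<in>{1..k}. G c (rp s) t * (\<Sum>l\<in>{1..N}. \<pi> t l))"
      unfolding sum_distrib_left by (rule sum.swap)
    also have "\<dots> = (\<Sum>t\<in>{1..k}. Jk c s t)" unfolding Jk_def by (intro sum.cong refl) (simp only: \<pi>sum mult_1_right)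
    finally show "(\<Sum>t\<in>{1..k}. Jk c s t) = 1" by simp
  qed
  have Jk_id: "real (Suc d) * Jk c s t - real (Suc c) * Jk d s t = (real (Suc d) - real (Suc c)) * mmul k (Jk d) (Jk c) s t"
    if s: "s \<in> {1..k}" for c d s t
  proof -
    have "real (Suc d) * Jk c s t - real (Suc c) * Jk d s t =
        (\<Sum>l\<in>{l\<in>{1..N}. cls l = t}. (real (Suc d) - real (Suc c)) * mmul N (J d) (J c) (rp s) l)"
      unfolding Jk_def G_def sum_distrib_left sum_subtractf[symmetric]
      by (intro sum.cong refl identity rp s) auto
    also have "\<dots> = (real (Suc d) - real (Suc c)) * (\<Sum>m\<in>{1..N}. J d (rp s) m * G c m t)"
    proof -
      have "(\<Sum>l\<in>{l\<in>{1..N}. cls l = t}. mmul N (J d) (J c) (rp s) l) = (\<Sum>m\<in>{1..N}. J d (rp s) m * G c m t)"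
        unfolding mmul_def G_def sum_distrib_left by (rule sum.swap)
      then show ?thesis by (simp only: sum_distrib_left[symmetric])
    qed
    also have "(\<Sum>m\<in>{1..N}. J d (rp s) m * G c m t) = (\<Sum>m\<in>{1..N}. \<Sum>u\<in>{1..k}. J d (rp s) m * h m u * Jk c u t)"
      by (intro sum.cong refl) (simp only: G_split sum_distrib_left mult.assoc)
    also have "\<dots> = (\<Sum>u\<in>{1..k}. (\<Sum>m\<in>{1..N}. J d (rp s) m * h m u) * Jk c u t)"
      unfolding sum_distrib_right by (rule sum.swap)
    also have "\<dots> = mmul k (Jk d) (Jk c) s t"
      unfolding mmul_def by (simp only: G_h[OF rp(1)[OF s]] Jk_def[symmetric])
    finally show ?thesis .
  qed
  interpret K: pseudo_resolvent k Jk
    by unfold_locales (use k Jk_stoch Jk_id in auto)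
  have "(\<lambda>m. Jk (s m) t u) \<longlonglongrightarrow> of_bool (t = u)" if t: "t \<in> {1..k}" for t u
  proof -
    have "(\<lambda>m. Jk (s m) t u) \<longlonglongrightarrow> (\<Sum>l\<in>{l\<in>{1..N}. cls l = u}. Q (rp t) l)"
      unfolding Jk_def G_def by (intro tendsto_sum Q rp t) auto
    also have "(\<Sum>l\<in>{l\<in>{1..N}. cls l = u}. Q (rp t) l) = (\<Sum>l\<in>{l\<in>{1..N}. cls l = u}. \<pi> t l)"
      by (intro sum.cong refl rp(2)[symmetric] t) auto
    also have "\<dots> = of_bool (t = u)" unfolding \<pi>cls[OF t] by auto
    finally show ?thesis .
  qed
  then have "\<exists>\<mu>' P'. 0 < \<mu>' \<and> stochastic_matrix k P' \<and> (\<forall>c. resolvent_kernel k \<mu>' P' (real (Suc c)) (Jk c))"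
    by (intro K.generator[OF s])
  then obtain \<mu>' P' where "0 < \<mu>'" "stochastic_matrix k P'" "\<And>c. resolvent_kernel k \<mu>' P' (real (Suc c)) (Jk c)"
    by blast
  moreover have "limit_chain N k J Jk cls \<pi> h"
    by unfold_locales (fact k \<pi> cls hprob h_class factor)+
  ultimately show ?thesis using that by blast
qed

end

text \<open>Compactness: the entries of all resolvents lie in \<open>[0,1]\<close> whatever the jump rates are.\<close>
theorem convergent_resolvents:
  assumes N: "1 \<le> N" and par: "\<And>n. parameters N (\<nu> n) (\<mu> n) (P n)"
  obtains r JJ \<nu>l where "strict_mono (r :: nat \<Rightarrow> nat)"
    and "pseudo_resolvent N JJ" and "probability_vector N \<nu>l"
    and "\<And>c i j. i \<in> {1..N} \<Longrightarrow> j \<in> {1..N} \<Longrightarrow> (\<lambda>n. resolvent_matrix N (\<mu> (r n)) (P (r n)) (real (Suc c)) i j) \<longlonglongrightarrow> JJ c i j"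
    and "\<And>i. i \<in> {1..N} \<Longrightarrow> (\<lambda>n. \<nu> (r n) i) \<longlonglongrightarrow> \<nu>l i"
proof -
  have \<mu>: "0 < \<mu> n" and P: "stochastic_matrix N (P n)" and \<nu>: "probability_vector N (\<nu> n)" for n
    using par[of n] by (auto simp: parameters_def)
  let ?J = "\<lambda>n c. resolvent_matrix N (\<mu> n) (P n) (real (Suc c))"
  have st: "stochastic_matrix N (?J n c)" for n c by (rule resolvent_matrix_stochastic[OF P \<mu>]) simp
  define f where "f n = case_sum (\<lambda>(c, i, j). if i \<in> {1..N} \<and> j \<in> {1..N} then ?J n c i j else 0) (\<lambda>i. if i \<in> {1..N} then \<nu> n i else 0)" for n
  have \<nu>b: "0 \<le> \<nu> n i \<and> \<nu> n i \<le> 1" if "i \<in> {1..N}" for n i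
    using \<nu>[of n] member_le_sum[OF that, of "\<nu> n"] that by (auto simp: probability_vector_def)
  have Jb: "\<bar>?J n c i j\<bar> \<le> 1" if "i \<in> {1..N}" "j \<in> {1..N}" for n c i j
    using stochastic_entry[OF st that, of n c] by auto
  have "\<bar>f n a\<bar> \<le> 1" for n a
  proof (cases a)
    case (Inl t)
    obtain c i j where "t = (c, i, j)" by (cases t)
    then show ?thesis using Jb[of i j n c] Inl by (simp add: f_def del: atLeastAtMost_iff of_nat_Suc)
  next
    case (Inr i)
    then show ?thesis using \<nu>b[of i n] by (simp add: f_def del: atLeastAtMost_iff)
  qed
  from bounded_pointwise_subsequence[of f "\<lambda>_. 1", OF this]
  obtain r l where r: "strict_mono (r :: nat \<Rightarrow> nat)" and l: "\<And>a. (\<lambda>n. f (r n) a) \<longlonglongrightarrow> l a" by blast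
  define JJ where "JJ c i j = l (Inl (c, i, j))" for c i j
  define \<nu>l where "\<nu>l i = l (Inr i)" for i
  have J: "(\<lambda>n. ?J (r n) c i j) \<longlonglongrightarrow> JJ c i j" if "i \<in> {1..N}" "j \<in> {1..N}" for c i j
    using l[of "Inl (c, i, j)"] that by (simp add: f_def JJ_def del: atLeastAtMost_iff of_nat_Suc)
  have \<nu>c: "(\<lambda>n. \<nu> (r n) i) \<longlonglongrightarrow> \<nu>l i" if "i \<in> {1..N}" for i
    using l[of "Inr i"] that by (simp add: f_def \<nu>l_def del: atLeastAtMost_iff)
  have "probability_vector N \<nu>l"
    unfolding probability_vector_def
  proof (intro conjI ballI)
    show "0 \<le> \<nu>l i" if "i \<in> {1..N}" for i
      by (rule LIMSEQ_le_const[OF \<nu>c[OF that]]) (use \<nu>b[OF that] in auto)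
    have "(\<lambda>n. \<Sum>i\<in>{1..N}. \<nu> (r n) i) \<longlonglongrightarrow> (\<Sum>i\<in>{1..N}. \<nu>l i)" by (intro tendsto_sum \<nu>c)
    moreover have "(\<Sum>i\<in>{1..N}. \<nu> (r n) i) = 1" for n using \<nu> by (simp add: probability_vector_def)
    ultimately show "(\<Sum>i\<in>{1..N}. \<nu>l i) = 1" by (simp add: LIMSEQ_const_iff)
  qed
  moreover have "pseudo_resolvent N JJ"
  proof
    show "1 \<le> N" by (rule N)
    show "stochastic_matrix N (JJ c)" for c by (rule stochastic_limit[of N "\<lambda>n. ?J (r n) c"], rule st, rule J)
    fix c d i j assume i: "i \<in> {1..N}" and j: "j \<in> {1..N}"
    have "(\<lambda>n. real (Suc d) * ?J (r n) c i j - real (Suc c) * ?J (r n) d i j) \<longlonglongrightarrow> real (Suc d) * JJ c i j - real (Suc c) * JJ d i j"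
      by (intro tendsto_intros J i j)
    moreover have "(\<lambda>n. (real (Suc d) - real (Suc c)) * mmul N (?J (r n) d) (?J (r n) c) i j) \<longlonglongrightarrow> (real (Suc d) - real (Suc c)) * mmul N (JJ d) (JJ c) i j"
      by (intro tendsto_intros mmul_tendsto J i j)
    moreover have "real (Suc d) * ?J (r n) c i j - real (Suc c) * ?J (r n) d i j = (real (Suc d) - real (Suc c)) * mmul N (?J (r n) d) (?J (r n) c) i j" for n
      by (rule resolvent_identity[OF P \<mu> _ _ i j]) simp_all
    ultimately show "real (Suc d) * JJ c i j - real (Suc c) * JJ d i j = (real (Suc d) - real (Suc c)) * mmul N (JJ d) (JJ c) i j"
      using LIMSEQ_unique by (simp only:) blast
  qed
  ultimately show ?thesis using that[OF r] J \<nu>c by blast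
qed

section \<open>Path laws and class averages\<close>

lemma path_exp_mono:
  assumes J: "stochastic_matrix N J" and i: "i \<in> {1..N}" and le: "\<And>l. length l = m \<Longrightarrow> F l \<le> F' l"
  shows "path_exp N J m F i \<le> path_exp N J m F' i"
  using i le
proof (induction m arbitrary: i F F')
  case (Suc m)
  show ?case unfolding path_exp.simps
    by (intro sum_mono mult_left_mono Suc.IH) (use stochastic_entry[OF J Suc.prems(1)] Suc.prems in auto)
qed simp

lemma path_exp_const:
  assumes J: "stochastic_matrix N J" and i: "i \<in> {1..N}"
  shows "path_exp N J m (\<lambda>_. C) i = C"
  using i
proof (induction m arbitrary: i)
  case (Suc m)
  have "path_exp N J (Suc m) (\<lambda>_. C) i = (\<Sum>j\<in>{1..N}. J i j * C)"
    unfolding path_exp.simps by (intro sum.cong refl) (simp only: Suc.IH)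
  also have "\<dots> = C" unfolding sum_distrib_right[symmetric]
    using J Suc.prems by (simp add: stochastic_matrix_def probability_vector_def)
  finally show ?case .
qed simp

lemma path_exp_tendsto:
  assumes "\<And>i j. i \<in> {1..N} \<Longrightarrow> j \<in> {1..N} \<Longrightarrow> (\<lambda>n. J n i j) \<longlonglongrightarrow> J' i j" and i: "i \<in> {1..N}"
  shows "(\<lambda>n. path_exp N (J n) m F i) \<longlonglongrightarrow> path_exp N J' m F i"
  using i
proof (induction m arbitrary: i F)
  case (Suc m)
  then show ?case unfolding path_exp.simps by (intro tendsto_sum tendsto_mult assms(1)) auto
qed simp

text \<open>The maximal inequality for a Markov chain: \<open>g\<close> has mean zero after each step whatever the
  previous state was, so its partial sums are a martingale.\<close>
lemma path_exp_maximal: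
  assumes J: "stochastic_matrix N J" and g: "\<And>j. \<bar>g j\<bar> \<le> (1 :: real)"
    and mean: "\<And>i. i \<in> {1..N} \<Longrightarrow> (\<Sum>j\<in>{1..N}. J i j * g j) = 0" and \<eta>: "0 < \<eta>" and i: "i \<in> {1..N}"
  shows "path_exp N J m (\<lambda>l. of_bool (\<exists>a\<le>length l. \<eta> \<le> \<bar>x + (\<Sum>q<a. g (l ! q))\<bar>)) i \<le> (x\<^sup>2 + real m) / \<eta>\<^sup>2"
  using i
proof (induction m arbitrary: i x)
  case 0
  show ?case
  proof (cases "\<eta> \<le> \<bar>x\<bar>")
    case True
    then have "\<eta>\<^sup>2 \<le> x\<^sup>2" using \<eta> by (simp add: abs_le_square_iff[symmetric])
    then have "1 \<le> x\<^sup>2 / \<eta>\<^sup>2" using \<eta> by simp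
    with True show ?thesis by simp
  qed simp
next
  case (Suc m)
  show ?case
  proof (cases "\<eta> \<le> \<bar>x\<bar>")
    case True
    then have "\<eta>\<^sup>2 \<le> x\<^sup>2" using \<eta> by (simp add: abs_le_square_iff[symmetric])
    then have "1 \<le> (x\<^sup>2 + real (Suc m)) / \<eta>\<^sup>2" using \<eta> by (simp add: le_divide_eq)
    moreover have "path_exp N J (Suc m) (\<lambda>l. of_bool (\<exists>a\<le>length l. \<eta> \<le> \<bar>x + (\<Sum>q<a. g (l ! q))\<bar>)) i \<le> path_exp N J (Suc m) (\<lambda>_. 1) i"
      by (rule path_exp_mono[OF J Suc.prems]) simp
    ultimately show ?thesis unfolding path_exp_const[OF J Suc.prems] by linarith
  next
    case False
    have split: "(\<exists>a\<le>length (j # l). \<eta> \<le> \<bar>x + (\<Sum>q<a. g ((j # l) ! q))\<bar>) \<longleftrightarrow>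
        (\<exists>a\<le>length l. \<eta> \<le> \<bar>(x + g j) + (\<Sum>q<a. g (l ! q))\<bar>)" for j l
    proof -
      have e: "x + (\<Sum>q<Suc a. g ((j # l) ! q)) = (x + g j) + (\<Sum>q<a. g (l ! q))" for a
        by (simp only: sum.lessThan_Suc_shift) simp
      show ?thesis
      proof
        assume "\<exists>a\<le>length (j # l). \<eta> \<le> \<bar>x + (\<Sum>q<a. g ((j # l) ! q))\<bar>"
        then obtain a where a: "a \<le> length (j # l)" "\<eta> \<le> \<bar>x + (\<Sum>q<a. g ((j # l) ! q))\<bar>" by blast
        with False obtain b where "a = Suc b" by (cases a) auto
        with a e[of b] show "\<exists>a\<le>length l. \<eta> \<le> \<bar>(x + g j) + (\<Sum>q<a. g (l ! q))\<bar>" by (intro exI[of _ b]) simp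
      next
        assume "\<exists>a\<le>length l. \<eta> \<le> \<bar>(x + g j) + (\<Sum>q<a. g (l ! q))\<bar>"
        then obtain b where b: "b \<le> length l" "\<eta> \<le> \<bar>(x + g j) + (\<Sum>q<b. g (l ! q))\<bar>" by blast
        with e[of b] show "\<exists>a\<le>length (j # l). \<eta> \<le> \<bar>x + (\<Sum>q<a. g ((j # l) ! q))\<bar>" by (intro exI[of _ "Suc b"]) simp
      qed
    qed
    have Ji: "0 \<le> J i j" if "j \<in> {1..N}" for j using stochastic_entry[OF J Suc.prems that] by simp
    have one: "(\<Sum>j\<in>{1..N}. J i j) = 1" using J Suc.prems by (simp add: stochastic_matrix_def probability_vector_def)
    have "path_exp N J (Suc m) (\<lambda>l. of_bool (\<exists>a\<le>length l. \<eta> \<le> \<bar>x + (\<Sum>q<a. g (l ! q))\<bar>)) i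
        \<le> (\<Sum>j\<in>{1..N}. J i j * (((x + g j)\<^sup>2 + real m) / \<eta>\<^sup>2))"
      unfolding path_exp.simps split by (intro sum_mono mult_left_mono Suc.IH Ji)
    also have "\<dots> \<le> (\<Sum>j\<in>{1..N}. J i j * ((x\<^sup>2 + 1 + real m) / \<eta>\<^sup>2) + 2 * x / \<eta>\<^sup>2 * (J i j * g j))"
    proof (rule sum_mono)
      fix j assume j: "j \<in> {1..N}"
      have "(g j)\<^sup>2 \<le> 1" using g[of j] by (simp add: abs_square_le_1)
      then have "(x + g j)\<^sup>2 + real m \<le> (x\<^sup>2 + 1 + real m) + 2 * x * g j" by (simp add: power2_sum)
      then have "((x + g j)\<^sup>2 + real m) / \<eta>\<^sup>2 \<le> ((x\<^sup>2 + 1 + real m) + 2 * x * g j) / \<eta>\<^sup>2"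
        by (rule divide_right_mono) simp
      from mult_left_mono[OF this Ji[OF j]]
      show "J i j * (((x + g j)\<^sup>2 + real m) / \<eta>\<^sup>2) \<le> J i j * ((x\<^sup>2 + 1 + real m) / \<eta>\<^sup>2) + 2 * x / \<eta>\<^sup>2 * (J i j * g j)"
        by (simp add: add_divide_distrib distrib_left mult_ac)
    qed
    also have "\<dots> = (x\<^sup>2 + 1 + real m) / \<eta>\<^sup>2"
      unfolding sum.distrib sum_distrib_right[symmetric] sum_distrib_left[symmetric] mean[OF Suc.prems] one by simp
    finally show ?thesis by (simp add: add_ac)
  qed
qed

context limit_chain
begin

lemma \<pi>_sum: "s \<in> {1..k} \<Longrightarrow> (\<Sum>l\<in>{1..N}. \<pi> s l) = 1"
  using \<pi> by (simp add: probability_vector_def)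

text \<open>Integration against \<open>JJ c i\<close> only sees states charged by the equilibrium laws, so \<open>f\<close> may depend on the class
  as if it were known.\<close>
lemma JJ_expectation:
  assumes i: "i \<in> {1..N}" and f: "\<And>t l. t \<in> {1..k} \<Longrightarrow> l \<in> {1..N} \<Longrightarrow> \<pi> t l \<noteq> 0 \<Longrightarrow> f l = f' t l"
  shows "(\<Sum>l\<in>{1..N}. JJ c i l * f l) = (\<Sum>s\<in>{1..k}. h i s * (\<Sum>t\<in>{1..k}. Jk c s t * (\<Sum>l\<in>{1..N}. \<pi> t l * f' t l)))"
proof -
  have "(\<Sum>l\<in>{1..N}. JJ c i l * f l) = (\<Sum>l\<in>{1..N}. \<Sum>s\<in>{1..k}. \<Sum>t\<in>{1..k}. h i s * (Jk c s t * (\<pi> t l * f' t l)))"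
  proof (intro sum.cong refl)
    fix l assume l: "l \<in> {1..N}"
    have "h i s * Jk c s t * \<pi> t l * f l = h i s * (Jk c s t * (\<pi> t l * f' t l))" if "t \<in> {1..k}" for s t
      using f[OF that l] by (cases "\<pi> t l = 0") auto
    then show "JJ c i l * f l = (\<Sum>s\<in>{1..k}. \<Sum>t\<in>{1..k}. h i s * (Jk c s t * (\<pi> t l * f' t l)))"
      unfolding factor[OF i l] sum_distrib_right by (intro sum.cong refl)
  qed
  also have "\<dots> = (\<Sum>s\<in>{1..k}. \<Sum>t\<in>{1..k}. \<Sum>l\<in>{1..N}. h i s * (Jk c s t * (\<pi> t l * f' t l)))"
  proof -
    have "(\<Sum>s\<in>{1..k}. \<Sum>l\<in>{1..N}. \<Sum>t\<in>{1..k}. h i s * (Jk c s t * (\<pi> t l * f' t l))) =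
        (\<Sum>s\<in>{1..k}. \<Sum>t\<in>{1..k}. \<Sum>l\<in>{1..N}. h i s * (Jk c s t * (\<pi> t l * f' t l)))"
      by (rule sum.cong[OF refl], rule sum.swap)
    from trans[OF sum.swap this] show ?thesis .
  qed
  finally show ?thesis by (simp only: sum_distrib_left)
qed

text \<open>The observed classes of the limit form a Markov chain by themselves, the one with transition matrices
  \<open>Jk c\<close>: a state charged by \<open>\<pi> t\<close> has the future of its class.\<close>
lemma path_exp_classes:
  assumes i: "i \<in> {1..N}"
  shows "path_exp N (JJ c) m (\<lambda>l. F (map cls l)) i = (\<Sum>s\<in>{1..k}. h i s * path_exp k (Jk c) m F s)"
  using i
proof (induction m arbitrary: i F)
  case 0
  then show ?case using h[of i] by (simp add: probability_vector_def sum_distrib_right[symmetric])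
next
  case (Suc m)
  have "path_exp N (JJ c) (Suc m) (\<lambda>l. F (map cls l)) i
    = (\<Sum>l\<in>{1..N}. JJ c i l * path_exp N (JJ c) m (\<lambda>ys. F (cls l # map cls ys)) l)" by simp
  also have "\<dots> = (\<Sum>s\<in>{1..k}. h i s * (\<Sum>t\<in>{1..k}. Jk c s t * (\<Sum>l\<in>{1..N}. \<pi> t l * path_exp k (Jk c) m (\<lambda>ys. F (t # ys)) t)))"
  proof (rule JJ_expectation[OF Suc.prems])
    fix t l assume t: "t \<in> {1..k}" and l: "l \<in> {1..N}" and nz: "\<pi> t l \<noteq> 0"
    have "path_exp N (JJ c) m (\<lambda>ys. F (cls l # map cls ys)) l = (\<Sum>s\<in>{1..k}. h l s * path_exp k (Jk c) m (\<lambda>ys. F (t # ys)) s)"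
      using Suc.IH[OF l, of "\<lambda>ys. F (t # ys)"] cls[OF t l nz] by simp
    also have "\<dots> = (\<Sum>s\<in>{1..k}. of_bool (t = s) *\<^sub>R path_exp k (Jk c) m (\<lambda>ys. F (t # ys)) s)"
      by (intro sum.cong refl) (auto simp: h_class[OF t l nz])
    also have "\<dots> = path_exp k (Jk c) m (\<lambda>ys. F (t # ys)) t"
      by (rule sum_of_bool_scaleR) (use t in auto)
    finally show "path_exp N (JJ c) m (\<lambda>ys. F (cls l # map cls ys)) l = path_exp k (Jk c) m (\<lambda>ys. F (t # ys)) t" .
  qed
  also have "\<dots> = (\<Sum>s\<in>{1..k}. h i s * path_exp k (Jk c) (Suc m) F s)"
    unfolding path_exp.simps by (intro sum.cong refl arg_cong2[where f = "(*)"]) (simp only: sum_distrib_right[symmetric] \<pi>_sum mult_1_left)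
  finally show ?case .
qed

text \<open>The extension by \<open>0\<close> covers the dummy class of the transient states.\<close>
definition class_mean :: "nat \<Rightarrow> nat \<Rightarrow> real" where
  "class_mean s x = (if s \<in> {1..k} then \<pi> s x else 0)"

text \<open>Given its class, the next observed state is distributed by the equilibrium law, whatever came before.\<close>
lemma class_average_mean_zero:
  assumes i: "i \<in> {1..N}" and x: "x \<in> {1..N}"
  shows "(\<Sum>l\<in>{1..N}. JJ c i l * (of_bool (l = x) - class_mean (cls l) x)) = 0"
proof -
  have z: "(\<Sum>l\<in>{1..N}. \<pi> t l * (of_bool (l = x) - \<pi> t x)) = 0" if t: "t \<in> {1..k}" for t
  proof -
    have "(\<Sum>l\<in>{1..N}. \<pi> t l * of_bool (l = x)) = \<pi> t x"
      using mmul_id_right[OF x, of "\<lambda>_ l. \<pi> t l"] by (simp add: mmul_def)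
    moreover have "(\<Sum>l\<in>{1..N}. \<pi> t l * \<pi> t x) = \<pi> t x" unfolding sum_distrib_right[symmetric] \<pi>_sum[OF t] by simp
    ultimately show ?thesis unfolding right_diff_distrib sum_subtractf by simp
  qed
  have "(\<Sum>l\<in>{1..N}. JJ c i l * (of_bool (l = x) - class_mean (cls l) x)) =
      (\<Sum>s\<in>{1..k}. h i s * (\<Sum>t\<in>{1..k}. Jk c s t * (\<Sum>l\<in>{1..N}. \<pi> t l * (of_bool (l = x) - \<pi> t x))))"
    by (rule JJ_expectation[OF i]) (simp add: cls class_mean_def del: atLeastAtMost_iff)
  also have "\<dots> = 0" by (intro sum.neutral ballI) (simp add: z[simplified])
  finally show ?thesis .
qed

lemma class_mean_bounds: "x \<in> {1..N} \<Longrightarrow> 0 \<le> class_mean s x \<and> class_mean s x \<le> 1"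
  using \<pi>[of s] member_le_sum[of x "{1..N}" "\<pi> s"] \<pi>_sum[of s]
  by (auto simp: class_mean_def probability_vector_def)

end

section \<open>Gluing infinitely many couplings\<close>

text \<open>The common part of the two laws is put on the diagonal, and the remainders are coupled independently. If
  they vanish, then \<open>R = 0\<close> and the second summand vanishes, by the convention for
  division by zero.\<close>
lemma maximal_coupling:
  fixes p p' :: "'a \<Rightarrow> real"
  assumes G: "finite G" and p: "\<And>g. 0 \<le> p g" "sum p G = 1" and p': "\<And>g. 0 \<le> p' g" "sum p' G = 1"
  obtains \<gamma> where "\<And>g k. 0 \<le> \<gamma> g k" "\<And>g. g \<in> G \<Longrightarrow> (\<Sum>k\<in>G. \<gamma> g k) = p' g" "\<And>k. k \<in> G \<Longrightarrow> (\<Sum>g\<in>G. \<gamma> g k) = p k"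
    "(\<Sum>g\<in>G. p' g - \<gamma> g g) \<le> (\<Sum>g\<in>G. \<bar>p' g - p g\<bar>)"
proof -
  define m where "m g = min (p g) (p' g)" for g
  define R where "R = (\<Sum>g\<in>G. p g - m g)"
  have R': "R = (\<Sum>g\<in>G. p' g - m g)" using p p' by (simp add: R_def sum_subtractf)
  have nn: "0 \<le> p g - m g" "0 \<le> p' g - m g" "0 \<le> m g" for g using p p' by (auto simp: m_def)
  have R0: "0 \<le> R" unfolding R_def by (intro sum_nonneg nn)
  define \<gamma> where "\<gamma> g k = (if g = k then m g else 0) + (p' g - m g) * (p k - m k) / R" for g k
  have c: "x * R / R = x" if "R = 0 \<Longrightarrow> x = 0" for x using that by auto
  show ?thesis
  proof (rule that[of \<gamma>])
    show "0 \<le> \<gamma> g k" for g k using nn R0 by (auto simp: \<gamma>_def intro!: add_nonneg_nonneg divide_nonneg_nonneg mult_nonneg_nonneg)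
    show "(\<Sum>k\<in>G. \<gamma> g k) = p' g" if g: "g \<in> G" for g
    proof -
      have "(\<Sum>k\<in>G. \<gamma> g k) = m g + (p' g - m g) * R / R"
        using G g by (simp add: \<gamma>_def sum.distrib R_def sum_divide_distrib[symmetric] sum_distrib_left[symmetric])
      moreover have "(p' g - m g) * R / R = p' g - m g"
        by (rule c) (use g sum_nonneg_eq_0_iff[OF G, of "\<lambda>g. p' g - m g"] nn R' in auto)
      ultimately show ?thesis by simp
    qed
    show "(\<Sum>g\<in>G. \<gamma> g k) = p k" if g: "k \<in> G" for k
    proof -
      have "(\<Sum>g\<in>G. \<gamma> g k) = m k + (p k - m k) * R / R"
      proof -
        have "(\<Sum>g\<in>G. \<gamma> g k) = m k + (\<Sum>g\<in>G. (p' g - m g) * (p k - m k) / R)"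
          using G g by (simp add: \<gamma>_def sum.distrib)
        also have "(\<Sum>g\<in>G. (p' g - m g) * (p k - m k) / R) = (\<Sum>g\<in>G. p' g - m g) * (p k - m k) / R"
          unfolding sum_distrib_right sum_divide_distrib ..
        finally show ?thesis unfolding R'[symmetric] by (simp only: mult.commute)
      qed
      moreover have "(p k - m k) * R / R = p k - m k"
        by (rule c) (use g sum_nonneg_eq_0_iff[OF G, of "\<lambda>g. p g - m g"] nn R_def in auto)
      ultimately show ?thesis by simp
    qed
    show "(\<Sum>g\<in>G. p' g - \<gamma> g g) \<le> (\<Sum>g\<in>G. \<bar>p' g - p g\<bar>)"
    proof (rule sum_mono)
      fix g
      have "0 \<le> (p' g - m g) * (p g - m g) / R" using nn R0 by (intro divide_nonneg_nonneg mult_nonneg_nonneg)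
      then have "p' g - \<gamma> g g \<le> p' g - m g" by (simp add: \<gamma>_def)
      also have "\<dots> \<le> \<bar>p' g - p g\<bar>" by (simp add: m_def min_def)
      finally show "p' g - \<gamma> g g \<le> \<bar>p' g - p g\<bar>" .
    qed
  qed
qed

text \<open>A coupling of finite-valued observables extends to the whole space: \<open>\<rho> g\<close> is the conditional law of
  the sample given that the coupled observable equals \<open>g\<close>. Where \<open>p' g = 0\<close> the value \<open>B\<close> is a default.\<close>
lemma reweighting:
  fixes B :: "'w measure" and K :: "'w \<Rightarrow> nat"
  assumes B: "prob_space B" and K: "K \<in> measurable B (count_space UNIV)" and G: "finite G" "\<And>\<omega>. \<omega> \<in> space B \<Longrightarrow> K \<omega> \<in> G"
    and p': "\<And>g. 0 \<le> p' g" "sum p' G = 1"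
  obtains \<rho> where "\<And>g. prob_space (\<rho> g)" "\<And>g. sets (\<rho> g) = sets B"
    "\<And>A. A \<in> sets B \<Longrightarrow> (\<Sum>g\<in>G. p' g * measure (\<rho> g) A) = measure B A"
    "(\<Sum>g\<in>G. p' g * measure (\<rho> g) {\<omega>\<in>space B. K \<omega> \<noteq> g}) \<le> (\<Sum>g\<in>G. \<bar>p' g - measure B {\<omega>\<in>space B. K \<omega> = g}\<bar>)"
proof -
  interpret B: prob_space B by (rule B)
  have Km: "{\<omega>\<in>space B. K \<omega> = g} \<in> sets B" for g
    using measurable_sets[OF K, of "{g}"] by (simp add: vimage_def Int_def conj_commute)
  define p where "p g = measure B {\<omega>\<in>space B. K \<omega> = g}" for g
  have slice: "measure B A = (\<Sum>k\<in>G. measure B (A \<inter> {\<omega>\<in>space B. K \<omega> = k}))" if A: "A \<in> sets B" for A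
  proof -
    have "measure B (\<Union>k\<in>G. A \<inter> {\<omega>\<in>space B. K \<omega> = k}) = (\<Sum>k\<in>G. measure B (A \<inter> {\<omega>\<in>space B. K \<omega> = k}))"
      by (rule B.finite_measure_finite_Union) (use G A Km in \<open>auto simp: disjoint_family_on_def\<close>)
    moreover have "(\<Union>k\<in>G. A \<inter> {\<omega>\<in>space B. K \<omega> = k}) = A" using G(2) sets.sets_into_space[OF A] by auto
    ultimately show ?thesis by simp
  qed
  have p: "0 \<le> p g" "sum p G = 1" for g
    using slice[of "space B"] B.prob_space by (auto simp: p_def Int_absorb1)
  obtain \<gamma> where \<gamma>: "\<And>g k. 0 \<le> \<gamma> g k" "\<And>g. g \<in> G \<Longrightarrow> (\<Sum>k\<in>G. \<gamma> g k) = p' g" "\<And>k. k \<in> G \<Longrightarrow> (\<Sum>g\<in>G. \<gamma> g k) = p k"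
    "(\<Sum>g\<in>G. p' g - \<gamma> g g) \<le> (\<Sum>g\<in>G. \<bar>p' g - p g\<bar>)"
    using maximal_coupling[OF G(1) p p'] by blast
  have \<gamma>0: "\<gamma> g k = 0" if "g \<in> G" "k \<in> G" "p k = 0" for g k
    using \<gamma>(3)[OF that(2)] sum_nonneg_eq_0_iff[OF G(1), of "\<lambda>g. \<gamma> g k"] \<gamma>(1) that by auto
  have \<gamma>0': "\<gamma> g k = 0" if "g \<in> G" "k \<in> G" "p' g = 0" for g k
    using \<gamma>(2)[OF that(1)] sum_nonneg_eq_0_iff[OF G(1), of "\<lambda>k. \<gamma> g k"] \<gamma>(1) that by auto
  \<comment> \<open>the density, on the event that \<open>K\<close> takes the value \<open>k\<close>, of the conditional law given \<open>g\<close>\<close>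
  define w where "w g k = \<gamma> g k / (p' g * p k)" for g k
  have w0: "0 \<le> w g k" for g k using \<gamma>(1) p(1) p'(1) by (simp add: w_def)
  define \<rho> where "\<rho> g = (if g \<in> G \<and> p' g \<noteq> 0 then density B (\<lambda>\<omega>. ennreal (w g (K \<omega>))) else B)" for g
  have wm [measurable]: "(\<lambda>\<omega>. ennreal (w g (K \<omega>))) \<in> borel_measurable B" for g
    by (rule measurable_compose[OF K]) simp
  have em: "emeasure (\<rho> g) A = ennreal (\<Sum>k\<in>G. w g k * measure B (A \<inter> {\<omega>\<in>space B. K \<omega> = k}))"
    if A: "A \<in> sets B" and g: "g \<in> G" "p' g \<noteq> 0" for A g
  proof -
    have "emeasure (\<rho> g) A = (\<integral>\<^sup>+ \<omega>. ennreal (w g (K \<omega>)) * indicator A \<omega> \<partial>B)"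
      using g A by (simp add: \<rho>_def emeasure_density)
    also have "\<dots> = (\<integral>\<^sup>+ \<omega>. (\<Sum>k\<in>G. ennreal (w g k) * indicator (A \<inter> {\<omega>\<in>space B. K \<omega> = k}) \<omega>) \<partial>B)"
    proof (rule nn_integral_cong)
      fix \<omega> assume \<omega>: "\<omega> \<in> space B"
      have "(\<Sum>k\<in>G. ennreal (w g k) * indicator (A \<inter> {\<omega>\<in>space B. K \<omega> = k}) \<omega>) =
          (\<Sum>k\<in>G. if k = K \<omega> then ennreal (w g (K \<omega>)) * indicator A \<omega> else 0)"
        by (intro sum.cong refl) (auto simp: indicator_def \<omega>)
      then show "ennreal (w g (K \<omega>)) * indicator A \<omega> = (\<Sum>k\<in>G. ennreal (w g k) * indicator (A \<inter> {\<omega>\<in>space B. K \<omega> = k}) \<omega>)"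
        using G \<omega> by simp
    qed
    also have "\<dots> = (\<Sum>k\<in>G. \<integral>\<^sup>+ \<omega>. ennreal (w g k) * indicator (A \<inter> {\<omega>\<in>space B. K \<omega> = k}) \<omega> \<partial>B)"
      by (rule nn_integral_sum) (use A Km in auto)
    also have "\<dots> = (\<Sum>k\<in>G. ennreal (w g k * measure B (A \<inter> {\<omega>\<in>space B. K \<omega> = k})))"
      by (intro sum.cong refl, subst nn_integral_cmult_indicator)
         (use A Km w0 in \<open>auto simp: B.emeasure_eq_measure ennreal_mult\<close>)
    also have "\<dots> = ennreal (\<Sum>k\<in>G. w g k * measure B (A \<inter> {\<omega>\<in>space B. K \<omega> = k}))"
      by (rule sum_ennreal) (simp add: w0)
    finally show ?thesis .
  qed
  have me: "p' g * measure (\<rho> g) A = (\<Sum>k\<in>G. \<gamma> g k / p k * measure B (A \<inter> {\<omega>\<in>space B. K \<omega> = k}))"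
    if A: "A \<in> sets B" and g: "g \<in> G" for A g
  proof (cases "p' g = 0")
    case True
    then show ?thesis using \<gamma>0'[OF g _ True] by simp
  next
    case False
    have "measure (\<rho> g) A = (\<Sum>k\<in>G. w g k * measure B (A \<inter> {\<omega>\<in>space B. K \<omega> = k}))"
      using em[OF A g False] w0 by (simp add: measure_def sum_nonneg)
    then show ?thesis using False by (simp add: sum_distrib_left w_def)
  qed
  have full: "measure B ({\<omega>\<in>space B. P \<omega>} \<inter> {\<omega>\<in>space B. K \<omega> = k}) = p k" if "\<And>\<omega>. \<omega> \<in> space B \<Longrightarrow> K \<omega> = k \<Longrightarrow> P \<omega>" for P k
    unfolding p_def by (rule arg_cong[where f = "measure B"]) (use that in auto)
  have cancel: "\<gamma> g k / p k * p k = \<gamma> g k" if "g \<in> G" "k \<in> G" for g k using \<gamma>0[OF that] by auto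
  show ?thesis
  proof (rule that[of \<rho>])
    show "prob_space (\<rho> g)" for g
    proof (cases "g \<in> G \<and> p' g \<noteq> 0")
      case True
      then have g: "g \<in> G" "p' g \<noteq> 0" by auto
      have "p' g * measure (\<rho> g) (space B) = (\<Sum>k\<in>G. \<gamma> g k)"
        unfolding me[OF sets.top g(1)] using full[of _ "\<lambda>_. True"] cancel[OF g(1)] by (intro sum.cong refl) simp
      then have 1: "measure (\<rho> g) (space B) = 1" using \<gamma>(2)[OF g(1)] g(2) by simp
      have "emeasure (\<rho> g) (space B) \<noteq> \<infinity>" using em[OF sets.top g] by simp
      then have "emeasure (\<rho> g) (space B) = 1" using 1 by (simp add: emeasure_eq_ennreal_measure)
      moreover have "space (\<rho> g) = space B" by (rule sets_eq_imp_space_eq) (simp add: \<rho>_def)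
      ultimately show ?thesis by (intro prob_spaceI) simp
    next
      case False
      then show ?thesis using B by (auto simp: \<rho>_def)
    qed
    show "sets (\<rho> g) = sets B" for g by (simp add: \<rho>_def)
    show "(\<Sum>g\<in>G. p' g * measure (\<rho> g) A) = measure B A" if A: "A \<in> sets B" for A
    proof -
      have "(\<Sum>g\<in>G. p' g * measure (\<rho> g) A) = (\<Sum>g\<in>G. \<Sum>k\<in>G. \<gamma> g k / p k * measure B (A \<inter> {\<omega>\<in>space B. K \<omega> = k}))"
        by (intro sum.cong refl me A)
      also have "\<dots> = (\<Sum>k\<in>G. (\<Sum>g\<in>G. \<gamma> g k) / p k * measure B (A \<inter> {\<omega>\<in>space B. K \<omega> = k}))"
        by (subst sum.swap) (simp add: sum_distrib_right sum_divide_distrib)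
      also have "\<dots> = (\<Sum>k\<in>G. measure B (A \<inter> {\<omega>\<in>space B. K \<omega> = k}))"
      proof (intro sum.cong refl)
        fix k assume k: "k \<in> G"
        have "measure B (A \<inter> {\<omega>\<in>space B. K \<omega> = k}) \<le> p k"
          unfolding p_def by (rule B.finite_measure_mono) (use Km in auto)
        then show "(\<Sum>g\<in>G. \<gamma> g k) / p k * measure B (A \<inter> {\<omega>\<in>space B. K \<omega> = k}) = measure B (A \<inter> {\<omega>\<in>space B. K \<omega> = k})"
          unfolding \<gamma>(3)[OF k] using measure_nonneg[of B "A \<inter> {\<omega>\<in>space B. K \<omega> = k}"] by (cases "p k = 0") auto
      qed
      finally show ?thesis using slice[OF A] by simp
    qed
    have "p' g * measure (\<rho> g) {\<omega>\<in>space B. K \<omega> \<noteq> g} = p' g - \<gamma> g g" if g: "g \<in> G" for g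
    proof -
      have "{\<omega>\<in>space B. K \<omega> \<noteq> g} = space B - {\<omega>\<in>space B. K \<omega> = g}" by auto
      then have s: "{\<omega>\<in>space B. K \<omega> \<noteq> g} \<in> sets B" using Km[of g] by simp
      have "p' g * measure (\<rho> g) {\<omega>\<in>space B. K \<omega> \<noteq> g} = (\<Sum>k\<in>G. if k = g then 0 else \<gamma> g k)"
        unfolding me[OF s g]
      proof (intro sum.cong refl)
        fix k assume k: "k \<in> G"
        show "\<gamma> g k / p k * measure B ({\<omega>\<in>space B. K \<omega> \<noteq> g} \<inter> {\<omega>\<in>space B. K \<omega> = k}) = (if k = g then 0 else \<gamma> g k)"
        proof (cases "k = g")
          case True
          then have "{\<omega>\<in>space B. K \<omega> \<noteq> g} \<inter> {\<omega>\<in>space B. K \<omega> = k} = {}" by auto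
          with True show ?thesis by simp
        next
          case False
          then show ?thesis using full[of k "\<lambda>\<omega>. K \<omega> \<noteq> g"] cancel[OF g k] by simp
        qed
      qed
      also have "\<dots> = (\<Sum>k\<in>G - {g}. \<gamma> g k)" using G(1) by (intro sum.mono_neutral_cong_right) auto
      also have "\<dots> = p' g - \<gamma> g g" using \<gamma>(2)[OF g] sum.remove[OF G(1) g, of "\<gamma> g"] by simp
      finally show ?thesis .
    qed
    then have "(\<Sum>g\<in>G. p' g * measure (\<rho> g) {\<omega>\<in>space B. K \<omega> \<noteq> g}) = (\<Sum>g\<in>G. p' g - \<gamma> g g)" by simp
    with \<gamma>(4) show "(\<Sum>g\<in>G. p' g * measure (\<rho> g) {\<omega>\<in>space B. K \<omega> \<noteq> g}) \<le> (\<Sum>g\<in>G. \<bar>p' g - measure B {\<omega>\<in>space B. K \<omega> = g}\<bar>)"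
      by (simp add: p_def)
  qed
qed

abbreviation sample_space :: "sample measure" where
  "sample_space \<equiv> (\<Pi>\<^sub>M n\<in>UNIV. borel) \<Otimes>\<^sub>M (\<Pi>\<^sub>M n\<in>UNIV. borel \<Otimes>\<^sub>M borel)"

lemma sets_base: "sets (base \<mu>) = sets sample_space"
  unfolding base_def by (intro sets_pair_measure_cong sets_PiM_cong) simp_all

text \<open>A sequence of samples is coded in one sequence of reals, as the common probability space consists of such sequences.
  The three tags \<open>0\<close>, \<open>1\<close>, \<open>2\<close> separate the components of a sample.\<close>
definition decode :: "(nat \<Rightarrow> real) \<Rightarrow> nat \<Rightarrow> sample" where
  "decode v a = ((\<lambda>i. v (prod_encode (a, prod_encode (0, i)))),
     (\<lambda>i. (v (prod_encode (a, prod_encode (1, i))), v (prod_encode (a, prod_encode (2, i))))))"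

definition encode :: "(nat \<Rightarrow> sample) \<Rightarrow> nat \<Rightarrow> real" where
  "encode w j = (let (a, j') = prod_decode j; (b, i) = prod_decode j' in
     if b = 0 then fst (w a) i else if b = 1 then fst (snd (w a) i) else snd (snd (w a) i))"

lemma decode_encode: "decode (encode w) = w"
  by (simp add: fun_eq_iff decode_def encode_def prod_eq_iff)

lemma decode_measurable:
  "decode \<in> measurable (\<Pi>\<^sub>M n\<in>UNIV. borel) (\<Pi>\<^sub>M n\<in>(UNIV :: nat set). sample_space)"
proof (rule measurable_PiM_single')
  fix a :: nat
  show "(\<lambda>v. decode v a) \<in> measurable (\<Pi>\<^sub>M n\<in>UNIV. borel) sample_space"
    unfolding decode_def
    by (intro measurable_Pair measurable_PiM_single') (auto simp: space_PiM space_pair_measure)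
qed (auto simp: space_PiM space_pair_measure)

lemma encode_measurable:
  "encode \<in> measurable (\<Pi>\<^sub>M n\<in>(UNIV :: nat set). sample_space) (\<Pi>\<^sub>M n\<in>UNIV. borel)"
proof (rule measurable_PiM_single')
  fix j :: nat
  obtain a j' where j: "prod_decode j = (a, j')" by (cases "prod_decode j")
  obtain b i where j': "prod_decode j' = (b, i)" by (cases "prod_decode j'")
  have a: "(\<lambda>w. w a) \<in> measurable (\<Pi>\<^sub>M n\<in>(UNIV :: nat set). sample_space) sample_space" by measurable
  have 1: "(\<lambda>s. fst s i) \<in> borel_measurable sample_space" by measurable
  have c: "(\<lambda>s. snd s i) \<in> measurable sample_space (borel \<Otimes>\<^sub>M borel)" by measurable
  have 2: "(\<lambda>s. fst (snd s i)) \<in> borel_measurable sample_space" by (rule measurable_compose[OF c measurable_fst])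
  have 3: "(\<lambda>s. snd (snd s i)) \<in> borel_measurable sample_space" by (rule measurable_compose[OF c measurable_snd])
  show "(\<lambda>w. encode w j) \<in> borel_measurable (\<Pi>\<^sub>M n\<in>(UNIV :: nat set). sample_space)"
    unfolding encode_def j j' Let_def prod.case
    using measurable_compose[OF a 1] measurable_compose[OF a 2] measurable_compose[OF a 3] by simp
qed (auto simp: space_PiM)

text \<open>All couplings with the same sample of \<open>M0\<close> are realized together. The product space contains a sample of
  \<open>M0\<close> and, for each \<open>n\<close> and each value \<open>g\<close>, an independent sample of the conditional law \<open>\<rho> n g\<close>; the value
  \<open>K' n\<close> of the first sample decides which of them becomes the \<open>n\<close>-th process. Hence no
  regular conditional probabilities are needed.\<close>
theorem gluing:
  fixes M0 :: "sample measure" and B :: "nat \<Rightarrow> sample measure" and K K' :: "nat \<Rightarrow> sample \<Rightarrow> nat"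
  assumes M0: "prob_space M0" "sets M0 = sets sample_space"
    and B: "\<And>n. prob_space (B n)" "\<And>n. sets (B n) = sets sample_space"
    and K': "\<And>n. K' n \<in> measurable M0 (count_space UNIV)" and K: "\<And>n. K n \<in> measurable (B n) (count_space UNIV)"
    and G: "\<And>n. finite (G n)" "\<And>n \<omega>. K' n \<omega> \<in> G n" "\<And>n \<omega>. K n \<omega> \<in> G n"
  obtains M :: "(nat \<Rightarrow> real) measure" and F0 F where "prob_space M"
    and "F0 \<in> measurable M M0" "distr M M0 F0 = M0"
    and "\<And>n. F n \<in> measurable M (B n)" "\<And>n. distr M (B n) (F n) = B n"
    and "\<And>n. measure M {\<omega>\<in>space M. K n (F n \<omega>) \<noteq> K' n (F0 \<omega>)} \<le>
      (\<Sum>g\<in>G n. \<bar>measure M0 {\<omega>\<in>space M0. K' n \<omega> = g} - measure (B n) {\<omega>\<in>space (B n). K n \<omega> = g}\<bar>)"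
proof -
  interpret M0: prob_space M0 by (rule M0)
  have spM0: "space M0 = UNIV" using sets_eq_imp_space_eq[OF M0(2)] by (simp add: space_pair_measure space_PiM)
  have spB: "space (B n) = UNIV" for n using sets_eq_imp_space_eq[OF B(2)] by (simp add: space_pair_measure space_PiM)
  define p' where "p' n g = measure M0 {\<omega>\<in>space M0. K' n \<omega> = g}" for n g
  have K'm: "{\<omega>\<in>space M0. K' n \<omega> = g} \<in> sets M0" for n g
    using measurable_sets[OF K', of "{g}" n] by (simp add: vimage_def Int_def conj_commute)
  have p'sum: "sum (p' n) (G n) = 1" for n
  proof -
    have "measure M0 (\<Union>g\<in>G n. {\<omega>\<in>space M0. K' n \<omega> = g}) = (\<Sum>g\<in>G n. p' n g)"
      unfolding p'_def by (rule M0.finite_measure_finite_Union) (use G K'm in \<open>auto simp: disjoint_family_on_def\<close>)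
    moreover have "(\<Union>g\<in>G n. {\<omega>\<in>space M0. K' n \<omega> = g}) = space M0" using G(2) by auto
    ultimately show ?thesis by (simp add: M0.prob_space)
  qed
  define fits where "fits n \<rho> \<longleftrightarrow> (\<forall>g. prob_space (\<rho> g) \<and> sets (\<rho> g) = sets (B n)) \<and>
      (\<forall>A\<in>sets (B n). (\<Sum>g\<in>G n. p' n g * measure (\<rho> g) A) = measure (B n) A) \<and>
      (\<Sum>g\<in>G n. p' n g * measure (\<rho> g) {\<omega>\<in>space (B n). K n \<omega> \<noteq> g}) \<le> (\<Sum>g\<in>G n. \<bar>p' n g - measure (B n) {\<omega>\<in>space (B n). K n \<omega> = g}\<bar>)" for n \<rho>
  have "\<exists>\<rho>. fits n \<rho>" for n
  proof -
    have p0: "0 \<le> p' n g" for g by (simp add: p'_def)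
    have GK: "K n \<omega> \<in> G n" if "\<omega> \<in> space (B n)" for \<omega> by (rule G(3))
    obtain \<rho> where "\<And>g. prob_space (\<rho> g)" "\<And>g. sets (\<rho> g) = sets (B n)"
      "\<And>A. A \<in> sets (B n) \<Longrightarrow> (\<Sum>g\<in>G n. p' n g * measure (\<rho> g) A) = measure (B n) A"
      "(\<Sum>g\<in>G n. p' n g * measure (\<rho> g) {\<omega>\<in>space (B n). K n \<omega> \<noteq> g}) \<le> (\<Sum>g\<in>G n. \<bar>p' n g - measure (B n) {\<omega>\<in>space (B n). K n \<omega> = g}\<bar>)"
      using reweighting[OF B(1)[of n] K[of n] G(1)[of n] GK p0 p'sum[of n]] by blast
    then have "fits n \<rho>" unfolding fits_def by blast
    then show ?thesis by blast
  qed
  then have "\<forall>n. \<exists>\<rho>. fits n \<rho>" by blast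
  from choice[OF this] obtain \<rho> where fits: "\<And>n. fits n (\<rho> n)" by blast
  have \<rho>: "prob_space (\<rho> n g)" "sets (\<rho> n g) = sets (B n)"
      "A \<in> sets (B n) \<Longrightarrow> (\<Sum>g\<in>G n. p' n g * measure (\<rho> n g) A) = measure (B n) A"
      "(\<Sum>g\<in>G n. p' n g * measure (\<rho> n g) {\<omega>\<in>space (B n). K n \<omega> \<noteq> g}) \<le> (\<Sum>g\<in>G n. \<bar>p' n g - measure (B n) {\<omega>\<in>space (B n). K n \<omega> = g}\<bar>)" for n g A
    using fits[of n] unfolding fits_def by blast+
  \<comment> \<open>coordinate \<open>0\<close> carries \<open>M0\<close>, the other coordinates enumerate the pairs \<open>(n, g)\<close>\<close>
  define \<Omega> where "\<Omega> i = (case i of 0 \<Rightarrow> M0 | Suc j \<Rightarrow> case prod_decode j of (n, g) \<Rightarrow> \<rho> n g)" for i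
  have \<Omega>p: "prob_space (\<Omega> i)" and \<Omega>s: "sets (\<Omega> i) = sets sample_space" for i
    using \<rho>(1,2) B(2) M0 by (auto simp: \<Omega>_def split: nat.split prod.split)
  interpret \<Omega>: product_prob_space \<Omega> "UNIV :: nat set" by (rule product_prob_spaceI) (rule \<Omega>p)
  let ?P = "\<Pi>\<^sub>M i\<in>UNIV. \<Omega> i"
  have \<Omega>0: "\<Omega> 0 = M0" by (simp add: \<Omega>_def)
  have \<Omega>1: "\<Omega> (Suc (prod_encode (n, g))) = \<rho> n g" for n g by (simp add: \<Omega>_def)
  have sP: "sets ?P = sets (\<Pi>\<^sub>M n\<in>(UNIV :: nat set). sample_space)" by (rule sets_PiM_cong) (simp_all add: \<Omega>s)
  have spP: "space ?P = UNIV" using sets_eq_imp_space_eq[OF sP] by (simp add: space_PiM space_pair_measure)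
  define M where "M = distr ?P (\<Pi>\<^sub>M n\<in>UNIV. borel) encode"
  have enc: "encode \<in> measurable ?P (\<Pi>\<^sub>M n\<in>UNIV. borel)"
    using encode_measurable by (simp add: measurable_cong_sets[OF sP refl])
  have dec: "decode \<in> measurable M ?P"
    using decode_measurable by (simp add: M_def measurable_cong_sets[OF refl sP])
  have Mp: "prob_space M" unfolding M_def by (rule \<Omega>.P.prob_space_distr[OF enc])
  have dM: "distr M ?P decode = ?P"
  proof -
    have "distr M ?P decode = distr ?P ?P (decode \<circ> encode)"
      unfolding M_def by (rule distr_distr) (use dec enc in \<open>simp_all add: M_def\<close>)
    also have "decode \<circ> encode = (\<lambda>w. w)" by (simp add: fun_eq_iff decode_encode)
    finally show ?thesis by (simp add: distr_id2)
  qed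
  define f0 where "f0 w = w (0 :: nat)" for w :: "nat \<Rightarrow> sample"
  define f where "f n w = w (Suc (prod_encode (n, K' n (w 0))))" for n and w :: "nat \<Rightarrow> sample"
  have co: "(\<lambda>w. w i) \<in> measurable ?P (\<Omega> i)" for i by (rule measurable_component_singleton) simp
  have f0m: "f0 \<in> measurable ?P M0" using co[of 0] unfolding \<Omega>0 f0_def .
  have K'c: "(\<lambda>w. K' n (w 0)) \<in> measurable ?P (count_space UNIV)" for n
    using measurable_compose[OF f0m K'] by (simp add: f0_def)
  have fm: "f n \<in> measurable ?P (B n)" for n
    unfolding f_def
  proof (rule measurable_compose_countable[where f = "\<lambda>g w. w (Suc (prod_encode (n, g)))", OF _ K'c])
    show "(\<lambda>w. w (Suc (prod_encode (n, g)))) \<in> measurable ?P (B n)" for g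
      using co[of "Suc (prod_encode (n, g))"] unfolding \<Omega>1 by (simp add: measurable_cong_sets[OF refl \<rho>(2)])
  qed
  have d0: "distr ?P M0 f0 = M0"
  proof -
    have "distr ?P (\<Omega> 0) (\<lambda>w. w 0) = \<Omega> 0" by (rule distr_PiM_component) (simp_all add: \<Omega>p)
    then show ?thesis by (simp add: \<Omega>0 f0_def[abs_def])
  qed
  have two: "measure ?P {w. K' n (w 0) = g \<and> w (Suc (prod_encode (n, g))) \<in> A} = p' n g * measure (\<rho> n g) A"
    if A: "A \<in> sets (B n)" for n g A
  proof -
    let ?j = "Suc (prod_encode (n, g))"
    let ?E = "\<lambda>i. if i = 0 then {\<omega>\<in>space M0. K' n \<omega> = g} else A"
    have "measure ?P (prod_emb UNIV \<Omega> {0, ?j} (Pi\<^sub>E {0, ?j} ?E)) = (\<Prod>i\<in>{0, ?j}. measure (\<Omega> i) (?E i))"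
      by (rule \<Omega>.measure_PiM_emb) (use A K'm \<Omega>0 \<Omega>1 \<rho>(2) in auto)
    moreover have "prod_emb UNIV \<Omega> {0, ?j} (Pi\<^sub>E {0, ?j} ?E) = {w. K' n (w 0) = g \<and> w ?j \<in> A}"
      using spP by (auto simp: prod_emb_def space_PiM spM0 PiE_iff)
    ultimately show ?thesis by (simp add: \<Omega>0 \<Omega>1 p'_def)
  qed
  have slice: "measure ?P {w. K' n (w 0) \<in> G n \<and> (\<exists>g\<in>G n. K' n (w 0) = g \<and> w (Suc (prod_encode (n, g))) \<in> A g)}
      = (\<Sum>g\<in>G n. p' n g * measure (\<rho> n g) (A g))" if A: "\<And>g. A g \<in> sets (B n)" for n A
  proof -
    have m: "{w. K' n (w 0) = g \<and> w (Suc (prod_encode (n, g))) \<in> A g} \<in> sets ?P" for g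
    proof -
      have "(\<lambda>w. K' n (w 0)) -` {g} \<inter> space ?P \<in> sets ?P" by (rule measurable_sets[OF K'c]) simp
      moreover have "(\<lambda>w. w (Suc (prod_encode (n, g)))) -` A g \<inter> space ?P \<in> sets ?P"
        by (rule measurable_sets[OF co]) (use A \<Omega>1 \<rho>(2) in simp)
      ultimately have "((\<lambda>w. K' n (w 0)) -` {g} \<inter> space ?P) \<inter> ((\<lambda>w. w (Suc (prod_encode (n, g)))) -` A g \<inter> space ?P) \<in> sets ?P"
        by (rule sets.Int)
      then show ?thesis by (simp add: spP vimage_def Int_def)
    qed
    have "measure ?P (\<Union>g\<in>G n. {w. K' n (w 0) = g \<and> w (Suc (prod_encode (n, g))) \<in> A g}) =
        (\<Sum>g\<in>G n. measure ?P {w. K' n (w 0) = g \<and> w (Suc (prod_encode (n, g))) \<in> A g})"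
      by (rule \<Omega>.P.finite_measure_finite_Union) (use G m in \<open>auto simp: disjoint_family_on_def\<close>)
    moreover have "(\<Union>g\<in>G n. {w. K' n (w 0) = g \<and> w (Suc (prod_encode (n, g))) \<in> A g}) =
        {w. K' n (w 0) \<in> G n \<and> (\<exists>g\<in>G n. K' n (w 0) = g \<and> w (Suc (prod_encode (n, g))) \<in> A g)}" by auto
    ultimately show ?thesis by (simp add: two[OF A])
  qed
  have d1: "distr ?P (B n) (f n) = B n" for n
  proof (rule measure_eqI)
    fix A assume "A \<in> sets (distr ?P (B n) (f n))"
    then have A: "A \<in> sets (B n)" by simp
    interpret Bn: prob_space "B n" by (rule B)
    have "emeasure (distr ?P (B n) (f n)) A = emeasure ?P (f n -` A \<inter> space ?P)" by (rule emeasure_distr[OF fm A])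
    also have "f n -` A \<inter> space ?P = {w. K' n (w 0) \<in> G n \<and> (\<exists>g\<in>G n. K' n (w 0) = g \<and> w (Suc (prod_encode (n, g))) \<in> A)}"
      using G(2) by (auto simp: f_def spP)
    finally show "emeasure (distr ?P (B n) (f n)) A = emeasure (B n) A"
      using slice[of "\<lambda>_. A" n, OF A] \<rho>(3)[OF A] by (simp add: \<Omega>.P.emeasure_eq_measure Bn.emeasure_eq_measure)
  qed simp
  have Kne: "{\<omega>\<in>space (B n). K n \<omega> \<noteq> g} \<in> sets (B n)" for n g
    using measurable_sets[OF K, of "- {g}" n] by (simp add: vimage_def Int_def conj_commute)
  have dist: "measure ?P {w\<in>space ?P. K n (f n w) \<noteq> K' n (f0 w)} = (\<Sum>g\<in>G n. p' n g * measure (\<rho> n g) {\<omega>\<in>space (B n). K n \<omega> \<noteq> g})" for n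
  proof -
    have "{w\<in>space ?P. K n (f n w) \<noteq> K' n (f0 w)} =
      {w. K' n (w 0) \<in> G n \<and> (\<exists>g\<in>G n. K' n (w 0) = g \<and> w (Suc (prod_encode (n, g))) \<in> {\<omega>\<in>space (B n). K n \<omega> \<noteq> g})}"
      using G(2) by (auto simp: f_def f0_def spP spB)
    then show ?thesis using slice[of "\<lambda>g. {\<omega>\<in>space (B n). K n \<omega> \<noteq> g}" n, OF Kne] by simp
  qed
  show ?thesis
  proof (rule that[of M "\<lambda>v. f0 (decode v)" "\<lambda>n v. f n (decode v)"])
    show "prob_space M" by (rule Mp)
    show "(\<lambda>v. f0 (decode v)) \<in> measurable M M0" by (rule measurable_compose[OF dec f0m])
    show "(\<lambda>v. f n (decode v)) \<in> measurable M (B n)" for n by (rule measurable_compose[OF dec fm])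
    show "distr M M0 (\<lambda>v. f0 (decode v)) = M0"
      using distr_distr[OF f0m dec] by (simp add: dM d0 comp_def)
    show "distr M (B n) (\<lambda>v. f n (decode v)) = B n" for n
      using distr_distr[OF fm dec] by (simp add: dM d1 comp_def)
    show "measure M {\<omega>\<in>space M. K n (f n (decode \<omega>)) \<noteq> K' n (f0 (decode \<omega>))} \<le>
      (\<Sum>g\<in>G n. \<bar>measure M0 {\<omega>\<in>space M0. K' n \<omega> = g} - measure (B n) {\<omega>\<in>space (B n). K n \<omega> = g}\<bar>)" for n
    proof -
      let ?A = "{w\<in>space ?P. K n (f n w) \<noteq> K' n (f0 w)}"
      have kf: "(\<lambda>w. K n (f n w)) \<in> measurable ?P (count_space UNIV)" by (rule measurable_compose[OF fm K])
      have kf0: "(\<lambda>w. K' n (f0 w)) \<in> measurable ?P (count_space UNIV)" by (rule measurable_compose[OF f0m K'])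
      have "?A \<in> sets ?P" using kf kf0 by measurable
      from measure_preserving_measure[OF dec dM this]
      have "measure M {\<omega>\<in>space M. decode \<omega> \<in> ?A} = measure ?P ?A" .
      moreover have "{\<omega>\<in>space M. decode \<omega> \<in> ?A} = {\<omega>\<in>space M. K n (f n (decode \<omega>)) \<noteq> K' n (f0 (decode \<omega>))}"
        by (auto simp: spP)
      ultimately show ?thesis using dist[of n] \<rho>(4)[of n] by (simp add: p'_def)
    qed
  qed
qed

section \<open>Norms and suprema\<close>

text \<open>Expansion in the standard basis.\<close>
lemma is_norm_bound:
  fixes nrm :: "real^'d \<Rightarrow> real"
  assumes "is_norm nrm"
  obtains C where "0 < C" "\<And>v. nrm v \<le> C * norm v"
proof -
  have nn: "0 \<le> nrm v" and sc: "nrm (c *\<^sub>R v) = \<bar>c\<bar> * nrm v" and tri: "nrm (v + w) \<le> nrm v + nrm w" and z: "nrm 0 = 0" for c v w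
    using assms by (auto simp: is_norm_def)
  have sum_le: "nrm (\<Sum>i\<in>I. f i) \<le> (\<Sum>i\<in>I. nrm (f i))" if "finite I" for I and f :: "'d \<Rightarrow> real^'d"
    using that
  proof (induction I rule: finite_induct)
    case (insert i I)
    then show ?case using tri[of "f i" "\<Sum>i\<in>I. f i"] by simp
  qed (simp add: z)
  define C where "C = 1 + (\<Sum>i\<in>UNIV. nrm (axis i 1))"
  have C: "0 < C" unfolding C_def by (intro add_pos_nonneg sum_nonneg nn) simp
  have "nrm v \<le> C * norm v" for v
  proof -
    have "v = (\<Sum>i\<in>UNIV. v $ i *\<^sub>R axis i 1)" using basis_expansion[of v] by (simp add: scalar_mult_eq_scaleR)
    then have "nrm v \<le> (\<Sum>i\<in>UNIV. nrm (v $ i *\<^sub>R axis i 1))" by (metis sum_le finite)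
    also have "\<dots> \<le> (\<Sum>i\<in>UNIV. norm v * nrm (axis i 1))"
      unfolding sc by (intro sum_mono mult_right_mono nn component_le_norm_cart)
    also have "\<dots> \<le> C * norm v" unfolding sum_distrib_left[symmetric] C_def by (simp add: algebra_simps)
    finally show ?thesis .
  qed
  with C show ?thesis by (rule that)
qed

lemma is_norm_continuous:
  fixes nrm :: "real^'d \<Rightarrow> real"
  assumes "is_norm nrm" shows "continuous_on X nrm"
proof -
  obtain C where C: "0 < C" "\<And>v. nrm v \<le> C * norm v" by (rule is_norm_bound[OF assms]) (rule that, assumption+)
  have tri: "nrm (v + w) \<le> nrm v + nrm w" for v w using assms by (auto simp: is_norm_def)
  have le: "nrm v - nrm w \<le> C * dist v w" for v w
    using tri[of "v - w" w] C(2)[of "v - w"] by (simp add: dist_norm)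
  have lip: "C-lipschitz_on X nrm"
  proof (rule lipschitz_onI)
    fix v w show "dist (nrm v) (nrm w) \<le> C * dist v w"
      using le[of v w] le[of w v] by (simp add: dist_real_def dist_commute)
  qed (use C in simp)
  then show ?thesis by (rule lipschitz_on_continuous_on)
qed

text \<open>By continuity the rational times suffice.\<close>
lemma SUP_exceeds_iff:
  fixes \<phi> :: "real \<Rightarrow> real"
  assumes T: "0 < T" and cont: "continuous_on {0..T} \<phi>"
  shows "(SUP t\<in>{0..T}. \<phi> t) > \<delta> \<longleftrightarrow> (\<exists>q\<in>{0<..<T} \<inter> \<rat>. \<phi> q > \<delta>)"
proof
  assume "(SUP t\<in>{0..T}. \<phi> t) > \<delta>"
  then have gt: False if "\<forall>t\<in>{0..T}. \<phi> t \<le> \<delta>"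
  proof -
    have "(SUP t\<in>{0..T}. \<phi> t) \<le> \<delta>" using T that by (intro cSUP_least) auto
    with \<open>(SUP t\<in>{0..T}. \<phi> t) > \<delta>\<close> show False by simp
  qed
  show "\<exists>q\<in>{0<..<T} \<inter> \<rat>. \<phi> q > \<delta>"
  proof (rule ccontr)
    assume "\<not> ?thesis"
    then have le: "\<And>q. q \<in> {0<..<T} \<inter> \<rat> \<Longrightarrow> \<phi> q \<le> \<delta>" by (auto simp: not_less)
    have "{0<..<T} \<subseteq> closure ({0<..<T} \<inter> \<rat>)"
      using open_Int_closure_subset[of "{0<..<T}" "\<rat>"] by (simp add: Rats_closure_real)
    then have "closure {0<..<T} \<subseteq> closure ({0<..<T} \<inter> \<rat>)" by (simp add: closure_minimal)
    moreover have cl: "closure {0<..<T} = {0..T}" using T by simp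
    moreover have "closure ({0<..<T} \<inter> \<rat>) \<subseteq> closure {0<..<T}" by (rule closure_mono) auto
    ultimately have eq: "closure ({0<..<T} \<inter> \<rat>) = {0..T}" by auto
    have "\<phi> t \<le> \<delta>" if "t \<in> {0..T}" for t
      by (rule continuous_le_on_closure[of "{0<..<T} \<inter> \<rat>" \<phi>]) (use eq cont that le in auto)
    with gt show False by blast
  qed
next
  assume "\<exists>q\<in>{0<..<T} \<inter> \<rat>. \<phi> q > \<delta>"
  then obtain q where "q \<in> {0<..<T}" "\<delta> < \<phi> q" by auto
  then have q: "q \<in> {0..T}" "\<delta> < \<phi> q" by auto
  have "bdd_above (\<phi> ` {0..T})"
    by (intro bounded_imp_bdd_above compact_imp_bounded compact_continuous_image cont compact_Icc)
  then have "\<phi> q \<le> (SUP t\<in>{0..T}. \<phi> t)" using q(1) by (intro cSUP_upper)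
  with q show "(SUP t\<in>{0..T}. \<phi> t) > \<delta>" by simp
qed

lemma SUP_exceeds_measurable:
  fixes T :: real
  assumes T: "0 < T" and cont: "\<And>\<omega>. \<omega> \<in> space M \<Longrightarrow> continuous_on {0..T} (\<lambda>t. \<phi> t \<omega> :: real)"
    and m: "\<And>t. 0 \<le> t \<Longrightarrow> \<phi> t \<in> borel_measurable M"
  shows "{\<omega>\<in>space M. (SUP t\<in>{0..T}. \<phi> t \<omega>) > \<delta>} \<in> sets M"
proof -
  have "{\<omega>\<in>space M. (SUP t\<in>{0..T}. \<phi> t \<omega>) > \<delta>} = (\<Union>q\<in>{0<..<T} \<inter> \<rat>. {\<omega>\<in>space M. \<phi> q \<omega> > \<delta>})"
    using SUP_exceeds_iff[OF T cont] by auto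
  also have "\<dots> \<in> sets M"
  proof (rule sets.countable_UN'')
    show "countable ({0<..<T} \<inter> \<rat>)" using countable_rat by (rule countable_subset[rotated]) auto
    show "{\<omega>\<in>space M. \<phi> q \<omega> > \<delta>} \<in> sets M" if "q \<in> {0<..<T} \<inter> \<rat>" for q
    proof -
      have [measurable]: "\<phi> q \<in> borel_measurable M" by (rule m) (use that in auto)
      show ?thesis by measurable
    qed
  qed
  finally show ?thesis .
qed

section \<open>Closeness of trajectories\<close>

text \<open>The deterministic estimate, applied to two samples of base spaces.\<close>
lemma trajectories_close:
  fixes A B :: "nat \<Rightarrow> real^'d^'d"
  assumes t: "0 \<le> t" "t \<le> T" and K: "0 \<le> K" and \<epsilon>: "0 \<le> \<epsilon>" and N: "1 \<le> N" and k: "1 \<le> k"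
    and A: "\<And>l v. l \<in> {1..N} \<Longrightarrow> norm (A l *v v) \<le> K * norm v"
    and BK: "\<And>j v. j \<in> {1..k} \<Longrightarrow> norm (B j *v v) \<le> K * norm v"
    and B: "\<And>j. j \<in> {1..k} \<Longrightarrow> B j = (\<Sum>l\<in>{1..N}. p j l *\<^sub>R A l)"
    and close: "\<And>s l. s \<in> {0..T} \<Longrightarrow> l \<in> {1..N} \<Longrightarrow>
      \<bar>occupation (chain_from N \<nu> P (fst \<omega>)) (hold (snd \<omega>)) l s
        - (\<Sum>j\<in>{1..k}. occupation (chain_from k \<nu>' P' (fst \<omega>')) (hold (snd \<omega>')) j s * p j l)\<bar> \<le> \<epsilon>"
  shows "norm (trajectory A N \<nu> P x0 t \<omega> - trajectory B k \<nu>' P' x0 t \<omega>')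
    \<le> \<epsilon> * (real N * K * (2 * K + 1) * (exp ((2 * K + 1) * T))\<^sup>2 * norm x0)"
proof -
  let ?F = "(range (jump_time (hold (snd \<omega>))) \<inter> {..T}) \<union> (range (jump_time (hold (snd \<omega>'))) \<inter> {..T})"
  have sub: "{0..T} \<subseteq> {0..}" by auto
  show ?thesis
  proof (rule solutions_close_if_occupations_close[where F = ?F and \<sigma> = "\<lambda>t. switching N \<nu> P t \<omega>" and \<sigma>' = "\<lambda>t. switching k \<nu>' P' t \<omega>'"
        and q = "occupation (chain_from N \<nu> P (fst \<omega>)) (hold (snd \<omega>))" and q' = "occupation (chain_from k \<nu>' P' (fst \<omega>')) (hold (snd \<omega>'))" and p = p and A = A and B = B and k = k,
        OF _ t K \<epsilon> _ _ _ _ _ _ _ _ A BK B _ _ _ _ _ _ close])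
    show "finite ?F" by (intro finite_UnI finite_jump_times) simp_all
    show "continuous_on {0..T} (\<lambda>t. trajectory A N \<nu> P x0 t \<omega>)" "continuous_on {0..T} (\<lambda>t. trajectory B k \<nu>' P' x0 t \<omega>')"
      by (rule continuous_on_subset[OF trajectory_continuous sub])+
    show "trajectory A N \<nu> P x0 0 \<omega> = x0" "trajectory B k \<nu>' P' x0 0 \<omega>' = x0" by (rule trajectory_0)+
    show "switching N \<nu> P s \<omega> \<in> {1..N}" "switching k \<nu>' P' s \<omega>' \<in> {1..k}" for s
      unfolding switching_def by (rule chain_from_range[OF N], rule chain_from_range[OF k])
    show "continuous_on {0..T} (occupation (chain_from N \<nu> P (fst \<omega>)) (hold (snd \<omega>)) l)"
      "continuous_on {0..T} (occupation (chain_from k \<nu>' P' (fst \<omega>')) (hold (snd \<omega>')) l)" for l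
      by (rule continuous_on_subset[OF occupation_continuous sub], simp)+
    show "occupation (chain_from N \<nu> P (fst \<omega>)) (hold (snd \<omega>)) l 0 = 0"
      "occupation (chain_from k \<nu>' P' (fst \<omega>')) (hold (snd \<omega>')) l 0 = 0" for l
      by (rule occupation_0, simp)+
    fix s assume s: "s \<in> {0..T} - ?F"
    then have s0: "0 \<le> s" and j1: "s \<notin> range (jump_time (hold (snd \<omega>)))" and j2: "s \<notin> range (jump_time (hold (snd \<omega>')))" by auto
    show "((\<lambda>t. trajectory A N \<nu> P x0 t \<omega>) has_vector_derivative A (switching N \<nu> P s \<omega>) *v trajectory A N \<nu> P x0 s \<omega>) (at s)"
      by (rule trajectory_derivative[OF s0 j1])
    show "((\<lambda>t. trajectory B k \<nu>' P' x0 t \<omega>') has_vector_derivative B (switching k \<nu>' P' s \<omega>') *v trajectory B k \<nu>' P' x0 s \<omega>') (at s)"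
      by (rule trajectory_derivative[OF s0 j2])
    show "(occupation (chain_from N \<nu> P (fst \<omega>)) (hold (snd \<omega>)) l has_real_derivative of_bool (switching N \<nu> P s \<omega> = l)) (at s)"
      "(occupation (chain_from k \<nu>' P' (fst \<omega>')) (hold (snd \<omega>')) l has_real_derivative of_bool (switching k \<nu>' P' s \<omega>' = l)) (at s)" for l
      unfolding switching_def by (rule occupation_derivative[OF admissible_hold s0 j1], rule occupation_derivative[OF admissible_hold s0 j2])
  qed
qed

lemma path_exp_sum:
  "path_exp N J m (\<lambda>l. \<Sum>x\<in>X. F x l) i = (\<Sum>x\<in>X. path_exp N J m (F x) i)"
proof (induction m arbitrary: F i)
  case (Suc m)
  show ?case unfolding path_exp.simps Suc.IH sum_distrib_left by (rule sum.swap)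
qed simp

context limit_chain
begin

text \<open>Lists of observed states for which the knowledge of the classes alone does not predict the numbers of visits up to an error
  \<open>\<eta>\<close>.\<close>
definition atypical :: "real \<Rightarrow> nat list set" where
  "atypical \<eta> = {l. \<exists>x\<in>{1..N}. \<exists>a\<le>length l. \<eta> \<le> \<bar>\<Sum>q<a. of_bool (l ! q = x) - class_mean (cls (l ! q)) x\<bar>}"

text \<open>The martingale inequality for each of the \<open>N\<close> states.\<close>
lemma atypical_unlikely:
  assumes J: "stochastic_matrix N (JJ c)" and \<eta>: "0 < \<eta>" and i: "i \<in> {1..N}"
  shows "path_exp N (JJ c) m (\<lambda>l. of_bool (l \<in> atypical \<eta>)) i \<le> real N * real m / \<eta>\<^sup>2"
proof -
  let ?g = "\<lambda>x j. of_bool (j = x) - class_mean (cls j) x :: real"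
  let ?F = "\<lambda>x l. of_bool (\<exists>a\<le>length l. \<eta> \<le> \<bar>0 + (\<Sum>q<a. ?g x (l ! q))\<bar>) :: real"
  have "path_exp N (JJ c) m (\<lambda>l. of_bool (l \<in> atypical \<eta>)) i \<le> path_exp N (JJ c) m (\<lambda>l. \<Sum>x\<in>{1..N}. ?F x l) i"
  proof (rule path_exp_mono[OF J i])
    fix l :: "nat list"
    show "of_bool (l \<in> atypical \<eta>) \<le> (\<Sum>x\<in>{1..N}. ?F x l)"
    proof (cases "l \<in> atypical \<eta>")
      case True
      then obtain x where x: "x \<in> {1..N}" "?F x l = 1" by (auto simp: atypical_def simp del: atLeastAtMost_iff)
      have "?F x l \<le> (\<Sum>x\<in>{1..N}. ?F x l)" by (rule member_le_sum) (use x in auto)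
      with x True show ?thesis by simp
    next
      case False
      have "0 \<le> (\<Sum>x\<in>{1..N}. ?F x l)" by (rule sum_nonneg) simp
      with False show ?thesis by simp
    qed
  qed
  also have "\<dots> = (\<Sum>x\<in>{1..N}. path_exp N (JJ c) m (?F x) i)" by (rule path_exp_sum)
  also have "\<dots> \<le> (\<Sum>x\<in>{1..N}. (0\<^sup>2 + real m) / \<eta>\<^sup>2)"
  proof (rule sum_mono)
    fix x assume x: "x \<in> {1..N}"
    show "path_exp N (JJ c) m (?F x) i \<le> (0\<^sup>2 + real m) / \<eta>\<^sup>2"
    proof (rule path_exp_maximal[OF J _ _ \<eta> i])
      show "\<bar>?g x j\<bar> \<le> 1" for j using class_mean_bounds[OF x, of "cls j"] by (cases "j = x") auto
      show "(\<Sum>j\<in>{1..N}. JJ c i' j * ?g x j) = 0" if "i' \<in> {1..N}" for i' by (rule class_average_mean_zero[OF that x])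
    qed
  qed
  also have "\<dots> = real N * real m / \<eta>\<^sup>2" by simp
  finally show ?thesis .
qed

end

lemma obs_range: "(\<And>n. z n \<in> {1..N}) \<Longrightarrow> obs z d r \<le> N"
  by (auto simp: obs_def)

text \<open>Three errors are added: from the occupation time of the state to its visits, from the visits to the prediction by the classes, and
  from the visits of the classes to the occupation times of the limit chain. The last one occurs once for each class.\<close>
lemma (in limit_chain) occupations_close:
  assumes c: "0 < c" and \<epsilon>: "0 \<le> \<epsilon>" and a: "a \<le> m" and x: "x \<in> {1..N}"
    and same: "map cls (map z [0..<m]) = map z' [0..<m]"
    and typical: "map z [0..<m] \<notin> atypical (c * \<epsilon>)"
    and o: "\<bar>o1 - (\<Sum>q<a. of_bool (z q = x)) / c\<bar> \<le> \<epsilon>"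
    and o': "\<And>s. s \<in> {1..k} \<Longrightarrow> \<bar>o2 s - (\<Sum>q<a. of_bool (z' q = s)) / c\<bar> \<le> \<epsilon>"
  shows "\<bar>o1 - (\<Sum>s\<in>{1..k}. o2 s * \<pi> s x)\<bar> \<le> (2 + real N) * \<epsilon>"
proof -
  have cls: "cls (z q) = z' q" if "q < a" for q
  proof -
    have "map cls (map z [0..<m]) ! q = map z' [0..<m] ! q" by (simp only: same)
    then show ?thesis using that a by simp
  qed
  have pi01: "0 \<le> \<pi> s x \<and> \<pi> s x \<le> 1" if "s \<in> {1..k}" for s
    using class_mean_bounds[OF x, of s] that by (simp add: class_mean_def)
  have typc: "\<bar>(\<Sum>q<a. of_bool (z q = x)) - (\<Sum>q<a. class_mean (z' q) x)\<bar> < c * \<epsilon>"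
  proof -
    have "\<not> (c * \<epsilon> \<le> \<bar>\<Sum>q<a. of_bool (map z [0..<m] ! q = x) - class_mean (cls (map z [0..<m] ! q)) x\<bar>)"
      using typical x a unfolding atypical_def by (auto simp del: nth_map atLeastAtMost_iff)
    also have "(\<Sum>q<a. of_bool (map z [0..<m] ! q = x) - class_mean (cls (map z [0..<m] ! q)) x)
      = (\<Sum>q<a. of_bool (z q = x) - class_mean (z' q) x)"
      by (rule sum.cong) (use a cls in auto)
    finally show ?thesis by (simp add: sum_subtractf)
  qed
  have cm: "class_mean (z' q) x = (\<Sum>s\<in>{1..k}. of_bool (z' q = s) * \<pi> s x)" for q
  proof (cases "z' q \<in> {1..k}")
    case True
    then show ?thesis
      using sum_of_bool_scaleR[of "{1..k}" "z' q" "\<lambda>s. \<pi> s x"] by (simp add: class_mean_def)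
  next
    case False
    then have "(\<Sum>s\<in>{1..k}. of_bool (z' q = s) * \<pi> s x) = 0" by (intro sum.neutral) auto
    with False show ?thesis by (simp only: class_mean_def if_False)
  qed
  have "(\<Sum>q<a. class_mean (z' q) x) = (\<Sum>s\<in>{1..k}. (\<Sum>q<a. of_bool (z' q = s)) * \<pi> s x)"
    unfolding cm sum_distrib_right by (rule sum.swap)
  then have eq: "(\<Sum>q<a. class_mean (z' q) x) / c = (\<Sum>s\<in>{1..k}. (\<Sum>q<a. of_bool (z' q = s)) / c * \<pi> s x)"
    by (simp add: sum_divide_distrib)
  have e1: "\<bar>(\<Sum>q<a. of_bool (z q = x)) / c - (\<Sum>q<a. class_mean (z' q) x) / c\<bar> \<le> \<epsilon>"
  proof -
    have "\<bar>(\<Sum>q<a. of_bool (z q = x)) / c - (\<Sum>q<a. class_mean (z' q) x) / c\<bar>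
      = \<bar>(\<Sum>q<a. of_bool (z q = x)) - (\<Sum>q<a. class_mean (z' q) x)\<bar> / c"
      using c by (simp add: diff_divide_distrib[symmetric] abs_divide)
    also have "\<dots> \<le> \<epsilon>" using typc c by (simp add: pos_divide_le_eq mult.commute)
    finally show ?thesis .
  qed
  have e2: "\<bar>(\<Sum>q<a. class_mean (z' q) x) / c - (\<Sum>s\<in>{1..k}. o2 s * \<pi> s x)\<bar> \<le> real N * \<epsilon>"
  proof -
    have "\<bar>(\<Sum>q<a. class_mean (z' q) x) / c - (\<Sum>s\<in>{1..k}. o2 s * \<pi> s x)\<bar>
      = \<bar>\<Sum>s\<in>{1..k}. ((\<Sum>q<a. of_bool (z' q = s)) / c - o2 s) * \<pi> s x\<bar>"
      unfolding eq by (simp only: sum_subtractf[symmetric] left_diff_distrib)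
    also have "\<dots> \<le> (\<Sum>s\<in>{1..k}. \<bar>((\<Sum>q<a. of_bool (z' q = s)) / c - o2 s) * \<pi> s x\<bar>)" by (rule sum_abs)
    also have "\<dots> \<le> (\<Sum>s\<in>{1..k}. \<epsilon>)"
    proof (rule sum_mono)
      fix s assume s: "s \<in> {1..k}"
      have "\<bar>((\<Sum>q<a. of_bool (z' q = s)) / c - o2 s)\<bar> * \<bar>\<pi> s x\<bar> \<le> \<epsilon> * 1"
        by (rule mult_mono) (use o'[OF s] pi01[OF s] \<epsilon> in \<open>auto simp: abs_minus_commute\<close>)
      then show "\<bar>((\<Sum>q<a. of_bool (z' q = s)) / c - o2 s) * \<pi> s x\<bar> \<le> \<epsilon>" by (simp only: abs_mult mult_1_right)
    qed
    also have "\<dots> \<le> real N * \<epsilon>" using k \<epsilon> by (simp add: mult_right_mono)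
    finally show ?thesis .
  qed
  show ?thesis using o e1 e2 by (simp add: algebra_simps abs_le_iff)
qed

section \<open>Coupling at a given precision\<close>

text \<open>The limit chain together with the sequence of chains, already thinned out so that its
  resolvents and initial laws converge.\<close>
locale chain_convergence = limit_chain N k JJ Jk cls \<pi> h
  for N k :: nat and JJ Jk cls \<pi> h +
  fixes \<nu> :: "nat \<Rightarrow> nat \<Rightarrow> real" and \<mu> :: "nat \<Rightarrow> real" and P :: "nat \<Rightarrow> nat \<Rightarrow> nat \<Rightarrow> real"
    and \<nu>l :: "nat \<Rightarrow> real" and \<mu>' :: real and P' :: "nat \<Rightarrow> nat \<Rightarrow> real"
  assumes par: "\<And>n. parameters N (\<nu> n) (\<mu> n) (P n)"
    and JJ_stoch: "\<And>c. stochastic_matrix N (JJ c)"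
    and conv_resolvent: "\<And>c i j. i \<in> {1..N} \<Longrightarrow> j \<in> {1..N} \<Longrightarrow>
      (\<lambda>n. resolvent_matrix N (\<mu> n) (P n) (real (Suc c)) i j) \<longlonglongrightarrow> JJ c i j"
    and conv_init: "\<And>i. i \<in> {1..N} \<Longrightarrow> (\<lambda>n. \<nu> n i) \<longlonglongrightarrow> \<nu>l i"
    and \<nu>l: "probability_vector N \<nu>l"
    and \<mu>': "0 < \<mu>'" and P': "stochastic_matrix k P'"
    and Jk: "\<And>c. resolvent_kernel k \<mu>' P' (real (Suc c)) (Jk c)"
begin

text \<open>The law of the first class when the initial state has the limiting law.\<close>
definition \<nu>' :: "nat \<Rightarrow> real" where
  "\<nu>' s = (\<Sum>i\<in>{1..N}. \<nu>l i * h i s)"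

lemma N1: "1 \<le> N" using k by auto
lemma k1: "1 \<le> k" using k by auto
lemma \<mu>: "0 < \<mu> n" using par[of n] by (simp add: parameters_def)

lemma \<nu>'_parameters: "parameters k \<nu>' \<mu>' P'"
proof -
  have "0 \<le> \<nu>' s" if s: "s \<in> {1..k}" for s
    unfolding \<nu>'_def
  proof (rule sum_nonneg, rule mult_nonneg_nonneg)
    fix i assume i: "i \<in> {1..N}"
    show "0 \<le> \<nu>l i" using \<nu>l i by (auto simp: probability_vector_def)
    show "0 \<le> h i s" using h[OF i] s by (auto simp: probability_vector_def)
  qed
  moreover have "(\<Sum>s\<in>{1..k}. \<nu>' s) = 1"
  proof -
    have "(\<Sum>s\<in>{1..k}. \<nu>' s) = (\<Sum>i\<in>{1..N}. \<nu>l i * (\<Sum>s\<in>{1..k}. h i s))"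
      unfolding \<nu>'_def sum_distrib_left by (rule sum.swap)
    also have "\<dots> = (\<Sum>i\<in>{1..N}. \<nu>l i * 1)"
    proof (rule sum.cong[OF refl])
      fix i assume i: "i \<in> {1..N}"
      show "\<nu>l i * (\<Sum>s\<in>{1..k}. h i s) = \<nu>l i * 1" using h[OF i] by (simp only: probability_vector_def)
    qed
    finally show ?thesis using \<nu>l by (simp add: probability_vector_def)
  qed
  ultimately show ?thesis using \<mu>' P' by (simp add: parameters_def probability_vector_def)
qed

lemma resolvent_kernel_n: "resolvent_kernel N (\<mu> n) (P n) (real (Suc c)) (resolvent_matrix N (\<mu> n) (P n) (real (Suc c)))"
  by (rule resolvent_kernel_matrix) (use par[of n] in \<open>simp_all add: parameters_def\<close>)

abbreviation "sample_path c m n \<omega> \<equiv> map (skeleton_state (real (Suc c)) N (\<nu> n) (P n) \<omega>) [0..<m]"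
abbreviation "sample_path' c m \<omega> \<equiv> map (skeleton_state (real (Suc c)) k \<nu>' P' \<omega>) [0..<m]"

lemma sample_path_measurable: "sample_path c m n \<in> measurable (base (\<mu> n)) (count_space UNIV)"
  by (rule skeleton_law(1)[OF par N1 _ resolvent_kernel_n]) simp

lemma sample_path'_measurable: "sample_path' c m \<in> measurable (base \<mu>') (count_space UNIV)"
  by (rule skeleton_law(1)[OF \<nu>'_parameters k1 _ Jk]) simp

text \<open>The limit is written by \<open>path_exp\<close>, since no process with the resolvents \<open>JJ\<close> has been constructed.\<close>
lemma skeleton_laws_converge:
  "(\<lambda>n. measure (base (\<mu> n)) {\<omega>. sample_path c m n \<omega> \<in> X}) \<longlonglongrightarrow> (\<Sum>i\<in>{1..N}. \<nu>l i * path_exp N (JJ c) m (\<lambda>l. of_bool (l \<in> X)) i)"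
proof -
  have "measure (base (\<mu> n)) {\<omega>. sample_path c m n \<omega> \<in> X}
    = (\<Sum>i\<in>{1..N}. \<nu> n i * path_exp N (resolvent_matrix N (\<mu> n) (P n) (real (Suc c))) m (\<lambda>l. of_bool (l \<in> X)) i)" for n
    by (rule skeleton_law(2)[OF par N1 _ resolvent_kernel_n]) simp
  moreover have "(\<lambda>n. \<Sum>i\<in>{1..N}. \<nu> n i * path_exp N (resolvent_matrix N (\<mu> n) (P n) (real (Suc c))) m (\<lambda>l. of_bool (l \<in> X)) i)
    \<longlonglongrightarrow> (\<Sum>i\<in>{1..N}. \<nu>l i * path_exp N (JJ c) m (\<lambda>l. of_bool (l \<in> X)) i)"
    by (intro tendsto_sum tendsto_mult conv_init path_exp_tendsto conv_resolvent)
  ultimately show ?thesis by simp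
qed

text \<open>Here the limit is the law of the observed states of an actual process, the limit chain.\<close>
lemma class_laws_converge:
  "(\<lambda>n. measure (base (\<mu> n)) {\<omega>. map cls (sample_path c m n \<omega>) = g}) \<longlonglongrightarrow> measure (base \<mu>') {\<omega>. sample_path' c m \<omega> = g}"
proof -
  have "(\<lambda>n. measure (base (\<mu> n)) {\<omega>. map cls (sample_path c m n \<omega>) = g})
      \<longlonglongrightarrow> (\<Sum>i\<in>{1..N}. \<nu>l i * path_exp N (JJ c) m (\<lambda>l. of_bool (map cls l \<in> {g})) i)"
    using skeleton_laws_converge[of c m "{l. map cls l = g}"] by (simp only: mem_Collect_eq singleton_iff)
  also have "(\<Sum>i\<in>{1..N}. \<nu>l i * path_exp N (JJ c) m (\<lambda>l. of_bool (map cls l \<in> {g})) i)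
    = (\<Sum>i\<in>{1..N}. \<nu>l i * (\<Sum>s\<in>{1..k}. h i s * path_exp k (Jk c) m (\<lambda>l. of_bool (l \<in> {g})) s))"
  proof (rule sum.cong[OF refl])
    fix i assume "i \<in> {1..N}"
    then show "\<nu>l i * path_exp N (JJ c) m (\<lambda>l. of_bool (map cls l \<in> {g})) i
      = \<nu>l i * (\<Sum>s\<in>{1..k}. h i s * path_exp k (Jk c) m (\<lambda>l. of_bool (l \<in> {g})) s)"
      by (subst path_exp_classes) (rule \<open>i \<in> {1..N}\<close>, rule refl)
  qed
  also have "\<dots> = (\<Sum>s\<in>{1..k}. \<nu>' s * path_exp k (Jk c) m (\<lambda>l. of_bool (l \<in> {g})) s)"
    unfolding \<nu>'_def sum_distrib_left sum_distrib_right mult.assoc by (rule sum.swap)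
  also have "\<dots> = measure (base \<mu>') {\<omega>. sample_path' c m \<omega> \<in> {g}}"
    by (rule skeleton_law(2)[OF \<nu>'_parameters k1 _ Jk, symmetric]) simp
  finally show ?thesis by (simp only: singleton_iff)
qed

lemma eventually_typical:
  assumes \<eta>: "0 < \<eta>" and \<kappa>: "0 < \<kappa>" and bound: "real N * real m / \<kappa>\<^sup>2 \<le> \<eta>"
  shows "eventually (\<lambda>n. measure (base (\<mu> n)) {\<omega>. sample_path c m n \<omega> \<in> atypical \<kappa>} \<le> 2 * \<eta>) sequentially"
proof -
  let ?L = "\<Sum>i\<in>{1..N}. \<nu>l i * path_exp N (JJ c) m (\<lambda>l. of_bool (l \<in> atypical \<kappa>)) i"
  have "?L \<le> (\<Sum>i\<in>{1..N}. \<nu>l i * \<eta>)"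
  proof (rule sum_mono)
    fix i assume i: "i \<in> {1..N}"
    show "\<nu>l i * path_exp N (JJ c) m (\<lambda>l. of_bool (l \<in> atypical \<kappa>)) i \<le> \<nu>l i * \<eta>"
    proof (rule mult_left_mono)
      show "path_exp N (JJ c) m (\<lambda>l. of_bool (l \<in> atypical \<kappa>)) i \<le> \<eta>"
        using atypical_unlikely[OF JJ_stoch \<kappa> i] bound by (rule order_trans)
      show "0 \<le> \<nu>l i" using \<nu>l i by (auto simp: probability_vector_def)
    qed
  qed
  also have "\<dots> = \<eta>" using \<nu>l by (simp add: probability_vector_def sum_distrib_right[symmetric])
  finally have "?L < 2 * \<eta>" using \<eta> by simp
  from order_tendstoD(2)[OF skeleton_laws_converge this] show ?thesis
    by (rule eventually_mono) (rule less_imp_le)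
qed

lemma eventually_classes_close:
  assumes \<eta>: "0 < \<eta>"
  shows "eventually (\<lambda>n. (\<Sum>g\<in>G. \<bar>measure (base \<mu>') {\<omega>. sample_path' c m \<omega> = g}
      - measure (base (\<mu> n)) {\<omega>. map cls (sample_path c m n \<omega>) = g}\<bar>) \<le> \<eta>) sequentially"
proof -
  have "(\<lambda>n. \<Sum>g\<in>G. \<bar>measure (base \<mu>') {\<omega>. sample_path' c m \<omega> = g} - measure (base (\<mu> n)) {\<omega>. map cls (sample_path c m n \<omega>) = g}\<bar>)
    \<longlonglongrightarrow> (\<Sum>g\<in>G. \<bar>measure (base \<mu>') {\<omega>. sample_path' c m \<omega> = g} - measure (base \<mu>') {\<omega>. sample_path' c m \<omega> = g}\<bar>)"
    by (intro tendsto_sum tendsto_rabs tendsto_diff tendsto_const class_laws_converge)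
  then have "(\<lambda>n. \<Sum>g\<in>G. \<bar>measure (base \<mu>') {\<omega>. sample_path' c m \<omega> = g} - measure (base (\<mu> n)) {\<omega>. map cls (sample_path c m n \<omega>) = g}\<bar>) \<longlonglongrightarrow> 0"
    by simp
  from order_tendstoD(2)[OF this \<eta>] show ?thesis by (rule eventually_mono) (rule less_imp_le)
qed

definition occupations_match :: "real \<Rightarrow> real \<Rightarrow> nat \<Rightarrow> sample \<Rightarrow> sample \<Rightarrow> bool" where
  "occupations_match T \<epsilon> n \<omega> \<omega>' \<longleftrightarrow> (\<forall>t\<in>{0..T}. \<forall>l\<in>{1..N}.
     \<bar>occupation (chain_from N (\<nu> n) (P n) (fst \<omega>)) (hold (snd \<omega>)) l t
       - (\<Sum>j\<in>{1..k}. occupation (chain_from k \<nu>' P' (fst \<omega>')) (hold (snd \<omega>')) j t * \<pi> j l)\<bar> \<le> \<epsilon>)"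

text \<open>Everything that a coupling at precision \<open>\<epsilon>\<close> needs: observables with close laws, whose agreement
  outside small bad sets forces the occupation times to match.\<close>
definition glueable :: "real \<Rightarrow> real \<Rightarrow> (sample \<Rightarrow> nat) \<Rightarrow> (nat \<Rightarrow> sample \<Rightarrow> nat) \<Rightarrow> nat set \<Rightarrow> sample set \<Rightarrow> nat \<Rightarrow> bool" where
  "glueable T \<epsilon> K' K G Bad' n \<longleftrightarrow>
     (\<Sum>g\<in>G. \<bar>measure (base \<mu>') {\<omega>. K' \<omega> = g} - measure (base (\<mu> n)) {\<omega>. K n \<omega> = g}\<bar>) \<le> \<epsilon> \<and>
     (\<exists>Bad\<in>sets (base (\<mu> n)). measure (base (\<mu> n)) Bad \<le> 3 * \<epsilon> \<and>
        (\<forall>\<omega> \<omega>'. \<omega> \<notin> Bad \<longrightarrow> \<omega>' \<notin> Bad' \<longrightarrow> K n \<omega> = K' \<omega>' \<longrightarrow> occupations_match T ((2 + real N) * \<epsilon>) n \<omega> \<omega>'))"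

text \<open>The observables are the lists of observed classes, coded by natural numbers. The rate \<open>c\<close> is
  chosen first, from the precision alone, and then \<open>n\<close> large enough for this rate.\<close>
lemma eventually_glueable:
  assumes T: "0 < T" and \<epsilon>: "0 < \<epsilon>"
  obtains K' K G Bad' where "K' \<in> measurable (base \<mu>') (count_space UNIV)"
    and "\<And>n. K n \<in> measurable (base (\<mu> n)) (count_space UNIV)"
    and "finite G" "\<And>\<omega>. K' \<omega> \<in> G" "\<And>n \<omega>. K n \<omega> \<in> G"
    and "Bad' \<in> sets (base \<mu>')" "measure (base \<mu>') Bad' \<le> \<epsilon>"
    and "eventually (glueable T \<epsilon> K' K G Bad') sequentially"
proof -
  from occupation_close_to_skeleton[OF T \<epsilon> \<epsilon>, of N] obtain c1 where c1:
    "\<forall>c\<ge>c1. \<forall>\<nu> \<mu> P. 0 < \<mu> \<longrightarrow>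
      (\<exists>Bad\<in>sets (base \<mu>). measure (base \<mu>) Bad \<le> \<epsilon> \<and>
      (\<forall>\<omega>. \<omega> \<notin> Bad \<longrightarrow> (\<forall>t\<in>{0..T}. \<forall>l\<in>{1..N}.
        \<bar>occupation (chain_from N \<nu> P (fst \<omega>)) (hold (snd \<omega>)) l t
          - (\<Sum>q<nat \<lfloor>c * t\<rfloor>. of_bool (skeleton_state c N \<nu> P \<omega> q = l)) / c\<bar> \<le> \<epsilon>)))" by (elim exE conjE) (rule that)
  from occupation_close_to_skeleton[OF T \<epsilon> \<epsilon>, of k] obtain c2 where c2:
    "\<forall>c\<ge>c2. \<forall>\<nu> \<mu> P. 0 < \<mu> \<longrightarrow>
      (\<exists>Bad\<in>sets (base \<mu>). measure (base \<mu>) Bad \<le> \<epsilon> \<and>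
      (\<forall>\<omega>. \<omega> \<notin> Bad \<longrightarrow> (\<forall>t\<in>{0..T}. \<forall>l\<in>{1..k}.
        \<bar>occupation (chain_from k \<nu> P (fst \<omega>)) (hold (snd \<omega>)) l t
          - (\<Sum>q<nat \<lfloor>c * t\<rfloor>. of_bool (skeleton_state c k \<nu> P \<omega> q = l)) / c\<bar> \<le> \<epsilon>)))" by (elim exE conjE) (rule that)
  \<comment> \<open>with \<open>m \<le> rate * T\<close> observations, the last term makes the probability \<open>N m / (rate * \<epsilon>)\<^sup>2\<close> of atypical lists at most \<open>\<epsilon>\<close>\<close>
  define c where "c = nat \<lceil>max (max c1 c2) (real N * T / \<epsilon> ^ 3)\<rceil>"
  define rate where "rate = real (Suc c)"
  have "max (max c1 c2) (real N * T / \<epsilon> ^ 3) \<le> real c" unfolding c_def by (rule of_nat_ceiling)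
  then have rate: "0 < rate" "c1 \<le> rate" "c2 \<le> rate" "real N * T / \<epsilon> ^ 3 \<le> rate" by (auto simp: rate_def)
  define m where "m = nat \<lfloor>rate * T\<rfloor>"
  have m: "real m \<le> rate * T" using rate(1) T by (simp add: m_def)
  have atyp: "real N * real m / (rate * \<epsilon>)\<^sup>2 \<le> \<epsilon>"
  proof -
    have "real N * T \<le> rate * \<epsilon> ^ 3" using rate(4) \<epsilon> by (simp add: pos_divide_le_eq)
    then have "rate * (real N * T) \<le> rate * (rate * \<epsilon> ^ 3)" using rate(1) by (intro mult_left_mono) auto
    moreover have "real N * real m \<le> real N * (rate * T)" using m by (rule mult_left_mono) simp
    ultimately have "real N * real m \<le> \<epsilon> * (rate * \<epsilon>)\<^sup>2"
      by (simp add: power2_eq_square power3_eq_cube algebra_simps)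
    then show ?thesis using rate(1) \<epsilon> by (simp add: pos_divide_le_eq)
  qed
  define LL where "LL = {l. set l \<subseteq> cls ` {0..N} \<union> {0..k} \<and> length l = m}"
  define K where "K n \<omega> = to_nat (map cls (sample_path c m n \<omega>))" for n \<omega>
  define K' where "K' \<omega> = to_nat (sample_path' c m \<omega>)" for \<omega>
  have finLL: "finite LL" unfolding LL_def by (rule finite_lists_length_eq) simp
  have inLL: "map cls (sample_path c m n \<omega>) \<in> LL" for n \<omega>
  proof -
    have "skeleton_state (real (Suc c)) N (\<nu> n) (P n) \<omega> q \<le> N" for q
      by (rule obs_range) (rule chain_from_range[OF N1])
    then show ?thesis unfolding LL_def by (auto simp del: of_nat_Suc)
  qed
  have inLL': "sample_path' c m \<omega> \<in> LL" for \<omega>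
  proof -
    have "skeleton_state (real (Suc c)) k \<nu>' P' \<omega> q \<le> k" for q
      by (rule obs_range) (rule chain_from_range[OF k1])
    then show ?thesis unfolding LL_def by (auto simp del: of_nat_Suc)
  qed
  obtain Bad' where Bad': "Bad' \<in> sets (base \<mu>')" "measure (base \<mu>') Bad' \<le> \<epsilon>"
    "\<And>\<omega> t l. \<omega> \<notin> Bad' \<Longrightarrow> t \<in> {0..T} \<Longrightarrow> l \<in> {1..k} \<Longrightarrow>
        \<bar>occupation (chain_from k \<nu>' P' (fst \<omega>)) (hold (snd \<omega>)) l t
          - (\<Sum>q<nat \<lfloor>rate * t\<rfloor>. of_bool (skeleton_state rate k \<nu>' P' \<omega> q = l)) / rate\<bar> \<le> \<epsilon>"
    using c2[rule_format, OF rate(3) \<mu>', of \<nu>' P'] by (elim bexE conjE) (rule that, assumption+, blast)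
  have "glueable T \<epsilon> K' K (to_nat ` LL) Bad' n"
    if close: "(\<Sum>g\<in>LL. \<bar>measure (base \<mu>') {\<omega>. sample_path' c m \<omega> = g} - measure (base (\<mu> n)) {\<omega>. map cls (sample_path c m n \<omega>) = g}\<bar>) \<le> \<epsilon>"
      and typical: "measure (base (\<mu> n)) {\<omega>. sample_path c m n \<omega> \<in> atypical (rate * \<epsilon>)} \<le> 2 * \<epsilon>" for n
  proof -
    obtain Bad where Bad: "Bad \<in> sets (base (\<mu> n))" "measure (base (\<mu> n)) Bad \<le> \<epsilon>"
      "\<And>\<omega> t l. \<omega> \<notin> Bad \<Longrightarrow> t \<in> {0..T} \<Longrightarrow> l \<in> {1..N} \<Longrightarrow>
        \<bar>occupation (chain_from N (\<nu> n) (P n) (fst \<omega>)) (hold (snd \<omega>)) l t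
          - (\<Sum>q<nat \<lfloor>rate * t\<rfloor>. of_bool (skeleton_state rate N (\<nu> n) (P n) \<omega> q = l)) / rate\<bar> \<le> \<epsilon>"
      using c1[rule_format, OF rate(2) \<mu>, of n "\<nu> n" "P n"] by (elim bexE conjE) (rule that, assumption+, blast)
    let ?At = "{\<omega>. sample_path c m n \<omega> \<in> atypical (rate * \<epsilon>)}"
    have At: "?At \<in> sets (base (\<mu> n))"
      using measurable_sets[OF sample_path_measurable[where c=c and m=m and n=n], of "atypical (rate * \<epsilon>)"] by (simp add: vimage_def del: of_nat_Suc)
    have "(\<Sum>g\<in>to_nat ` LL. \<bar>measure (base \<mu>') {\<omega>. K' \<omega> = g} - measure (base (\<mu> n)) {\<omega>. K n \<omega> = g}\<bar>) \<le> \<epsilon>"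
    proof -
      have inj: "inj_on to_nat LL" by (rule inj_on_subset[OF inj_to_nat]) simp
      show ?thesis using close unfolding sum.reindex[OF inj] K_def K'_def o_def by (simp only: inj_eq[OF inj_to_nat])
    qed
    moreover have "Bad \<union> ?At \<in> sets (base (\<mu> n))" using Bad(1) At by (rule sets.Un)
    moreover have "measure (base (\<mu> n)) (Bad \<union> ?At) \<le> 3 * \<epsilon>"
      using measure_Un_le[OF Bad(1) At] Bad(2) typical by linarith
    moreover have "occupations_match T ((2 + real N) * \<epsilon>) n \<omega> \<omega>'"
      if good: "\<omega> \<notin> Bad \<union> ?At" and good': "\<omega>' \<notin> Bad'" and eq: "K n \<omega> = K' \<omega>'" for \<omega> \<omega>'
      unfolding occupations_match_def
    proof (intro ballI)
      fix t l assume t: "t \<in> {0..T}" and l: "l \<in> {1..N}"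
      have "rate * t \<le> rate * T" using t rate(1) by (intro mult_left_mono) auto
      then have a: "nat \<lfloor>rate * t\<rfloor> \<le> m" unfolding m_def by (intro nat_mono floor_mono)
      have same: "map cls (sample_path c m n \<omega>) = sample_path' c m \<omega>'"
        using eq unfolding K_def K'_def by (rule injD[OF inj_to_nat])
      have nat: "sample_path c m n \<omega> \<notin> atypical (rate * \<epsilon>)" and nb: "\<omega> \<notin> Bad" using good by (simp_all del: of_nat_Suc)
      show "\<bar>occupation (chain_from N (\<nu> n) (P n) (fst \<omega>)) (hold (snd \<omega>)) l t
       - (\<Sum>j\<in>{1..k}. occupation (chain_from k \<nu>' P' (fst \<omega>')) (hold (snd \<omega>')) j t * \<pi> j l)\<bar> \<le> (2 + real N) * \<epsilon>"
        by (rule occupations_close[OF rate(1) less_imp_le[OF \<epsilon>] a l same[folded rate_def] nat[folded rate_def] Bad(3)[OF nb t l] Bad'(3)[OF good' t]])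
    qed
    ultimately show ?thesis unfolding glueable_def by blast
  qed
  then have ev: "eventually (glueable T \<epsilon> K' K (to_nat ` LL) Bad') sequentially"
    using eventually_classes_close[OF \<epsilon>, where G=LL and c=c and m=m] eventually_typical[OF \<epsilon> _ atyp, where c=c] rate(1) \<epsilon>
    by (auto elim: eventually_elim2 simp del: of_nat_Suc)
  have "K' \<in> measurable (base \<mu>') (count_space UNIV)"
    unfolding K'_def by (rule measurable_compose[OF sample_path'_measurable]) simp
  moreover have "K n \<in> measurable (base (\<mu> n)) (count_space UNIV)" for n
    unfolding K_def by (rule measurable_compose[OF sample_path_measurable]) simp
  moreover have "finite (to_nat ` LL)" using finLL by (rule finite_imageI)
  moreover have "K' \<omega> \<in> to_nat ` LL" "K n \<omega> \<in> to_nat ` LL" for n \<omega>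
    unfolding K_def K'_def by (rule imageI, rule inLL' inLL)+
  ultimately show ?thesis using Bad'(1,2) ev by (rule that)
qed

end

section \<open>Convergence of the glued processes\<close>

lemma finitely_many_bounded:
  fixes A :: "nat \<Rightarrow> real^'d^'d"
  obtains K where "0 \<le> K" "\<And>l v. l \<in> {1..N} \<Longrightarrow> norm (A l *v v) \<le> K * norm v"
proof
  let ?K = "\<Sum>l\<in>{1..N}. onorm ((*v) (A l))"
  show "0 \<le> ?K" by (intro sum_nonneg onorm_pos_le matrix_vector_mul_bounded_linear)
  fix l v assume l: "l \<in> {1..N}"
  have "norm (A l *v v) \<le> onorm ((*v) (A l)) * norm v" by (rule onorm[OF matrix_vector_mul_bounded_linear])
  also have "onorm ((*v) (A l)) \<le> ?K"
    by (rule member_le_sum) (use l in \<open>auto intro: onorm_pos_le\<close>)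
  finally show "norm (A l *v v) \<le> ?K * norm v" by (simp add: mult_right_mono)
qed

text \<open>The supports of the equilibrium laws are disjoint because they lie in different classes.\<close>
lemma (in limit_chain) convexified_modes_averages:
  "convexified_modes N A k (\<lambda>j. \<Sum>l\<in>{1..N}. \<pi> j l *\<^sub>R A l)"
  unfolding convexified_modes_def
proof (intro conjI exI[of _ "\<lambda>j. {l\<in>{1..N}. \<pi> j l \<noteq> 0}"] ballI)
  show "k \<in> {1..N}" by (rule k)
  show "disjoint_family_on (\<lambda>j. {l\<in>{1..N}. \<pi> j l \<noteq> 0}) {1..k}"
    unfolding disjoint_family_on_def using cls by blast
  fix j assume j: "j \<in> {1..k}"
  show "{l\<in>{1..N}. \<pi> j l \<noteq> 0} \<subseteq> {1..N}" by auto
  have sum: "(\<Sum>l\<in>{l\<in>{1..N}. \<pi> j l \<noteq> 0}. \<pi> j l) = 1"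
    using \<pi>_sum[OF j] by (subst sum.mono_neutral_left[of "{1..N}"]) auto
  show "{l\<in>{1..N}. \<pi> j l \<noteq> 0} \<noteq> {}"
  proof
    assume e: "{l\<in>{1..N}. \<pi> j l \<noteq> 0} = {}"
    show False using sum unfolding e by simp
  qed
  have "(\<Sum>l\<in>{1..N}. \<pi> j l *\<^sub>R A l) = (\<Sum>l\<in>{l\<in>{1..N}. \<pi> j l \<noteq> 0}. \<pi> j l *\<^sub>R A l)"
    by (rule sum.mono_neutral_right) auto
  also have "\<dots> \<in> convex hull (A ` {l\<in>{1..N}. \<pi> j l \<noteq> 0})"
  proof (rule convex_sum)
    show "0 \<le> \<pi> j l" if "l \<in> {l\<in>{1..N}. \<pi> j l \<noteq> 0}" for l
      using \<pi>[OF j] that by (simp add: probability_vector_def)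
    show "A l \<in> convex hull (A ` {l\<in>{1..N}. \<pi> j l \<noteq> 0})" if "l \<in> {l\<in>{1..N}. \<pi> j l \<noteq> 0}" for l
      by (rule hull_inc, rule imageI, rule that)
  qed (use sum in \<open>auto simp: convex_convex_hull\<close>)
  finally show "(\<Sum>l\<in>{1..N}. \<pi> j l *\<^sub>R A l) \<in> convex hull (A ` {l\<in>{1..N}. \<pi> j l \<noteq> 0})" .
qed

context chain_convergence
begin

definition mean_mode :: "(nat \<Rightarrow> real^'d^'d) \<Rightarrow> nat \<Rightarrow> real^'d^'d" where
  "mean_mode A j = (\<Sum>l\<in>{1..N}. \<pi> j l *\<^sub>R A l)"

text \<open>Passage from matching occupation times to an arbitrary norm of the distance of the trajectories.\<close>
lemma trajectories_uniformly_close: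
  fixes A :: "nat \<Rightarrow> real^'d^'d" and nrm :: "real^'d \<Rightarrow> real"
  assumes nrm: "is_norm nrm"
  obtains C :: "real \<Rightarrow> real" where "\<And>T. 0 \<le> C T"
    "\<And>T \<epsilon> n \<omega> \<omega>' t. 0 \<le> \<epsilon> \<Longrightarrow> occupations_match T \<epsilon> n \<omega> \<omega>' \<Longrightarrow> t \<in> {0..T} \<Longrightarrow>
      nrm (trajectory (mean_mode A) k \<nu>' P' x0 t \<omega>' - trajectory A N (\<nu> n) (P n) x0 t \<omega>) \<le> \<epsilon> * C T"
proof -
  obtain K where K: "0 \<le> K" "\<And>l v. l \<in> {1..N} \<Longrightarrow> norm (A l *v v) \<le> K * norm v"
    by (rule finitely_many_bounded[of N A]) (rule that, assumption+)
  have BK: "norm (mean_mode A j *v v) \<le> K * norm v" if j: "j \<in> {1..k}" for j v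
  proof -
    have p0: "0 \<le> \<pi> j l" if "l \<in> {1..N}" for l using \<pi>[OF j] that by (simp add: probability_vector_def)
    have "norm (mean_mode A j *v v) \<le> (\<Sum>l\<in>{1..N}. norm (\<pi> j l *\<^sub>R (A l *v v)))"
      unfolding mean_mode_def sum_matrix_vector_mult by (rule norm_sum)
    also have "\<dots> \<le> (\<Sum>l\<in>{1..N}. \<pi> j l * (K * norm v))"
    proof (rule sum_mono)
      fix l assume l: "l \<in> {1..N}"
      show "norm (\<pi> j l *\<^sub>R (A l *v v)) \<le> \<pi> j l * (K * norm v)"
        using mult_left_mono[OF K(2)[OF l, of v] p0[OF l]] p0[OF l] by simp
    qed
    also have "\<dots> = K * norm v" unfolding sum_distrib_right[symmetric] using \<pi>_sum[OF j] by simp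
    finally show ?thesis .
  qed
  obtain c where c: "0 < c" "\<And>v. nrm v \<le> c * norm v"
    by (rule is_norm_bound[OF nrm]) (rule that, assumption+)
  define C where "C T = c * (real N * K * (2 * K + 1) * (exp ((2 * K + 1) * T))\<^sup>2 * norm x0)" for T
  show ?thesis
  proof (rule that[of C])
    show "0 \<le> C T" for T unfolding C_def using c(1) K(1) by simp
    fix T \<epsilon> :: real and n \<omega> \<omega>' t
    assume \<epsilon>: "0 \<le> \<epsilon>" and match: "occupations_match T \<epsilon> n \<omega> \<omega>'" and t: "t \<in> {0..T}"
    have "norm (trajectory A N (\<nu> n) (P n) x0 t \<omega> - trajectory (mean_mode A) k \<nu>' P' x0 t \<omega>')
      \<le> \<epsilon> * (real N * K * (2 * K + 1) * (exp ((2 * K + 1) * T))\<^sup>2 * norm x0)"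
    proof (rule trajectories_close[where p = \<pi>])
      show "mean_mode A j = (\<Sum>l\<in>{1..N}. \<pi> j l *\<^sub>R A l)" for j by (rule mean_mode_def)
      show "\<bar>occupation (chain_from N (\<nu> n) (P n) (fst \<omega>)) (hold (snd \<omega>)) l s
        - (\<Sum>j\<in>{1..k}. occupation (chain_from k \<nu>' P' (fst \<omega>')) (hold (snd \<omega>')) j s * \<pi> j l)\<bar> \<le> \<epsilon>"
        if "s \<in> {0..T}" "l \<in> {1..N}" for s l
        using match that unfolding occupations_match_def by blast
    qed (use t \<epsilon> K BK N1 k1 in auto)
    then have "c * norm (trajectory (mean_mode A) k \<nu>' P' x0 t \<omega>' - trajectory A N (\<nu> n) (P n) x0 t \<omega>) \<le> \<epsilon> * C T"
      unfolding C_def norm_minus_commute[of "trajectory A N (\<nu> n) (P n) x0 t \<omega>"]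
      using c(1) by (subst mult.left_commute) (rule mult_left_mono, auto)
    with c(2) show "nrm (trajectory (mean_mode A) k \<nu>' P' x0 t \<omega>' - trajectory A N (\<nu> n) (P n) x0 t \<omega>) \<le> \<epsilon> * C T"
      by (rule order_trans)
  qed
qed

text \<open>The \<open>p\<close>-th member of the subsequence is coupled with the limit chain at precision \<open>1 / (p + 1)\<close> on
  \<open>[0, p + 1]\<close>. The failure probability adds up from disagreement of the observables, the bad set of
  the limit chain, and the bad set of the other chain, which counts three times.\<close>
lemma glued_processes:
  obtains r :: "nat \<Rightarrow> nat" and M :: "(nat \<Rightarrow> real) measure" and F0 F where "strict_mono r" "prob_space M"
    "F0 \<in> measurable M (base \<mu>')" "distr M (base \<mu>') F0 = base \<mu>'"
    "\<And>p. F p \<in> measurable M (base (\<mu> (r p)))" "\<And>p. distr M (base (\<mu> (r p))) (F p) = base (\<mu> (r p))"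
    "\<And>p. \<exists>E\<in>sets M. measure M E \<le> 5 / real (Suc p) \<and>
       (\<forall>\<omega>\<in>space M - E. occupations_match (real (Suc p)) ((2 + real N) / real (Suc p)) (r p) (F p \<omega>) (F0 \<omega>))"
proof -
  have "\<forall>p. \<exists>K' K G Bad'. K' \<in> measurable (base \<mu>') (count_space UNIV) \<and>
      (\<forall>n. K n \<in> measurable (base (\<mu> n)) (count_space UNIV)) \<and>
      finite G \<and> (\<forall>\<omega>. K' \<omega> \<in> G) \<and> (\<forall>n \<omega>. K n \<omega> \<in> G) \<and>
      Bad' \<in> sets (base \<mu>') \<and> measure (base \<mu>') Bad' \<le> 1 / real (Suc p) \<and>
      eventually (glueable (real (Suc p)) (1 / real (Suc p)) K' K G Bad') sequentially"
    (is "\<forall>p. \<exists>K' K G Bad'. ?good p K' K G Bad'")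
  proof
    fix p
    have *: "0 < real (Suc p)" "0 < 1 / real (Suc p)" by simp_all
    show "\<exists>K' K G Bad'. ?good p K' K G Bad'"
      by (rule eventually_glueable[OF *]) (intro exI conjI allI, assumption+)
  qed
  then obtain K' K G Bad' where lev: "\<And>p. ?good p (K' p) (K p) (G p) (Bad' p)" by metis
  note K' = lev[THEN conjunct1] and K = lev[THEN conjunct2, THEN conjunct1, rule_format]
    and G = lev[THEN conjunct2, THEN conjunct2, THEN conjunct1]
      lev[THEN conjunct2, THEN conjunct2, THEN conjunct2, THEN conjunct1, rule_format]
      lev[THEN conjunct2, THEN conjunct2, THEN conjunct2, THEN conjunct2, THEN conjunct1, rule_format]
    and rest = lev[THEN conjunct2, THEN conjunct2, THEN conjunct2, THEN conjunct2, THEN conjunct2]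
  note Bad' = rest[THEN conjunct1] rest[THEN conjunct2, THEN conjunct1] and ev = rest[THEN conjunct2, THEN conjunct2]
  let ?gl = "\<lambda>p. glueable (real (Suc p)) (1 / real (Suc p)) (K' p) (K p) (G p) (Bad' p)"
  \<comment> \<open>each precision is reached eventually, so a strictly increasing choice exists\<close>
  have "\<exists>r. \<forall>p. ?gl p (r p) \<and> r p < r (Suc p)"
  proof (rule dependent_nat_choice)
    show "\<exists>n. ?gl 0 n" using ev[of 0] eventually_happens by fastforce
    show "\<exists>y. ?gl (Suc p) y \<and> n < y" for n p
      using eventually_conj[OF ev[of "Suc p"] eventually_gt_at_top[of n]] eventually_happens by fastforce
  qed
  then obtain r where gl: "\<And>p. ?gl p (r p)" and r: "strict_mono r" by (auto simp: strict_mono_Suc_iff)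
  obtain M :: "(nat \<Rightarrow> real) measure" and F0 F where M: "prob_space M"
    and F0: "F0 \<in> measurable M (base \<mu>')" "distr M (base \<mu>') F0 = base \<mu>'"
    and F: "\<And>p. F p \<in> measurable M (base (\<mu> (r p)))" "\<And>p. distr M (base (\<mu> (r p))) (F p) = base (\<mu> (r p))"
    and differ: "\<And>p. measure M {\<omega>\<in>space M. K p (r p) (F p \<omega>) \<noteq> K' p (F0 \<omega>)} \<le>
      (\<Sum>g\<in>G p. \<bar>measure (base \<mu>') {\<omega>\<in>space (base \<mu>'). K' p \<omega> = g}
        - measure (base (\<mu> (r p))) {\<omega>\<in>space (base (\<mu> (r p))). K p (r p) \<omega> = g}\<bar>)"
    by (rule gluing[where B = "\<lambda>p. base (\<mu> (r p))" and K = "\<lambda>p. K p (r p)", OF prob_space_base[OF \<mu>'] sets_base prob_space_base[OF \<mu>] sets_base K' K G])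
      (rule that, assumption+)
  interpret M: prob_space M by (rule M)
  show ?thesis
  proof (rule that[OF r M F0 F])
    fix p
    let ?\<epsilon> = "1 / real (Suc p)"
    let ?D = "{\<omega>\<in>space M. K p (r p) (F p \<omega>) \<noteq> K' p (F0 \<omega>)}"
    obtain Bad where Bad: "Bad \<in> sets (base (\<mu> (r p)))" "measure (base (\<mu> (r p))) Bad \<le> 3 * ?\<epsilon>"
      and match: "\<And>\<omega> \<omega>'. \<omega> \<notin> Bad \<Longrightarrow> \<omega>' \<notin> Bad' p \<Longrightarrow> K p (r p) \<omega> = K' p \<omega>'
        \<Longrightarrow> occupations_match (real (Suc p)) ((2 + real N) * ?\<epsilon>) (r p) \<omega> \<omega>'"
      using gl[of p] unfolding glueable_def by blast
    have D: "?D \<in> sets M"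
    proof -
      have [measurable]: "(\<lambda>\<omega>. K p (r p) (F p \<omega>)) \<in> measurable M (count_space UNIV)"
        "(\<lambda>\<omega>. K' p (F0 \<omega>)) \<in> measurable M (count_space UNIV)"
        by (rule measurable_compose[OF F(1) K], rule measurable_compose[OF F0(1) K'])
      show ?thesis by measurable
    qed
    have pD: "measure M ?D \<le> ?\<epsilon>" using differ[of p] gl[of p] by (simp add: glueable_def)
    let ?E1 = "{\<omega>\<in>space M. F p \<omega> \<in> Bad}" and ?E2 = "{\<omega>\<in>space M. F0 \<omega> \<in> Bad' p}"
    have E: "?E1 \<in> sets M" "?E2 \<in> sets M"
      using measurable_sets[OF F(1) Bad(1)] measurable_sets[OF F0(1) Bad'(1), of p]
      by (simp_all add: vimage_def Int_def conj_commute)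
    have pE: "measure M ?E1 \<le> 3 * ?\<epsilon>" "measure M ?E2 \<le> ?\<epsilon>"
      using measure_preserving_measure[OF F Bad(1)] Bad(2) measure_preserving_measure[OF F0 Bad'(1), of p] Bad'(2)[of p] by simp_all
    show "\<exists>E\<in>sets M. measure M E \<le> 5 / real (Suc p) \<and>
       (\<forall>\<omega>\<in>space M - E. occupations_match (real (Suc p)) ((2 + real N) / real (Suc p)) (r p) (F p \<omega>) (F0 \<omega>))"
    proof (intro bexI[of _ "?D \<union> ?E1 \<union> ?E2"] conjI ballI)
      have "measure M (?D \<union> ?E1 \<union> ?E2) \<le> measure M ?D + measure M ?E1 + measure M ?E2"
        using measure_Un_le[of "?D \<union> ?E1" M ?E2] measure_Un_le[of ?D M ?E1] D E by simp
      also have "\<dots> \<le> 5 * ?\<epsilon>" using pD pE by linarith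
      finally show "measure M (?D \<union> ?E1 \<union> ?E2) \<le> 5 / real (Suc p)" by simp
      show "?D \<union> ?E1 \<union> ?E2 \<in> sets M" using D E by blast
      fix \<omega> assume "\<omega> \<in> space M - (?D \<union> ?E1 \<union> ?E2)"
      then have "F p \<omega> \<notin> Bad" "F0 \<omega> \<notin> Bad' p" "K p (r p) (F p \<omega>) = K' p (F0 \<omega>)" by auto
      from match[OF this] show "occupations_match (real (Suc p)) ((2 + real N) / real (Suc p)) (r p) (F p \<omega>) (F0 \<omega>)" by simp
    qed
  qed
qed

theorem glued_processes_converge:
  fixes A :: "nat \<Rightarrow> real^'d^'d" and nrm :: "real^'d \<Rightarrow> real" and x0 :: "real^'d"
  assumes nrm: "is_norm nrm"
  shows "\<exists>(r :: nat \<Rightarrow> nat) (M :: (nat \<Rightarrow> real) measure) xs \<sigma>s x \<sigma>. strict_mono r \<and> prob_space M \<and>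
       (\<forall>n. markov_process M N A (\<nu> (r n)) (\<mu> (r n)) (P (r n)) x0 (xs n) (\<sigma>s n)) \<and>
       markov_process M k (mean_mode A) \<nu>' \<mu>' P' x0 x \<sigma> \<and>
       (\<forall>T>0. \<forall>\<delta>>0.
          (\<forall>n. {\<omega>\<in>space M. (SUP t\<in>{0..T}. nrm (x t \<omega> - xs n t \<omega>)) > \<delta>} \<in> sets M) \<and>
          (\<lambda>n. measure M {\<omega>\<in>space M. (SUP t\<in>{0..T}. nrm (x t \<omega> - xs n t \<omega>)) > \<delta>})
            \<longlonglongrightarrow> 0)"
proof -
  obtain r :: "nat \<Rightarrow> nat" and M :: "(nat \<Rightarrow> real) measure" and F0 F where r: "strict_mono r" and M: "prob_space M"
    and F0: "F0 \<in> measurable M (base \<mu>')" "distr M (base \<mu>') F0 = base \<mu>'"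
    and F: "\<And>p. F p \<in> measurable M (base (\<mu> (r p)))" "\<And>p. distr M (base (\<mu> (r p))) (F p) = base (\<mu> (r p))"
    and close: "\<And>p. \<exists>E\<in>sets M. measure M E \<le> 5 / real (Suc p) \<and>
       (\<forall>\<omega>\<in>space M - E. occupations_match (real (Suc p)) ((2 + real N) / real (Suc p)) (r p) (F p \<omega>) (F0 \<omega>))"
    by (rule glued_processes) (rule that, assumption+)
  interpret M: prob_space M by (rule M)
  let ?xs = "\<lambda>n t \<omega>. trajectory A N (\<nu> (r n)) (P (r n)) x0 t (F n \<omega>)"
  let ?x = "\<lambda>t \<omega>. trajectory (mean_mode A) k \<nu>' P' x0 t (F0 \<omega>)"
  obtain C :: "real \<Rightarrow> real" where C: "\<And>T. 0 \<le> C T"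
    "\<And>T \<epsilon> n \<omega> \<omega>' t. 0 \<le> \<epsilon> \<Longrightarrow> occupations_match T \<epsilon> n \<omega> \<omega>' \<Longrightarrow> t \<in> {0..T} \<Longrightarrow>
      nrm (trajectory (mean_mode A) k \<nu>' P' x0 t \<omega>' - trajectory A N (\<nu> n) (P n) x0 t \<omega>) \<le> \<epsilon> * C T"
    by (rule trajectories_uniformly_close[OF nrm, of A x0]) (rule that, assumption+)
  have meas: "{\<omega>\<in>space M. (SUP t\<in>{0..T}. nrm (?x t \<omega> - ?xs n t \<omega>)) > \<delta>} \<in> sets M" if T: "0 < T" for T \<delta> n
  proof (rule SUP_exceeds_measurable[OF T])
    have sub: "{0..T} \<subseteq> {0..}" by auto
    show "continuous_on {0..T} (\<lambda>t. nrm (?x t \<omega> - ?xs n t \<omega>))" for \<omega>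
      by (rule continuous_on_compose2[OF is_norm_continuous[OF nrm, of UNIV]])
        (auto intro!: continuous_on_diff continuous_on_subset[OF trajectory_continuous sub])
    fix t
    have nrm_meas: "nrm \<in> borel_measurable borel"
      by (rule borel_measurable_continuous_onI[OF is_norm_continuous[OF nrm]])
    have "?x t \<in> borel_measurable M"
      by (rule measurable_compose[OF F0(1)]) (rule trajectory_measurable)
    moreover have "?xs n t \<in> borel_measurable M"
      by (rule measurable_compose[OF F(1)[of n]]) (rule trajectory_measurable)
    ultimately show "(\<lambda>\<omega>. nrm (?x t \<omega> - ?xs n t \<omega>)) \<in> borel_measurable M"
      by (intro measurable_compose[OF _ nrm_meas] borel_measurable_diff)
  qed
  have lim: "(\<lambda>n. measure M {\<omega>\<in>space M. (SUP t\<in>{0..T}. nrm (?x t \<omega> - ?xs n t \<omega>)) > \<delta>}) \<longlonglongrightarrow> 0"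
    if T: "0 < T" and \<delta>: "0 < \<delta>" for T \<delta>
  proof (rule real_tendsto_sandwich[OF _ _ tendsto_const])
    have inv0: "(\<lambda>p. c / real (Suc p)) \<longlonglongrightarrow> 0" for c
      using tendsto_mult[OF tendsto_const[of c] LIMSEQ_inverse_real_of_nat] by (simp add: field_simps)
    show "(\<lambda>p. 5 / real (Suc p)) \<longlonglongrightarrow> 0" by (rule inv0)
    show "eventually (\<lambda>n. 0 \<le> measure M {\<omega>\<in>space M. (SUP t\<in>{0..T}. nrm (?x t \<omega> - ?xs n t \<omega>)) > \<delta>}) sequentially" by simp
    have e1: "eventually (\<lambda>p. (2 + real N) * C T / real (Suc p) < \<delta>) sequentially"
      by (rule order_tendstoD(2)[OF inv0 \<delta>])
    have e2: "eventually (\<lambda>p. T \<le> real (Suc p)) sequentially"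
      using eventually_ge_at_top[of "nat \<lceil>T\<rceil>"] by (rule eventually_mono) linarith
    show "eventually (\<lambda>p. measure M {\<omega>\<in>space M. (SUP t\<in>{0..T}. nrm (?x t \<omega> - ?xs p t \<omega>)) > \<delta>} \<le> 5 / real (Suc p)) sequentially"
      using e1 e2
    proof eventually_elim
      case (elim p)
      obtain E where E: "E \<in> sets M" "measure M E \<le> 5 / real (Suc p)"
        and match: "\<And>\<omega>. \<omega> \<in> space M - E \<Longrightarrow> occupations_match (real (Suc p)) ((2 + real N) / real (Suc p)) (r p) (F p \<omega>) (F0 \<omega>)"
        using close[of p] by blast
      have "{\<omega>\<in>space M. (SUP t\<in>{0..T}. nrm (?x t \<omega> - ?xs p t \<omega>)) > \<delta>} \<subseteq> E"
      proof (rule ccontr)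
        assume "\<not> ?thesis"
        then obtain \<omega> where \<omega>: "\<omega> \<in> space M - E" and gt: "(SUP t\<in>{0..T}. nrm (?x t \<omega> - ?xs p t \<omega>)) > \<delta>" by auto
        have m: "occupations_match T ((2 + real N) / real (Suc p)) (r p) (F p \<omega>) (F0 \<omega>)"
          using match[OF \<omega>] elim(2) unfolding occupations_match_def by auto
        have "(SUP t\<in>{0..T}. nrm (?x t \<omega> - ?xs p t \<omega>)) \<le> (2 + real N) / real (Suc p) * C T"
          by (rule cSUP_least) (use T C(2)[OF _ m] in auto)
        with gt elim(1) show False by simp
      qed
      then have "measure M {\<omega>\<in>space M. (SUP t\<in>{0..T}. nrm (?x t \<omega> - ?xs p t \<omega>)) > \<delta>} \<le> measure M E"
        by (rule M.finite_measure_mono[OF _ E(1)])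
      with E(2) show ?case by linarith
    qed
  qed
  have proc: "markov_process M N A (\<nu> (r n)) (\<mu> (r n)) (P (r n)) x0 (?xs n) (\<lambda>t \<omega>. switching N (\<nu> (r n)) (P (r n)) t (F n \<omega>))" for n
    by (rule markov_process_from_base[OF par N1 M F])
  have proc': "markov_process M k (mean_mode A) \<nu>' \<mu>' P' x0 ?x (\<lambda>t \<omega>. switching k \<nu>' P' t (F0 \<omega>))"
    by (rule markov_process_from_base[OF \<nu>'_parameters k1 M F0])
  show ?thesis
    by (rule exI[of _ r], rule exI[of _ M], rule exI[of _ ?xs],
        rule exI[of _ "\<lambda>n t \<omega>. switching N (\<nu> (r n)) (P (r n)) t (F n \<omega>)"],
        rule exI[of _ ?x], rule exI[of _ "\<lambda>t \<omega>. switching k \<nu>' P' t (F0 \<omega>)"])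
      (intro conjI allI impI r M proc proc' meas lim)
qed

end

theorem theorem3p3:
  fixes N :: nat
    and A :: "nat \<Rightarrow> real^'d^'d"
    and nrm :: "real^'d \<Rightarrow> real"
    and x0 :: "real^'d"
    and \<nu> :: "nat \<Rightarrow> nat \<Rightarrow> real"
    and \<mu> :: "nat \<Rightarrow> real"
    and P :: "nat \<Rightarrow> nat \<Rightarrow> nat \<Rightarrow> real"
  assumes "1 \<le> N"
    and "is_norm nrm"
    and "\<And>n. parameters N (\<nu> n) (\<mu> n) (P n)"
  shows "\<exists>(r :: nat \<Rightarrow> nat) k (B :: nat \<Rightarrow> real^'d^'d) \<nu>' \<mu>' P'.
    strict_mono r \<and> convexified_modes N A k B \<and> parameters k \<nu>' \<mu>' P' \<and>
    (\<exists>(M :: (nat \<Rightarrow> real) measure)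
       (xs :: nat \<Rightarrow> real \<Rightarrow> (nat \<Rightarrow> real) \<Rightarrow> real^'d) (\<sigma>s :: nat \<Rightarrow> real \<Rightarrow> (nat \<Rightarrow> real) \<Rightarrow> nat)
       (x :: real \<Rightarrow> (nat \<Rightarrow> real) \<Rightarrow> real^'d) (\<sigma> :: real \<Rightarrow> (nat \<Rightarrow> real) \<Rightarrow> nat).
       prob_space M \<and>
       (\<forall>n. markov_process M N A (\<nu> (r n)) (\<mu> (r n)) (P (r n)) x0 (xs n) (\<sigma>s n)) \<and>
       markov_process M k B \<nu>' \<mu>' P' x0 x \<sigma> \<and>
       (\<forall>T>0. \<forall>\<delta>>0.
          (\<forall>n. {\<omega>\<in>space M. (SUP t\<in>{0..T}. nrm (x t \<omega> - xs n t \<omega>)) > \<delta>} \<in> sets M) \<and>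
          (\<lambda>n. measure M {\<omega>\<in>space M. (SUP t\<in>{0..T}. nrm (x t \<omega> - xs n t \<omega>)) > \<delta>})
            \<longlonglongrightarrow> 0))"
proof -
  obtain r1 JJ \<nu>l where r1: "strict_mono (r1 :: nat \<Rightarrow> nat)"
    and JJ: "pseudo_resolvent N JJ" and \<nu>l: "probability_vector N \<nu>l"
    and conv: "\<And>c i j. i \<in> {1..N} \<Longrightarrow> j \<in> {1..N} \<Longrightarrow>
      (\<lambda>n. resolvent_matrix N (\<mu> (r1 n)) (P (r1 n)) (real (Suc c)) i j) \<longlonglongrightarrow> JJ c i j"
      "\<And>i. i \<in> {1..N} \<Longrightarrow> (\<lambda>n. \<nu> (r1 n) i) \<longlonglongrightarrow> \<nu>l i"
    by (rule convergent_resolvents[OF assms(1,3)]) (rule that, assumption+)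
  obtain k cls \<pi> h Jk \<mu>' P' where lc: "limit_chain N k JJ Jk cls \<pi> h"
    and lim: "0 < \<mu>'" "stochastic_matrix k P'" "\<And>c. resolvent_kernel k \<mu>' P' (real (Suc c)) (Jk c)"
    by (rule pseudo_resolvent.limit_chain_exists[OF JJ]) (rule that, assumption+)
  interpret chain_convergence N k JJ Jk cls \<pi> h "\<lambda>n. \<nu> (r1 n)" "\<lambda>n. \<mu> (r1 n)" "\<lambda>n. P (r1 n)" \<nu>l \<mu>' P'
    by (intro chain_convergence.intro chain_convergence_axioms.intro lc assms(3) pseudo_resolvent.stoch[OF JJ] conv \<nu>l lim)
  have modes: "convexified_modes N A k (mean_mode A)"
    using convexified_modes_averages[of A] by (simp only: mean_mode_def[abs_def])
  obtain r2 :: "nat \<Rightarrow> nat" and M :: "(nat \<Rightarrow> real) measure" and xs \<sigma>s x \<sigma> where r2: "strict_mono r2"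
    and glued: "prob_space M"
      "\<forall>n. markov_process M N A (\<nu> (r1 (r2 n))) (\<mu> (r1 (r2 n))) (P (r1 (r2 n))) x0 (xs n) (\<sigma>s n)"
      "markov_process M k (mean_mode A) \<nu>' \<mu>' P' x0 x \<sigma>"
      "\<forall>T>0. \<forall>\<delta>>0.
          (\<forall>n. {\<omega>\<in>space M. (SUP t\<in>{0..T}. nrm (x t \<omega> - xs n t \<omega>)) > \<delta>} \<in> sets M) \<and>
          (\<lambda>n. measure M {\<omega>\<in>space M. (SUP t\<in>{0..T}. nrm (x t \<omega> - xs n t \<omega>)) > \<delta>}) \<longlonglongrightarrow> 0"
    using glued_processes_converge[OF assms(2), of A x0] by (elim exE conjE) (rule that, assumption+)
  have r: "strict_mono (\<lambda>n. r1 (r2 n))" using strict_mono_o[OF r1 r2] by (simp add: o_def)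
  show ?thesis
    by (rule exI[of _ "\<lambda>n. r1 (r2 n)"], rule exI[of _ k], rule exI[of _ "mean_mode A"], rule exI[of _ \<nu>'],
        rule exI[of _ \<mu>'], rule exI[of _ P'], intro conjI r modes \<nu>'_parameters,
        rule exI[of _ M], rule exI[of _ xs], rule exI[of _ \<sigma>s], rule exI[of _ x], rule exI[of _ \<sigma>],
        intro conjI glued)
qed

end
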